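(* Let $\mathfrak{g}$ be one of the five infinite-dimensional exceptional simple Lie superalgebras $E(4,4)$, $E(5,10)$, $E(3,6)$, $E(3,8)$, $E(1,6)$ over $\mathbb{F}$. If $\sigma\neq 0$ is a Hom-Lie superalgebra structure on $\mathfrak{g}$, then $\sigma=\mathrm{id}|_{\mathfrak{g}}$; that is, the only Hom-Lie superalgebra structure on $\mathfrak{g}$ is the trivial one.
   Context: $\mathbb{F}$ is an algebraically closed field of characteristic zero; $|x|\in\mathbb{Z}_2$ is the parity of a homogeneous element $x$. **Hom-Lie superalgebra structure.** Let $(\mathfrak{g},[\cdot,\cdot])$ be a Lie superalgebra over $\mathbb{F}$. A Hom-Lie superalgebra structure on $\mathfrak{g}$ is an even (parity-preserving) linear map $\sigma:\mathfrak{g}\to\mathfrak{g}$ such that for all homogeneous $x,y,z\in\mathfrak{g}$: (i) $\sigma[x,y]=[\sigma(x),\sigma(y)]$; (ii) $(-1)^{|x||z|}[\sigma(x),[y,z]]+(-1)^{|y||x|}[\sigma(y),[z,x]]+(-1)^{|z||y|}[\sigma(z),[x,y]]=0$. It is called trivial if $\sigma=\mathrm{id}|_{\mathfrak{g}}$. **$E(5,10)$.** The even part is the Lie algebra of polynomial vector fields $\sum_{i=1}^5 f_i\partial_i$, $f_i\in\mathbb{F}[x_1,\dots,x_5]$, $\partial_i=\partial/\partial x_i$, with $\sum_i\partial_i(f_i)=0$. The odd part is the space of closed polynomial differential 2-forms on $\mathbb{F}^5$. Write $\mathrm{d}_{ij}=\mathrm{d}x_i\wedge \mathrm{d}x_j$.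 The bracket of a vector field with a 2-form is the Lie derivative; the bracket of two 2-forms is given bilinearly by $[f\mathrm{d}_{ij},g\mathrm{d}_{kl}]=\varepsilon_{tijkl}fg\,\partial_t$, where $\varepsilon_{tijkl}$ is the sign of the permutation $(tijkl)$ if $\{t,i,j,k,l\}=\{1,2,3,4,5\}$, and if $i,j,k,l$ are not distinct the bracket is $0$. **$E(3,6)$.** Give $E(5,10)$ the $\mathbb{Z}$-grading for which $x_1,x_2,x_3$ and $\partial_1,\partial_2,\partial_3$ have degree $0$, $x_4,x_5$ have degree $1$, $\partial_4,\partial_5$ have degree $-1$, and a 2-form has degree (number of factors from $x_4,x_5,\mathrm{d}x_4,\mathrm{d}x_5$) minus $1$. $E(3,6)$ is the degree-$0$ subalgebra. **$E(3,8)$.** Let $U=\mathbb{F}^3$, $V=\mathbb{F}^2$, and let $\omega$ be a nonzero alternating bilinear form on $V$. Let $\mathfrak{n}=\mathfrak{g}_{-1}\oplus\mathfrak{g}_{-2}\oplus\mathfrak{g}_{-3}$, with $\mathfrak{g}_{-1}=U\otimes V$ (odd), $\mathfrak{g}_{-2}=\wedge^2U$ (even; isomorphic to $U^*$ up to a twist by a character), $\mathfrak{g}_{-3}=\wedge^3U\otimes V$ (odd), and brackets $[u\otimes v,u'\otimes v']=\omega(v,v')\,u\wedge u'$, $[u\otimes v,b]=(u\wedge b)\otimes v$ for $b\in\wedge^2U$, other brackets between these components being $0$. Let $\mathfrak{g}_0=\mathfrak{gl}(U)\oplus\mathfrak{sl}(V)$ act naturally. $E(3,8)=\bigoplus_{i\ge-3}\mathfrak{g}_i$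 is the full (generalized Cartan) prolongation of $(\mathfrak{n},\mathfrak{g}_0)$, i.e. the largest $\mathbb{Z}$-graded Lie superalgebra with this nonpositive part that is transitive (if $x\in\mathfrak{g}_i$, $i\ge0$, and $[x,\mathfrak{g}_{-1}]=0$, then $x=0$). **$E(1,6)$.** Let $K(1,6)=\mathbb{F}[x]\otimes\Lambda(\xi_1,\dots,\xi_6)$ ($x$ even, $\xi_i$ odd), with bracket $$[f,g]=\Big(2f-\sum_{i=1}^6\xi_i\partial_i(f)\Big)\partial_x(g)-(-1)^{|f||g|}\Big(2g-\sum_{i=1}^6\xi_i\partial_i(g)\Big)\partial_x(f)+(-1)^{|f|}\sum_{i=1}^6\partial_i(f)\partial_i(g),$$ where $\partial_i=\partial/\partial\xi_i$, $\partial_x=\partial/\partial x$, graded by $\deg(x^a\xi_{i_1}\cdots\xi_{i_r})=2a+r-2$. The span of the $\xi_i\xi_j\xi_k$ is, under the bracket action of $\langle\xi_i\xi_j\rangle\cong\mathfrak{so}(6)$, a direct sum of two irreducible 10-dimensional submodules; let $M$ be one of them (both choices give isomorphic results). $E(1,6)$ is the graded subalgebra of $K(1,6)$ generated by $K(1,6)_{-2}\oplus K(1,6)_{-1}\oplus K(1,6)_0\oplus\langle x\xi_1,\dots,x\xi_6\rangle\oplus M$. **$E(4,4)$.** The even part is the Lie algebra $W_4$ of polynomial vector fields on $\mathbb{F}^4$; the odd part is the space $\Omega^1(4)$ of polynomial 1-forms on $\mathbb{F}^4$. For $X,Y\in W_4$, $[X,Y]$ is the usual bracket; $[X,\omega]=L_X\omega-\tfrac12\mathrm{div}(X)\,\omega$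 for $\omega\in\Omega^1(4)$; and for $\omega_1,\omega_2\in\Omega^1(4)$, $[\omega_1,\omega_2]$ is the vector field $X$ with $\iota_X(\mathrm{d}x_1\wedge \mathrm{d}x_2\wedge \mathrm{d}x_3\wedge \mathrm{d}x_4)=\mathrm{d}\omega_1\wedge\omega_2+\omega_1\wedge \mathrm{d}\omega_2$. *)

theory Defs
  imports
    "HOL-Analysis.Determinants"
    "HOL-Computational_Algebra.Polynomial"
    "HOL-Combinatorics.Permutations"
    "HOL-Library.Poly_Mapping"
    "HOL-Library.Function_Algebras"
    "HOL-Library.Numeral_Type"
begin

section \<open>Lie superalgebras and Hom-Lie superalgebra structures\<close>

text \<open>
  The algebras below live on subspaces of an ambient type, so a superalgebra is given by its two
  homogeneous parts inside that type; brackets and maps only matter on these parts and their sum.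
\<close>

record ('k, 'v) superalgebra =
  even_part :: "'v set"
  odd_part :: "'v set"
  scl :: "'k \<Rightarrow> 'v \<Rightarrow> 'v"
  brk :: "'v \<Rightarrow> 'v \<Rightarrow> 'v"

definition whole :: "('k, 'v::ab_group_add) superalgebra \<Rightarrow> 'v set" where
  "whole g = {x + y | x y. x \<in> even_part g \<and> y \<in> odd_part g}"

definition part :: "('k, 'v) superalgebra \<Rightarrow> nat \<Rightarrow> 'v set" where
  "part g p = (if even p then even_part g else odd_part g)"

definition lie_superalgebra :: "('k::field, 'v::ab_group_add) superalgebra \<Rightarrow> bool" where
  "lie_superalgebra g \<longleftrightarrow>
     vector_space (scl g) \<and>
     module.subspace (scl g) (even_part g) \<and> module.subspace (scl g) (odd_part g) \<and>
     even_part g \<inter> odd_part g = {0} \<and>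
     (\<forall>p q. \<forall>x\<in>part g p. \<forall>y\<in>part g q. brk g x y \<in> part g (p + q)) \<and>
     (\<forall>x\<in>whole g. \<forall>y\<in>whole g. \<forall>z\<in>whole g. \<forall>c.
        brk g (x + y) z = brk g x z + brk g y z \<and> brk g x (y + z) = brk g x y + brk g x z \<and>
        brk g (scl g c x) y = scl g c (brk g x y) \<and> brk g x (scl g c y) = scl g c (brk g x y)) \<and>
     (\<forall>p q. \<forall>x\<in>part g p. \<forall>y\<in>part g q. brk g x y = - scl g ((-1) ^ (p * q)) (brk g y x)) \<and>
     (\<forall>p q r. \<forall>x\<in>part g p. \<forall>y\<in>part g q. \<forall>z\<in>part g r.
        brk g x (brk g y z) =
        brk g (brk g x y) z + scl g ((-1) ^ (p * q)) (brk g y (brk g x z)))"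

definition hom_lie_structure ::
    "('k::field, 'v::ab_group_add) superalgebra \<Rightarrow> ('v \<Rightarrow> 'v) \<Rightarrow> bool" where
  "hom_lie_structure g \<sigma> \<longleftrightarrow>
     (\<forall>x\<in>whole g. \<forall>y\<in>whole g. \<sigma> (x + y) = \<sigma> x + \<sigma> y) \<and>
     (\<forall>c. \<forall>x\<in>whole g. \<sigma> (scl g c x) = scl g c (\<sigma> x)) \<and>
     (\<forall>p. \<forall>x\<in>part g p. \<sigma> x \<in> part g p) \<and>
     (\<forall>p q. \<forall>x\<in>part g p. \<forall>y\<in>part g q. \<sigma> (brk g x y) = brk g (\<sigma> x) (\<sigma> y)) \<and>
     (\<forall>p q r. \<forall>x\<in>part g p. \<forall>y\<in>part g q. \<forall>z\<in>part g r.
        scl g ((-1) ^ (p * r)) (brk g (\<sigma> x) (brk g y z)) +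
        scl g ((-1) ^ (q * p)) (brk g (\<sigma> y) (brk g z x)) +
        scl g ((-1) ^ (r * q)) (brk g (\<sigma> z) (brk g x y)) = 0)"

definition nonzero_map :: "('k, 'v::ab_group_add) superalgebra \<Rightarrow> ('v \<Rightarrow> 'v) \<Rightarrow> bool" where
  "nonzero_map g \<sigma> \<longleftrightarrow> (\<exists>x\<in>whole g. \<sigma> x \<noteq> 0)"

definition trivial_structure :: "('k, 'v::ab_group_add) superalgebra \<Rightarrow> ('v \<Rightarrow> 'v) \<Rightarrow> bool" where
  "trivial_structure g \<sigma> \<longleftrightarrow> (\<forall>x\<in>whole g. \<sigma> x = x)"


section \<open>Polynomial vector fields and differential forms\<close>

type_synonym ('a, 'n) mpoly = "('n \<Rightarrow>\<^sub>0 nat) \<Rightarrow>\<^sub>0 'a"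
type_synonym ('a, 'n) vfield = "('a, 'n) mpoly ^ 'n"
type_synonym ('a, 'n) form1 = "('a, 'n) mpoly ^ 'n"

text \<open>
  A 2-form is the skew-symmetric matrix of its values on \<open>(\<partial>\<^sub>i, \<partial>\<^sub>j)\<close>, that is, \<open>w\<close> stands for the sum
  of \<open>w $ i $ j dx\<^sub>i \<and> dx\<^sub>j\<close> over \<open>i < j\<close>; 3-forms are represented likewise.  Coordinates are indexed by
  the numeral types 4 and 5, in which \<open>4 = 0\<close> and \<open>5 = 0\<close> respectively: the last coordinate is the
  least element of the index type.
\<close>

type_synonym ('a, 'n) form2 = "('a, 'n) mpoly ^ 'n ^ 'n"
type_synonym ('a, 'n) form3 = "('a, 'n) mpoly ^ 'n ^ 'n ^ 'n"

definition mconst :: "'a \<Rightarrow> ('a::zero, 'n) mpoly" where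
  "mconst c = Poly_Mapping.single 0 c"

definition mderiv :: "'n \<Rightarrow> ('a::comm_semiring_1, 'n) mpoly \<Rightarrow> ('a, 'n) mpoly" where
  "mderiv i f = (\<Sum>m\<in>Poly_Mapping.keys f.
     Poly_Mapping.single (m - Poly_Mapping.single i 1)
       (of_nat (Poly_Mapping.lookup m i) * Poly_Mapping.lookup f m))"

definition vf_bracket ::
    "('a::comm_ring_1, 'n::finite) vfield \<Rightarrow> ('a, 'n) vfield \<Rightarrow> ('a, 'n) vfield" where
  "vf_bracket X Y = (\<chi> j. \<Sum>i\<in>UNIV. X $ i * mderiv i (Y $ j) - Y $ i * mderiv i (X $ j))"

definition divergence :: "('a::comm_ring_1, 'n::finite) vfield \<Rightarrow> ('a, 'n) mpoly" where
  "divergence X = (\<Sum>i\<in>UNIV. mderiv i (X $ i))"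

definition lie_deriv1 ::
    "('a::comm_ring_1, 'n::finite) vfield \<Rightarrow> ('a, 'n) form1 \<Rightarrow> ('a, 'n) form1" where
  "lie_deriv1 X w = (\<chi> i. \<Sum>k\<in>UNIV. X $ k * mderiv k (w $ i) + mderiv i (X $ k) * w $ k)"

definition lie_deriv2 ::
    "('a::comm_ring_1, 'n::finite) vfield \<Rightarrow> ('a, 'n) form2 \<Rightarrow> ('a, 'n) form2" where
  "lie_deriv2 X w = (\<chi> i j. \<Sum>k\<in>UNIV. X $ k * mderiv k (w $ i $ j)
     + mderiv i (X $ k) * w $ k $ j + mderiv j (X $ k) * w $ i $ k)"

definition closed_form2 :: "('a::comm_ring_1, 'n::finite) form2 \<Rightarrow> bool" where
  "closed_form2 w \<longleftrightarrow> (\<forall>i j. w $ i $ j = - w $ j $ i) \<and>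
     (\<forall>i j k. mderiv i (w $ j $ k) + mderiv j (w $ k $ i) + mderiv k (w $ i $ j) = 0)"

definition ext_deriv1 :: "('a::comm_ring_1, 'n::finite) form1 \<Rightarrow> ('a, 'n) form2" where
  "ext_deriv1 w = (\<chi> i j. mderiv i (w $ j) - mderiv j (w $ i))"

definition wedge21 ::
    "('a::comm_ring_1, 'n::finite) form2 \<Rightarrow> ('a, 'n) form1 \<Rightarrow> ('a, 'n) form3" where
  "wedge21 a w = (\<chi> i j k. a $ i $ j * w $ k + a $ j $ k * w $ i + a $ k $ i * w $ j)"

definition wedge12 ::
    "('a::comm_ring_1, 'n::finite) form1 \<Rightarrow> ('a, 'n) form2 \<Rightarrow> ('a, 'n) form3" where
  "wedge12 w a = (\<chi> i j k. w $ i * a $ j $ k + w $ j * a $ k $ i + w $ k * a $ i $ j)"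

definition eps4 :: "4 \<Rightarrow> 4 \<Rightarrow> 4 \<Rightarrow> 4 \<Rightarrow> int" where
  "eps4 t i j k = (if distinct [t, i, j, k]
     then sign (\<lambda>m::4. if m = 1 then t else if m = 2 then i else if m = 3 then j else k)
     else 0)"

definition eps5 :: "5 \<Rightarrow> 5 \<Rightarrow> 5 \<Rightarrow> 5 \<Rightarrow> 5 \<Rightarrow> int" where
  "eps5 t i j k l = (if distinct [t, i, j, k, l]
     then sign (\<lambda>m::5. if m = 1 then t else if m = 2 then i else if m = 3 then j
                       else if m = 4 then k else l)
     else 0)"


section \<open>\<open>E(4,4)\<close>\<close>

text \<open>An element is a pair of a vector field (even) and a 1-form (odd).\<close>

definition interior_vol4 :: "('a::comm_ring_1, 4) vfield \<Rightarrow> ('a, 4) form3" where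
  "interior_vol4 X = (\<chi> i j k. \<Sum>t\<in>UNIV. of_int (eps4 t i j k) * X $ t)"

definition E44_odd_bracket ::
    "('a::field, 4) form1 \<Rightarrow> ('a, 4) form1 \<Rightarrow> ('a, 4) vfield" where
  "E44_odd_bracket w1 w2 =
     (THE X. interior_vol4 X = wedge21 (ext_deriv1 w1) w2 + wedge12 w1 (ext_deriv1 w2))"

definition E44_action :: "('a::field, 4) vfield \<Rightarrow> ('a, 4) form1 \<Rightarrow> ('a, 4) form1" where
  "E44_action X w = lie_deriv1 X w - (mconst (1 / 2) * divergence X) *s w"

definition E44 :: "('a::field, ('a, 4) vfield \<times> ('a, 4) form1) superalgebra" where
  "E44 = \<lparr> even_part = {(X, 0) | X. True},
           odd_part = {(0, w) | w. True},
           scl = (\<lambda>c (X, w). (mconst c *s X, mconst c *s w)),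
           brk = (\<lambda>(X, w) (Y, v). (vf_bracket X Y + E44_odd_bracket w v,
                                     E44_action X v - E44_action Y w)) \<rparr>"


section \<open>\<open>E(5,10)\<close> and \<open>E(3,6)\<close>\<close>

text \<open>An element is a pair of a divergence-free vector field (even) and a closed 2-form (odd).\<close>

definition E510_odd_bracket ::
    "('a::comm_ring_1, 5) form2 \<Rightarrow> ('a, 5) form2 \<Rightarrow> ('a, 5) vfield" where
  "E510_odd_bracket w v = (\<chi> t. \<Sum>(i, j)\<in>{(i, j). i < j}. \<Sum>(k, l)\<in>{(k, l). k < l}.
     of_int (eps5 t i j k l) * (w $ i $ j * v $ k $ l))"

definition E510 :: "('a::field, ('a, 5) vfield \<times> ('a, 5) form2) superalgebra" where
  "E510 = \<lparr> even_part = {(X, 0) | X. divergence X = 0},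
            odd_part = {(0, w) | w. closed_form2 w},
            scl = (\<lambda>c (X, w). (mconst c *s X, (\<chi> i. mconst c *s (w $ i)))),
            brk = (\<lambda>(X, w) (Y, v). (vf_bracket X Y + E510_odd_bracket w v,
                                      lie_deriv2 X v - lie_deriv2 Y w)) \<rparr>"

definition index_weight :: "5 \<Rightarrow> int" where
  "index_weight i = (if i = 4 \<or> i = 5 then 1 else 0)"

definition mpoly_homogeneous :: "int \<Rightarrow> ('a::zero, 5) mpoly \<Rightarrow> bool" where
  "mpoly_homogeneous d f \<longleftrightarrow> (\<forall>m\<in>Poly_Mapping.keys f.
     int (Poly_Mapping.lookup m 4 + Poly_Mapping.lookup m 5) = d)"

definition E510_degree :: "int \<Rightarrow> (('a::zero, 5) vfield \<times> ('a, 5) form2) set" where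
  "E510_degree d = {(X, w).
     (\<forall>i. mpoly_homogeneous (d + index_weight i) (X $ i)) \<and>
     (\<forall>i j. mpoly_homogeneous (d + 1 - index_weight i - index_weight j) (w $ i $ j))}"

definition E36 :: "('a::field, ('a, 5) vfield \<times> ('a, 5) form2) superalgebra" where
  "E36 = E510 \<lparr> even_part := even_part E510 \<inter> E510_degree 0,
                odd_part := odd_part E510 \<inter> E510_degree 0 \<rparr>"


section \<open>\<open>K(1,6)\<close> and \<open>E(1,6)\<close>\<close>

text \<open>
  \<open>f $ I\<close> is the coefficient in \<open>F[x]\<close> of the product of the \<open>\<xi>\<^sub>i\<close> for \<open>i \<in> I\<close>, taken in increasing
  order of the index type 6, in which \<open>6 = 0\<close> is the least element.
\<close>

type_synonym 'a K16 = "'a poly ^ (6 set)"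

definition K16_scale :: "'a::field \<Rightarrow> 'a K16 \<Rightarrow> 'a K16" where
  "K16_scale c f = [:c:] *s f"

definition K16_mult :: "'a::field K16 \<Rightarrow> 'a K16 \<Rightarrow> 'a K16" where
  "K16_mult f g = (\<chi> K. \<Sum>I\<in>Pow K.
     (-1) ^ card {(i, j). i \<in> I \<and> j \<in> K - I \<and> j < i} * (f $ I * g $ (K - I)))"

definition monomial16 :: "'a::field poly \<Rightarrow> 6 set \<Rightarrow> 'a K16" where
  "monomial16 p I = axis I p"

definition xi :: "6 \<Rightarrow> 'a::field K16" where
  "xi i = monomial16 1 {i}"

definition K16_dx :: "'a::field K16 \<Rightarrow> 'a K16" where
  "K16_dx f = (\<chi> I. pderiv (f $ I))"

definition K16_dxi :: "6 \<Rightarrow> 'a::field K16 \<Rightarrow> 'a K16" where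
  "K16_dxi i f = (\<chi> I. if i \<in> I then 0 else (-1) ^ card {j \<in> I. j < i} * f $ (insert i I))"

definition K16_part :: "nat \<Rightarrow> 'a::field K16 \<Rightarrow> 'a K16" where
  "K16_part p f = (\<chi> I. if even (card I + p) then f $ I else 0)"

definition K16_two_minus_euler :: "'a::field K16 \<Rightarrow> 'a K16" where
  "K16_two_minus_euler f = K16_scale 2 f - (\<Sum>i\<in>UNIV. K16_mult (xi i) (K16_dxi i f))"

text \<open>The bracket of \<open>f\<close> of parity \<open>p\<close> with \<open>g\<close> of parity \<open>q\<close>.\<close>

definition K16_hom_bracket :: "nat \<Rightarrow> nat \<Rightarrow> 'a::field K16 \<Rightarrow> 'a K16 \<Rightarrow> 'a K16" where
  "K16_hom_bracket p q f g =
     K16_mult (K16_two_minus_euler f) (K16_dx g)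
     - K16_scale ((-1) ^ (p * q)) (K16_mult (K16_two_minus_euler g) (K16_dx f))
     + K16_scale ((-1) ^ p) (\<Sum>i\<in>UNIV. K16_mult (K16_dxi i f) (K16_dxi i g))"

definition K16_bracket :: "'a::field K16 \<Rightarrow> 'a K16 \<Rightarrow> 'a K16" where
  "K16_bracket f g =
     (\<Sum>p\<in>{0, 1}. \<Sum>q\<in>{0, 1}. K16_hom_bracket p q (K16_part p f) (K16_part q g))"

definition K16_degree :: "int \<Rightarrow> 'a::field K16 set" where
  "K16_degree d = {f. \<forall>I a. coeff (f $ I) a \<noteq> 0 \<longrightarrow> 2 * int a + int (card I) - 2 = d}"

definition cubic16 :: "'a::field K16 set" where
  "cubic16 = module.span K16_scale {K16_mult (xi i) (K16_mult (xi j) (xi k)) | i j k. True}"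

definition so6_submodule :: "'a::field K16 set \<Rightarrow> bool" where
  "so6_submodule N \<longleftrightarrow> module.subspace K16_scale N \<and> N \<subseteq> cubic16 \<and>
     (\<forall>i j. \<forall>f\<in>N. K16_bracket (K16_mult (xi i) (xi j)) f \<in> N)"

definition so6_irreducible10 :: "'a::field K16 set \<Rightarrow> bool" where
  "so6_irreducible10 M \<longleftrightarrow> so6_submodule M \<and> M \<noteq> {0} \<and>
     (\<forall>N. so6_submodule N \<and> N \<subseteq> M \<longrightarrow> N = {0} \<or> N = M) \<and>
     vector_space.dim K16_scale M = 10"

definition E16_generators :: "'a::field K16 set \<Rightarrow> 'a K16 set" where
  "E16_generators M = K16_degree (-2) \<union> K16_degree (-1) \<union> K16_degree 0 \<union>
     {K16_mult (monomial16 [:0, 1:] {}) (xi i) | i. True} \<union> M"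

definition E16_whole :: "'a::field K16 set \<Rightarrow> 'a K16 set" where
  "E16_whole M = \<Inter>{S. module.subspace K16_scale S \<and> E16_generators M \<subseteq> S \<and>
     (\<forall>f\<in>S. \<forall>g\<in>S. K16_bracket f g \<in> S)}"

definition E16 :: "'a::field K16 set \<Rightarrow> ('a, 'a K16) superalgebra" where
  "E16 M = \<lparr> even_part = {f \<in> E16_whole M. K16_part 0 f = f},
             odd_part = {f \<in> E16_whole M. K16_part 1 f = f},
             scl = K16_scale,
             brk = K16_bracket \<rparr>"


section \<open>The full prolongation\<close>

text \<open>
  Let \<open>(D k)\<close>, \<open>k \<le> 0\<close>, be the components of a nonpositively graded Lie superalgebra with bracket \<open>B\<close> and
  scalar multiplication \<open>s\<close>, in which an element of degree \<open>k\<close> has parity \<open>k mod 2\<close>.  A component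
  of its full prolongation in degree \<open>k > 0\<close> consists of the superderivations of degree \<open>k\<close> from the
  negative part \<open>n\<close> into the algebra built so far.  All these iterated spaces of maps are realised in
  one type by uncurrying: an element \<open>\<phi>\<close> is encoded by the function that sends a word of
  letters \<open>(d\<^sub>1, y\<^sub>1), \<dots>, (d\<^sub>m, y\<^sub>m)\<close>, where \<open>y\<^sub>r \<in> D d\<^sub>r\<close> and \<open>d\<^sub>r < 0\<close>, to the component of nonpositive
  degree of \<open>[\<dots>[\<phi>, y\<^sub>1], \<dots>, y\<^sub>m]\<close>.  Thus \<open>act \<phi> (d, y)\<close> encodes \<open>[\<phi>, y]\<close>, and \<open>\<phi> []\<close> is \<open>\<phi>\<close> itself if
  \<open>\<phi>\<close> has nonpositive degree and 0 otherwise.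

  Only derivations of degree \<open>k\<close> and parity \<open>k mod 2\<close> are used.  This loses nothing: an
  element of degree \<open>k > 0\<close> and of the other parity in a transitive prolongation vanishes, as
  \<open>prolongation_maximal\<close> below confirms.
\<close>

definition psign :: "int \<Rightarrow> 'k::ring_1" where
  "psign n = (if even n then 1 else -1)"

type_synonym 'l word = "(int \<times> 'l) list"

definition letter :: "(int \<Rightarrow> 'l set) \<Rightarrow> int \<times> 'l \<Rightarrow> bool" where
  "letter D l \<longleftrightarrow> fst l < 0 \<and> snd l \<in> D (fst l)"

definition act :: "('l word \<Rightarrow> 'l) \<Rightarrow> int \<times> 'l \<Rightarrow> 'l word \<Rightarrow> 'l" where
  "act \<phi> l = (\<lambda>w. \<phi> (l # w))"

definition fscale :: "('k \<Rightarrow> 'l \<Rightarrow> 'l) \<Rightarrow> 'k \<Rightarrow> ('w \<Rightarrow> 'l) \<Rightarrow> 'w \<Rightarrow> 'l" where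
  "fscale s c \<phi> = (\<lambda>w. s c (\<phi> w))"

definition iter_bracket ::
    "(int \<Rightarrow> 'l::zero set) \<Rightarrow> ('l \<Rightarrow> 'l \<Rightarrow> 'l) \<Rightarrow> 'l \<Rightarrow> 'l word \<Rightarrow> 'l" where
  "iter_bracket D B x w = (if list_all (letter D) w then foldl (\<lambda>y l. B y (snd l)) x w else 0)"

text \<open>
  \<open>(k, \<phi>) \<in> prolong D B s\<close> says that \<open>\<phi>\<close> is an element of degree \<open>k\<close>.  The last premise of the
  second rule is the derivation property \<open>[\<phi>, [y, z]] = [[\<phi>, y], z] + (-1)\<^bsup>k d\<^esup> [y, [\<phi>, z]]\<close>, in
  which the last term is rewritten as a right action by skew-symmetry.
\<close>

inductive_set prolong ::
    "(int \<Rightarrow> 'l::ab_group_add set) \<Rightarrow> ('l \<Rightarrow> 'l \<Rightarrow> 'l) \<Rightarrow> ('k::field \<Rightarrow> 'l \<Rightarrow> 'l)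
     \<Rightarrow> (int \<times> ('l word \<Rightarrow> 'l)) set"
  for D B s where
    nonpos: "k \<le> 0 \<Longrightarrow> x \<in> D k \<Longrightarrow> (k, iter_bracket D B x) \<in> prolong D B s"
  | pos: "\<lbrakk>k > 0; \<phi> [] = 0;
       \<forall>l. \<not> letter D l \<longrightarrow> act \<phi> l = 0;
       \<forall>l. letter D l \<longrightarrow> (k + fst l, act \<phi> l) \<in> prolong D B s;
       \<forall>d<0. \<forall>y\<in>D d. \<forall>z\<in>D d. \<forall>a b.
         act \<phi> (d, s a y + s b z) = fscale s a (act \<phi> (d, y)) + fscale s b (act \<phi> (d, z));
       \<forall>d<0. \<forall>e<0. \<forall>y\<in>D d. \<forall>z\<in>D e.
         act \<phi> (d + e, B y z) =
         act (act \<phi> (d, y)) (e, z) - fscale s (psign (d * e)) (act (act \<phi> (e, z)) (d, y))\<rbrakk>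
       \<Longrightarrow> (k, \<phi>) \<in> prolong D B s"

text \<open>
  The bracket of \<open>\<phi>\<close> of degree \<open>i\<close> and \<open>\<psi>\<close> of degree \<open>j\<close>.  For \<open>i, j \<ge> 0\<close> it is determined by
  \<open>[[\<phi>, \<psi>], y] = [\<phi>, [\<psi>, y]] + (-1)\<^bsup>j d\<^esup> [[\<phi>, y], \<psi>]\<close> for \<open>y \<in> D d\<close>.
\<close>

fun prolong_bracket ::
    "('l::ab_group_add \<Rightarrow> 'l \<Rightarrow> 'l) \<Rightarrow> ('k::field \<Rightarrow> 'l \<Rightarrow> 'l) \<Rightarrow> int \<Rightarrow> int
     \<Rightarrow> ('l word \<Rightarrow> 'l) \<Rightarrow> ('l word \<Rightarrow> 'l) \<Rightarrow> 'l word \<Rightarrow> 'l" where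
  "prolong_bracket B s i j \<phi> \<psi> w =
     (if j < 0 then act \<phi> (j, \<psi> []) w
      else if i < 0 then - s (psign (i * j)) (act \<psi> (i, \<phi> []) w)
      else case w of
        [] \<Rightarrow> B (\<phi> []) (\<psi> [])
      | l # v \<Rightarrow> prolong_bracket B s i (j + fst l) \<phi> (act \<psi> l) v
                + s (psign (j * fst l)) (prolong_bracket B s (i + fst l) j (act \<phi> l) \<psi> v))"

declare prolong_bracket.simps [simp del]

definition prolongation ::
    "(int \<Rightarrow> 'l::ab_group_add set) \<Rightarrow> ('l \<Rightarrow> 'l \<Rightarrow> 'l) \<Rightarrow> ('k::field \<Rightarrow> 'l \<Rightarrow> 'l)
     \<Rightarrow> ('k, int \<Rightarrow>\<^sub>0 ('l word \<Rightarrow> 'l)) superalgebra" where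
  "prolongation D B s =
     \<lparr> even_part = {x. \<forall>k\<in>Poly_Mapping.keys x.
         even k \<and> (k, Poly_Mapping.lookup x k) \<in> prolong D B s},
       odd_part = {x. \<forall>k\<in>Poly_Mapping.keys x.
         odd k \<and> (k, Poly_Mapping.lookup x k) \<in> prolong D B s},
       scl = (\<lambda>c. Poly_Mapping.map (fscale s c)),
       brk = (\<lambda>x y. \<Sum>i\<in>Poly_Mapping.keys x. \<Sum>j\<in>Poly_Mapping.keys y.
         Poly_Mapping.single (i + j)
           (prolong_bracket B s i j (Poly_Mapping.lookup x i) (Poly_Mapping.lookup y j))) \<rparr>"

subsection \<open>The full prolongation is a Lie superalgebra\<close>

locale nonpositive_superalgebra =
  fixes D :: "int \<Rightarrow> 'l::ab_group_add set" and B :: "'l \<Rightarrow> 'l \<Rightarrow> 'l" and s :: "'k::field \<Rightarrow> 'l \<Rightarrow> 'l"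
  assumes vs: "vector_space s"
    and sub: "\<And>k. module.subspace s (D k)"
    and D_pos: "\<And>k. k > 0 \<Longrightarrow> D k = {0}"
    and D_disj: "\<And>i j x. x \<in> D i \<Longrightarrow> x \<in> D j \<Longrightarrow> x \<noteq> 0 \<Longrightarrow> i = j"
    and B_closed: "\<And>i j x y. x \<in> D i \<Longrightarrow> y \<in> D j \<Longrightarrow> B x y \<in> D (i + j)"
    and B_lin: "\<And>i j x x' y a b. x \<in> D i \<Longrightarrow> x' \<in> D i \<Longrightarrow> y \<in> D j \<Longrightarrow>
                  B (s a x + s b x') y = s a (B x y) + s b (B x' y)"
    and B_skew: "\<And>i j x y. x \<in> D i \<Longrightarrow> y \<in> D j \<Longrightarrow> B x y = - s (psign (i * j)) (B y x)"
    and B_jacobi: "\<And>i j k x y z. x \<in> D i \<Longrightarrow> y \<in> D j \<Longrightarrow> z \<in> D k \<Longrightarrow>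
                  B x (B y z) = B (B x y) z + s (psign (i * j)) (B y (B x z))"
begin

sublocale S: vector_space s by (rule vs)

sublocale F: vector_space "fscale s :: 'k \<Rightarrow> ('l word \<Rightarrow> 'l) \<Rightarrow> 'l word \<Rightarrow> 'l"
  by unfold_locales (auto simp: fscale_def fun_eq_iff S.scale_right_distrib S.scale_left_distrib)

abbreviation "P k \<equiv> {\<phi>. (k, \<phi>) \<in> prolong D B s}"
abbreviation "br \<equiv> prolong_bracket B s"
abbreviation "emb \<equiv> iter_bracket D B"
abbreviation "fs \<equiv> fscale s :: 'k \<Rightarrow> ('l word \<Rightarrow> 'l) \<Rightarrow> 'l word \<Rightarrow> 'l"

lemma psign_times [simp]: "psign a * psign b = (psign (a + b) :: 'k)"
  by (auto simp: psign_def)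

lemma psign_mult [simp]: "s (psign a) (s (psign b) x) = s (psign (a + b)) x"
  by (auto simp: psign_def)

lemma fpsign_mult [simp]: "fs (psign a) (fs (psign b) x) = fs (psign (a + b)) x"
  by (auto simp: psign_def)

lemma fs_psign: "fs (psign a) \<phi> = (if even a then \<phi> else - \<phi>)"
  by (auto simp: psign_def)

lemma s_psign: "s (psign a) x = (if even a then x else - x)"
  by (auto simp: psign_def)

lemma fscale_apply [simp]: "fs c \<phi> w = s c (\<phi> w)"
  by (simp add: fscale_def)

lemma act_apply: "act \<phi> l w = \<phi> (l # w)"
  by (simp add: act_def)

lemma act_add: "act (\<phi> + \<psi>) l = act \<phi> l + act \<psi> l"
  and act_scale: "act (fs c \<phi>) l = fs c (act \<phi> l)"
  and act_minus: "act (- \<phi>) l = - act \<phi> l"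
  and act_diff: "act (\<phi> - \<psi>) l = act \<phi> l - act \<psi> l"
  and act_zero: "act 0 l = (0 :: 'l word \<Rightarrow> 'l)"
  by (auto simp: act_def fun_eq_iff)

lemmas act_lin = act_add act_scale act_minus act_diff act_zero

lemma D_zero: "0 \<in> D k"
  and D_add: "x \<in> D k \<Longrightarrow> y \<in> D k \<Longrightarrow> x + y \<in> D k"
  and D_scale: "x \<in> D k \<Longrightarrow> s c x \<in> D k"
  using sub[of k] S.subspace_0 S.subspace_add S.subspace_scale by blast+

lemma B_zero_left: "y \<in> D j \<Longrightarrow> B 0 y = 0"
  using B_lin[of 0 0 0 y j 0 0] D_zero by simp

lemma B_lin_right:
  assumes "x \<in> D i" "y \<in> D j" "y' \<in> D j"
  shows "B x (s a y + s b y') = s a (B x y) + s b (B x y')"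
proof -
  have "s a y + s b y' \<in> D j" using assms D_add D_scale by blast
  hence "B x (s a y + s b y') = - s (psign (i * j)) (B (s a y + s b y') x)"
    using B_skew assms by blast
  also have "\<dots> = s a (- s (psign (i * j)) (B y x)) + s b (- s (psign (i * j)) (B y' x))"
    using B_lin[OF assms(2,3,1)]
    by (simp add: S.scale_right_distrib mult.commute)
  also have "\<dots> = s a (B x y) + s b (B x y')"
    using B_skew[OF assms(1,2)] B_skew[OF assms(1,3)] by simp
  finally show ?thesis .
qed

lemma B_zero_right: "y \<in> D j \<Longrightarrow> B y 0 = 0"
  using B_lin_right[of y j 0 0 0 0 0] D_zero by simp

lemma emb_Nil [simp]: "emb x [] = x"
  by (simp add: iter_bracket_def)

lemma foldl_B_zero: "list_all (letter D) w \<Longrightarrow> foldl (\<lambda>y l. B y (snd l)) 0 w = 0"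
  by (induction w) (auto simp: letter_def B_zero_left)

lemma emb_zero [simp]: "emb 0 = 0"
  by (auto simp: fun_eq_iff iter_bracket_def foldl_B_zero)

lemma act_emb: "letter D l \<Longrightarrow> act (emb x) l = emb (B x (snd l))"
  by (auto simp: act_def iter_bracket_def fun_eq_iff)

lemma act_emb': "y \<in> D d \<Longrightarrow> d < 0 \<Longrightarrow> act (emb x) (d, y) = emb (B x y)"
  by (simp add: act_emb letter_def)

lemma act_emb_not: "\<not> letter D l \<Longrightarrow> act (emb x) l = 0"
  by (auto simp: act_def iter_bracket_def fun_eq_iff)

lemma foldl_lin:
  assumes "list_all (letter D) w" "x \<in> D k" "y \<in> D k"
  shows "foldl (\<lambda>y l. B y (snd l)) (s a x + s b y) w =
         s a (foldl (\<lambda>y l. B y (snd l)) x w) + s b (foldl (\<lambda>y l. B y (snd l)) y w)"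
  using assms
proof (induction w arbitrary: x y k)
  case (Cons l w)
  have l: "snd l \<in> D (fst l)" using Cons.prems by (simp add: letter_def)
  have "B x (snd l) \<in> D (k + fst l)" "B y (snd l) \<in> D (k + fst l)"
    using Cons.prems l B_closed by auto
  from Cons.IH[OF _ this] show ?case
    using Cons.prems l by (simp add: B_lin[of x k y "snd l" "fst l"])
qed simp

lemma emb_lin:
  assumes "x \<in> D k" "y \<in> D k"
  shows "emb (s a x + s b y) = fs a (emb x) + fs b (emb y)"
  using foldl_lin[OF _ assms] by (auto simp: fun_eq_iff iter_bracket_def)

lemma emb_add: "x \<in> D k \<Longrightarrow> y \<in> D k \<Longrightarrow> emb (x + y) = emb x + emb y"
  using emb_lin[of x k y 1 1] by simp

lemma emb_scale: "x \<in> D k \<Longrightarrow> emb (s a x) = fs a (emb x)"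
  using emb_lin[of x k 0 a 0] D_zero by simp

lemma emb_minus: "x \<in> D k \<Longrightarrow> emb (- x) = - emb x"
  using emb_scale[of x k "-1"] by simp

lemma P_emb: "k \<le> 0 \<Longrightarrow> x \<in> D k \<Longrightarrow> (k, emb x) \<in> prolong D B s"
  by (rule prolong.nonpos)

lemma P_nonpos_iff:
  assumes "k \<le> 0"
  shows "(k, \<phi>) \<in> prolong D B s \<longleftrightarrow> \<phi> [] \<in> D k \<and> \<phi> = emb (\<phi> [])"
  using assms by (auto elim: prolong.cases dest: prolong.nonpos[of k _ D B s])

lemma P_nonposE:
  assumes "(k, \<phi>) \<in> prolong D B s" "k \<le> 0"
  obtains x where "x \<in> D k" "\<phi> = emb x"
  using assms P_nonpos_iff by blast

lemma P_Nil: "(k, \<phi>) \<in> prolong D B s \<Longrightarrow> \<phi> [] \<in> D k"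
  by (auto elim: prolong.cases simp: D_zero)

lemma P_zero: "(k, 0) \<in> prolong D B s"
proof (induction "nat k" arbitrary: k rule: less_induct)
  case less
  show ?case
  proof (cases "k \<le> 0")
    case True
    thus ?thesis using P_emb[OF True D_zero] by simp
  next
    case False
    show ?thesis
      by (rule prolong.pos) (use False less in \<open>auto simp: act_lin letter_def\<close>)
  qed
qed

lemma act_not: "(k, \<phi>) \<in> prolong D B s \<Longrightarrow> \<not> letter D l \<Longrightarrow> act \<phi> l = 0"
  by (auto elim!: prolong.cases simp: act_emb_not)

lemma act_closed: "(k, \<phi>) \<in> prolong D B s \<Longrightarrow> (k + fst l, act \<phi> l) \<in> prolong D B s"
proof (cases "letter D l")
  case False
  assume "(k, \<phi>) \<in> prolong D B s"
  thus ?thesis using act_not[OF _ False] P_zero by simp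
next
  case True
  assume "(k, \<phi>) \<in> prolong D B s"
  thus ?thesis
  proof cases
    case (nonpos x)
    thus ?thesis using True act_emb B_closed[of x k "snd l" "fst l"]
      by (auto simp: letter_def intro!: P_emb)
  next
    case pos
    thus ?thesis using True by blast
  qed
qed

lemma act_closed': "(k, \<phi>) \<in> prolong D B s \<Longrightarrow> (k + d, act \<phi> (d, y)) \<in> prolong D B s"
  using act_closed[of k \<phi> "(d, y)"] by simp

lemma act_letter_lin:
  assumes "(k, \<phi>) \<in> prolong D B s" "d < 0" "y \<in> D d" "z \<in> D d"
  shows "act \<phi> (d, s a y + s b z) = fs a (act \<phi> (d, y)) + fs b (act \<phi> (d, z))"
  using assms(1)
proof cases
  case (nonpos x)
  have "s a y + s b z \<in> D d" using assms D_add D_scale by auto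
  thus ?thesis using nonpos assms
    by (simp add: act_emb' B_lin_right[of x k y d z]
      emb_lin[OF B_closed[of x k y d] B_closed[of x k z d]])
next
  case pos
  thus ?thesis using assms by blast
qed

lemma act_letter_zero: "(k, \<phi>) \<in> prolong D B s \<Longrightarrow> d < 0 \<Longrightarrow> act \<phi> (d, 0) = 0"
  using act_letter_lin[of k \<phi> d 0 0 0 0] D_zero by simp

lemma act_letter_scale:
  "(k, \<phi>) \<in> prolong D B s \<Longrightarrow> d < 0 \<Longrightarrow> y \<in> D d \<Longrightarrow> act \<phi> (d, s a y) = fs a (act \<phi> (d, y))"
  using act_letter_lin[of k \<phi> d y 0 a 0] D_zero by simp

lemma B_jacobi_right:
  assumes "x \<in> D i" "y \<in> D j" "z \<in> D k"
  shows "B x (B y z) = B (B x y) z - s (psign (j * k)) (B (B x z) y)"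
proof -
  have "B y (B x z) = - s (psign (j * (i + k))) (B (B x z) y)"
    using B_skew[OF assms(2) B_closed[OF assms(1,3)]] .
  hence "s (psign (i * j)) (B y (B x z)) = - s (psign (j * k)) (B (B x z) y)"
    by (auto simp: s_psign)
  thus ?thesis using B_jacobi[OF assms] by simp
qed

lemma act_derivation:
  assumes "(k, \<phi>) \<in> prolong D B s" "d < 0" "e < 0" "y \<in> D d" "z \<in> D e"
  shows "act \<phi> (d + e, B y z) =
         act (act \<phi> (d, y)) (e, z) - fs (psign (d * e)) (act (act \<phi> (e, z)) (d, y))"
  using assms(1)
proof cases
  case (nonpos x)
  have 1: "B (B x y) z \<in> D (k + d + e)" using B_closed nonpos assms by simp
  have 2: "B (B x z) y \<in> D (k + d + e)"
    using B_closed[OF B_closed[OF nonpos(3) assms(5)] assms(4)] by (simp add: algebra_simps)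
  have "B x (B y z) = s 1 (B (B x y) z) + s (- psign (d * e)) (B (B x z) y)"
    using B_jacobi_right nonpos assms by simp
  hence "emb (B x (B y z)) = emb (B (B x y) z) - fs (psign (d * e)) (emb (B (B x z) y))"
    using emb_lin[OF 1 2, of 1 "- psign (d * e)"] by simp
  thus ?thesis using nonpos assms B_closed[OF assms(4,5)]
    by (simp add: act_emb')
next
  case pos
  thus ?thesis using assms by blast
qed

lemma P_lin:
  "(k, \<phi>) \<in> prolong D B s \<Longrightarrow> (k, \<psi>) \<in> prolong D B s \<Longrightarrow> (k, fs a \<phi> + fs b \<psi>) \<in> prolong D B s"
proof (induction "nat k" arbitrary: k \<phi> \<psi> rule: less_induct)
  case less
  show ?case
  proof (cases "k \<le> 0")
    case True
    then obtain x y where xy: "x \<in> D k" "\<phi> = emb x" "y \<in> D k" "\<psi> = emb y"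
      using less.prems P_nonposE by metis
    have "fs a \<phi> + fs b \<psi> = emb (s a x + s b y)" using xy emb_lin by simp
    thus ?thesis using True xy D_add D_scale by (auto intro!: P_emb)
  next
    case False
    show ?thesis
    proof (rule prolong.pos, goal_cases)
      case 1
      show ?case using False by simp
    next
      case 2
      show ?case using P_Nil[OF less.prems(1)] P_Nil[OF less.prems(2)] D_pos[of k] False by simp
    next
      case 3
      show ?case using less.prems act_not by (simp add: act_lin)
    next
      case 4
      show ?case
        using less.prems False
        by (auto simp: act_lin letter_def intro!: less.hyps act_closed')
    next
      case 5
      show ?case using act_letter_lin[OF less.prems(1)] act_letter_lin[OF less.prems(2)]
        by (simp add: act_lin F.scale_right_distrib algebra_simps mult.commute)
    next
      case 6
      show ?case
        by (auto simp: act_lin act_derivation[OF less.prems(1)] act_derivation[OF less.prems(2)]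
          F.scale_right_distrib F.scale_right_diff_distrib mult.commute)
    qed
  qed
qed

lemma P_add: "(k, \<phi>) \<in> prolong D B s \<Longrightarrow> (k, \<psi>) \<in> prolong D B s \<Longrightarrow> (k, \<phi> + \<psi>) \<in> prolong D B s"
  using P_lin[of k \<phi> \<psi> 1 1] by simp

lemma P_scale: "(k, \<phi>) \<in> prolong D B s \<Longrightarrow> (k, fs a \<phi>) \<in> prolong D B s"
  using P_lin[of k \<phi> 0 a 0] P_zero by simp

lemma P_minus: "(k, \<phi>) \<in> prolong D B s \<Longrightarrow> (k, - \<phi>) \<in> prolong D B s"
  using P_scale[of k \<phi> "-1"] by simp

lemma P_eqI:
  assumes "(k, \<phi>) \<in> prolong D B s" "(k, \<psi>) \<in> prolong D B s" "k > 0"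
    and "\<And>l. letter D l \<Longrightarrow> act \<phi> l = act \<psi> l"
  shows "\<phi> = \<psi>"
proof
  fix w
  show "\<phi> w = \<psi> w"
  proof (cases w)
    case Nil
    thus ?thesis using P_Nil[OF assms(1)] P_Nil[OF assms(2)] D_pos[OF assms(3)] by simp
  next
    case (Cons l v)
    have "act \<phi> l = act \<psi> l"
      using assms(4) act_not[OF assms(1)] act_not[OF assms(2)] by (cases "letter D l") auto
    thus ?thesis unfolding Cons act_def by (simp add: fun_eq_iff)
  qed
qed

lemma br_neg_right: "j < 0 \<Longrightarrow> br i j \<phi> \<psi> = act \<phi> (j, \<psi> [])"
  by (rule ext) (simp add: prolong_bracket.simps)

lemma br_neg_left: "i < 0 \<Longrightarrow> \<not> j < 0 \<Longrightarrow> br i j \<phi> \<psi> = - fs (psign (i * j)) (act \<psi> (i, \<phi> []))"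
  by (rule ext) (simp add: prolong_bracket.simps)

lemma br_act:
  "i \<ge> 0 \<Longrightarrow> j \<ge> 0 \<Longrightarrow> act (br i j \<phi> \<psi>) l =
     br i (j + fst l) \<phi> (act \<psi> l) + fs (psign (j * fst l)) (br (i + fst l) j (act \<phi> l) \<psi>)"
  by (rule ext) (simp add: prolong_bracket.simps[of B s i j \<phi> \<psi>] act_def)

lemma br_Nil: "i \<ge> 0 \<Longrightarrow> j \<ge> 0 \<Longrightarrow> br i j \<phi> \<psi> [] = B (\<phi> []) (\<psi> [])"
  by (simp add: prolong_bracket.simps)

lemma br_lin_left:
  assumes "(i, \<phi>) \<in> prolong D B s" "(i, \<phi>') \<in> prolong D B s" "(j, \<psi>) \<in> prolong D B s"
  shows "br i j (fs a \<phi> + fs b \<phi>') \<psi> = fs a (br i j \<phi> \<psi>) + fs b (br i j \<phi>' \<psi>)"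
proof
  fix w
  show "br i j (fs a \<phi> + fs b \<phi>') \<psi> w = (fs a (br i j \<phi> \<psi>) + fs b (br i j \<phi>' \<psi>)) w"
    using assms
  proof (induction w arbitrary: i j \<phi> \<phi>' \<psi>)
    case Nil
    show ?case
    proof (cases "i < 0 \<or> j < 0")
      case True
      thus ?thesis using act_letter_lin[OF Nil(3), of i "\<phi> []" "\<phi>' []"] P_Nil Nil
        by (cases "j < 0")
          (auto simp: br_neg_right br_neg_left act_apply S.scale_right_distrib
            mult.commute)
    next
      case False
      thus ?thesis using B_lin[of "\<phi> []" i "\<phi>' []" "\<psi> []" j] P_Nil Nil by (simp add: br_Nil)
    qed
  next
    case (Cons l v)
    show ?case
    proof (cases "i < 0 \<or> j < 0")
      case True
      thus ?thesis using act_letter_lin[OF Cons(4), of i "\<phi> []" "\<phi>' []"] P_Nil Cons.prems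
        by (cases "j < 0")
          (auto simp: br_neg_right br_neg_left act_apply S.scale_right_distrib
            mult.commute)
    next
      case False
      hence *: "br i j \<phi> \<psi> (l # v) = br i (j + fst l) \<phi> (act \<psi> l) v
           + s (psign (j * fst l)) (br (i + fst l) j (act \<phi> l) \<psi> v)" for \<phi>
        using br_act[of i j \<phi> \<psi> l] by (simp add: act_def fun_eq_iff)
      show ?thesis
        unfolding * act_add act_scale
          Cons.IH[OF Cons.prems(1,2) act_closed[OF Cons.prems(3)], of l]
          Cons.IH[OF act_closed[OF Cons.prems(1)] act_closed[OF Cons.prems(2)] Cons.prems(3), of l]
        by (simp add: * S.scale_right_distrib mult.commute)
    qed
  qed
qed

lemma br_lin_right:
  assumes "(i, \<phi>) \<in> prolong D B s" "(j, \<psi>) \<in> prolong D B s" "(j, \<psi>') \<in> prolong D B s"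
  shows "br i j \<phi> (fs a \<psi> + fs b \<psi>') = fs a (br i j \<phi> \<psi>) + fs b (br i j \<phi> \<psi>')"
proof
  fix w
  show "br i j \<phi> (fs a \<psi> + fs b \<psi>') w = (fs a (br i j \<phi> \<psi>) + fs b (br i j \<phi> \<psi>')) w"
    using assms
  proof (induction w arbitrary: i j \<phi> \<psi>' \<psi>)
    case Nil
    show ?case
    proof (cases "i < 0 \<or> j < 0")
      case True
      thus ?thesis using act_letter_lin[OF Nil(1), of j "\<psi> []" "\<psi>' []"] P_Nil Nil
        by (cases "j < 0")
          (auto simp: br_neg_right br_neg_left act_apply S.scale_right_distrib
            mult.commute)
    next
      case False
      thus ?thesis using B_lin_right[of "\<phi> []" i "\<psi> []" j "\<psi>' []"] P_Nil Nil
        by (simp add: br_Nil)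
    qed
  next
    case (Cons l v)
    show ?case
    proof (cases "i < 0 \<or> j < 0")
      case True
      thus ?thesis using act_letter_lin[OF Cons(2), of j "\<psi> []" "\<psi>' []"] P_Nil Cons.prems
        by (cases "j < 0")
          (auto simp: br_neg_right br_neg_left act_apply S.scale_right_distrib
            mult.commute)
    next
      case False
      hence *: "br i j \<phi> \<psi> (l # v) = br i (j + fst l) \<phi> (act \<psi> l) v
           + s (psign (j * fst l)) (br (i + fst l) j (act \<phi> l) \<psi> v)" for \<psi>
        using br_act[of i j \<phi> \<psi> l] by (simp add: act_def fun_eq_iff)
      show ?thesis
        unfolding * act_add act_scale
          Cons.IH[OF Cons.prems(1) act_closed[OF Cons.prems(2)] act_closed[OF Cons.prems(3)], of l]
          Cons.IH[OF act_closed[OF Cons.prems(1)] Cons.prems(2,3), of l]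
        by (simp add: * S.scale_right_distrib mult.commute)
    qed
  qed
qed

lemma br_zero_left: "(j, \<psi>) \<in> prolong D B s \<Longrightarrow> br i j 0 \<psi> = 0"
  using br_lin_left[OF P_zero P_zero, of j \<psi> i 0 0] by simp

lemma br_zero_right: "(i, \<phi>) \<in> prolong D B s \<Longrightarrow> br i j \<phi> 0 = 0"
  using br_lin_right[OF _ P_zero P_zero, of i \<phi> j 0 0] by simp

lemma br_add_left: "(i, \<phi>) \<in> prolong D B s \<Longrightarrow> (i, \<phi>') \<in> prolong D B s \<Longrightarrow>
    (j, \<psi>) \<in> prolong D B s \<Longrightarrow> br i j (\<phi> + \<phi>') \<psi> = br i j \<phi> \<psi> + br i j \<phi>' \<psi>"
  using br_lin_left[of i \<phi> \<phi>' j \<psi> 1 1] by simp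

lemma br_add_right: "(i, \<phi>) \<in> prolong D B s \<Longrightarrow> (j, \<psi>) \<in> prolong D B s \<Longrightarrow>
    (j, \<psi>') \<in> prolong D B s \<Longrightarrow> br i j \<phi> (\<psi> + \<psi>') = br i j \<phi> \<psi> + br i j \<phi> \<psi>'"
  using br_lin_right[of i \<phi> j \<psi> \<psi>' 1 1] by simp

lemma br_scale_left: "(i, \<phi>) \<in> prolong D B s \<Longrightarrow> (j, \<psi>) \<in> prolong D B s \<Longrightarrow>
    br i j (fs c \<phi>) \<psi> = fs c (br i j \<phi> \<psi>)"
  using br_lin_left[of i \<phi> 0 j \<psi> c 0] P_zero by simp

lemma br_scale_right: "(i, \<phi>) \<in> prolong D B s \<Longrightarrow> (j, \<psi>) \<in> prolong D B s \<Longrightarrow>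
    br i j \<phi> (fs c \<psi>) = fs c (br i j \<phi> \<psi>)"
  using br_lin_right[of i \<phi> j \<psi> 0 c 0] P_zero by simp

lemma br_minus_left: "(i, \<phi>) \<in> prolong D B s \<Longrightarrow> (j, \<psi>) \<in> prolong D B s \<Longrightarrow>
    br i j (- \<phi>) \<psi> = - br i j \<phi> \<psi>"
  using br_scale_left[of i \<phi> j \<psi> "-1"] by simp

lemma br_minus_right: "(i, \<phi>) \<in> prolong D B s \<Longrightarrow> (j, \<psi>) \<in> prolong D B s \<Longrightarrow>
    br i j \<phi> (- \<psi>) = - br i j \<phi> \<psi>"
  using br_scale_right[of i \<phi> j \<psi> "-1"] by simp

lemma br_emb_neg:
  assumes "x \<in> D i" "y \<in> D j" "i \<le> 0" "j < 0"
  shows "br i j (emb x) (emb y) = emb (B x y)"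
  using assms by (simp add: br_neg_right act_emb')

lemma br_skew_neg:
  assumes "(i, \<phi>) \<in> prolong D B s" "(j, \<psi>) \<in> prolong D B s" "i < 0 \<or> j < 0"
  shows "br i j \<phi> \<psi> = - fs (psign (i * j)) (br j i \<psi> \<phi>)"
proof -
  consider "i < 0" "j < 0" | "i < 0" "j \<ge> 0" | "i \<ge> 0" "j < 0" using assms(3) by linarith
  thus ?thesis
  proof cases
    case 1
    obtain x where x: "x \<in> D i" "\<phi> = emb x" using P_nonposE[OF assms(1)] 1 by auto
    obtain y where y: "y \<in> D j" "\<psi> = emb y" using P_nonposE[OF assms(2)] 1 by auto
    have "emb (B x y) = - fs (psign (i * j)) (emb (B y x))"
      using B_skew[OF x(1) y(1)] emb_minus[OF D_scale[OF B_closed[OF y(1) x(1)]]]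
        emb_scale[OF B_closed[OF y(1) x(1)]] by simp
    thus ?thesis using x y 1 by (simp add: br_emb_neg)
  next
    case 2
    thus ?thesis by (simp add: br_neg_right br_neg_left)
  next
    case 3
    thus ?thesis by (auto simp: br_neg_right br_neg_left mult.commute fs_psign)
  qed
qed

lemma br_leibniz:
  assumes "(i, \<phi>) \<in> prolong D B s" "(j, \<psi>) \<in> prolong D B s"
  shows "act (br i j \<phi> \<psi>) l =
     br i (j + fst l) \<phi> (act \<psi> l) + fs (psign (j * fst l)) (br (i + fst l) j (act \<phi> l) \<psi>)"
proof (cases "letter D l")
  case False
  have "act (br i j \<phi> \<psi>) l = 0"
  proof (cases "i < 0 \<or> j < 0")
    case True
    thus ?thesis using act_not[OF act_closed[OF assms(1)] False]
        act_not[OF act_closed[OF assms(2)] False]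
      by (cases "j < 0") (auto simp: br_neg_right br_neg_left act_lin)
  next
    case False
    thus ?thesis using act_not[OF assms(1) \<open>\<not> letter D l\<close>] act_not[OF assms(2) \<open>\<not> letter D l\<close>]
      using assms by (simp add: br_act br_zero_left br_zero_right)
  qed
  thus ?thesis using act_not[OF assms(1) False] act_not[OF assms(2) False]
    using assms by (simp add: br_zero_left br_zero_right)
next
  case True
  obtain d y where l: "l = (d, y)" by (cases l)
  have dy: "d < 0" "y \<in> D d" using True l by (auto simp: letter_def)
  show ?thesis
  proof (cases "j < 0")
    case j: True
    obtain z where z: "z \<in> D j" "\<psi> = emb z" using P_nonposE[OF assms(2)] j by auto
    have "act \<phi> (j + d, B z y) =
        act (act \<phi> (j, z)) (d, y) - fs (psign (j * d)) (act (act \<phi> (d, y)) (j, z))"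
      using act_derivation[OF assms(1) j dy(1) z(1) dy(2)] .
    thus ?thesis using z j dy by (simp add: l br_neg_right act_emb')
  next
    case j: False
    show ?thesis
    proof (cases "i < 0")
      case i: True
      obtain x where x: "x \<in> D i" "\<phi> = emb x" using P_nonposE[OF assms(1)] i by auto
      have 1: "br i (j + d) \<phi> (act \<psi> l) = - fs (psign (i * (j + d))) (act (act \<psi> l) (i, x))"
        using br_skew_neg[OF assms(1) act_closed[OF assms(2), of l]] i x
        by (simp add: l br_neg_right)
      have 2: "br (i + d) j (act \<phi> l) \<psi> = - fs (psign ((i + d) * j)) (act \<psi> (i + d, B x y))"
        using i j dy x by (simp add: l br_neg_left act_emb')
      have 3: "act \<psi> (i + d, B x y) =
          act (act \<psi> (i, x)) (d, y) - fs (psign (i * d)) (act (act \<psi> (d, y)) (i, x))"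
        using act_derivation[OF assms(2) i dy(1) x(1) dy(2)] .
      show ?thesis using 1 2 3 i j x
        by (auto simp: l br_neg_left act_lin fs_psign)
    next
      case False
      thus ?thesis using j br_act by simp
    qed
  qed
qed

lemma br_emb:
  assumes "x \<in> D i" "y \<in> D j" "i \<le> 0" "j \<le> 0"
  shows "br i j (emb x) (emb y) = emb (B x y)"
proof (cases "i < 0 \<or> j < 0")
  case True
  note P = P_emb[OF assms(3,1)] P_emb[OF assms(4,2)]
  show ?thesis
  proof (cases "j < 0")
    case True
    thus ?thesis using br_emb_neg assms by blast
  next
    case False
    hence i: "i < 0" using True by simp
    have "br i j (emb x) (emb y) = - fs (psign (i * j)) (emb (B y x))"
      using br_skew_neg[OF P] i br_emb_neg[OF assms(2,1,4) i] by simp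
    also have "\<dots> = emb (B x y)"
      using B_skew[OF assms(1,2)] emb_minus[OF D_scale[OF B_closed[OF assms(2,1)]]]
        emb_scale[OF B_closed[OF assms(2,1)]] by simp
    finally show ?thesis .
  qed
next
  case False
  hence 0: "i = 0" "j = 0" using assms by auto
  note P = P_emb[OF assms(3,1)] P_emb[OF assms(4,2)]
  show ?thesis
  proof
    fix w
    show "br i j (emb x) (emb y) w = emb (B x y) w"
    proof (cases w)
      case Nil
      thus ?thesis using 0 by (simp add: br_Nil)
    next
      case (Cons l v)
      have "act (br i j (emb x) (emb y)) l = act (emb (B x y)) l"
      proof (cases "letter D l")
        case False
        thus ?thesis using P 0
          by (simp add: br_act act_emb_not br_zero_left br_zero_right)
      next
        case True
        obtain d z where l: "l = (d, z)" by (cases l)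
        have dz: "d < 0" "z \<in> D d" using True l by (auto simp: letter_def)
        have xz: "B x z \<in> D d" "B y z \<in> D d" using B_closed[of x 0 z d] B_closed[of y 0 z d]
          using assms 0 dz by auto
        have "br 0 d (emb x) (emb (B y z)) = emb (B x (B y z))"
          using br_emb_neg xz dz assms 0 by simp
        moreover have "br d 0 (emb (B x z)) (emb y) = - emb (B y (B x z))"
          using br_skew_neg[OF P_emb[OF _ xz(1)] P(2)] dz 0
            br_emb_neg[of y 0 "B x z" d] xz assms by (simp add: psign_def)
        moreover have "emb (B x (B y z)) = emb (B (B x y) z) + emb (B y (B x z))"
          using B_jacobi[of x 0 y 0 z d] assms 0 dz
            emb_add[of "B (B x y) z" d "B y (B x z)"] B_closed[of "B x y" 0 z d]
            B_closed[of x 0 y 0] B_closed[of y 0 "B x z" d] xz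
          by (simp add: psign_def)
        ultimately show ?thesis
          using 0 dz br_act[of 0 0 "emb x" "emb y" l]
          by (simp add: l act_emb' psign_def)
      qed
      thus ?thesis by (simp add: Cons act_def fun_eq_iff)
    qed
  qed
qed

lemma br_closed:
  "(i, \<phi>) \<in> prolong D B s \<Longrightarrow> (j, \<psi>) \<in> prolong D B s \<Longrightarrow> (i + j, br i j \<phi> \<psi>) \<in> prolong D B s"
proof (induction "nat (i + j)" arbitrary: i j \<phi> \<psi> rule: less_induct)
  case less
  note p = less.prems
  consider "j < 0" | "i < 0" "j \<ge> 0" | "i = 0" "j = 0" | "i \<ge> 0" "j \<ge> 0" "i + j > 0" by linarith
  thus ?case
  proof cases
    case 1
    thus ?thesis using act_closed[OF p(1), of "(j, \<psi> [])"] by (simp add: br_neg_right)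
  next
    case 2
    thus ?thesis using act_closed[OF p(2), of "(i, \<phi> [])"]
      by (auto simp: br_neg_left add.commute intro!: P_minus P_scale)
  next
    case 3
    obtain x where x: "x \<in> D i" "\<phi> = emb x" using P_nonposE[OF p(1)] 3 by auto
    obtain y where y: "y \<in> D j" "\<psi> = emb y" using P_nonposE[OF p(2)] 3 by auto
    show ?thesis using x y 3 br_emb[OF x(1) y(1)] B_closed[OF x(1) y(1)]
      by (auto intro!: P_emb)
  next
    case 4
    note L = br_leibniz[OF p]
    note A = act_closed[OF p(1)] act_closed[OF p(2)]
    show ?thesis
    proof (rule prolong.pos, goal_cases)
      case 1
      show ?case using 4 by simp
    next
      case 2
      have N: "\<phi> [] \<in> D i" "\<psi> [] \<in> D j" using p P_Nil by auto
      hence "\<phi> [] = 0 \<or> \<psi> [] = 0" using 4 D_pos[of i] D_pos[of j] by (cases "i > 0") auto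
      thus ?case using 4 N by (auto simp: br_Nil B_zero_left B_zero_right)
    next
      case 3
      show ?case using act_not[OF p(1)] act_not[OF p(2)] p
        by (simp add: L br_zero_left br_zero_right)
    next
      case 4
      show ?case
      proof (intro allI impI)
        fix l assume l: "letter D l"
        have "(i + (j + fst l), br i (j + fst l) \<phi> (act \<psi> l)) \<in> prolong D B s"
          using less.hyps[OF _ p(1) A(2)] l \<open>i + j > 0\<close> by (auto simp: letter_def)
        moreover have "((i + fst l) + j, br (i + fst l) j (act \<phi> l) \<psi>) \<in> prolong D B s"
          using less.hyps[OF _ A(1) p(2)] l \<open>i + j > 0\<close> by (auto simp: letter_def)
        ultimately show "(i + j + fst l, act (br i j \<phi> \<psi>) l) \<in> prolong D B s"
          unfolding L by (intro P_add P_scale) (simp_all add: algebra_simps)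
      qed
    next
      case 5
      show ?case
      proof (intro allI impI ballI)
        fix d y z a b assume d: "(d::int) < 0" and y: "y \<in> D d" and z: "z \<in> D d"
        note a = act_letter_lin[OF p(1) d y z, of a b] act_letter_lin[OF p(2) d y z, of a b]
        note c = A[of "(d, y)", simplified] A[of "(d, z)", simplified]
        have e1: "br i (j + d) \<phi> (fs a (act \<psi> (d, y)) + fs b (act \<psi> (d, z))) =
            fs a (br i (j + d) \<phi> (act \<psi> (d, y))) + fs b (br i (j + d) \<phi> (act \<psi> (d, z)))"
          by (rule br_lin_right[OF p(1) c(2) c(4)])
        have e2: "br (i + d) j (fs a (act \<phi> (d, y)) + fs b (act \<phi> (d, z))) \<psi> =
            fs a (br (i + d) j (act \<phi> (d, y)) \<psi>) + fs b (br (i + d) j (act \<phi> (d, z)) \<psi>)"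
          by (rule br_lin_left[OF c(1) c(3) p(2)])
        show "act (br i j \<phi> \<psi>) (d, s a y + s b z) =
            fs a (act (br i j \<phi> \<psi>) (d, y)) + fs b (act (br i j \<phi> \<psi>) (d, z))"
          unfolding L a fst_conv e1 e2
          by (simp add: F.scale_right_distrib mult.commute)
      qed
    next
      case 6
      show ?case
      proof (intro allI impI ballI)
        fix d e y z assume d: "(d::int) < 0" and e: "(e::int) < 0" and y: "y \<in> D d" and z: "z \<in> D e"
        note a = act_derivation[OF p(1) d e y z] act_derivation[OF p(2) d e y z]
        note c = A[of "(d, y)", simplified] A[of "(e, z)", simplified]
        note cc = act_closed[OF c(1), of "(e, z)", simplified] act_closed[OF c(2), of "(e, z)", simplified]
          act_closed[OF c(3), of "(d, y)", simplified] act_closed[OF c(4), of "(d, y)", simplified]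
        have cc3: "(i + (d + e), act (act \<phi> (e, z)) (d, y)) \<in> prolong D B s"
          and cc4: "(j + (d + e), act (act \<psi> (e, z)) (d, y)) \<in> prolong D B s"
          and cc1: "(i + (d + e), act (act \<phi> (d, y)) (e, z)) \<in> prolong D B s"
          and cc2: "(j + (d + e), act (act \<psi> (d, y)) (e, z)) \<in> prolong D B s"
          using cc by (simp_all add: algebra_simps)
        have e1: "br i (j + (d + e)) \<phi> (act \<psi> (d + e, B y z)) =
            br i (j + (d + e)) \<phi> (act (act \<psi> (d, y)) (e, z))
            - fs (psign (d * e)) (br i (j + (d + e)) \<phi> (act (act \<psi> (e, z)) (d, y)))"
          using br_lin_right[OF p(1) cc2 cc4, of 1 "- psign (d * e)"] by (simp add: a)
        have e2: "br (i + (d + e)) j (act \<phi> (d + e, B y z)) \<psi> =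
            br (i + (d + e)) j (act (act \<phi> (d, y)) (e, z)) \<psi>
            - fs (psign (d * e)) (br (i + (d + e)) j (act (act \<phi> (e, z)) (d, y)) \<psi>)"
          using br_lin_left[OF cc1 cc3 p(2), of 1 "- psign (d * e)"] by (simp add: a)
        have f: "act (act (br i j \<phi> \<psi>) (d, y)) (e, z) =
            br i (j + (d + e)) \<phi> (act (act \<psi> (d, y)) (e, z))
            + fs (psign ((j + d) * e)) (br (i + e) (j + d) (act \<phi> (e, z)) (act \<psi> (d, y)))
            + fs (psign (j * d)) (br (i + d) (j + e) (act \<phi> (d, y)) (act \<psi> (e, z)))
            + fs (psign (j * (d + e))) (br (i + (d + e)) j (act (act \<phi> (d, y)) (e, z)) \<psi>)"
          using br_leibniz[OF p(1) c(2), of "(e, z)"] br_leibniz[OF c(1) p(2), of "(e, z)"]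
          by (auto simp: L act_lin fs_psign algebra_simps)
        have g: "act (act (br i j \<phi> \<psi>) (e, z)) (d, y) =
            br i (j + (d + e)) \<phi> (act (act \<psi> (e, z)) (d, y))
            + fs (psign ((j + e) * d)) (br (i + d) (j + e) (act \<phi> (d, y)) (act \<psi> (e, z)))
            + fs (psign (j * e)) (br (i + e) (j + d) (act \<phi> (e, z)) (act \<psi> (d, y)))
            + fs (psign (j * (d + e))) (br (i + (d + e)) j (act (act \<phi> (e, z)) (d, y)) \<psi>)"
          using br_leibniz[OF p(1) c(4), of "(d, y)"] br_leibniz[OF c(3) p(2), of "(d, y)"]
          by (auto simp: L act_lin fs_psign algebra_simps)
        show "act (br i j \<phi> \<psi>) (d + e, B y z) = act (act (br i j \<phi> \<psi>) (d, y)) (e, z)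
            - fs (psign (d * e)) (act (act (br i j \<phi> \<psi>) (e, z)) (d, y))"
          unfolding f g L[of "(d + e, B y z)"] fst_conv e1 e2
          by (auto simp: fs_psign algebra_simps)
      qed
    qed
  qed
qed

lemma br_skew:
  "(i, \<phi>) \<in> prolong D B s \<Longrightarrow> (j, \<psi>) \<in> prolong D B s \<Longrightarrow>
   br i j \<phi> \<psi> = - fs (psign (i * j)) (br j i \<psi> \<phi>)"
proof (induction "nat (i + j)" arbitrary: i j \<phi> \<psi> rule: less_induct)
  case less
  note p = less.prems
  consider "i < 0 \<or> j < 0" | "i = 0" "j = 0" | "i \<ge> 0" "j \<ge> 0" "i + j > 0" by linarith
  thus ?case
  proof cases
    case 1
    thus ?thesis using br_skew_neg p by blast
  next
    case 2
    obtain x where x: "x \<in> D 0" "\<phi> = emb x" using P_nonposE[OF p(1)] 2 by auto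
    obtain y where y: "y \<in> D 0" "\<psi> = emb y" using P_nonposE[OF p(2)] 2 by auto
    show ?thesis using x y 2 B_skew[OF x(1) y(1)] emb_minus[OF B_closed[OF y(1) x(1)]]
      by (simp add: br_emb psign_def)
  next
    case 3
    show ?thesis
    proof (rule P_eqI[where k = "i + j"])
      show "(i + j, br i j \<phi> \<psi>) \<in> prolong D B s" using br_closed p by blast
      have "(i + j, br j i \<psi> \<phi>) \<in> prolong D B s" using br_closed[OF p(2,1)] by (simp add: add.commute)
      thus "(i + j, - fs (psign (i * j)) (br j i \<psi> \<phi>)) \<in> prolong D B s"
        using P_minus P_scale by blast
      show "i + j > 0" using 3 by simp
      fix l assume l: "letter D l"
      note A = act_closed[OF p(1), of l] act_closed[OF p(2), of l]
      have "br i (j + fst l) \<phi> (act \<psi> l) =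
          - fs (psign (i * (j + fst l))) (br (j + fst l) i (act \<psi> l) \<phi>)"
        using less.hyps[OF _ p(1) A(2)] l 3 by (auto simp: letter_def)
      moreover have "br (i + fst l) j (act \<phi> l) \<psi> =
          - fs (psign ((i + fst l) * j)) (br j (i + fst l) \<psi> (act \<phi> l))"
        using less.hyps[OF _ A(1) p(2)] l 3 by (auto simp: letter_def)
      ultimately show "act (br i j \<phi> \<psi>) l = act (- fs (psign (i * j)) (br j i \<psi> \<phi>)) l"
        by (auto simp: act_lin br_leibniz[OF p] br_leibniz[OF p(2,1)] fs_psign)
    qed
  qed
qed

lemma br_jacobi_neg:
  assumes "(i, \<phi>) \<in> prolong D B s" "(j, \<psi>) \<in> prolong D B s" "(k, \<rho>) \<in> prolong D B s" "k < 0"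
  shows "br i (j + k) \<phi> (br j k \<psi> \<rho>) =
    br (i + j) k (br i j \<phi> \<psi>) \<rho> + fs (psign (i * j)) (br j (i + k) \<psi> (br i k \<phi> \<rho>))"
  using br_leibniz[OF assms(1,2), of "(k, \<rho> [])"]
    br_skew[OF assms(2) act_closed[OF assms(1), of "(k, \<rho> [])"]] assms(4)
  by (auto simp: br_neg_right fs_psign)

lemma br_jacobi:
  "(i, \<phi>) \<in> prolong D B s \<Longrightarrow> (j, \<psi>) \<in> prolong D B s \<Longrightarrow> (k, \<rho>) \<in> prolong D B s \<Longrightarrow>
   br i (j + k) \<phi> (br j k \<psi> \<rho>) =
   br (i + j) k (br i j \<phi> \<psi>) \<rho> + fs (psign (i * j)) (br j (i + k) \<psi> (br i k \<phi> \<rho>))"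
proof (induction "nat (i + j + k)" arbitrary: i j k \<phi> \<psi> \<rho> rule: less_induct)
  case less
  note p = less.prems
  note c = br_closed[OF p(1,2)] br_closed[OF p(1,3)] br_closed[OF p(2,3)]
  note c' = br_closed[OF p(2,1)] br_closed[OF p(3,1)] br_closed[OF p(3,2)]
  consider "k < 0" | "k \<ge> 0" "j < 0" | "k \<ge> 0" "j \<ge> 0" "i < 0" | "i = 0" "j = 0" "k = 0"
    | "i \<ge> 0" "j \<ge> 0" "k \<ge> 0" "i + j + k > 0" by linarith
  thus ?case
  proof cases
    case 1
    thus ?thesis using br_jacobi_neg p by blast
  next
    case 2
    have J: "br i (k + j) \<phi> (br k j \<rho> \<psi>) =
      br (i + k) j (br i k \<phi> \<rho>) \<psi> + fs (psign (i * k)) (br k (i + j) \<rho> (br i j \<phi> \<psi>))"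
      using br_jacobi_neg[OF p(1,3,2) 2(2)] .
    have "br j k \<psi> \<rho> = - fs (psign (j * k)) (br k j \<rho> \<psi>)" using br_skew[OF p(2,3)] .
    hence 1: "br i (j + k) \<phi> (br j k \<psi> \<rho>) = - fs (psign (j * k)) (br i (k + j) \<phi> (br k j \<rho> \<psi>))"
      using br_minus_right[OF p(1) P_scale[OF c'(3)]] br_scale_right[OF p(1) c'(3)]
      by (simp add: add.commute)
    have 2: "br j (i + k) \<psi> (br i k \<phi> \<rho>) =
        - fs (psign (j * (i + k))) (br (i + k) j (br i k \<phi> \<rho>) \<psi>)"
      using br_skew[OF p(2) c(2)] .
    have 3: "br (i + j) k (br i j \<phi> \<psi>) \<rho> =
        - fs (psign ((i + j) * k)) (br k (i + j) \<rho> (br i j \<phi> \<psi>))"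
      using br_skew[OF c(1) p(3)] .
    show ?thesis unfolding 1 2 3 J by (auto simp: fs_psign)
  next
    case 3
    have J: "br j (k + i) \<psi> (br k i \<rho> \<phi>) =
      br (j + k) i (br j k \<psi> \<rho>) \<phi> + fs (psign (j * k)) (br k (j + i) \<rho> (br j i \<psi> \<phi>))"
      using br_jacobi_neg[OF p(2,3,1) 3(3)] .
    have "br i k \<phi> \<rho> = - fs (psign (i * k)) (br k i \<rho> \<phi>)" using br_skew[OF p(1,3)] .
    hence 1: "br j (i + k) \<psi> (br i k \<phi> \<rho>) = - fs (psign (i * k)) (br j (k + i) \<psi> (br k i \<rho> \<phi>))"
      using br_minus_right[OF p(2) P_scale[OF c'(2)]] br_scale_right[OF p(2) c'(2)]
      by (simp add: add.commute)
    have 2: "br i (j + k) \<phi> (br j k \<psi> \<rho>) =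
        - fs (psign (i * (j + k))) (br (j + k) i (br j k \<psi> \<rho>) \<phi>)"
      using br_skew[OF p(1) c(3)] .
    have "br i j \<phi> \<psi> = - fs (psign (i * j)) (br j i \<psi> \<phi>)" using br_skew[OF p(1,2)] .
    hence "br k (i + j) \<rho> (br i j \<phi> \<psi>) = - fs (psign (i * j)) (br k (j + i) \<rho> (br j i \<psi> \<phi>))"
      using br_minus_right[OF p(3) P_scale[OF c'(1)]] br_scale_right[OF p(3) c'(1)]
      by (simp add: add.commute)
    hence 3: "br (i + j) k (br i j \<phi> \<psi>) \<rho> =
        fs (psign ((i + j) * k + i * j)) (br k (j + i) \<rho> (br j i \<psi> \<phi>))"
      using br_skew[OF c(1) p(3)] by (auto simp: fs_psign)
    show ?thesis unfolding 1 2 3 J by (auto simp: fs_psign)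
  next
    case 4
    obtain x where x: "x \<in> D 0" "\<phi> = emb x" using P_nonposE[OF p(1)] 4 by auto
    obtain y where y: "y \<in> D 0" "\<psi> = emb y" using P_nonposE[OF p(2)] 4 by auto
    obtain z where z: "z \<in> D 0" "\<rho> = emb z" using P_nonposE[OF p(3)] 4 by auto
    have m: "B x y \<in> D 0" "B y z \<in> D 0" "B x z \<in> D 0"
      using B_closed[of _ 0 _ 0] x y z by auto
    hence m': "B (B x y) z \<in> D 0" "B y (B x z) \<in> D 0"
      using B_closed[of _ 0 _ 0] x y z by auto
    show ?thesis using x y z m 4 B_jacobi[OF x(1) y(1) z(1)] emb_add[OF m']
      by (simp add: br_emb psign_def)
  next
    case 5
    show ?thesis
    proof (rule P_eqI[where k = "i + j + k"])
      show "(i + j + k, br i (j + k) \<phi> (br j k \<psi> \<rho>)) \<in> prolong D B s"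
        using br_closed[OF p(1) c(3)] by (simp add: algebra_simps)
      show "(i + j + k, br (i + j) k (br i j \<phi> \<psi>) \<rho>
          + fs (psign (i * j)) (br j (i + k) \<psi> (br i k \<phi> \<rho>))) \<in> prolong D B s"
        using br_closed[OF c(1) p(3)] br_closed[OF p(2) c(2)]
        by (intro P_add P_scale) (simp_all add: algebra_simps)
      show "i + j + k > 0" using 5 by simp
      fix l assume l: "letter D l"
      define d where "d = fst l"
      have d: "d < 0" using l by (simp add: letter_def d_def)
      note A = act_closed[OF p(1), of l, folded d_def] act_closed[OF p(2), of l, folded d_def]
        act_closed[OF p(3), of l, folded d_def]
      note H1 = less.hyps[OF _ A(1) p(2,3)]
      note H2 = less.hyps[OF _ p(1) A(2) p(3)]
      note H3 = less.hyps[OF _ p(1,2) A(3)]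
      have h: "nat (i + d + j + k) < nat (i + j + k)" "nat (i + (j + d) + k) < nat (i + j + k)"
        "nat (i + j + (k + d)) < nat (i + j + k)"
        using d 5 by auto
      note C1 = br_closed[OF A(1) p(2)] br_closed[OF A(1) p(3)]
      note C2 = br_closed[OF p(1) A(2)] br_closed[OF A(2) p(3)]
      note C3 = br_closed[OF p(1) A(3)] br_closed[OF p(2) A(3)]
      have ids: "i + d + j = i + j + d" "i + (j + d) = i + j + d" "j + d + k = j + k + d"
        "j + (k + d) = j + k + d" "i + d + k = i + k + d" "i + (k + d) = i + k + d"
        by simp_all
      note C1 = C1[unfolded ids] and C2 = C2[unfolded ids] and C3 = C3[unfolded ids]
      have e1: "act (br i (j + k) \<phi> (br j k \<psi> \<rho>)) l =
          br i (j + k + d) \<phi> (br j (k + d) \<psi> (act \<rho> l))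
          + fs (psign (k * d)) (br i (j + k + d) \<phi> (br (j + d) k (act \<psi> l) \<rho>))
          + fs (psign ((j + k) * d)) (br (i + d) (j + k) (act \<phi> l) (br j k \<psi> \<rho>))"
        using br_leibniz[OF p(1) c(3), of l] br_leibniz[OF p(2,3), of l]
          br_add_right[OF p(1) C3(2) P_scale[OF C2(2)]] br_scale_right[OF p(1) C2(2)]
        by (simp add: d_def)
      have e2: "act (br (i + j) k (br i j \<phi> \<psi>) \<rho>) l =
          br (i + j) (k + d) (br i j \<phi> \<psi>) (act \<rho> l)
          + fs (psign (k * d)) (br (i + j + d) k (br i (j + d) \<phi> (act \<psi> l)) \<rho>)
          + fs (psign (k * d + j * d)) (br (i + j + d) k (br (i + d) j (act \<phi> l) \<psi>) \<rho>)"
        using br_leibniz[OF c(1) p(3), of l] br_leibniz[OF p(1,2), of l]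
          br_add_left[OF C2(1) P_scale[OF C1(1)] p(3)] br_scale_left[OF C1(1) p(3)]
        by (simp add: d_def F.scale_right_distrib)
      have e3: "act (br j (i + k) \<psi> (br i k \<phi> \<rho>)) l =
          br j (i + k + d) \<psi> (br i (k + d) \<phi> (act \<rho> l))
          + fs (psign (k * d)) (br j (i + k + d) \<psi> (br (i + d) k (act \<phi> l) \<rho>))
          + fs (psign ((i + k) * d)) (br (j + d) (i + k) (act \<psi> l) (br i k \<phi> \<rho>))"
        using br_leibniz[OF p(2) c(2), of l] br_leibniz[OF p(1,3), of l]
          br_add_right[OF p(2) C3(1) P_scale[OF C1(2)]] br_scale_right[OF p(2) C1(2)]
        by (simp add: d_def)
      show "act (br i (j + k) \<phi> (br j k \<psi> \<rho>)) l = act (br (i + j) k (br i j \<phi> \<psi>) \<rho>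
          + fs (psign (i * j)) (br j (i + k) \<psi> (br i k \<phi> \<rho>))) l"
        unfolding act_add act_scale e1 e2 e3
          H1[OF h(1), unfolded ids] H2[OF h(2), unfolded ids] H3[OF h(3), unfolded ids]
        by (auto simp: fs_psign algebra_simps)
    qed
  qed
qed

abbreviation "G \<equiv> prolongation D B s"
abbreviation "bk \<equiv> brk (prolongation D B s)"
abbreviation "sg \<equiv> scl (prolongation D B s)"

definition "W = {x. \<forall>k. (k, Poly_Mapping.lookup x k) \<in> prolong D B s}"

lemma W_D: "x \<in> W \<Longrightarrow> (k, Poly_Mapping.lookup x k) \<in> prolong D B s"
  by (simp add: W_def)

lemma lookup_sg [simp]: "Poly_Mapping.lookup (sg c x) k = fs c (Poly_Mapping.lookup x k)"
  by (cases "Poly_Mapping.lookup x k = 0") (auto simp: prolongation_def map.rep_eq when_def)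

lemma W_zero: "0 \<in> W"
  by (simp add: W_def P_zero)

lemma W_add: "x \<in> W \<Longrightarrow> y \<in> W \<Longrightarrow> x + y \<in> W"
  by (simp add: W_def P_add lookup_add)

lemma W_scale: "x \<in> W \<Longrightarrow> sg c x \<in> W"
  by (simp add: W_def P_scale)

lemma W_single: "(k, \<phi>) \<in> prolong D B s \<Longrightarrow> Poly_Mapping.single k \<phi> \<in> W"
  by (auto simp: W_def lookup_single when_def P_zero)

lemma W_sum: "(\<And>i. i \<in> I \<Longrightarrow> h i \<in> W) \<Longrightarrow> sum h I \<in> W"
  by (induction I rule: infinite_finite_induct) (auto simp: W_zero W_add)

lemma sg_vs: "vector_space sg"
  by unfold_locales
    (auto intro!: poly_mapping_eqI simp: lookup_add F.scale_right_distrib F.scale_left_distrib)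

sublocale GV: vector_space sg by (rule sg_vs)

lemma part_iff: "x \<in> part G p \<longleftrightarrow> x \<in> W \<and> (\<forall>k\<in>Poly_Mapping.keys x. even (k + int p))"
proof -
  have "x \<in> W" if x: "\<forall>k\<in>Poly_Mapping.keys x. (k, Poly_Mapping.lookup x k) \<in> prolong D B s"
    unfolding W_def
  proof (intro CollectI allI)
    fix k
    show "(k, Poly_Mapping.lookup x k) \<in> prolong D B s"
      using x P_zero[of k] by (cases "k \<in> Poly_Mapping.keys x") (auto simp: in_keys_iff)
  qed
  hence "(\<forall>k\<in>Poly_Mapping.keys x. (k, Poly_Mapping.lookup x k) \<in> prolong D B s) \<longleftrightarrow> x \<in> W"
    by (auto simp: W_def)
  thus ?thesis by (auto simp: part_def prolongation_def)
qed

lemma poly_expand: "x = (\<Sum>k\<in>Poly_Mapping.keys x. Poly_Mapping.single k (Poly_Mapping.lookup x k))"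
  by (rule poly_mapping_eqI) (auto simp: lookup_sum lookup_single when_def in_keys_iff)

lemma bk_superset:
  assumes "x \<in> W" "y \<in> W" "finite I" "finite J"
    "Poly_Mapping.keys x \<subseteq> I" "Poly_Mapping.keys y \<subseteq> J"
  shows "bk x y = (\<Sum>i\<in>I. \<Sum>j\<in>J. Poly_Mapping.single (i + j)
           (br i j (Poly_Mapping.lookup x i) (Poly_Mapping.lookup y j)))"
proof -
  have "bk x y = (\<Sum>i\<in>Poly_Mapping.keys x. \<Sum>j\<in>J. Poly_Mapping.single (i + j)
           (br i j (Poly_Mapping.lookup x i) (Poly_Mapping.lookup y j)))"
    unfolding prolongation_def superalgebra.simps
    using assms by (intro sum.cong sum.mono_neutral_left refl)
      (auto simp: in_keys_iff br_zero_right W_D)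
  also have "\<dots> = (\<Sum>i\<in>I. \<Sum>j\<in>J. Poly_Mapping.single (i + j)
           (br i j (Poly_Mapping.lookup x i) (Poly_Mapping.lookup y j)))"
    using assms by (intro sum.mono_neutral_left) (auto simp: in_keys_iff br_zero_left W_D)
  finally show ?thesis .
qed

lemma bk_add_left:
  assumes "x \<in> W" "x' \<in> W" "y \<in> W"
  shows "bk (x + x') y = bk x y + bk x' y"
proof -
  let ?I = "Poly_Mapping.keys x \<union> Poly_Mapping.keys x'" and ?J = "Poly_Mapping.keys y"
  have "Poly_Mapping.keys (x + x') \<subseteq> ?I" by (rule keys_add)
  thus ?thesis
    using assms W_D bk_superset[of "x + x'" y ?I ?J] bk_superset[of x y ?I ?J]
      bk_superset[of x' y ?I ?J]
    by (simp add: W_add lookup_add br_add_left single_add sum.distrib)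
qed

lemma bk_add_right:
  assumes "x \<in> W" "y \<in> W" "y' \<in> W"
  shows "bk x (y + y') = bk x y + bk x y'"
proof -
  let ?I = "Poly_Mapping.keys x" and ?J = "Poly_Mapping.keys y \<union> Poly_Mapping.keys y'"
  have "Poly_Mapping.keys (y + y') \<subseteq> ?J" by (rule keys_add)
  thus ?thesis
    using assms W_D bk_superset[of x "y + y'" ?I ?J] bk_superset[of x y ?I ?J]
      bk_superset[of x y' ?I ?J]
    by (simp add: W_add lookup_add br_add_right single_add sum.distrib)
qed

lemma sg_single: "sg c (Poly_Mapping.single k \<phi>) = Poly_Mapping.single k (fs c \<phi>)"
  by (rule poly_mapping_eqI) (auto simp: lookup_single when_def)

lemma sg_sum: "sg c (sum h I) = (\<Sum>i\<in>I. sg c (h i))"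
  by (rule GV.scale_sum_right)

lemma keys_sg: "Poly_Mapping.keys (sg c x) \<subseteq> Poly_Mapping.keys x"
  by (auto simp: in_keys_iff)

lemma bk_scale_left:
  assumes "x \<in> W" "y \<in> W"
  shows "bk (sg c x) y = sg c (bk x y)"
  using assms W_D bk_superset[of "sg c x" y "Poly_Mapping.keys x" "Poly_Mapping.keys y"]
    bk_superset[of x y "Poly_Mapping.keys x" "Poly_Mapping.keys y"]
  by (simp add: W_scale keys_sg br_scale_left sg_sum sg_single)

lemma bk_scale_right:
  assumes "x \<in> W" "y \<in> W"
  shows "bk x (sg c y) = sg c (bk x y)"
  using assms W_D bk_superset[of x "sg c y" "Poly_Mapping.keys x" "Poly_Mapping.keys y"]
    bk_superset[of x y "Poly_Mapping.keys x" "Poly_Mapping.keys y"]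
  by (simp add: W_scale keys_sg br_scale_right sg_sum sg_single)

lemma bk_zero_left: "y \<in> W \<Longrightarrow> bk 0 y = 0"
  using bk_scale_left[of 0 y 0] W_zero by simp

lemma bk_zero_right: "x \<in> W \<Longrightarrow> bk x 0 = 0"
  using bk_scale_right[of x 0 0] W_zero by simp

lemma bk_sum_left: "(\<And>i. i \<in> I \<Longrightarrow> h i \<in> W) \<Longrightarrow> y \<in> W \<Longrightarrow> bk (sum h I) y = (\<Sum>i\<in>I. bk (h i) y)"
  by (induction I rule: infinite_finite_induct) (auto simp: bk_zero_left bk_add_left W_sum)

lemma bk_sum_right: "(\<And>i. i \<in> I \<Longrightarrow> h i \<in> W) \<Longrightarrow> x \<in> W \<Longrightarrow> bk x (sum h I) = (\<Sum>i\<in>I. bk x (h i))"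
  by (induction I rule: infinite_finite_induct) (auto simp: bk_zero_right bk_add_right W_sum)

lemma bk_single:
  assumes "(i, \<phi>) \<in> prolong D B s" "(j, \<psi>) \<in> prolong D B s"
  shows "bk (Poly_Mapping.single i \<phi>) (Poly_Mapping.single j \<psi>) =
         Poly_Mapping.single (i + j) (br i j \<phi> \<psi>)"
  using bk_superset[of "Poly_Mapping.single i \<phi>" "Poly_Mapping.single j \<psi>" "{i}" "{j}"]
    W_single assms by simp

abbreviation "cmp x k \<equiv> Poly_Mapping.single k (Poly_Mapping.lookup x k)"

lemma cmp_W: "x \<in> W \<Longrightarrow> cmp x k \<in> W"
  by (intro W_single W_D)

lemma bk_expand:
  assumes "x \<in> W" "y \<in> W"
  shows "bk x y = (\<Sum>i\<in>Poly_Mapping.keys x. \<Sum>j\<in>Poly_Mapping.keys y. bk (cmp x i) (cmp y j))"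
  using assms by (subst bk_superset[of x y "Poly_Mapping.keys x" "Poly_Mapping.keys y"])
    (auto simp: bk_single W_D)

lemma bk_W: "x \<in> W \<Longrightarrow> y \<in> W \<Longrightarrow> bk x y \<in> W"
  by (subst bk_expand) (auto intro!: W_sum simp: bk_single W_D br_closed W_single)

lemma keys_sum_subset: "Poly_Mapping.keys (sum h I) \<subseteq> (\<Union>i\<in>I. Poly_Mapping.keys (h i))"
proof (induction I rule: infinite_finite_induct)
  case (insert i I)
  thus ?case using keys_add[of "h i" "sum h I"] by auto
qed auto

lemma bk_keys:
  assumes "x \<in> W" "y \<in> W" "k \<in> Poly_Mapping.keys (bk x y)"
  shows "\<exists>i\<in>Poly_Mapping.keys x. \<exists>j\<in>Poly_Mapping.keys y. k = i + j"
proof -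
  have "Poly_Mapping.keys (bk x y) \<subseteq> (\<Union>i\<in>Poly_Mapping.keys x. \<Union>j\<in>Poly_Mapping.keys y. {i + j})"
    unfolding bk_expand[OF assms(1,2)]
    using assms by (intro order.trans[OF keys_sum_subset] UN_mono order_refl)
      (auto simp: bk_single W_D split: if_splits)
  with assms(3) show ?thesis by blast
qed

lemma bk_part:
  assumes "x \<in> part G p" "y \<in> part G q"
  shows "bk x y \<in> part G (p + q)"
  unfolding part_iff
proof (intro conjI ballI)
  have W: "x \<in> W" "y \<in> W" using assms by (auto simp: part_iff)
  show "bk x y \<in> W" using W by (rule bk_W)
  fix k assume "k \<in> Poly_Mapping.keys (bk x y)"
  then obtain i j where "i \<in> Poly_Mapping.keys x" "j \<in> Poly_Mapping.keys y" "k = i + j"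
    using bk_keys[OF W] by blast
  moreover from this have "even (i + int p)" "even (j + int q)" using assms by (auto simp: part_iff)
  ultimately show "even (k + int (p + q))" by simp
qed

lemma part_sub: "module.subspace sg (part G p)"
  unfolding GV.subspace_def
proof (intro conjI ballI allI)
  show "0 \<in> part G p" by (simp add: part_iff W_zero)
next
  fix x y assume "x \<in> part G p" "y \<in> part G p"
  thus "x + y \<in> part G p" using keys_add[of x y] W_add unfolding part_iff by blast
next
  fix x c assume "x \<in> part G p"
  thus "sg c x \<in> part G p" using keys_sg[of c x] W_scale unfolding part_iff by blast
qed

lemma whole_W: "x \<in> whole G \<longleftrightarrow> x \<in> W"
proof
  have e: "even_part G = part G 0" "odd_part G = part G 1" by (auto simp: part_def)
  show "x \<in> W" if "x \<in> whole G"
    using that W_add unfolding whole_def e by (auto simp: part_iff)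
  assume x: "x \<in> W"
  let ?E = "{k \<in> Poly_Mapping.keys x. even k}" and ?O = "{k \<in> Poly_Mapping.keys x. odd k}"
  have u: "Poly_Mapping.keys x = ?E \<union> ?O" by auto
  have "x = (\<Sum>k\<in>?E. cmp x k) + (\<Sum>k\<in>?O. cmp x k)"
    by (subst poly_expand[of x], subst u, rule sum.union_disjoint) auto
  moreover have "(\<Sum>k\<in>?E. cmp x k) \<in> part G 0" "(\<Sum>k\<in>?O. cmp x k) \<in> part G 1"
    by (auto intro!: module.subspace_sum[OF GV.module_axioms part_sub])
      (auto simp: part_iff cmp_W x split: if_splits)
  ultimately show "x \<in> whole G" unfolding whole_def e by blast
qed

lemma bk_skew:
  assumes "x \<in> part G p" "y \<in> part G q"
  shows "bk x y = - sg ((-1) ^ (p * q)) (bk y x)"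
proof -
  have W: "x \<in> W" "y \<in> W" using assms by (auto simp: part_iff)
  have "bk (cmp x i) (cmp y j) = - sg ((-1) ^ (p * q)) (bk (cmp y j) (cmp x i))"
    if "i \<in> Poly_Mapping.keys x" "j \<in> Poly_Mapping.keys y" for i j
  proof -
    have "even (i + int p)" "even (j + int q)" using assms that by (auto simp: part_iff)
    hence "(-1) ^ (p * q) = (psign (i * j) :: 'k)"
      by (auto simp: psign_def minus_one_power_iff)
    thus ?thesis using W br_skew[OF W_D W_D, of x y i j]
      by (simp add: bk_single W_D sg_single single_uminus add.commute)
  qed
  thus ?thesis using W
    by (simp add: bk_expand[of x y] bk_expand[of y x] sg_sum sum_negf sum.swap[of _ _ "Poly_Mapping.keys y"])
qed

lemma bk_jacobi:
  assumes "x \<in> part G p" "y \<in> part G q" "z \<in> part G r"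
  shows "bk x (bk y z) = bk (bk x y) z + sg ((-1) ^ (p * q)) (bk y (bk x z))"
proof -
  have W: "x \<in> W" "y \<in> W" "z \<in> W" using assms by (auto simp: part_iff)
  let ?X = "Poly_Mapping.keys x" and ?Y = "Poly_Mapping.keys y" and ?Z = "Poly_Mapping.keys z"
  have J: "bk (cmp x i) (bk (cmp y j) (cmp z k)) = bk (bk (cmp x i) (cmp y j)) (cmp z k)
      + sg ((-1) ^ (p * q)) (bk (cmp y j) (bk (cmp x i) (cmp z k)))"
    if "i \<in> ?X" "j \<in> ?Y" for i j k
  proof -
    have "even (i + int p)" "even (j + int q)" using assms that by (auto simp: part_iff)
    hence "(-1) ^ (p * q) = (psign (i * j) :: 'k)"
      by (auto simp: psign_def minus_one_power_iff)
    moreover have a: "j + (i + k) = i + (j + k)" by simp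
    ultimately show ?thesis using br_jacobi[OF W_D[OF W(1)] W_D[OF W(2)] W_D[OF W(3)], of i j k]
      by (simp add: bk_single W_D W br_closed sg_single single_add add.assoc a)
  qed
  have t3: "bk a (bk b c) = (\<Sum>i\<in>Poly_Mapping.keys a. \<Sum>j\<in>Poly_Mapping.keys b. \<Sum>k\<in>Poly_Mapping.keys c.
      bk (cmp a i) (bk (cmp b j) (cmp c k)))" if "a \<in> W" "b \<in> W" "c \<in> W" for a b c
  proof -
    have "bk a (bk b c) = (\<Sum>i\<in>Poly_Mapping.keys a. bk (cmp a i) (bk b c))"
      by (subst poly_expand[of a], rule bk_sum_left) (auto simp: that bk_W cmp_W)
    also have "\<dots> = (\<Sum>i\<in>Poly_Mapping.keys a. \<Sum>j\<in>Poly_Mapping.keys b. \<Sum>k\<in>Poly_Mapping.keys c.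
      bk (cmp a i) (bk (cmp b j) (cmp c k)))"
      unfolding bk_expand[OF that(2,3)]
      by (intro sum.cong refl)
        (simp add: bk_sum_right cmp_W that bk_W W_sum)
    finally show ?thesis .
  qed
  have t2: "bk (bk x y) z = (\<Sum>i\<in>?X. \<Sum>j\<in>?Y. \<Sum>k\<in>?Z. bk (bk (cmp x i) (cmp y j)) (cmp z k))"
  proof -
    have "bk (bk x y) z = (\<Sum>k\<in>?Z. bk (bk x y) (cmp z k))"
      by (subst poly_expand[of z], rule bk_sum_right) (auto simp: W bk_W cmp_W)
    also have "\<dots> = (\<Sum>k\<in>?Z. \<Sum>i\<in>?X. \<Sum>j\<in>?Y. bk (bk (cmp x i) (cmp y j)) (cmp z k))"
      unfolding bk_expand[OF W(1,2)]
      by (intro sum.cong refl) (simp add: bk_sum_left cmp_W W bk_W W_sum)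
    finally show ?thesis
      by (simp add: sum.swap[of _ _ ?Z])
  qed
  have "bk x (bk y z) = (\<Sum>i\<in>?X. \<Sum>j\<in>?Y. \<Sum>k\<in>?Z. bk (bk (cmp x i) (cmp y j)) (cmp z k)
      + sg ((-1) ^ (p * q)) (bk (cmp y j) (bk (cmp x i) (cmp z k))))"
    unfolding t3[OF W] by (intro sum.cong refl J) auto
  also have "\<dots> = bk (bk x y) z + sg ((-1) ^ (p * q))
      (\<Sum>i\<in>?X. \<Sum>j\<in>?Y. \<Sum>k\<in>?Z. bk (cmp y j) (bk (cmp x i) (cmp z k)))"
    by (simp add: sum.distrib t2 sg_sum)
  also have "(\<Sum>i\<in>?X. \<Sum>j\<in>?Y. \<Sum>k\<in>?Z. bk (cmp y j) (bk (cmp x i) (cmp z k))) = bk y (bk x z)"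
    unfolding t3[OF W(2,1,3)] by (rule sum.swap)
  finally show ?thesis .
qed

theorem prolongation_lie_superalgebra: "lie_superalgebra G"
  unfolding lie_superalgebra_def
proof (intro conjI)
  have e: "even_part G = part G 0" "odd_part G = part G 1" by (auto simp: part_def)
  show "module.subspace sg (even_part G)" "module.subspace sg (odd_part G)"
    unfolding e by (rule part_sub)+
  show "even_part G \<inter> odd_part G = {0}"
    unfolding e by (auto simp: part_iff W_zero)
  show "vector_space sg" by (rule sg_vs)
  show "\<forall>p q. \<forall>x\<in>part G p. \<forall>y\<in>part G q. bk x y \<in> part G (p + q)"
    using bk_part by blast
  show "\<forall>x\<in>whole G. \<forall>y\<in>whole G. \<forall>z\<in>whole G. \<forall>c.
      bk (x + y) z = bk x z + bk y z \<and> bk x (y + z) = bk x y + bk x z \<and>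
      bk (sg c x) y = sg c (bk x y) \<and> bk x (sg c y) = sg c (bk x y)"
  proof (intro ballI allI)
    fix x y z c assume "x \<in> whole G" "y \<in> whole G" "z \<in> whole G"
    hence "x \<in> W" "y \<in> W" "z \<in> W" by (simp_all only: whole_W)
    thus "bk (x + y) z = bk x z + bk y z \<and> bk x (y + z) = bk x y + bk x z \<and>
      bk (sg c x) y = sg c (bk x y) \<and> bk x (sg c y) = sg c (bk x y)"
      by (simp add: bk_add_left bk_add_right bk_scale_left bk_scale_right)
  qed
  show "\<forall>p q. \<forall>x\<in>part G p. \<forall>y\<in>part G q. bk x y = - sg ((-1) ^ (p * q)) (bk y x)"
    using bk_skew by blast
  show "\<forall>p q r. \<forall>x\<in>part G p. \<forall>y\<in>part G q. \<forall>z\<in>part G r.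
      bk x (bk y z) = bk (bk x y) z + sg ((-1) ^ (p * q)) (bk y (bk x z))"
    using bk_jacobi by blast
qed

end

subsection \<open>Maximality\<close>

text \<open>
  \<open>transitive_prolongation D B s H E f\<close>: the Lie superalgebra \<open>H\<close> is graded over the integers with
  components \<open>E k\<close>, is transitive, and \<open>f\<close> identifies its nonpositive part with that given
  by \<open>D\<close>, \<open>B\<close> and \<open>s\<close>.
\<close>

definition transitive_prolongation ::
    "(int \<Rightarrow> 'l::ab_group_add set) \<Rightarrow> ('l \<Rightarrow> 'l \<Rightarrow> 'l) \<Rightarrow> ('k::field \<Rightarrow> 'l \<Rightarrow> 'l)
     \<Rightarrow> ('k, 'v::ab_group_add) superalgebra \<Rightarrow> (int \<Rightarrow> 'v set) \<Rightarrow> ('l \<Rightarrow> 'v) \<Rightarrow> bool" where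
  "transitive_prolongation D B s H E f \<longleftrightarrow>
     lie_superalgebra H \<and>
     (\<forall>k. module.subspace (scl H) (E k)) \<and>
     (\<forall>k. \<forall>x\<in>E k. \<exists>a\<in>even_part H \<inter> E k. \<exists>b\<in>odd_part H \<inter> E k. x = a + b) \<and>
     whole H = {sum h K | h K. finite K \<and> (\<forall>k\<in>K. h k \<in> E k)} \<and>
     (\<forall>h K. finite K \<and> (\<forall>k\<in>K. h k \<in> E k) \<and> sum h K = 0 \<longrightarrow> (\<forall>k\<in>K. h k = 0)) \<and>
     (\<forall>i j. \<forall>x\<in>E i. \<forall>y\<in>E j. brk H x y \<in> E (i + j)) \<and>
     (\<forall>k\<le>0. bij_betw f (D k) (E k) \<and> f ` D k \<subseteq> part H (nat \<bar>k\<bar>)) \<and>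
     (\<forall>k\<le>0. \<forall>x\<in>D k. \<forall>y\<in>D k. \<forall>a b. f (s a x + s b y) = scl H a (f x) + scl H b (f y)) \<and>
     (\<forall>i\<le>0. \<forall>j\<le>0. \<forall>x\<in>D i. \<forall>y\<in>D j. brk H (f x) (f y) = f (B x y)) \<and>
     (\<forall>k\<ge>0. \<forall>x\<in>E k. (\<forall>y\<in>E (-1). brk H x y = 0) \<longrightarrow> x = 0)"

definition graded_embedding ::
    "(int \<Rightarrow> 'l set) \<Rightarrow> ('k::field, 'v::ab_group_add) superalgebra \<Rightarrow> (int \<Rightarrow> 'v set) \<Rightarrow> ('l \<Rightarrow> 'v)
     \<Rightarrow> ('k, 'w::ab_group_add) superalgebra \<Rightarrow> (int \<Rightarrow> 'w set) \<Rightarrow> ('l \<Rightarrow> 'w) \<Rightarrow> ('v \<Rightarrow> 'w) \<Rightarrow> bool" where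
  "graded_embedding D H E f H' E' f' \<Psi> \<longleftrightarrow>
     (\<forall>x\<in>whole H. \<forall>y\<in>whole H. \<Psi> (x + y) = \<Psi> x + \<Psi> y) \<and>
     (\<forall>c. \<forall>x\<in>whole H. \<Psi> (scl H c x) = scl H' c (\<Psi> x)) \<and>
     (\<forall>x\<in>whole H. \<forall>y\<in>whole H. \<Psi> (brk H x y) = brk H' (\<Psi> x) (\<Psi> y)) \<and>
     (\<forall>p. \<Psi> ` part H p \<subseteq> part H' p) \<and> (\<forall>k. \<Psi> ` E k \<subseteq> E' k) \<and> inj_on \<Psi> (whole H) \<and>
     (\<forall>k\<le>0. \<forall>x\<in>D k. \<Psi> (f x) = f' x)"

context nonpositive_superalgebra
begin

definition GE :: "int \<Rightarrow> (int \<Rightarrow>\<^sub>0 ('l word \<Rightarrow> 'l)) set" where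
  "GE k = {Poly_Mapping.single k \<phi> | \<phi>. (k, \<phi>) \<in> prolong D B s}"

definition Gf :: "'l \<Rightarrow> int \<Rightarrow>\<^sub>0 ('l word \<Rightarrow> 'l)" where
  "Gf x = (if x = 0 then 0
           else Poly_Mapping.single (SOME k. k \<le> 0 \<and> x \<in> D k) (emb x))"

lemma Gf_eq:
  assumes "k \<le> 0" "x \<in> D k"
  shows "Gf x = Poly_Mapping.single k (emb x)"
proof (cases "x = 0")
  case False
  hence "(SOME k. k \<le> 0 \<and> x \<in> D k) = k" using assms False D_disj by (intro some_equality) blast+
  thus ?thesis using False by (simp add: Gf_def)
qed (simp add: Gf_def)

theorem prolongation_transitive:
  assumes gen: "\<And>d. d < -1 \<Longrightarrow> D d \<subseteq> S.span {B y z | y z. y \<in> D (-1) \<and> z \<in> D (d + 1)}"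
    and faithful: "\<And>x. x \<in> D 0 \<Longrightarrow> (\<And>y. y \<in> D (-1) \<Longrightarrow> B x y = 0) \<Longrightarrow> x = 0"
  shows "transitive_prolongation D B s G GE Gf"
proof -
  have part_single: "Poly_Mapping.single k \<phi> \<in> part G p" if "(k, \<phi>) \<in> prolong D B s" "even (k + int p)"
    for k \<phi> p using that W_single by (auto simp: part_iff)
  have GE_sub: "GV.subspace (GE k)" for k
    unfolding GV.subspace_def GE_def
    using P_zero[of k] P_add[of k] P_scale[of k]
    by (auto simp: sg_single single_add[symmetric]) (metis single_zero)
  have GE_W: "x \<in> GE k \<Longrightarrow> x \<in> W" for x k
    using W_single by (auto simp: GE_def)
  have dec: "\<exists>a\<in>even_part G \<inter> GE k. \<exists>b\<in>odd_part G \<inter> GE k. x = a + b" if x: "x \<in> GE k" for x k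
  proof -
    obtain \<phi> where p: "x = Poly_Mapping.single k \<phi>" "(k, \<phi>) \<in> prolong D B s" using x by (auto simp: GE_def)
    have e: "even_part G = part G 0" "odd_part G = part G 1" by (auto simp: part_def)
    have z: "0 \<in> part G q" "0 \<in> GE k" for q using part_sub GE_sub GV.subspace_0 by blast+
    show ?thesis
    proof (cases "even k")
      case True
      thus ?thesis using x z p part_single[OF p(2), of 0] unfolding e
        by (intro bexI[of _ x] bexI[of _ 0]) auto
    next
      case False
      thus ?thesis using x z p part_single[OF p(2), of 1] unfolding e
        by (intro bexI[of _ 0] bexI[of _ x]) auto
    qed
  qed
  have whole: "whole G = {sum h K | h K. finite K \<and> (\<forall>k\<in>K. h k \<in> GE k)}"
  proof (intro equalityI subsetI)
    fix x assume "x \<in> whole G"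
    hence "x \<in> W" by (simp add: whole_W)
    hence "\<forall>k\<in>Poly_Mapping.keys x. cmp x k \<in> GE k" using W_D by (auto simp: GE_def)
    thus "x \<in> {sum h K | h K. finite K \<and> (\<forall>k\<in>K. h k \<in> GE k)}"
      using poly_expand[of x] by (intro CollectI exI[of _ "cmp x"] exI[of _ "Poly_Mapping.keys x"]) auto
  next
    fix x assume "x \<in> {sum h K | h K. finite K \<and> (\<forall>k\<in>K. h k \<in> GE k)}"
    thus "x \<in> whole G" using GE_W by (auto simp: whole_W intro!: W_sum)
  qed
  have indep: "\<forall>k\<in>K. h k = 0"
    if K: "finite K" "\<forall>k\<in>K. h k \<in> GE k" "sum h K = 0" for h K
  proof
    fix k assume k: "k \<in> K"
    have "Poly_Mapping.lookup (h i) k = (if i = k then Poly_Mapping.lookup (h k) k else 0)"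
      if "i \<in> K" for i using that \<open>\<forall>k\<in>K. h k \<in> GE k\<close>
      by (auto simp: GE_def lookup_single when_def split: if_splits)
    hence "Poly_Mapping.lookup (sum h K) k = (\<Sum>i\<in>K. if i = k then Poly_Mapping.lookup (h k) k else 0)"
      by (simp add: lookup_sum)
    also have "\<dots> = Poly_Mapping.lookup (h k) k" using k K(1) by simp
    finally have "Poly_Mapping.lookup (h k) k = 0" using K(3) by simp
    moreover obtain \<phi> where "h k = Poly_Mapping.single k \<phi>" using K(2) k by (auto simp: GE_def)
    ultimately show "h k = 0" by simp
  qed
  have br_GE: "bk x y \<in> GE (i + j)" if "x \<in> GE i" "y \<in> GE j" for x y i j
    using that br_closed by (auto simp: GE_def bk_single)
  have f_bij: "bij_betw Gf (D k) (GE k)" if "k \<le> 0" for k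
  proof (rule bij_betwI')
    show "Gf x = Gf y \<longleftrightarrow> x = y" if "x \<in> D k" "y \<in> D k" for x y
    proof
      assume "Gf x = Gf y"
      hence "emb x [] = emb y []"
        using Gf_eq[OF \<open>k \<le> 0\<close>] that by (metis lookup_single_eq)
      thus "x = y" by simp
    qed simp
    show "Gf x \<in> GE k" if "x \<in> D k" for x
      using that \<open>k \<le> 0\<close> Gf_eq P_emb by (auto simp: GE_def)
    show "\<exists>x\<in>D k. y = Gf x" if "y \<in> GE k" for y
      using that \<open>k \<le> 0\<close> Gf_eq P_nonposE unfolding GE_def by (smt (verit) mem_Collect_eq)
  qed
  have f_part: "Gf ` D k \<subseteq> part G (nat \<bar>k\<bar>)" if "k \<le> 0" for k
    using that Gf_eq part_single P_emb by (auto simp: even_nat_iff)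
  have f_lin: "Gf (s a x + s b y) = sg a (Gf x) + sg b (Gf y)"
    if "k \<le> 0" "x \<in> D k" "y \<in> D k" for k x y a b
    using that Gf_eq[OF that(1)] D_add D_scale emb_lin[of x k y a b]
    by (simp add: sg_single single_add)
  have f_br: "bk (Gf x) (Gf y) = Gf (B x y)"
    if "i \<le> 0" "j \<le> 0" "x \<in> D i" "y \<in> D j" for i j x y
    using that Gf_eq[OF that(1,3)] Gf_eq[OF that(2,4)]
      Gf_eq[OF _ B_closed[OF that(3,4)]] br_emb P_emb
    by (simp add: bk_single)
  have trans: "x = 0" if k: "k \<ge> 0" and x: "x \<in> GE k" and 0: "\<forall>y\<in>GE (-1). bk x y = 0" for k x
  proof -
    obtain \<phi> where p: "x = Poly_Mapping.single k \<phi>" "(k, \<phi>) \<in> prolong D B s"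
      using x by (auto simp: GE_def)
    have m1: "act \<phi> (-1, y) = 0" if "y \<in> D (-1)" for y
    proof -
      have y: "(-1, emb y) \<in> prolong D B s" using that P_emb by simp
      hence "Poly_Mapping.single (-1) (emb y) \<in> GE (-1)" by (auto simp: GE_def)
      hence "Poly_Mapping.single (k - 1) (br k (-1) \<phi> (emb y)) = 0"
        using 0 p(1) bk_single[OF p(2) y] by simp
      hence "br k (-1) \<phi> (emb y) = 0" by (metis lookup_single_eq lookup_zero)
      thus ?thesis by (simp add: br_neg_right)
    qed
    have all: "act \<phi> (- 1 - int n, y) = 0" if "y \<in> D (- 1 - int n)" for n y
      using that
    proof (induction n arbitrary: y)
      case 0
      thus ?case using m1 by simp
    next
      case (Suc n)
      let ?d = "- 1 - int (Suc n)"
      have sp: "GV.subspace (GE k)" by (rule GE_sub)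
      have "y \<in> S.span {B y z | y z. y \<in> D (-1) \<and> z \<in> D (?d + 1)}"
        using gen[of ?d] Suc.prems by auto
      hence "y \<in> D ?d \<and> act \<phi> (?d, y) = 0"
      proof (induction rule: S.span_induct_alt)
        case base
        thus ?case using D_zero act_letter_zero[OF p(2)] by simp
      next
        case (step c w u)
        then obtain a b where ab: "w = B a b" "a \<in> D (-1)" "b \<in> D (?d + 1)" by auto
        have w: "w \<in> D ?d" using B_closed[OF ab(2,3)] ab by simp
        have e: "?d + 1 = - 1 - int n" by simp
        have b0: "act \<phi> (?d + 1, b) = 0" using Suc.IH ab(3) unfolding e by blast
        have "act \<phi> (-1 + (?d + 1), B a b) = 0"
          using act_derivation[OF p(2) _ _ ab(2,3)] m1[OF ab(2)] b0 by (simp add: act_lin)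
        hence w0: "act \<phi> (?d, w) = 0" using ab by simp
        have "act \<phi> (?d, s c w + s 1 u) = fs c 0 + fs 1 0"
          using act_letter_lin[OF p(2) _ w conjunct1[OF step(2)], of c 1]
          unfolding w0 conjunct2[OF step(2)] by simp
        hence "act \<phi> (?d, s c w + u) = 0"
          unfolding F.scale_zero_right S.scale_one add_0_left .
        thus ?case using D_add D_scale w step(2) by blast
      qed
      thus ?case by simp
    qed
    have z: "act \<phi> l = 0" if l: "letter D l" for l
    proof -
      obtain d y where "l = (d, y)" by (cases l)
      thus ?thesis using all[of y "nat (- d - 1)"] l by (auto simp: letter_def)
    qed
    show ?thesis
    proof (cases "k = 0")
      case False
      hence "\<phi> = 0" using k by (intro P_eqI[OF p(2) P_zero]) (auto simp: z act_lin)
      thus ?thesis using p by simp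
    next
      case True
      obtain x0 where x0: "x0 \<in> D 0" "\<phi> = emb x0" using P_nonposE[OF p(2)] True by auto
      have "B x0 y = 0" if "y \<in> D (-1)" for y
      proof -
        have "emb (B x0 y) = 0" using m1[OF that] that x0 by (simp add: act_emb')
        thus ?thesis by (metis emb_Nil zero_fun_apply)
      qed
      hence "x0 = 0" using faithful x0 by blast
      thus ?thesis using p x0 by simp
    qed
  qed
  show ?thesis
    unfolding transitive_prolongation_def
  proof (intro conjI)
    show "\<forall>k. GV.subspace (GE k)"
      by (intro allI GE_sub)
    show "\<forall>k. \<forall>x\<in>GE k. \<exists>a\<in>even_part G \<inter> GE k. \<exists>b\<in>odd_part G \<inter> GE k. x = a + b"
      by (intro allI ballI dec)
    show "\<forall>h K. finite K \<and> (\<forall>k\<in>K. h k \<in> GE k) \<and> sum h K = 0 \<longrightarrow> (\<forall>k\<in>K. h k = 0)"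
      by (intro allI impI, elim conjE) (rule indep)
    show "\<forall>i j. \<forall>x\<in>GE i. \<forall>y\<in>GE j. bk x y \<in> GE (i + j)"
      by (intro allI ballI br_GE)
    show "\<forall>k\<le>0. bij_betw Gf (D k) (GE k) \<and> Gf ` D k \<subseteq> part G (nat \<bar>k\<bar>)"
      by (intro allI impI conjI f_bij f_part)
    show "\<forall>k\<le>0. \<forall>x\<in>D k. \<forall>y\<in>D k. \<forall>a b. Gf (s a x + s b y) = sg a (Gf x) + sg b (Gf y)"
      by (intro allI impI ballI) (rule f_lin)
    show "\<forall>i\<le>0. \<forall>j\<le>0. \<forall>x\<in>D i. \<forall>y\<in>D j. bk (Gf x) (Gf y) = Gf (B x y)"
      by (intro allI impI ballI) (rule f_br)
    show "\<forall>k\<ge>0. \<forall>x\<in>GE k. (\<forall>y\<in>GE (- 1). bk x y = 0) \<longrightarrow> x = 0"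
      by (intro allI impI ballI) (rule trans)
  qed (rule prolongation_lie_superalgebra whole)+
qed

theorem prolongation_maximal:
  fixes H :: "('k, 'v::ab_group_add) superalgebra"
  assumes tp: "transitive_prolongation D B s H E f"
  shows "\<exists>\<Psi>. graded_embedding D H E f G GE Gf \<Psi>"
proof -
  note t = tp[unfolded transitive_prolongation_def]
  note l = conjunct1[OF t, unfolded lie_superalgebra_def]
  note t1 = t[THEN conjunct2, THEN conjunct1]
  note t2 = t[THEN conjunct2, THEN conjunct2, THEN conjunct1]
  note t3 = t[THEN conjunct2, THEN conjunct2, THEN conjunct2, THEN conjunct1]
  note t4 = t[THEN conjunct2, THEN conjunct2, THEN conjunct2, THEN conjunct2, THEN conjunct1]
  note t5 = t[THEN conjunct2, THEN conjunct2, THEN conjunct2, THEN conjunct2, THEN conjunct2, THEN conjunct1]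
  note t6 = t[THEN conjunct2, THEN conjunct2, THEN conjunct2, THEN conjunct2, THEN conjunct2, THEN conjunct2, THEN conjunct1]
  note t7 = t[THEN conjunct2, THEN conjunct2, THEN conjunct2, THEN conjunct2, THEN conjunct2, THEN conjunct2, THEN conjunct2, THEN conjunct1]
  note t8 = t[THEN conjunct2, THEN conjunct2, THEN conjunct2, THEN conjunct2, THEN conjunct2, THEN conjunct2, THEN conjunct2, THEN conjunct2, THEN conjunct1]
  note t9 = t[THEN conjunct2, THEN conjunct2, THEN conjunct2, THEN conjunct2, THEN conjunct2, THEN conjunct2, THEN conjunct2, THEN conjunct2, THEN conjunct2]
  note l0 = l[THEN conjunct1]
  note l1 = l[THEN conjunct2, THEN conjunct1]
  note l2 = l[THEN conjunct2, THEN conjunct2, THEN conjunct1]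
  note l3 = l[THEN conjunct2, THEN conjunct2, THEN conjunct2, THEN conjunct1]
  note l4 = l[THEN conjunct2, THEN conjunct2, THEN conjunct2, THEN conjunct2, THEN conjunct1]
  note l5 = l[THEN conjunct2, THEN conjunct2, THEN conjunct2, THEN conjunct2, THEN conjunct2, THEN conjunct1]
  note l6 = l[THEN conjunct2, THEN conjunct2, THEN conjunct2, THEN conjunct2, THEN conjunct2, THEN conjunct2, THEN conjunct1]
  note l7 = l[THEN conjunct2, THEN conjunct2, THEN conjunct2, THEN conjunct2, THEN conjunct2, THEN conjunct2, THEN conjunct2]
  interpret H: vector_space "scl H" by (rule l0)
  let ?b = "brk H" and ?s = "scl H"
  have Esub: "H.subspace (E k)" for k using t1 by (rule spec)
  have Eadd: "x + y \<in> E k" if "x \<in> E k" "y \<in> E k" for x y k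
    using H.subspace_add[OF Esub] that by blast
  have Escale: "?s c x \<in> E k" if "x \<in> E k" for x c k
    using H.subspace_scale[OF Esub] that by blast
  have E0: "0 \<in> E k" for k by (rule H.subspace_0[OF Esub])
  note whole = t3
  have Ew: "x \<in> whole H" if "x \<in> E k" for x k
    unfolding whole using that by (intro CollectI exI[of _ "\<lambda>_. x"] exI[of _ "{k}"]) auto
  have indep: "\<forall>k\<in>K. h k = 0" if "finite K" "\<forall>k\<in>K. h k \<in> E k" "sum h K = 0" for h K
    using t4[THEN spec[of _ h], THEN spec[of _ K]] that by blast
  have Ebr: "?b x y \<in> E (i + j)" if "x \<in> E i" "y \<in> E j" for x y i j using t5 that by blast
  have bij: "bij_betw f (D k) (E k)" and fpart: "f ` D k \<subseteq> part H (nat \<bar>k\<bar>)" if "k \<le> 0" for k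
    using t6 that by blast+
  have flin: "f (s a x + s b y) = ?s a (f x) + ?s b (f y)" if "k \<le> 0" "x \<in> D k" "y \<in> D k" for k x y a b
    using t7 that by blast
  have fbr: "?b (f x) (f y) = f (B x y)" if "i \<le> 0" "j \<le> 0" "x \<in> D i" "y \<in> D j" for i j x y
    using t8 that by blast
  have trans: "x = 0" if "k \<ge> 0" "x \<in> E k" "\<forall>y\<in>E (-1). ?b x y = 0" for k x
    using t9 that by blast
  have bpart: "?b x y \<in> part H (p + q)" if "x \<in> part H p" "y \<in> part H q" for x y p q
    using l4 that by blast
  have blin: "?b (x + y) z = ?b x z + ?b y z" "?b x (y + z) = ?b x y + ?b x z"
    "?b (?s c x) y = ?s c (?b x y)" "?b x (?s c y) = ?s c (?b x y)"
    if "x \<in> whole H" "y \<in> whole H" "z \<in> whole H" for x y z c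
    using l5[rule_format, OF that, of c] by simp_all
  have bskew: "?b x y = - ?s ((-1) ^ (p * q)) (?b y x)" if "x \<in> part H p" "y \<in> part H q" for x y p q
    using l6[rule_format, OF that] .
  have bjac: "?b x (?b y z) = ?b (?b x y) z + ?s ((-1) ^ (p * q)) (?b y (?b x z))"
    if "x \<in> part H p" "y \<in> part H q" "z \<in> part H r" for x y z p q r
    using l7[rule_format, OF that] .
  have pcong: "part H p = part H q" if "even p = even q" for p q using that by (simp add: part_def)
  have psub: "H.subspace (part H p)" for p using l1 l2 by (simp add: part_def)
  have pint: "x = 0" if "x \<in> part H p" "x \<in> part H q" "even p \<noteq> even q" for x p q
    using l3 that by (auto simp: part_def split: if_splits)
  have pdec: "\<exists>a\<in>part H 0 \<inter> E k. \<exists>b\<in>part H 1 \<inter> E k. x = a + b" if "x \<in> E k" for x k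
    using t2 that by (simp add: part_def)

  \<comment> \<open>transitivity forces the parity of a component to be that of its degree\<close>
  have wrong: "x = 0" if "x \<in> E k" "x \<in> part H (nat \<bar>k + 1\<bar>)" for x k
    using that
  proof (induction "nat k" arbitrary: k x rule: less_induct)
    case less
    show ?case
    proof (cases "k \<le> 0")
      case True
      hence "x \<in> part H (nat \<bar>k\<bar>)" using bij[OF True] fpart[OF True] less.prems
        by (auto simp: bij_betw_def)
      thus ?thesis using pint[OF _ less.prems(2)] by (auto simp: even_nat_iff)
    next
      case False
      have "?b x y = 0" if y: "y \<in> E (-1)" for y
      proof -
        have "y \<in> part H 1" using y bij[of "-1"] fpart[of "-1"] by (auto simp: bij_betw_def)
        hence "?b x y \<in> part H (nat \<bar>k + 1\<bar> + 1)" using bpart less.prems by blast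
        hence "?b x y \<in> part H (nat \<bar>k - 1 + 1\<bar>)"
          using pcong[of "nat \<bar>k + 1\<bar> + 1" "nat \<bar>k - 1 + 1\<bar>"] False by (auto simp: even_nat_iff)
        thus ?thesis using less.hyps[of "k - 1" "?b x y"] Ebr[OF less.prems(1) y] False by simp
      qed
      thus ?thesis using trans[of k x] less.prems False by auto
    qed
  qed
  have Epart: "x \<in> part H (nat \<bar>k\<bar>)" if x: "x \<in> E k" for x k
  proof -
    obtain a b where ab: "a \<in> part H 0" "a \<in> E k" "b \<in> part H 1" "b \<in> E k" "x = a + b"
      using pdec[OF x] by blast
    show ?thesis
    proof (cases "even k")
      case True
      hence "b = 0" using wrong[OF ab(4)] ab(3) pcong[of 1 "nat \<bar>k + 1\<bar>"] by (auto simp: even_nat_iff)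
      thus ?thesis using ab True pcong[of 0 "nat \<bar>k\<bar>"] by (auto simp: even_nat_iff)
    next
      case False
      hence "a = 0" using wrong[OF ab(2)] ab(1) pcong[of 0 "nat \<bar>k + 1\<bar>"] by (auto simp: even_nat_iff)
      thus ?thesis using ab False pcong[of 1 "nat \<bar>k\<bar>"] by (auto simp: even_nat_iff)
    qed
  qed
  have sgn: "(-1) ^ (nat \<bar>i\<bar> * nat \<bar>j\<bar>) = (psign (i * j) :: 'k)" for i j
    by (auto simp: psign_def minus_one_power_iff even_nat_iff)
  have Eskew: "?b x y = - ?s (psign (i * j)) (?b y x)" if "x \<in> E i" "y \<in> E j" for x y i j
    using bskew[OF Epart[OF that(1)] Epart[OF that(2)]] sgn by simp
  have Ejac: "?b x (?b y z) = ?b (?b x y) z + ?s (psign (i * j)) (?b y (?b x z))"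
    if "x \<in> E i" "y \<in> E j" "z \<in> E k" for x y z i j k
    using bjac[OF Epart[OF that(1)] Epart[OF that(2)] Epart[OF that(3)]] sgn by simp

  define g where "g k = inv_into (D k) f" for k
  have gf: "g k (f x) = x" if "k \<le> 0" "x \<in> D k" for k x
    unfolding g_def using bij[OF that(1)] that(2) by (simp add: bij_betw_def)
  have fg: "\<exists>y\<in>D k. x = f y" if "k \<le> 0" "x \<in> E k" for k x
    using bij[OF that(1)] that(2) by (auto simp: bij_betw_def)
  have fE: "f x \<in> E k" if "k \<le> 0" "x \<in> D k" for k x
    using bij[OF that(1)] that(2) by (auto simp: bij_betw_def)
  have f0: "f 0 = 0" using flin[of 0 0 0 0 0] D_zero by simp

  define \<Theta> :: "int \<Rightarrow> 'v \<Rightarrow> 'l word \<Rightarrow> 'l" where "\<Theta> k x w =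
    (if list_all (letter D) w \<and> k + sum_list (map fst w) \<le> 0
     then g (k + sum_list (map fst w)) (foldl (\<lambda>y l. ?b y (f (snd l))) x w) else 0)" for k x w
  have \<Theta>_act: "act (\<Theta> k x) l = \<Theta> (k + fst l) (?b x (f (snd l)))" if "letter D l" for k x l
    using that by (auto simp: act_def \<Theta>_def fun_eq_iff add.assoc)
  have \<Theta>_not: "act (\<Theta> k x) l = 0" if "\<not> letter D l" for k x l
    using that by (auto simp: act_def \<Theta>_def fun_eq_iff)
  have \<Theta>_f: "\<Theta> k (f x) = emb x" if "k \<le> 0" "x \<in> D k" for k x
  proof
    fix w
    show "\<Theta> k (f x) w = emb x w"
      using that
    proof (induction w arbitrary: k x)
      case Nil
      thus ?case using gf by (simp add: \<Theta>_def)
    next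
      case (Cons l v)
      show ?case
      proof (cases "letter D l")
        case True
        hence "B x (snd l) \<in> D (k + fst l)" "k + fst l \<le> 0" "snd l \<in> D (fst l)" "fst l \<le> 0"
          using Cons.prems B_closed by (auto simp: letter_def)
        thus ?thesis using Cons.IH[of "k + fst l" "B x (snd l)"] Cons.prems fbr[of k "fst l" x "snd l"]
          \<Theta>_act[OF True, of k "f x"] act_emb[OF True, of x] by (simp add: act_def fun_eq_iff)
      next
        case False
        thus ?thesis by (simp add: \<Theta>_def iter_bracket_def)
      qed
    qed
  qed
  have \<Theta>_lin: "\<Theta> k (?s a x + ?s b y) = fs a (\<Theta> k x) + fs b (\<Theta> k y)"
    if "x \<in> E k" "y \<in> E k" for k x y a b
  proof
    fix w
    show "\<Theta> k (?s a x + ?s b y) w = (fs a (\<Theta> k x) + fs b (\<Theta> k y)) w"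
      using that
    proof (induction w arbitrary: k x y)
      case Nil
      show ?case
      proof (cases "k \<le> 0")
        case True
        obtain u v where uv: "u \<in> D k" "x = f u" "v \<in> D k" "y = f v" using fg[OF True] Nil by metis
        have "\<Theta> k (f (s a u + s b v)) [] = s a u + s b v"
          using \<Theta>_f[OF True, of "s a u + s b v"] uv D_add D_scale by simp
        thus ?thesis using uv True flin[OF True uv(1,3)] \<Theta>_f by simp
      qed (simp add: \<Theta>_def)
    next
      case (Cons l v)
      show ?case
      proof (cases "letter D l")
        case True
        have l: "f (snd l) \<in> E (fst l)" using True fE by (simp add: letter_def)
        have "?b (?s a x + ?s b y) (f (snd l)) = ?s a (?b x (f (snd l))) + ?s b (?b y (f (snd l)))"
          using blin(1)[OF Ew[OF Escale[OF Cons.prems(1), of a]] Ew[OF Escale[OF Cons.prems(2), of b]] Ew[OF l]]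
            blin(3)[OF Ew[OF Cons.prems(1)] Ew[OF l] Ew[OF l], of a]
            blin(3)[OF Ew[OF Cons.prems(2)] Ew[OF l] Ew[OF l], of b] by simp
        thus ?thesis
          using Cons.IH[OF Ebr[OF Cons.prems(1) l] Ebr[OF Cons.prems(2) l]] \<Theta>_act[OF True, of k]
          by (simp add: act_def fun_eq_iff)
      next
        case False
        thus ?thesis by (simp add: \<Theta>_def)
      qed
    qed
  qed
  have \<Theta>_scale: "\<Theta> k (?s a x) = fs a (\<Theta> k x)" if "x \<in> E k" for k x a
    using \<Theta>_lin[OF that that, of a 0] by simp
  have \<Theta>_add: "\<Theta> k (x + y) = \<Theta> k x + \<Theta> k y" if "x \<in> E k" "y \<in> E k" for k x y
    using \<Theta>_lin[OF that, of 1 1] by simp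
  have \<Theta>_P: "(k, \<Theta> k x) \<in> prolong D B s" if "x \<in> E k" for k x
    using that
  proof (induction "nat k" arbitrary: k x rule: less_induct)
    case less
    show ?case
    proof (cases "k \<le> 0")
      case True
      thus ?thesis using fg[OF True less.prems] \<Theta>_f P_emb by auto
    next
      case False
      show ?thesis
      proof (rule prolong.pos, goal_cases)
        case 1
        show ?case using False by simp
      next
        case 2
        show ?case using False by (simp add: \<Theta>_def)
      next
        case 3
        show ?case using \<Theta>_not by simp
      next
        case 4
        show ?case using False less.hyps fE Ebr[OF less.prems] by (auto simp: \<Theta>_act letter_def)
      next
        case 5
        show ?case
        proof (intro allI impI ballI)
          fix d y z a b assume d: "(d::int) < 0" and y: "y \<in> D d" and z: "z \<in> D d"
          have E: "f y \<in> E d" "f z \<in> E d" using d y z fE by auto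
          have "?b x (f (s a y + s b z)) = ?s a (?b x (f y)) + ?s b (?b x (f z))"
            using flin[of d y z a b] d y z
              blin(2)[OF Ew[OF less.prems] Ew[OF Escale[OF E(1), of a]] Ew[OF Escale[OF E(2), of b]]]
              blin(4)[OF Ew[OF less.prems] Ew[OF E(1)] Ew[OF E(1)], of a]
              blin(4)[OF Ew[OF less.prems] Ew[OF E(2)] Ew[OF E(2)], of b] by simp
          thus "act (\<Theta> k x) (d, s a y + s b z) =
              fs a (act (\<Theta> k x) (d, y)) + fs b (act (\<Theta> k x) (d, z))"
            using d y z D_add D_scale \<Theta>_lin[OF Ebr[OF less.prems E(1)] Ebr[OF less.prems E(2)]]
            by (simp add: \<Theta>_act letter_def)
        qed
      next
        case 6
        show ?case
        proof (intro allI impI ballI)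
          fix d e y z assume d: "(d::int) < 0" and e: "(e::int) < 0" and y: "y \<in> D d" and z: "z \<in> D e"
          have E: "f y \<in> E d" "f z \<in> E e" using d e y z fE by auto
          have b: "B y z \<in> D (d + e)" using B_closed y z by simp
          note m = Ebr[OF less.prems E(1)] Ebr[OF less.prems E(2)]
          have mm: "?b (?b x (f y)) (f z) \<in> E (k + (d + e))" "?b (?b x (f z)) (f y) \<in> E (k + (d + e))"
            using Ebr[OF m(1) E(2)] Ebr[OF m(2) E(1)] by (simp_all add: algebra_simps)
          have "?b x (f (B y z)) = ?b x (?b (f y) (f z))" using fbr[of d e y z] d e y z by simp
          also have "\<dots> = ?b (?b x (f y)) (f z) + ?s (psign (k * d)) (?b (f y) (?b x (f z)))"
            by (rule Ejac[OF less.prems E])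
          also have "?b (f y) (?b x (f z)) = - ?s (psign (d * (k + e))) (?b (?b x (f z)) (f y))"
            by (rule Eskew[OF E(1) m(2)])
          also have "?b (?b x (f y)) (f z) + ?s (psign (k * d)) (- ?s (psign (d * (k + e))) (?b (?b x (f z)) (f y)))
            = ?s 1 (?b (?b x (f y)) (f z)) + ?s (- psign (d * e)) (?b (?b x (f z)) (f y))"
            by (auto simp: psign_def)
          finally have "\<Theta> (k + (d + e)) (?b x (f (B y z))) = \<Theta> (k + (d + e)) (?b (?b x (f y)) (f z))
              - fs (psign (d * e)) (\<Theta> (k + (d + e)) (?b (?b x (f z)) (f y)))"
            using \<Theta>_lin[OF mm, of 1 "- psign (d * e)"] by simp
          thus "act (\<Theta> k x) (d + e, B y z) = act (act (\<Theta> k x) (d, y)) (e, z)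
              - fs (psign (d * e)) (act (act (\<Theta> k x) (e, z)) (d, y))"
            using d e y z b by (simp add: \<Theta>_act letter_def algebra_simps)
        qed
      qed
    qed
  qed
  have \<Theta>_inj: "x = 0" if "x \<in> E k" "\<Theta> k x = 0" for k x
    using that
  proof (induction "nat k" arbitrary: k x rule: less_induct)
    case less
    show ?case
    proof (cases "k \<le> 0")
      case True
      then obtain y where y: "y \<in> D k" "x = f y" using fg less.prems by blast
      hence "emb y = 0" using \<Theta>_f[OF True y(1)] less.prems by simp
      hence "y = 0" by (metis emb_Nil zero_fun_apply)
      thus ?thesis using y f0 by simp
    next
      case False
      have "?b x y = 0" if y: "y \<in> E (-1)" for y
      proof -
        obtain z where z: "z \<in> D (-1)" "y = f z" using fg[of "-1" y] y by auto
        have "\<Theta> (k - 1) (?b x y) = 0"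
          using \<Theta>_act[of "(-1, z)" k x] z less.prems by (simp add: letter_def act_lin)
        thus ?thesis using less.hyps[of "k - 1" "?b x y"] False Ebr[OF less.prems(1) y] by simp
      qed
      thus ?thesis using trans[of k x] False less.prems by auto
    qed
  qed
  have \<Theta>_br: "\<Theta> (i + j) (?b x y) = br i j (\<Theta> i x) (\<Theta> j y)" if "x \<in> E i" "y \<in> E j" for i j x y
    using that
  proof (induction "nat (i + j)" arbitrary: i j x y rule: less_induct)
    case less
    note xy = less.prems
    consider "j < 0" | "i < 0" "j \<ge> 0" | "i = 0" "j = 0" | "i \<ge> 0" "j \<ge> 0" "i + j > 0" by linarith
    thus ?case
    proof cases
      case 1
      then obtain z where z: "z \<in> D j" "y = f z" using fg xy by (metis less_imp_le)
      thus ?thesis using 1 \<Theta>_f[of j z] \<Theta>_act[of "(j, z)" i x] by (simp add: br_neg_right letter_def)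
    next
      case 2
      then obtain z where z: "z \<in> D i" "x = f z" using fg xy by (metis less_imp_le)
      have e: "?b x y = - ?s (psign (i * j)) (?b y x)" using Eskew[OF xy] .
      have "?b y x \<in> E (i + j)" using Ebr[OF xy(2,1)] by (simp add: add.commute)
      hence "\<Theta> (i + j) (?b x y) = - fs (psign (i * j)) (\<Theta> (i + j) (?b y x))"
        using \<Theta>_scale[of "?b y x" "i + j" "- psign (i * j)"] e by simp
      thus ?thesis using 2 z \<Theta>_f[of i z] \<Theta>_act[of "(i, z)" j y]
        by (simp add: br_neg_left letter_def add.commute)
    next
      case 3
      obtain u where u: "u \<in> D 0" "x = f u" using fg[of 0 x] xy 3 by auto
      obtain v where v: "v \<in> D 0" "y = f v" using fg[of 0 y] xy 3 by auto
      have "B u v \<in> D 0" using B_closed[OF u(1) v(1)] by simp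
      thus ?thesis using u v 3 fbr[of 0 0 u v] \<Theta>_f[of 0] by (simp add: br_emb)
    next
      case 4
      show ?thesis
      proof (rule P_eqI[where k = "i + j"])
        show "(i + j, \<Theta> (i + j) (?b x y)) \<in> prolong D B s" by (rule \<Theta>_P[OF Ebr[OF xy]])
        show "(i + j, br i j (\<Theta> i x) (\<Theta> j y)) \<in> prolong D B s"
          by (rule br_closed[OF \<Theta>_P[OF xy(1)] \<Theta>_P[OF xy(2)]])
        show "i + j > 0" using 4 by simp
        fix l assume l: "letter D l"
        define d where "d = fst l"
        define z where "z = f (snd l)"
        have d: "d < 0" and z: "z \<in> E d" using l fE by (auto simp: letter_def d_def z_def)
        have "?b (?b x y) z = ?b x (?b y z) + ?s (psign (j * d)) (?b (?b x z) y)"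
        proof -
          have "?b y (?b x z) = - ?s (psign (j * (i + d))) (?b (?b x z) y)"
            by (rule Eskew[OF xy(2) Ebr[OF xy(1) z]])
          thus ?thesis using Ejac[OF xy z] by (auto simp: psign_def)
        qed
        moreover have "?b x (?b y z) \<in> E (i + j + d)" "?b (?b x z) y \<in> E (i + j + d)"
          using Ebr[OF xy(1) Ebr[OF xy(2) z]] Ebr[OF Ebr[OF xy(1) z] xy(2)] by (simp_all add: algebra_simps)
        ultimately have "\<Theta> (i + j + d) (?b (?b x y) z) = \<Theta> (i + (j + d)) (?b x (?b y z))
            + fs (psign (j * d)) (\<Theta> (i + d + j) (?b (?b x z) y))"
          using \<Theta>_lin[of "?b x (?b y z)" "i + j + d" "?b (?b x z) y" 1 "psign (j * d)"]
          by (simp add: algebra_simps)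
        also have "\<Theta> (i + (j + d)) (?b x (?b y z)) = br i (j + d) (\<Theta> i x) (\<Theta> (j + d) (?b y z))"
          by (rule less.hyps[OF _ xy(1) Ebr[OF xy(2) z]]) (use 4 d in auto)
        also have "\<Theta> (i + d + j) (?b (?b x z) y) = br (i + d) j (\<Theta> (i + d) (?b x z)) (\<Theta> j y)"
          by (rule less.hyps[OF _ Ebr[OF xy(1) z] xy(2)]) (use 4 d in auto)
        finally show "act (\<Theta> (i + j) (?b x y)) l = act (br i j (\<Theta> i x) (\<Theta> j y)) l"
          unfolding br_leibniz[OF \<Theta>_P[OF xy(1)] \<Theta>_P[OF xy(2)]] \<Theta>_act[OF l] d_def z_def .
      qed
    qed
  qed

  have wI: "sum h K \<in> whole H" if "finite K" "\<forall>k\<in>K. h k \<in> E k" for h K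
    unfolding whole using that by blast
  have "\<exists>h. \<forall>x\<in>whole H. (\<forall>k. h x k \<in> E k) \<and> finite {k. h x k \<noteq> 0} \<and> x = sum (h x) {k. h x k \<noteq> 0}"
  proof (rule bchoice, rule ballI)
    fix x assume "x \<in> whole H"
    then obtain h K where h: "finite K" "\<forall>k\<in>K. h k \<in> E k" "x = sum h K" unfolding whole by blast
    let ?h = "\<lambda>k. if k \<in> K then h k else 0"
    have "x = sum ?h K" using h by simp
    also have "\<dots> = sum ?h {k. ?h k \<noteq> 0}"
      by (rule sum.mono_neutral_right) (use h in auto)
    finally show "\<exists>h. (\<forall>k. h k \<in> E k) \<and> finite {k. h k \<noteq> 0} \<and> x = sum h {k. h k \<noteq> 0}"
      using h E0 by (intro exI[of _ ?h]) auto
  qed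
  then obtain C where C: "\<And>x k. x \<in> whole H \<Longrightarrow> C x k \<in> E k"
    "\<And>x. x \<in> whole H \<Longrightarrow> finite {k. C x k \<noteq> 0}"
    "\<And>x. x \<in> whole H \<Longrightarrow> x = sum (C x) {k. C x k \<noteq> 0}" by metis
  have Csum: "x = sum (C x) K" if "x \<in> whole H" "finite K" "{k. C x k \<noteq> 0} \<subseteq> K" for x K
  proof -
    have "sum (C x) {k. C x k \<noteq> 0} = sum (C x) K"
      by (rule sum.mono_neutral_left) (use that in auto)
    thus ?thesis using C(3)[OF that(1)] by simp
  qed
  have Cuniq: "C x = h" if x: "x \<in> whole H" and h: "\<And>k. h k \<in> E k" "finite K" "{k. h k \<noteq> 0} \<subseteq> K"
    "x = sum h K" for x h K
  proof
    fix k
    let ?K = "insert k (K \<union> {k. C x k \<noteq> 0})"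
    have fin: "finite ?K" using h C(2)[OF x] by simp
    have 1: "x = sum (C x) ?K" by (rule Csum[OF x fin]) auto
    have "sum h K = sum h ?K"
      by (rule sum.mono_neutral_left) (use h fin in auto)
    hence 2: "x = sum h ?K" using h(4) by simp
    have "(\<Sum>k\<in>?K. C x k - h k) = 0" using 1 2 sum_subtractf[of "C x" h ?K] by simp
    moreover have "\<forall>k\<in>?K. C x k - h k \<in> E k" using C(1)[OF x] h(1) H.subspace_diff[OF Esub] by blast
    ultimately have "\<forall>k\<in>?K. C x k - h k = 0" using indep[OF fin, of "\<lambda>k. C x k - h k"] by blast
    thus "C x k = h k" by simp
  qed
  have wadd: "x + y \<in> whole H \<and> C (x + y) = (\<lambda>k. C x k + C y k)"
    if x: "x \<in> whole H" and y: "y \<in> whole H" for x y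
  proof -
    let ?K = "{k. C x k \<noteq> 0} \<union> {k. C y k \<noteq> 0}"
    have fin: "finite ?K" using C(2) x y by simp
    have 1: "x = sum (C x) ?K" by (rule Csum[OF x fin]) auto
    have 2: "y = sum (C y) ?K" by (rule Csum[OF y fin]) auto
    have e: "x + y = (\<Sum>k\<in>?K. C x k + C y k)"
      by (simp only: sum.distrib 1[symmetric] 2[symmetric])
    have m: "C x k + C y k \<in> E k" for k using Eadd C(1) x y by blast
    have "x + y \<in> whole H" unfolding e by (rule wI[OF fin]) (use m in blast)
    moreover have "{k. C x k + C y k \<noteq> 0} \<subseteq> ?K" by auto
    ultimately show ?thesis using Cuniq[OF _ m fin _ e] by blast
  qed
  have wscale: "?s c x \<in> whole H \<and> C (?s c x) = (\<lambda>k. ?s c (C x k))" if x: "x \<in> whole H" for x c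
  proof -
    let ?K = "{k. C x k \<noteq> 0}"
    have fin: "finite ?K" using C(2) x by simp
    have 1: "x = sum (C x) ?K" by (rule Csum[OF x fin]) auto
    have e: "?s c x = (\<Sum>k\<in>?K. ?s c (C x k))"
      by (simp only: H.scale_sum_right[symmetric] 1[symmetric])
    have m: "?s c (C x k) \<in> E k" for k using Escale C(1) x by blast
    have "?s c x \<in> whole H" unfolding e by (rule wI[OF fin]) (use m in blast)
    moreover have "{k. ?s c (C x k) \<noteq> 0} \<subseteq> ?K" by auto
    ultimately show ?thesis using Cuniq[OF _ m fin _ e] by blast
  qed
  have w0: "0 \<in> whole H" using Ew[OF E0] .
  have Ce: "C x = (\<lambda>i. if i = k then x else 0)" if "x \<in> E k" for x k
    by (rule Cuniq[OF Ew[OF that], of _ "{k}"]) (use that E0 in auto)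
  have \<Theta>0: "\<Theta> k 0 = 0" for k using \<Theta>_scale[OF E0, of k 0] by simp

  define \<Psi> where "\<Psi> x = (\<Sum>k\<in>{k. C x k \<noteq> 0}. Poly_Mapping.single k (\<Theta> k (C x k)))" for x
  have look: "Poly_Mapping.lookup (\<Psi> x) k = \<Theta> k (C x k)" if "x \<in> whole H" for x k
  proof -
    have "Poly_Mapping.lookup (\<Psi> x) k = (\<Sum>i\<in>{k. C x k \<noteq> 0}. if k = i then \<Theta> k (C x k) else 0)"
      unfolding \<Psi>_def lookup_sum by (intro sum.cong) (auto simp: lookup_single when_def)
    also have "\<dots> = \<Theta> k (C x k)" using C(2)[OF that] \<Theta>0 by (subst sum.delta') auto
    finally show ?thesis .
  qed
  have \<Psi>W: "\<Psi> x \<in> W" if "x \<in> whole H" for x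
    using that \<Theta>_P[OF C(1)] by (auto simp: W_def look)
  have \<Psi>_add: "\<Psi> (x + y) = \<Psi> x + \<Psi> y" if "x \<in> whole H" "y \<in> whole H" for x y
    by (rule poly_mapping_eqI) (use that wadd[OF that] \<Theta>_add C(1) in \<open>simp add: look lookup_add\<close>)
  have \<Psi>_scale: "\<Psi> (?s c x) = sg c (\<Psi> x)" if "x \<in> whole H" for x c
    by (rule poly_mapping_eqI) (use that wscale[OF that, of c] \<Theta>_scale C(1) in \<open>simp add: look\<close>)
  have \<Psi>_e: "\<Psi> x = Poly_Mapping.single k (\<Theta> k x)" if "x \<in> E k" for x k
    by (rule poly_mapping_eqI) (use \<Theta>0 in \<open>auto simp: look Ew[OF that] Ce[OF that] lookup_single when_def\<close>)
  have \<Psi>_0: "\<Psi> 0 = 0" using \<Psi>_e[OF E0, of 0] \<Theta>0 by simp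
  have wsum: "sum h K \<in> whole H" if "\<And>k. k \<in> K \<Longrightarrow> h k \<in> whole H" for h :: "int \<Rightarrow> 'v" and K
    using that by (induction K rule: infinite_finite_induct) (auto simp: w0 wadd)
  have \<Psi>_sum: "\<Psi> (sum h K) = (\<Sum>k\<in>K. \<Psi> (h k))" if "\<And>k. k \<in> K \<Longrightarrow> h k \<in> whole H"
    for h :: "int \<Rightarrow> 'v" and K
    using that by (induction K rule: infinite_finite_induct) (auto simp: \<Psi>_0 \<Psi>_add wsum)
  have b0: "?b 0 x = 0" "?b x 0 = 0" if "x \<in> whole H" for x
    using blin(3)[OF w0 that that, of 0] blin(4)[OF that w0 w0, of 0] by simp_all
  have b_sum1: "?b (sum h K) y = (\<Sum>k\<in>K. ?b (h k) y)" if "\<And>k. k \<in> K \<Longrightarrow> h k \<in> whole H" "y \<in> whole H"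
    for h :: "int \<Rightarrow> 'v" and K y
    using that by (induction K rule: infinite_finite_induct) (auto simp: b0 blin wsum)
  have b_sum2: "?b y (sum h K) = (\<Sum>k\<in>K. ?b y (h k))" if "\<And>k. k \<in> K \<Longrightarrow> h k \<in> whole H" "y \<in> whole H"
    for h :: "int \<Rightarrow> 'v" and K y
    using that by (induction K rule: infinite_finite_induct) (auto simp: b0 blin wsum)
  have \<Psi>_br: "\<Psi> (?b x y) = bk (\<Psi> x) (\<Psi> y)" if x: "x \<in> whole H" and y: "y \<in> whole H" for x y
  proof -
    let ?I = "{k. C x k \<noteq> 0}" and ?J = "{k. C y k \<noteq> 0}"
    have Cx: "C x k \<in> whole H" and Cy: "C y k \<in> whole H" for k using C(1) Ew x y by blast+
    have bw: "?b (C x i) (C y j) \<in> whole H" for i j using Ew Ebr C(1) x y by blast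
    have "?b x y = ?b (sum (C x) ?I) (sum (C y) ?J)" using C(3) x y by simp
    also have "\<dots> = (\<Sum>i\<in>?I. \<Sum>j\<in>?J. ?b (C x i) (C y j))"
      by (simp add: b_sum1 b_sum2 Cx Cy wsum) (rule sum.swap)
    finally have "\<Psi> (?b x y) = (\<Sum>i\<in>?I. \<Sum>j\<in>?J. \<Psi> (?b (C x i) (C y j)))"
      by (simp add: \<Psi>_sum wsum bw)
    also have "\<dots> = (\<Sum>i\<in>?I. \<Sum>j\<in>?J. bk (\<Psi> (C x i)) (\<Psi> (C y j)))"
    proof (intro sum.cong refl)
      fix i j
      show "\<Psi> (?b (C x i) (C y j)) = bk (\<Psi> (C x i)) (\<Psi> (C y j))"
        using \<Psi>_e[OF Ebr[OF C(1)[OF x] C(1)[OF y]], of i j] \<Psi>_e[OF C(1)[OF x], of i]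
          \<Psi>_e[OF C(1)[OF y], of j] bk_single[OF \<Theta>_P[OF C(1)[OF x]] \<Theta>_P[OF C(1)[OF y]], of i j]
          \<Theta>_br[OF C(1)[OF x] C(1)[OF y], of i j] by simp
    qed
    also have "\<dots> = bk (\<Sum>i\<in>?I. \<Psi> (C x i)) (\<Sum>j\<in>?J. \<Psi> (C y j))"
      by (simp add: bk_sum_left bk_sum_right \<Psi>W Cx Cy W_sum) (rule sum.swap)
    also have "(\<Sum>i\<in>?I. \<Psi> (C x i)) = \<Psi> x"
      using \<Psi>_sum[of ?I "C x"] Cx C(3)[OF x] by simp
    also have "(\<Sum>j\<in>?J. \<Psi> (C y j)) = \<Psi> y"
      using \<Psi>_sum[of ?J "C y"] Cy C(3)[OF y] by simp
    finally show ?thesis .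
  qed
  have pw: "x \<in> whole H" if "x \<in> part H p" for x p
  proof -
    have "0 \<in> even_part H" "0 \<in> odd_part H"
      using H.subspace_0[OF psub[of 0]] H.subspace_0[OF psub[of 1]] by (simp_all add: part_def)
    thus ?thesis using that unfolding whole_def part_def
      by (auto split: if_splits intro: exI[of _ x] exI[of _ 0])
  qed
  have \<Psi>_part: "\<Psi> x \<in> part G p" if x: "x \<in> part H p" for x p
  proof -
    note w = pw[OF x]
    let ?K = "{k. C x k \<noteq> 0}" and ?R = "{k. C x k \<noteq> 0 \<and> even (k + int p)}"
      and ?Q = "{k. C x k \<noteq> 0 \<and> odd (k + int p)}"
    have fin: "finite ?K" using C(2) w by simp
    hence fin': "finite ?R" "finite ?Q" by (auto elim: rev_finite_subset)
    have K: "?K = ?R \<union> ?Q" and RQ: "?R \<inter> ?Q = {}" by auto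
    have "sum (C x) ?K = sum (C x) ?R + sum (C x) ?Q"
      by (subst K, rule sum.union_disjoint[OF fin' RQ])
    hence e: "x = sum (C x) ?R + sum (C x) ?Q"
      by (rule HOL.trans[OF C(3)[OF w]])
    have R: "sum (C x) ?R \<in> part H p"
    proof (rule H.subspace_sum[OF psub])
      fix k assume "k \<in> ?R"
      thus "C x k \<in> part H p" using Epart[OF C(1)[OF w], of k] pcong[of "nat \<bar>k\<bar>" p]
        by (auto simp: even_nat_iff)
    qed
    have Q: "sum (C x) ?Q \<in> part H (p + 1)"
    proof (rule H.subspace_sum[OF psub])
      fix k assume "k \<in> ?Q"
      thus "C x k \<in> part H (p + 1)" using Epart[OF C(1)[OF w], of k] pcong[of "nat \<bar>k\<bar>" "p + 1"]
        by (auto simp: even_nat_iff)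
    qed
    have "sum (C x) ?Q = x - sum (C x) ?R"
      by (rule iffD2[OF eq_diff_eq]) (rule HOL.trans[OF add.commute e[symmetric]])
    hence "sum (C x) ?Q \<in> part H p" using H.subspace_diff[OF psub x R] by simp
    hence "sum (C x) ?Q = 0" using pint[OF _ Q] by simp
    hence "\<forall>k\<in>?Q. C x k = 0" using indep[OF fin'(2), of "C x"] C(1)[OF w] by blast
    hence z: "C x k = 0" if "odd (k + int p)" for k using that by blast
    have "even (k + int p)" if "k \<in> Poly_Mapping.keys (\<Psi> x)" for k
      using that z[of k] \<Theta>0 by (auto simp: in_keys_iff look[OF w])
    thus ?thesis using \<Psi>W[OF w] unfolding part_iff by blast
  qed
  have \<Psi>_E: "\<Psi> x \<in> GE k" if "x \<in> E k" for x k
    using \<Psi>_e[OF that] \<Theta>_P[OF that] by (auto simp: GE_def)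
  have \<Psi>_inj: "inj_on \<Psi> (whole H)"
  proof (rule inj_onI)
    fix x y assume x: "x \<in> whole H" and y: "y \<in> whole H" and e: "\<Psi> x = \<Psi> y"
    have "C x k = C y k" for k
    proof -
      have "\<Theta> k (C x k) = \<Theta> k (C y k)" using e look x y by metis
      hence "\<Theta> k (?s 1 (C x k) + ?s (-1) (C y k)) = 0"
        by (subst \<Theta>_lin[OF C(1)[OF x] C(1)[OF y]]) simp
      moreover have "?s 1 (C x k) + ?s (-1) (C y k) \<in> E k" using Eadd Escale C(1) x y by blast
      ultimately have "?s 1 (C x k) + ?s (-1) (C y k) = 0" using \<Theta>_inj by blast
      thus ?thesis by simp
    qed
    hence "C x = C y" by blast
    thus "x = y" using C(3)[OF x] C(3)[OF y] by simp
  qed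
  have \<Psi>_f: "\<Psi> (f x) = Gf x" if "k \<le> 0" "x \<in> D k" for k x
    using \<Psi>_e[OF fE[OF that]] \<Theta>_f[OF that] Gf_eq[OF that] by simp
  show ?thesis
    unfolding graded_embedding_def
    by (rule exI[of _ \<Psi>]) (intro conjI allI ballI impI image_subsetI \<Psi>_inj; (rule \<Psi>_add \<Psi>_scale \<Psi>_br \<Psi>_part \<Psi>_E \<Psi>_f; assumption))
qed

end


section \<open>\<open>E(3,8)\<close>\<close>

text \<open>
  The nonpositive part consists of tuples \<open>(c, b, m, A, S)\<close>.  With the standard bases of
  \<open>U = F^3\<close> and \<open>V = F^2\<close>: \<open>m $ i $ p\<close> is the coefficient of \<open>u\<^sub>i \<otimes> v\<^sub>p\<close> in degree \<open>-1\<close>; the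
  skew-symmetric matrix \<open>b\<close> is the bivector whose coefficient at \<open>u\<^sub>i \<and> u\<^sub>j\<close>, \<open>i < j\<close>, is \<open>b $ i $ j\<close>, so
  that \<open>u \<and> u'\<close> has entries \<open>u\<^sub>i u'\<^sub>j - u\<^sub>j u'\<^sub>i\<close>; and \<open>c\<close> stands for \<open>u\<^sub>1 \<and> u\<^sub>2 \<and> u\<^sub>3 \<otimes> c\<close> in degree \<open>-3\<close>.
  In degree 0, \<open>A\<close> is in \<open>gl(U)\<close> and \<open>S\<close> in \<open>sl(V)\<close>.
\<close>

type_synonym 'a nonpos38 = "('a ^ 2) \<times> ('a ^ 3 ^ 3) \<times> ('a ^ 2 ^ 3) \<times> ('a ^ 3 ^ 3) \<times> ('a ^ 2 ^ 2)"

definition nonzero_alternating :: "('a::field ^ 2 \<Rightarrow> 'a ^ 2 \<Rightarrow> 'a) \<Rightarrow> bool" where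
  "nonzero_alternating \<omega> \<longleftrightarrow>
     (\<forall>v. Vector_Spaces.linear (*s) (*) (\<omega> v)) \<and>
     (\<forall>v. Vector_Spaces.linear (*s) (*) (\<lambda>u. \<omega> u v)) \<and>
     (\<forall>v. \<omega> v v = 0) \<and> (\<exists>u v. \<omega> u v \<noteq> 0)"

definition nonpos38_comp :: "int \<Rightarrow> 'a::field nonpos38 set" where
  "nonpos38_comp k =
     (if k = -3 then {(c, 0, 0, 0, 0) | c. True}
      else if k = -2 then {(0, b, 0, 0, 0) | b. transpose b = - b}
      else if k = -1 then {(0, 0, m, 0, 0) | m. True}
      else if k = 0 then {(0, 0, 0, A, S) | A S. trace S = 0}
      else {0})"

definition mscale :: "'a::field \<Rightarrow> 'a ^ 'n ^ 'm \<Rightarrow> 'a ^ 'n ^ 'm" where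
  "mscale a M = (\<chi> i. a *s (M $ i))"

definition nonpos38_scale :: "'a::field \<Rightarrow> 'a nonpos38 \<Rightarrow> 'a nonpos38" where
  "nonpos38_scale a = (\<lambda>(c, b, m, A, S). (a *s c, mscale a b, mscale a m, mscale a A, mscale a S))"

text \<open>\<open>(u \<otimes> v, b) \<mapsto> (u \<and> b) \<otimes> v\<close>\<close>

definition wedge38 :: "'a::field ^ 2 ^ 3 \<Rightarrow> 'a ^ 3 ^ 3 \<Rightarrow> 'a ^ 2" where
  "wedge38 m b = (b $ 2 $ 3) *s (m $ 1) + (b $ 3 $ 1) *s (m $ 2) + (b $ 1 $ 2) *s (m $ 3)"

text \<open>\<open>(u \<otimes> v, u' \<otimes> v') \<mapsto> \<omega>(v, v') u \<and> u'\<close>\<close>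

definition pairing38 ::
    "('a::field ^ 2 \<Rightarrow> 'a ^ 2 \<Rightarrow> 'a) \<Rightarrow> 'a ^ 2 ^ 3 \<Rightarrow> 'a ^ 2 ^ 3 \<Rightarrow> 'a ^ 3 ^ 3" where
  "pairing38 \<omega> m m' = (\<chi> i j. \<omega> (m $ i) (m' $ j) - \<omega> (m $ j) (m' $ i))"

definition nonpos38_bracket ::
    "('a::field ^ 2 \<Rightarrow> 'a ^ 2 \<Rightarrow> 'a) \<Rightarrow> 'a nonpos38 \<Rightarrow> 'a nonpos38 \<Rightarrow> 'a nonpos38" where
  "nonpos38_bracket \<omega> = (\<lambda>(c, b, m, A, S) (c', b', m', A', S').
     (wedge38 m b' - wedge38 m' b
        + (trace A *s c' + S *v c') - (trace A' *s c + S' *v c),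
      pairing38 \<omega> m m'
        + (A ** b' + b' ** transpose A) - (A' ** b + b ** transpose A'),
      (A ** m' + m' ** transpose S) - (A' ** m + m ** transpose S'),
      A ** A' - A' ** A,
      S ** S' - S' ** S))"

definition E38 ::
    "('a::field ^ 2 \<Rightarrow> 'a ^ 2 \<Rightarrow> 'a)
     \<Rightarrow> ('a, int \<Rightarrow>\<^sub>0 ('a nonpos38 word \<Rightarrow> 'a nonpos38)) superalgebra" where
  "E38 \<omega> = prolongation nonpos38_comp (nonpos38_bracket \<omega>) nonpos38_scale"

lemma nonzero_alternating_form:
  fixes \<omega> :: "'a::field ^ 2 \<Rightarrow> 'a ^ 2 \<Rightarrow> 'a"
  assumes "nonzero_alternating \<omega>"
  obtains t where "t \<noteq> 0" "\<omega> = (\<lambda>u v. t * (u $ 1 * v $ 2 - u $ 2 * v $ 1))"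
proof
  have r: "\<omega> v (a *s x + b *s y) = a * \<omega> v x + b * \<omega> v y" for v a x b y
    using assms unfolding nonzero_alternating_def by (simp add: Vector_Spaces.linear_iff)
  have l: "\<omega> (a *s x + b *s y) v = a * \<omega> x v + b * \<omega> y v" for v a x b y
    using assms unfolding nonzero_alternating_def by (simp add: Vector_Spaces.linear_iff)
  have z: "\<omega> v v = 0" for v using assms by (simp add: nonzero_alternating_def)
  let ?e = "axis 1 1 :: 'a ^ 2" and ?f = "axis 2 1 :: 'a ^ 2"
  have e: "u = u $ 1 *s ?e + u $ 2 *s ?f" for u :: "'a ^ 2"
    by (simp add: vec_eq_iff forall_2 axis_def)
  have "\<omega> (1 *s ?e + 1 *s ?f) (1 *s ?e + 1 *s ?f) = \<omega> ?e ?f + \<omega> ?f ?e"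
    unfolding r l by (simp add: z)
  hence s: "\<omega> ?f ?e = - \<omega> ?e ?f" using z by (metis eq_neg_iff_add_eq_0 add.commute)
  have *: "\<omega> u v = \<omega> ?e ?f * (u $ 1 * v $ 2 - u $ 2 * v $ 1)" for u v
  proof -
    have "\<omega> u v = \<omega> (u $ 1 *s ?e + u $ 2 *s ?f) (v $ 1 *s ?e + v $ 2 *s ?f)"
      using e by metis
    also have "\<dots> = \<omega> ?e ?f * (u $ 1 * v $ 2 - u $ 2 * v $ 1)"
      unfolding r l by (simp add: z s algebra_simps)
    finally show ?thesis .
  qed
  thus "\<omega> = (\<lambda>u v. \<omega> ?e ?f * (u $ 1 * v $ 2 - u $ 2 * v $ 1))" by blast
  show "\<omega> ?e ?f \<noteq> 0" using * assms unfolding nonzero_alternating_def by (metis mult_zero_left)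
qed

lemmas nonpos38_coords = vec_eq_iff forall_2 forall_3 sum_2 sum_3
  matrix_matrix_mult_def matrix_vector_mult_def transpose_def trace_def
  nonpos38_bracket_def nonpos38_scale_def wedge38_def pairing38_def mscale_def

lemma nonpos38_cases:
  fixes x :: "'a::field_char_0 nonpos38"
  assumes "x \<in> nonpos38_comp k"
  obtains c where "k = -3" "x = (c, 0, 0, 0, 0)"
  | b where "k = -2" "x = (0, b, 0, 0, 0)" "b $ 1 $ 1 = 0" "b $ 2 $ 2 = 0" "b $ 3 $ 3 = 0"
      "b $ 2 $ 1 = - b $ 1 $ 2" "b $ 3 $ 1 = - b $ 1 $ 3" "b $ 3 $ 2 = - b $ 2 $ 3"
  | m where "k = -1" "x = (0, 0, m, 0, 0)"
  | A S where "k = 0" "x = (0, 0, 0, A, S)" "S $ 2 $ 2 = - S $ 1 $ 1"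
  | "x = 0"
proof -
  consider c where "k = -3" "x = (c, 0, 0, 0, 0)" | b where "k = -2" "x = (0, b, 0, 0, 0)" "transpose b = - b"
    | m where "k = -1" "x = (0, 0, m, 0, 0)" | A S where "k = 0" "x = (0, 0, 0, A, S)" "trace S = 0" | "x = 0"
    using assms by (auto simp: nonpos38_comp_def split: if_splits)
  thus ?thesis
  proof cases
    case (2 b)
    have "b $ j $ i = - b $ i $ j" for i j
      using arg_cong[OF 2(3), of "\<lambda>M. M $ i $ j"] by (simp add: transpose_def)
    note b = this
    have z: "b $ i $ i = 0" for i
    proof -
      have "2 * b $ i $ i = 0" using b[of i i] by (simp only: mult_2 eq_neg_iff_add_eq_0)
      thus ?thesis by simp
    qed
    show ?thesis by (rule that(2)[OF 2(1,2) z z z b b b])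
  next
    case (4 A S)
    hence "S $ 2 $ 2 + S $ 1 $ 1 = 0" by (simp add: trace_def sum_2 add.commute)
    hence "S $ 2 $ 2 = - S $ 1 $ 1" by (simp only: eq_neg_iff_add_eq_0)
    thus ?thesis using that(4) 4 by blast
  qed (use that in blast)+
qed

lemma nonpos38_zero [simp]:
  "wedge38 m 0 = 0" "wedge38 0 b = 0" "trace (0 :: 'a::field ^ 'n ^ 'n) = 0"
  "transpose (0 :: 'a ^ 'n ^ 'm) = 0" "mscale a 0 = 0" "mscale 1 M = M" "mscale (-1) M = - M"
  "A ** (0 :: 'a ^ 'n ^ 'm) = 0" "(0 :: 'a ^ 'm ^ 'k) ** B = 0" "(0 :: 'a ^ 'm ^ 'k) *v v = 0"
  by (simp_all add: wedge38_def mscale_def vec_eq_iff trace_def transpose_def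
      matrix_matrix_mult_def matrix_vector_mult_def)

lemma nonpos38_superalgebra:
  fixes \<omega> :: "'a::field_char_0 ^ 2 \<Rightarrow> 'a ^ 2 \<Rightarrow> 'a"
  assumes "nonzero_alternating \<omega>"
  shows "nonpositive_superalgebra nonpos38_comp (nonpos38_bracket \<omega>) nonpos38_scale"
proof -
  obtain t where t: "\<omega> = (\<lambda>u v. t * (u $ 1 * v $ 2 - u $ 2 * v $ 1))"
    using nonzero_alternating_form[OF assms] by metis
  interpret V: vector_space "nonpos38_scale :: 'a \<Rightarrow> 'a nonpos38 \<Rightarrow> 'a nonpos38"
    by unfold_locales (auto simp: nonpos38_scale_def mscale_def vec_eq_iff algebra_simps)
  have tr: "transpose b = - b \<longleftrightarrow> (\<forall>i j. b $ j $ i = - b $ i $ j)" for b :: "'a ^ 3 ^ 3"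
    by (auto simp: vec_eq_iff transpose_def)
  have zero: "(0 :: 'a nonpos38) = (0, 0, 0, 0, 0)" by (simp add: zero_prod_def)
  have zmem: "(0, 0, 0, 0, 0) \<in> (nonpos38_comp k :: 'a nonpos38 set)" for k
    by (auto simp: nonpos38_comp_def zero_prod_def tr trace_def)
  show ?thesis
  proof (rule nonpositive_superalgebra.intro)
    show "vector_space (nonpos38_scale :: 'a \<Rightarrow> 'a nonpos38 \<Rightarrow> 'a nonpos38)" by (rule V.vector_space_axioms)
    have skew: "transpose (b + b') = - (b + b')" "transpose (mscale a b) = - mscale a b"
      if "transpose b = - b" "transpose b' = - b'" for a and b b' :: "'a ^ 3 ^ 3"
    proof -
      have "transpose (b + b') = transpose b + transpose b'"
        "transpose (mscale a b) = mscale a (transpose b)"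
        "mscale a (- b) = - mscale a b"
        by (simp_all add: vec_eq_iff transpose_def mscale_def)
      thus "transpose (b + b') = - (b + b')" "transpose (mscale a b) = - mscale a b"
        using that by simp_all
    qed
    have tr0: "trace (S + S') = 0" "trace (mscale a S) = 0"
      if "trace S = 0" "trace S' = 0" for a and S S' :: "'a ^ 2 ^ 2"
    proof -
      have "trace (S + S') = trace S + trace S'" "trace (mscale a S) = a * trace S"
        by (simp_all add: trace_def sum_2 mscale_def algebra_simps)
      thus "trace (S + S') = 0" "trace (mscale a S) = 0" using that by simp_all
    qed
    have m0: "mscale a 0 = 0" for a by (simp add: mscale_def vec_eq_iff)
    show "V.subspace (nonpos38_comp k)" for k
      unfolding V.subspace_def using zmem[of k]
      by (auto simp: nonpos38_comp_def nonpos38_scale_def zero skew tr0 m0)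
    show "nonpos38_comp k = ({0} :: 'a nonpos38 set)" if "k > 0" for k
      using that by (simp add: nonpos38_comp_def)
    show "i = j" if "x \<in> nonpos38_comp i" "x \<in> nonpos38_comp j" "x \<noteq> 0" for i j and x :: "'a nonpos38"
      using that by (auto simp: nonpos38_comp_def zero_prod_def split: if_splits)
    have mem: "(c, b, m, A, S) \<in> nonpos38_comp k \<longleftrightarrow>
        (k \<noteq> -3 \<longrightarrow> c = 0) \<and> (k \<noteq> -2 \<longrightarrow> b = 0) \<and> transpose b = - b \<and> (k \<noteq> -1 \<longrightarrow> m = 0) \<and>
        (k \<noteq> 0 \<longrightarrow> A = 0 \<and> S = 0) \<and> trace S = 0"
      for k c b m A and S :: "'a ^ 2 ^ 2"
    proof -
      have "transpose (0 :: 'a ^ 3 ^ 3) = 0" "trace (0 :: 'a ^ 2 ^ 2) = 0"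
        by (simp_all add: vec_eq_iff transpose_def trace_def)
      thus ?thesis by (auto simp: nonpos38_comp_def zero_prod_def)
    qed
    show "nonpos38_bracket \<omega> x y \<in> nonpos38_comp (i + j)"
      if "x \<in> nonpos38_comp i" "y \<in> nonpos38_comp j" for i j x y
      by (rule nonpos38_cases[OF that(1)]; rule nonpos38_cases[OF that(2)])
        (simp_all add: mem nonpos38_coords t zero algebra_simps)
    show "nonpos38_bracket \<omega> (nonpos38_scale a x + nonpos38_scale b x') y =
        nonpos38_scale a (nonpos38_bracket \<omega> x y) + nonpos38_scale b (nonpos38_bracket \<omega> x' y)"
      if "x \<in> nonpos38_comp i" "x' \<in> nonpos38_comp i" "y \<in> nonpos38_comp j" for i j x x' y a b
      by (cases x; cases x'; cases y) (simp add: nonpos38_coords t algebra_simps)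
    have p0: "pairing38 \<omega> m 0 = 0" "pairing38 \<omega> 0 m = 0" for m
      by (simp_all add: pairing38_def t vec_eq_iff)
    show "nonpos38_bracket \<omega> x y = - nonpos38_scale (psign (i * j)) (nonpos38_bracket \<omega> y x)"
      if "x \<in> nonpos38_comp i" "y \<in> nonpos38_comp j" for i j x y
      by (rule nonpos38_cases[OF that(1)]; rule nonpos38_cases[OF that(2)])
        (simp_all add: psign_def nonpos38_coords t zero algebra_simps)
    show "nonpos38_bracket \<omega> x (nonpos38_bracket \<omega> y z) = nonpos38_bracket \<omega> (nonpos38_bracket \<omega> x y) z
        + nonpos38_scale (psign (i * j)) (nonpos38_bracket \<omega> y (nonpos38_bracket \<omega> x z))"
      if "x \<in> nonpos38_comp i" "y \<in> nonpos38_comp j" "z \<in> nonpos38_comp k" for i j k x y z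
      by (rule nonpos38_cases[OF that(1)]; rule nonpos38_cases[OF that(2)]; rule nonpos38_cases[OF that(3)])
        (simp_all add: psign_def nonpos38_bracket_def nonpos38_scale_def zero p0,
         simp_all add: nonpos38_coords t algebra_simps)
  qed
qed

lemma nonpos38_generated:
  fixes \<omega> :: "'a::field_char_0 ^ 2 \<Rightarrow> 'a ^ 2 \<Rightarrow> 'a"
  assumes "nonzero_alternating \<omega>" "d < -1"
  shows "nonpos38_comp d \<subseteq> module.span nonpos38_scale
    {nonpos38_bracket \<omega> y z | y z. y \<in> nonpos38_comp (-1) \<and> z \<in> nonpos38_comp (d + 1)}"
    (is "_ \<subseteq> module.span _ ?G")
proof
  obtain t where t: "t \<noteq> 0" "\<omega> = (\<lambda>u v. t * (u $ 1 * v $ 2 - u $ 2 * v $ 1))"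
    using nonzero_alternating_form[OF assms(1)] by metis
  interpret N: nonpositive_superalgebra "nonpos38_comp :: int \<Rightarrow> 'a nonpos38 set"
    "nonpos38_bracket \<omega>" nonpos38_scale by (rule nonpos38_superalgebra[OF assms(1)])
  fix x :: "'a nonpos38" assume x: "x \<in> nonpos38_comp d"
  show "x \<in> N.S.span ?G"
    using x
  proof (cases rule: nonpos38_cases)
    case (1 c)
    let ?y = "(0, 0, axis 1 c, 0, 0) :: 'a nonpos38"
      and ?b = "(\<chi> i j. if i = 2 \<and> j = 3 then 1 else if i = 3 \<and> j = 2 then -1 else 0) :: 'a ^ 3 ^ 3"
    have "transpose ?b = - ?b" by (simp add: vec_eq_iff transpose_def forall_3)
    hence "?y \<in> nonpos38_comp (-1)" "(0, ?b, 0, 0, 0) \<in> nonpos38_comp (d + 1)"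
      using 1 by (auto simp: nonpos38_comp_def)
    moreover have "x = nonpos38_bracket \<omega> ?y (0, ?b, 0, 0, 0)"
      using 1 t(2) by (simp add: nonpos38_bracket_def wedge38_def pairing38_def zero_prod_def axis_def vec_eq_iff)
    ultimately show ?thesis by (intro N.S.span_base) blast
  next
    case (2 b)
    let ?m = "\<lambda>i p. (0, 0, axis i (axis p 1), 0, 0) :: 'a nonpos38"
    have m: "?m i p \<in> nonpos38_comp (-1)" for i p by (simp add: nonpos38_comp_def)
    have g: "nonpos38_bracket \<omega> (?m i 1) (?m j 2) \<in> N.S.span ?G" for i j
    proof -
      have "d + 1 = -1" using 2 by simp
      hence "nonpos38_bracket \<omega> (?m i 1) (?m j 2) \<in> ?G" using m[of i 1] m[of j 2] by (simp only: mem_Collect_eq) blast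
      thus ?thesis by (rule N.S.span_base)
    qed
    have "x = nonpos38_scale (b $ 1 $ 2 / t) (nonpos38_bracket \<omega> (?m 1 1) (?m 2 2))
      + nonpos38_scale (b $ 1 $ 3 / t) (nonpos38_bracket \<omega> (?m 1 1) (?m 3 2))
      + nonpos38_scale (b $ 2 $ 3 / t) (nonpos38_bracket \<omega> (?m 2 1) (?m 3 2))"
      using t 2 by (simp add: nonpos38_coords axis_def zero_prod_def)
    thus ?thesis using g by (auto intro!: N.S.span_add N.S.span_scale)
  qed (use assms(2) N.S.span_zero in auto)
qed

lemma nonpos38_faithful:
  fixes \<omega> :: "'a::field_char_0 ^ 2 \<Rightarrow> 'a ^ 2 \<Rightarrow> 'a"
  assumes "x \<in> nonpos38_comp 0" "\<And>y. y \<in> nonpos38_comp (-1) \<Longrightarrow> nonpos38_bracket \<omega> x y = 0"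
  shows "x = 0"
  using assms(1)
proof (cases rule: nonpos38_cases)
  case (4 A S)
  have e: "A ** m + m ** transpose S = 0" for m :: "'a ^ 2 ^ 3"
    using assms(2)[of "(0, 0, m, 0, 0)"] 4 by (simp add: nonpos38_comp_def nonpos38_bracket_def zero_prod_def)
  have f: "(if q = p then A $ k $ i else 0) + (if k = i then S $ q $ p else 0) = 0" for i k p q
    using arg_cong[OF e[of "axis i (axis p 1)"], of "\<lambda>M. M $ k $ q"]
    by (cases "k = i") (simp_all add: matrix_matrix_mult_def transpose_def axis_def
        if_distrib[of "\<lambda>v. v $ _"] if_distrib[of "\<lambda>v. _ * v"] if_distrib[of "\<lambda>v. v * _"] cong: if_cong)
  have o: "A $ k $ i = 0" if "k \<noteq> i" for k i using f[of 1 1 k i] that by simp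
  have u: "S $ q $ p = 0" if "q \<noteq> p" for q p using f[of q p 1 1] that by simp
  have d: "A $ i $ i + S $ p $ p = 0" for i p using f[of p p i i] by simp
  have "S $ 1 $ 1 + S $ 1 $ 1 = 0"
    using d[of 1 1] d[of 1 2] 4(3) by (simp add: eq_neg_iff_add_eq_0)
  hence s1: "S $ 1 $ 1 = 0" by (simp flip: mult_2)
  have "S $ p $ q = 0" for p q
    using u[of p q] s1 4(3) exhaust_2[of p] by (cases "p = q") auto
  moreover have "A $ k $ i = 0" for k i
    using o[of k i] d[of i 1] s1 by (cases "k = i") auto
  ultimately show ?thesis using 4 by (simp add: vec_eq_iff zero_prod_def)
qed auto

text \<open>
  \<open>E38 \<omega>\<close> is the largest transitive graded Lie superalgebra with the given nonpositive part.
\<close>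

theorem E38_full_prolongation:
  fixes \<omega> :: "'a::field_char_0 ^ 2 \<Rightarrow> 'a ^ 2 \<Rightarrow> 'a"
  assumes "nonzero_alternating \<omega>"
  shows "\<exists>E f. transitive_prolongation nonpos38_comp (nonpos38_bracket \<omega>) nonpos38_scale (E38 \<omega>) E f \<and>
    (\<forall>(H :: ('a, 'v::ab_group_add) superalgebra) E' f'.
       transitive_prolongation nonpos38_comp (nonpos38_bracket \<omega>) nonpos38_scale H E' f' \<longrightarrow>
       (\<exists>\<Psi>. graded_embedding nonpos38_comp H E' f' (E38 \<omega>) E f \<Psi>))"
proof -
  interpret N: nonpositive_superalgebra "nonpos38_comp :: int \<Rightarrow> 'a nonpos38 set"
    "nonpos38_bracket \<omega>" nonpos38_scale by (rule nonpos38_superalgebra[OF assms(1)])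
  show ?thesis unfolding E38_def
    using N.prolongation_transitive[OF nonpos38_generated[OF assms(1)] nonpos38_faithful[of _ \<omega>]]
      N.prolongation_maximal by blast
qed

end

theory Submission
  imports Defs
begin

text \<open>
  The twisted Jacobi identity, the last clause of \<open>hom_lie_structure\<close>, is linear in \<open>\<sigma>\<close> and holds for
  every scalar multiple of the identity.  In all five algebras \<open>\<sigma>\<close> turns out to be a scalar \<open>c\<close>; comparing \<open>\<sigma> [x, y] = c [x, y]\<close> with
  \<open>[\<sigma> x, \<sigma> y] = c\<^sup>2 [x, y]\<close> gives \<open>c = c\<^sup>2\<close>, hence \<open>c = 1\<close> if \<open>\<sigma>\<close> is not zero.

  The scalar is found on elements \<open>d\<close> of negative degree that act as translations.  If \<open>d\<close> and \<open>e\<close> are even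
  and commute with each other, and \<open>x\<close> commutes with \<open>d\<close>, then two of the three terms of the
  identity for \<open>d, e, x\<close> vanish and \<open>[\<sigma> d, [e, x]] = 0\<close>.  So \<open>\<sigma> d\<close> commutes with
  everything of the form \<open>[e, x]\<close>, and such elements are numerous enough to leave only the multiples of \<open>d\<close>.
  A suitable triple \<open>d, e, x\<close> shows that the factor \<open>c\<close> is the same for all \<open>d\<close>.

  Let \<open>\<tau> = \<sigma> - c\<close>.  As \<open>ad d\<close> is a derivation, the identity for \<open>d, x, y\<close> now reads
  \<open>[\<tau> x, [d, y]] = \<plusminus> [\<tau> y, [d, x]]\<close>.  It shows that \<open>\<tau> x\<close> commutes with \<open>[d, y]\<close> whenever
  \<open>\<tau> y = 0\<close> or \<open>[d, x] = 0\<close>.  First take \<open>x\<close> with \<open>[d, x] = 0\<close> for some \<open>d\<close>, so that \<open>\<tau> x\<close>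
  commutes with the whole image of \<open>ad d\<close>; then let \<open>x\<close> be arbitrary and use the elements just treated as \<open>y\<close>.
  For the vector fields and for \<open>E(1,6)\<close> the elements \<open>[d, y]\<close> that arise have a joint centralizer that is trivial,
  up to constants in the case of \<open>E(1,6)\<close>, which multiplicativity excludes.

  For \<open>E(4,4)\<close>, \<open>E(5,10)\<close> and \<open>E(3,6)\<close> the translations are partial derivatives; the argument is carried out
  once in the locale \<open>vector_field_superalgebra\<close>, whose assumptions are then verified for each algebra
  (\<open>E44_vector_field_superalgebra\<close>, \<open>E510_vector_field_superalgebra\<close>, \<open>E36_vector_field_superalgebra\<close>).  Its
  test elements are vector fields, so only brackets with an even factor enter.  For \<open>E(1,6)\<close>
  (\<open>E16_hom_lie_structure_trivial\<close>) the single translation is the constant 1 of \<open>K(1,6)\<close>, which acts as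
  \<open>2 \<partial>\<^sub>x\<close>, and the elements \<open>\<xi>\<^sub>i\<close>, \<open>\<xi>\<^sub>i \<xi>\<^sub>j\<close>, \<open>x \<xi>\<^sub>i\<close>, \<open>x\<close> and \<open>x\<^sup>2\<close>
  serve as partners.

  For \<open>E(3,8)\<close> the components of positive degree have no explicit description, so that the elements \<open>y\<close> above are
  not at hand.  There the argument, in the locale \<open>transitive38\<close>, uses the component of degree -2 as translations, and
  the brackets by elements of degree -2, -1 and 0.  Transitivity takes the place of explicit centralizers
  (\<open>centralizer_mod\<close>, \<open>gw_of_centralizer\<close>).  Once \<open>\<tau>\<close> vanishes in degree -2, triples with two partners of degree
  at most 0 show that it vanishes on the matrix units off the diagonal and on \<open>sl(V)\<close>, then in degree -1, and finally
  everywhere.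
\<close>

section \<open>Parities, basis vectors and small index types\<close>

lemma part_subset_whole:
  assumes "0 \<in> even_part g" "0 \<in> odd_part g" "x \<in> part g p"
  shows "x \<in> whole g"
proof (cases "even p")
  case True
  hence "x = x + 0 \<and> x \<in> even_part g \<and> 0 \<in> odd_part g" using assms by (simp add: part_def)
  thus ?thesis unfolding whole_def by blast
next
  case False
  hence "x = 0 + x \<and> 0 \<in> even_part g \<and> x \<in> odd_part g" using assms by (simp add: part_def)
  thus ?thesis unfolding whole_def by blast
qed

lemma axis_zero [simp]: "axis i 0 = 0"
  by (simp add: axis_eq_0_iff)

lemma smult_axis: "q *s axis i p = axis i (q * p :: 'a::comm_ring_1)"
  by (simp add: vec_eq_iff) (simp add: axis_def)

lemma axis_nth_if: "axis k x $ j = (if j = k then x else 0)"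
  by (simp add: axis_def)

lemma two_points_not_all:
  assumes "CARD('n::finite) \<ge> 3"
  shows "\<exists>k::'n. k \<noteq> i \<and> k \<noteq> j"
proof (rule ccontr)
  assume "\<not> ?thesis"
  hence "UNIV = {i, j}" by auto
  moreover have "card {i, j} \<le> 2" by (simp add: card_insert_if)
  ultimately have "CARD('n) \<le> 2" by simp
  thus False using assms by simp
qed

lemma three_cases:
  fixes i j k x :: 3
  assumes "i \<noteq> j" "j \<noteq> k" "i \<noteq> k"
  shows "x = i \<or> x = j \<or> x = k"
proof -
  have "card {i, j, k} = CARD(3)" using assms by simp
  hence "{i, j, k} = UNIV" by (intro card_subset_eq) simp_all
  thus ?thesis by auto
qed

section \<open>Partial derivatives of polynomials\<close>

text \<open>
  The coefficients of a derivative determine it, so linearity and commutation of the partial derivatives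
  are read off from this formula.
\<close>

lemma lookup_mderiv:
  fixes f :: "('a::comm_semiring_1, 'n) mpoly"
  shows "Poly_Mapping.lookup (mderiv i f) m =
     of_nat (Poly_Mapping.lookup m i + 1) * Poly_Mapping.lookup f (m + Poly_Mapping.single i 1)"
proof -
  let ?e = "Poly_Mapping.single i (1::nat)"
  have "Poly_Mapping.lookup (mderiv i f) m = (\<Sum>n\<in>Poly_Mapping.keys f.
      if n = m + ?e then of_nat (Poly_Mapping.lookup n i) * Poly_Mapping.lookup f n else 0)"
    unfolding mderiv_def lookup_sum
  proof (rule sum.cong)
    fix n assume "n \<in> Poly_Mapping.keys f"
    show "Poly_Mapping.lookup (Poly_Mapping.single (n - ?e)
        (of_nat (Poly_Mapping.lookup n i) * Poly_Mapping.lookup f n)) m =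
      (if n = m + ?e then of_nat (Poly_Mapping.lookup n i) * Poly_Mapping.lookup f n else 0)"
    \<comment> \<open>Subtraction of exponents is truncated, but where this matters the factor \<open>n\<^sub>i\<close> is zero.\<close>
    proof (cases "Poly_Mapping.lookup n i = 0")
      case True
      hence "n \<noteq> m + ?e" by (auto simp: lookup_add)
      thus ?thesis using True by simp
    next
      case False
      have "n - ?e + ?e = n"
        by (rule poly_mapping_eqI)
          (use False in \<open>auto simp: lookup_add lookup_minus lookup_single when_def\<close>)
      hence "n - ?e = m \<longleftrightarrow> n = m + ?e" by (metis add_diff_cancel_right')
      thus ?thesis by (auto simp: lookup_single when_def)
    qed
  qed simp
  also have "\<dots> = of_nat (Poly_Mapping.lookup m i + 1) * Poly_Mapping.lookup f (m + ?e)"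
    by (auto simp: lookup_add in_keys_iff)
  finally show ?thesis .
qed

lemma mderiv_zero [simp]: "mderiv i 0 = 0"
  by (simp add: mderiv_def)

lemma mderiv_add: "mderiv i (f + g) = mderiv i f + mderiv i g"
  by (rule poly_mapping_eqI) (simp add: lookup_mderiv lookup_add algebra_simps)

lemma mderiv_diff:
  fixes f g :: "('a::comm_ring_1, 'n) mpoly"
  shows "mderiv i (f - g) = mderiv i f - mderiv i g"
  by (rule poly_mapping_eqI) (simp add: lookup_mderiv lookup_minus algebra_simps)

lemma mderiv_uminus:
  fixes f :: "('a::comm_ring_1, 'n) mpoly"
  shows "mderiv i (- f) = - mderiv i f"
  by (rule poly_mapping_eqI) (simp add: lookup_mderiv)

lemma mderiv_sum: "mderiv i (sum h A) = (\<Sum>a\<in>A. mderiv i (h a))"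
  by (induction A rule: infinite_finite_induct) (simp_all add: mderiv_add)

lemma mderiv_commute: "mderiv i (mderiv j f) = mderiv j (mderiv i f)"
proof (cases "i = j")
  case False
  thus ?thesis
    by (intro poly_mapping_eqI)
      (simp add: lookup_mderiv lookup_add lookup_single when_def add_ac mult.left_commute)
qed simp

lemma mderiv_single:
  "mderiv i (Poly_Mapping.single m c) =
   Poly_Mapping.single (m - Poly_Mapping.single i 1) (of_nat (Poly_Mapping.lookup m i) * c)"
  by (cases "c = 0") (simp_all add: mderiv_def)

lemma mderiv_single_mult:
  fixes m n :: "'n \<Rightarrow>\<^sub>0 nat" and a b :: "'a::comm_semiring_1"
  defines "f \<equiv> Poly_Mapping.single m a" and "g \<equiv> Poly_Mapping.single n b"
  shows "mderiv i (f * g) = mderiv i f * g + f * mderiv i g"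
proof -
  let ?e = "Poly_Mapping.single i (1::nat)"
  have l: "Poly_Mapping.lookup m i \<noteq> 0 \<Longrightarrow> m - ?e + n = m + n - ?e" for m n :: "'n \<Rightarrow>\<^sub>0 nat"
    by (rule poly_mapping_eqI) (auto simp: lookup_add lookup_minus lookup_single when_def)
  have "Poly_Mapping.single (m - ?e) (of_nat (Poly_Mapping.lookup m i) * a) * g =
      Poly_Mapping.single (m + n - ?e) (of_nat (Poly_Mapping.lookup m i) * (a * b))"
    using l[of m n] by (cases "Poly_Mapping.lookup m i = 0") (simp_all add: g_def mult_single mult.assoc)
  moreover have "f * Poly_Mapping.single (n - ?e) (of_nat (Poly_Mapping.lookup n i) * b) =
      Poly_Mapping.single (m + n - ?e) (of_nat (Poly_Mapping.lookup n i) * (a * b))"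
    using l[of n m]
    by (cases "Poly_Mapping.lookup n i = 0") (simp_all add: f_def mult_single mult.left_commute add.commute)
  ultimately show ?thesis
    by (simp add: f_def g_def mult_single mderiv_single lookup_add distrib_right single_add)
qed

lemma mpoly_sum_of_monomials:
  "f = (\<Sum>m\<in>Poly_Mapping.keys f. Poly_Mapping.single m (Poly_Mapping.lookup f m))"
  by (rule poly_mapping_eqI) (simp add: lookup_sum lookup_single when_def in_keys_iff)

lemma mderiv_mult:
  fixes f g :: "('a::comm_semiring_1, 'n) mpoly"
  shows "mderiv i (f * g) = mderiv i f * g + f * mderiv i g"
proof -
  have *: "mderiv i (Poly_Mapping.single m a * g) =
      mderiv i (Poly_Mapping.single m a) * g + Poly_Mapping.single m a * mderiv i g" for m a
    by (subst (1 2 3) mpoly_sum_of_monomials[of g])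
      (simp add: sum_distrib_left mderiv_sum mderiv_single_mult sum.distrib)
  show ?thesis
    by (subst (1 2 3) mpoly_sum_of_monomials[of f])
      (simp add: sum_distrib_right mderiv_sum * sum.distrib)
qed

section \<open>Brackets of vector fields\<close>

definition var :: "'n \<Rightarrow> ('a::comm_semiring_1, 'n) mpoly" where
  "var i = Poly_Mapping.single (Poly_Mapping.single i 1) 1"

lemma mderiv_var [simp]: "mderiv j (var i) = (if i = j then 1 else 0)"
  by (simp add: var_def mderiv_single lookup_single when_def)

lemma mderiv_mconst [simp]: "mderiv i (mconst c) = 0"
  by (simp add: mconst_def mderiv_single)

lemma mderiv_one [simp]: "mderiv i 1 = 0"
  by (metis mderiv_mconst mconst_def single_one)

lemma mconst_hom [simp]:
  "mconst 0 = 0" "mconst 1 = 1" "mconst (a + b) = mconst a + mconst b"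
  "mconst (a * b) = mconst a * mconst (b :: 'a::comm_semiring_1)"
  by (simp_all add: mconst_def single_add mult_single)

lemma mconst_uminus [simp]: "mconst (- a :: 'a::comm_ring_1) = - mconst a"
  by (simp add: mconst_def single_uminus)

lemma mconst_eq_iff [simp]: "mconst a = mconst b \<longleftrightarrow> a = b"
  unfolding mconst_def by (metis lookup_single_eq)

lemma mconst_half [simp]:
  fixes f :: "('a::field_char_0, 'n) mpoly"
  shows "mconst (1 / 2) * (2 * f) = f"
proof -
  have "mconst (1 / 2) + mconst (1 / 2) = (1 :: ('a, 'n) mpoly)"
    using mconst_hom(3)[of "1 / 2 :: 'a" "1 / 2", symmetric] by (simp del: mconst_hom(3))
  thus ?thesis by (metis mult_2 distrib_left distrib_right mult_1)
qed

lemma mconst_axis: "mconst c *s axis i 1 = (axis i (mconst c) :: ('a::comm_ring_1, 'n::finite) vfield)"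
  by (simp add: vec_eq_iff) (simp add: axis_def)

lemma vf_bracket_translation:
  fixes Y :: "('a::comm_ring_1, 'n::finite) vfield"
  shows "vf_bracket (axis i 1) Y = (\<chi> j. mderiv i (Y $ j))"
proof -
  have m: "mderiv k ((axis i 1 :: ('a, 'n) vfield) $ j) = 0" for k j
    by (simp add: axis_def)
  show ?thesis
    by (simp add: vf_bracket_def vec_eq_iff m)
      (simp add: axis_def if_distrib[of "\<lambda>p. p * _"] cong: if_cong)
qed

lemma vf_bracket_axis:
  "vf_bracket (axis i 1) (axis l p) = axis l (mderiv i p)"
  unfolding vf_bracket_translation by (simp add: vec_eq_iff axis_def)

lemma vf_bracket_axis_var:
  fixes X :: "('a::comm_ring_1, 'n::finite) vfield"
  shows "vf_bracket X (axis l (var k)) = axis l (X $ k) - (\<chi> j. var k * mderiv l (X $ j))"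
proof -
  have "(axis l (var k) :: ('a, 'n) vfield) $ i = (if i = l then var k else 0)" for i
    by (simp add: axis_def)
  hence "(\<Sum>i\<in>UNIV. X $ i * mderiv i (axis l (var k) $ j) - axis l (var k) $ i * mderiv i (X $ j)) =
    (if j = l then X $ k else 0) - var k * mderiv l (X $ j)" for j
    by (simp add: sum_subtractf if_distrib[of "\<lambda>p. p * _"] if_distrib[of "\<lambda>p. _ * p"] cong: if_cong)
  thus ?thesis by (simp add: vf_bracket_def vec_eq_iff) (simp add: axis_def)
qed

lemma vf_bracket_skew: "vf_bracket X Y = - vf_bracket Y X"
  by (simp add: vf_bracket_def vec_eq_iff flip: sum_negf)

lemma vf_bracket_diff:
  "vf_bracket X (Y - Z) = vf_bracket X Y - vf_bracket X Z"
  by (simp add: vf_bracket_def vec_eq_iff mderiv_diff algebra_simps sum.distrib sum_subtractf)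

lemma vf_bracket_mconst:
  "vf_bracket X (mconst c *s Y) = mconst c *s vf_bracket X Y"
  by (simp add: vf_bracket_def vec_eq_iff mderiv_mult algebra_simps sum_distrib_left)

lemma vf_bracket_linear_left:
  "vf_bracket (X - mconst c *s Y) Z = vf_bracket X Z - mconst c *s vf_bracket Y Z"
  by (subst (1 2 3) vf_bracket_skew) (simp add: vf_bracket_diff vf_bracket_mconst vec_eq_iff)

lemma vf_bracket_constant_axis:
  "vf_bracket (axis i (mconst c)) Y = mconst c *s vf_bracket (axis i 1) Y"
  by (subst (1 2) vf_bracket_skew) (simp add: vf_bracket_mconst vec_eq_iff flip: mconst_axis)

lemma vf_bracket_zero [simp]: "vf_bracket X 0 = 0" "vf_bracket 0 X = 0"
  by (simp_all add: vf_bracket_def vec_eq_iff)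

text \<open>
  A translation differentiates coefficients, and differentiation satisfies the product rule.
\<close>

lemma vf_bracket_translation_derivation:
  "vf_bracket (axis i 1) (vf_bracket X Y) =
   vf_bracket (vf_bracket (axis i 1) X) Y + vf_bracket X (vf_bracket (axis i 1) Y)"
  unfolding vf_bracket_translation
  by (simp add: vf_bracket_def vec_eq_iff mderiv_sum mderiv_mult mderiv_diff mderiv_commute[of i]
      algebra_simps sum.distrib sum_subtractf)

section \<open>Hom-Lie structures on superalgebras of vector fields and tensor fields\<close>

text \<open>
  The common shape of \<open>E(4,4)\<close>, \<open>E(5,10)\<close> and \<open>E(3,6)\<close>: an even part of vector fields acts by \<open>act\<close> on an
  odd part of tensor fields.  \<open>I\<close> is the set of coordinates along which the even part contains translations, and
  \<open>S\<close> collects further translation-invariant even elements; for \<open>E(3,6)\<close> these generate the Lie algebra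
  \<open>sl\<^sub>2\<close> acting on the two remaining coordinates.

  The membership assumptions provide antiderivatives along \<open>\<partial>\<^sub>j\<close> of \<open>\<partial>\<^sub>l\<close> and of \<open>x\<^sub>k \<partial>\<^sub>l\<close>.  For
  \<open>l = j\<close> the obvious antiderivatives \<open>x\<^sub>j \<partial>\<^sub>j\<close> and \<open>x\<^sub>j x\<^sub>k \<partial>\<^sub>j\<close> are corrected by a field that does not
  depend on \<open>x\<^sub>j\<close>, which makes them free of divergence.  The last two assumptions are what remains to be checked
  about centralizers once the translations and the fields \<open>x\<^sub>k \<partial>\<^sub>l\<close> have been exploited.
\<close>

locale vector_field_superalgebra =
  fixes g :: "('a::field_char_0, ('a, 'n::finite) vfield \<times> 'f::ab_group_add) superalgebra"
    and act :: "('a, 'n) vfield \<Rightarrow> 'f \<Rightarrow> 'f"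
    and smult :: "'a \<Rightarrow> 'f \<Rightarrow> 'f"
    and I :: "'n set" and S :: "('a, 'n) vfield set"
  assumes scl: "scl g c (X, w) = (mconst c *s X, smult c w)"
    and brk_left: "brk g (X, 0) (Y, w) = (vf_bracket X Y, act X w)"
    and brk_right: "brk g (X, w) (Y, 0) = (vf_bracket X Y, - act Y w)"
    and even_part: "x \<in> even_part g \<Longrightarrow> snd x = 0"
    and odd_part: "x \<in> odd_part g \<Longrightarrow> fst x = 0"
    and vs: "vector_space smult"
    and part_zero: "0 \<in> even_part g" "0 \<in> odd_part g"
    and part_linear: "x \<in> even_part g \<Longrightarrow> y \<in> even_part g \<Longrightarrow> x - scl g c y \<in> even_part g"
        "x \<in> odd_part g \<Longrightarrow> y \<in> odd_part g \<Longrightarrow> x - scl g c y \<in> odd_part g"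
    and act_right: "act X (w - smult c w') = act X w - smult c (act X w')"
    and act_left: "act (X - mconst c *s Y) w = act X w - smult c (act Y w)"
    and act_translation: "i \<in> I \<Longrightarrow> act (axis i 1) (act Y w) =
          act (vf_bracket (axis i 1) Y) w + act Y (act (axis i 1) w)"
    and third: "\<exists>k\<in>I. k \<noteq> i \<and> k \<noteq> j"
    and translation_mem: "i \<in> I \<Longrightarrow> (axis i 1, 0) \<in> even_part g"
    and linear_mem: "i \<in> I \<Longrightarrow> l \<in> I \<Longrightarrow> l \<noteq> i \<Longrightarrow> (axis l (var i), 0) \<in> even_part g"
    and quadratic_mem: "i \<in> I \<Longrightarrow> k \<in> I \<Longrightarrow> l \<in> I \<Longrightarrow> l \<noteq> i \<Longrightarrow> l \<noteq> k \<Longrightarrow>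
          (axis l (mconst a * (var i * var k)), 0) \<in> even_part g"
    and corrected_mem: "j \<in> I \<Longrightarrow> k \<in> I \<Longrightarrow> j \<noteq> k \<Longrightarrow>
          (axis j (var j) - axis k (var k), 0) \<in> even_part g"
        "j \<in> I \<Longrightarrow> k \<in> I \<Longrightarrow> j \<noteq> k \<Longrightarrow>
          (axis j (var j * var k) - axis k (mconst (1 / 2) * (var k * var k)), 0) \<in> even_part g"
    and S_mem: "s \<in> S \<Longrightarrow> (s, 0) \<in> even_part g"
        "s \<in> S \<Longrightarrow> i \<in> I \<Longrightarrow> (var i *s s, 0) \<in> even_part g"
    and S_invariant: "s \<in> S \<Longrightarrow> i \<in> I \<Longrightarrow> vf_bracket (axis i 1) s = 0"
    and even_centralizer: "i \<in> I \<Longrightarrow> (X, 0) \<in> even_part g \<Longrightarrow> (\<And>j l. j \<in> I \<Longrightarrow> mderiv j (X $ l) = 0) \<Longrightarrow>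
          (\<And>j. j \<in> I \<Longrightarrow> j \<noteq> i \<Longrightarrow> X $ j = 0) \<Longrightarrow> (\<And>s. s \<in> S \<Longrightarrow> vf_bracket X s = 0) \<Longrightarrow>
          \<exists>c. X = axis i (mconst c)"
    and odd_centralizer: "(0, w) \<in> odd_part g \<Longrightarrow> (\<And>i. i \<in> I \<Longrightarrow> act (axis i 1) w = 0) \<Longrightarrow>
          (\<And>k l. k \<in> I \<Longrightarrow> l \<in> I \<Longrightarrow> k \<noteq> l \<Longrightarrow> act (axis l (var k)) w = 0) \<Longrightarrow> w = 0"
begin

sublocale F: vector_space smult by (rule vs)

definition tests :: "('a, 'n) vfield set" where
  "tests = {axis l 1 | l. l \<in> I} \<union> {axis l (var k) | k l. k \<in> I \<and> l \<in> I \<and> k \<noteq> l} \<union> S"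

lemma act_zero [simp]: "act 0 w = 0" "act X 0 = 0"
  using act_left[of 0 1 0 w] act_right[of X w 1 w] by simp_all

lemma act_scale: "act (mconst c *s X) w = smult c (act X w)"
  and act_minus: "act (- X) w = - act X w"
proof -
  have m: "act (- (mconst c *s X)) w = - smult c (act X w)" for c
    using act_left[of 0 c X w] by simp
  show "act (- X) w = - act X w" using m[of 1] by simp
  show "act (mconst c *s X) w = smult c (act X w)"
    using m[of "- c"] by (simp add: vector_sneg_minus1 vector_smult_assoc)
qed

lemma brk_zero [simp]: "brk g 0 (Y, 0) = 0" "brk g v 0 = 0"
  using brk_right[of 0 0 Y] brk_right[of "fst v" "snd v" 0] by (simp_all add: zero_prod_def)

lemma scl_vector_space: "vector_space (scl g)"
proof unfold_locales
  fix a b and x y :: "('a, 'n) vfield \<times> 'f"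
  obtain X w Y v where e: "x = (X, w)" "y = (Y, v)" by (cases x; cases y)
  show "scl g a (x + y) = scl g a x + scl g a y" "scl g (a + b) x = scl g a x + scl g b x"
    "scl g a (scl g b x) = scl g (a * b) x" "scl g 1 x = x"
    by (simp_all add: e scl F.scale_right_distrib F.scale_left_distrib vec_eq_iff algebra_simps)
qed

sublocale G: vector_space "scl g" by (rule scl_vector_space)

lemma part_whole: "x \<in> part g p \<Longrightarrow> x \<in> whole g"
  using part_zero by (rule part_subset_whole)

lemma translation_tests: "i \<in> I \<Longrightarrow> axis i 1 \<in> tests"
  and linear_tests: "k \<in> I \<Longrightarrow> l \<in> I \<Longrightarrow> k \<noteq> l \<Longrightarrow> axis l (var k) \<in> tests"
  and S_tests: "s \<in> S \<Longrightarrow> s \<in> tests"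
  by (auto simp: tests_def)

lemma constant_if_commutes:
  assumes "vf_bracket X (axis j 1) = 0"
  shows "mderiv j (X $ l) = 0"
  using assms by (subst (asm) vf_bracket_skew) (simp add: vf_bracket_translation vec_eq_iff)

text \<open>
  The translations make the coefficients of \<open>v\<close> constant along \<open>I\<close>.  Then \<open>[v, x\<^sub>k \<partial>\<^sub>l]\<close> has
  \<open>\<partial>\<^sub>l\<close>-component \<open>v\<^sub>k\<close> if \<open>v\<close> is a vector field, so that the centralizer assumption leaves a multiple of a
  translation whose coefficient is also zero.
\<close>

lemma tests_centralizer:
  assumes "v \<in> part g p" "\<And>z. z \<in> tests \<Longrightarrow> brk g v (z, 0) = 0"
  shows "v = 0"
proof (cases "even p")
  case True
  then obtain X where v: "v = (X, 0)" "(X, 0) \<in> even_part g"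
    using assms(1) even_part[of v] by (cases v) (auto simp: part_def)
  have b: "vf_bracket X z = 0" if "z \<in> tests" for z
    using assms(2)[OF that] v by (simp add: brk_right zero_prod_def)
  have d: "mderiv j (X $ l) = 0" if "j \<in> I" for j l
    using constant_if_commutes b translation_tests that by blast
  have c: "X $ k = 0" if k: "k \<in> I" for k
  proof -
    obtain l where l: "l \<in> I" "l \<noteq> k" using third by blast
    have "vf_bracket X (axis l (var k)) $ l = 0" using b[OF linear_tests[OF k l(1)]] l by simp
    thus ?thesis using d[OF l(1)] by (simp add: vf_bracket_axis_var)
  qed
  obtain i where i: "i \<in> I" using third by blast
  obtain e where "X = axis i (mconst e)"
    using even_centralizer[OF i v(2) d c b] S_tests by blast
  moreover from this have "mconst e = (0 :: ('a, 'n) mpoly)" using c[OF i] by (metis axis_nth)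
  ultimately have "X = 0" by (simp add:)
  thus ?thesis using v by (simp add: zero_prod_def)
next
  case False
  then obtain w where v: "v = (0, w)" "(0, w) \<in> odd_part g"
    using assms(1) odd_part[of v] by (cases v) (auto simp: part_def)
  have "act z w = 0" if "z \<in> tests" for z
    using assms(2)[OF that] v by (simp add: brk_right zero_prod_def)
  hence "w = 0" using odd_centralizer[OF v(2)] translation_tests linear_tests by blast
  thus ?thesis using v by (simp add: zero_prod_def)
qed

text \<open>
  These antiderivatives show that an element commuting with the image of a single \<open>ad \<partial>\<^sub>j\<close> commutes with all
  test elements.
\<close>

lemma primitive_of_test:
  assumes "z \<in> tests" "j \<in> I"
  obtains Y where "(Y, 0) \<in> even_part g" "vf_bracket (axis j 1) Y = z"
proof -
  consider l where "z = axis l 1" "l \<in> I" | k l where "z = axis l (var k)" "k \<in> I" "l \<in> I" "k \<noteq> l"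
    | "z \<in> S" using assms(1) by (auto simp: tests_def)
  thus thesis
  proof cases
    case (1 l)
    show thesis
    proof (cases "l = j")
      case True
      obtain k where "k \<in> I" "k \<noteq> j" using third by blast
      thus thesis using that[OF corrected_mem(1)[OF assms(2), of k]] 1 True
        by (simp add: vf_bracket_diff vf_bracket_axis)
    next
      case False
      thus thesis using that[OF linear_mem[OF assms(2), of l]] 1 by (simp add: vf_bracket_axis)
    qed
  next
    case (2 k l)
    show thesis
    proof (cases "l = j")
      case True
      thus thesis using that[OF corrected_mem(2)[OF assms(2), of k]] 2
        by (simp add: vf_bracket_diff vf_bracket_axis mderiv_mult)
    next
      case False
      show thesis
      proof (cases "k = j")
        case True
        thus thesis using that[OF quadratic_mem[of j j l "1 / 2"]] 2 False assms(2)
          by (simp add: vf_bracket_axis mderiv_mult flip: mult_2)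
      next
        case kj: False
        thus thesis using that[OF quadratic_mem[of j k l 1]] 2 False assms(2)
          by (simp add: vf_bracket_axis mderiv_mult)
      qed
    qed
  next
    case 3
    hence "vf_bracket (axis j 1) (var j *s z) = z"
      using S_invariant[OF 3 assms(2)] by (simp add: vf_bracket_translation vec_eq_iff mderiv_mult)
    thus thesis using that S_mem(2)[OF 3 assms(2)] by blast
  qed
qed

text \<open>
  The antiderivative is chosen independent of one of the other coordinates, because on such fields
  \<open>\<sigma>\<close> is already known when a general element is treated.
\<close>

lemma constant_primitive_of_test:
  assumes "z \<in> tests"
  obtains i j Y where "i \<in> I" "j \<in> I" "i \<noteq> j" "(Y, 0) \<in> even_part g"
    "vf_bracket (axis i 1) Y = z" "vf_bracket (axis j 1) Y = 0"
proof -
  consider l where "z = axis l 1" "l \<in> I" | k l where "z = axis l (var k)" "k \<in> I" "l \<in> I" "k \<noteq> l"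
    | "z \<in> S" using assms(1) by (auto simp: tests_def)
  thus thesis
  proof cases
    case (1 l)
    obtain i where "i \<in> I" "i \<noteq> l" using third by blast
    thus thesis using that[of i l "axis l (var i)"] linear_mem[of i l] 1
      by (simp add: vf_bracket_axis)
  next
    case (2 k l)
    thus thesis using that[of k l "axis l (mconst (1 / 2) * (var k * var k))"] quadratic_mem[of k k l "1 / 2"]
      by (simp add: vf_bracket_axis mderiv_mult flip: mult_2)
  next
    case 3
    obtain i where i: "i \<in> I" using third by blast
    obtain j where j: "j \<in> I" "j \<noteq> i" using third by blast
    have "vf_bracket (axis i 1) (var i *s z) = z" "vf_bracket (axis j 1) (var i *s z) = 0"
      using S_invariant[OF 3 i] S_invariant[OF 3 j(1)] j
      by (simp_all add: vf_bracket_translation vec_eq_iff mderiv_mult)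
    thus thesis using that[OF i j(1) _ S_mem(2)[OF 3 i]] j by blast
  qed
qed

context
  fixes \<sigma>
  assumes hom: "hom_lie_structure g \<sigma>"
begin

lemma sigma_even: "(X, 0) \<in> even_part g \<Longrightarrow> \<exists>V. \<sigma> (X, 0) = (V, 0) \<and> (V, 0) \<in> even_part g"
proof -
  assume X: "(X, 0) \<in> even_part g"
  hence "(X, 0) \<in> part g 0" by (simp add: part_def)
  hence "\<sigma> (X, 0) \<in> part g 0" using hom unfolding hom_lie_structure_def by blast
  hence *: "\<sigma> (X, 0) \<in> even_part g" by (simp add: part_def)
  hence "snd (\<sigma> (X, 0)) = 0" by (rule even_part)
  thus ?thesis using * by (cases "\<sigma> (X, 0)") auto
qed

lemma twisted_jacobi:
  assumes "(X, 0) \<in> even_part g" "(Y, 0) \<in> even_part g" "v \<in> part g p"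
  shows "brk g (\<sigma> (X, 0)) (brk g v (Y, 0)) + brk g (\<sigma> v) (brk g (Y, 0) (X, 0))
    + brk g (\<sigma> (Y, 0)) (brk g (X, 0) v) = 0"
proof -
  have m: "(X, 0) \<in> part g 0" "(Y, 0) \<in> part g 0" using assms by (simp_all add: part_def)
  have J: "\<forall>p q r. \<forall>x\<in>part g p. \<forall>y\<in>part g q. \<forall>z\<in>part g r.
        scl g ((-1) ^ (p * r)) (brk g (\<sigma> x) (brk g y z)) +
        scl g ((-1) ^ (q * p)) (brk g (\<sigma> y) (brk g z x)) +
        scl g ((-1) ^ (r * q)) (brk g (\<sigma> z) (brk g x y)) = 0"
    using hom unfolding hom_lie_structure_def by blast
  show ?thesis
    using J[rule_format, OF m(1) assms(3) m(2)] by simp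
qed

text \<open>
  The twisted Jacobi identity for \<open>\<partial>\<^sub>i\<close>, \<open>\<partial>\<^sub>j\<close> and a field \<open>Y\<close> that does not depend on \<open>x\<^sub>i\<close> says that
  the image \<open>V\<close> of \<open>\<partial>\<^sub>i\<close> commutes with \<open>[\<partial>\<^sub>j, Y]\<close>.  Fields \<open>Y\<close> of degree one show that \<open>V\<close> is constant
  along \<open>I\<close>, quadratic ones that only its \<open>i\<close>-th component along \<open>I\<close> survives.
\<close>

lemma sigma_translation:
  assumes i: "i \<in> I"
  shows "\<exists>c. \<sigma> (axis i 1, 0) = scl g c (axis i 1, 0)"
proof -
  obtain V where V: "\<sigma> (axis i 1, 0) = (V, 0)" "(V, 0) \<in> even_part g"
    using sigma_even translation_mem[OF i] by blast
  have c: "vf_bracket V (vf_bracket (axis j 1) Y) = 0"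
    if j: "j \<in> I" and Y: "(Y, 0) \<in> even_part g" "vf_bracket (axis i 1) Y = 0" for j Y
  proof -
    obtain V' where V': "\<sigma> (Y, 0) = (V', 0)" using sigma_even Y by blast
    obtain W where W: "\<sigma> (axis j 1, 0) = (W, 0)" using sigma_even translation_mem[OF j] by blast
    have "(axis j 1, 0) \<in> part g 0" using translation_mem[OF j] by (simp add: part_def)
    from twisted_jacobi[OF translation_mem[OF i] Y(1) this] show ?thesis
      using Y(2) vf_bracket_skew[of Y "axis i 1"] by (simp add: brk_left V V' W vf_bracket_axis zero_prod_def)
  qed
  have d: "mderiv k (V $ l) = 0" if k: "k \<in> I" for k l
  proof -
    obtain j where j: "j \<in> I" "j \<noteq> i" "j \<noteq> k" using third by blast
    from c[OF j(1) linear_mem[OF j(1) k]] j have "vf_bracket V (axis k 1) = 0"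
      by (simp add: vf_bracket_axis)
    thus ?thesis by (rule constant_if_commutes)
  qed
  have z: "V $ k = 0" if k: "k \<in> I" "k \<noteq> i" for k
  proof -
    obtain l where l: "l \<in> I" "l \<noteq> k" using third by blast
    have "vf_bracket V (axis l (var k)) = 0"
      using c[OF k(1) quadratic_mem[OF k(1) k(1) l(1), of "1 / 2"]] k l
      by (simp add: vf_bracket_axis mderiv_mult flip: mult_2)
    hence "vf_bracket V (axis l (var k)) $ l = 0" by simp
    thus ?thesis using d[OF l(1)] by (simp add: vf_bracket_axis_var)
  qed
  have s: "vf_bracket V s = 0" if s: "s \<in> S" for s
  proof -
    obtain j where j: "j \<in> I" "j \<noteq> i" using third by blast
    have "vf_bracket (axis i 1) (var j *s s) = 0" "vf_bracket (axis j 1) (var j *s s) = s"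
      using S_invariant[OF s i] S_invariant[OF s j(1)] j
      by (simp_all add: vf_bracket_translation vec_eq_iff mderiv_mult)
    thus ?thesis using c[OF j(1) S_mem(2)[OF s j(1)]] by simp
  qed
  obtain e where "V = axis i (mconst e)" using even_centralizer[OF i V(2) d z s] by blast
  hence "\<sigma> (axis i 1, 0) = scl g e (axis i 1, 0)"
    by (simp add: V scl mconst_axis)
  thus ?thesis by blast
qed

text \<open>
  Each translation has an eigenvalue; the triple \<open>\<partial>\<^sub>i\<close>, \<open>\<partial>\<^sub>j\<close>, \<open>x\<^sub>i x\<^sub>j \<partial>\<^sub>k\<close> compares those of two
  translations, since both nonzero terms are multiples of \<open>\<partial>\<^sub>k\<close>.
\<close>

lemma sigma_translations:
  obtains c where "\<And>i. i \<in> I \<Longrightarrow> \<sigma> (axis i 1, 0) = (axis i (mconst c), 0)"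
proof -
  have s: "scl g e (axis i 1, 0) = (axis i (mconst e), 0)" for e i
    by (simp add: scl mconst_axis)
  obtain c where c: "\<And>i. i \<in> I \<Longrightarrow> \<sigma> (axis i 1, 0) = (axis i (mconst (c i)), 0)"
    using sigma_translation unfolding s by metis
  have "c i = c j" if ij: "i \<in> I" "j \<in> I" "i \<noteq> j" for i j
  proof -
    obtain k where k: "k \<in> I" "k \<noteq> i" "k \<noteq> j" using third by blast
    define Y where "Y = (axis k (mconst 1 * (var i * var j)) :: ('a, 'n) vfield)"
    have Y: "(Y, 0) \<in> even_part g" unfolding Y_def using quadratic_mem ij k by blast
    obtain W where W: "\<sigma> (Y, 0) = (W, 0)" using sigma_even[OF Y] by blast
    have "vf_bracket Y (axis i 1) = - vf_bracket (axis i 1) Y" by (rule vf_bracket_skew)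
    also have "\<dots> = axis k (- var j)"
      using ij by (simp add: Y_def vf_bracket_axis mderiv_mult) (simp add: vec_eq_iff axis_def)
    finally have d: "vf_bracket Y (axis i 1) = axis k (- var j)"
      "vf_bracket (axis j 1) Y = axis k (var i)"
      using ij by (simp_all add: Y_def vf_bracket_axis mderiv_mult)
    have m: "vf_bracket (axis i (mconst e)) (axis k p) = axis k (mconst e * mderiv i p)" for i p e
      by (simp add: vf_bracket_constant_axis vf_bracket_axis smult_axis)
    have "(axis j 1, 0) \<in> part g 0" using translation_mem[OF ij(2)] by (simp add: part_def)
    from arg_cong[OF twisted_jacobi[OF translation_mem[OF ij(1)] Y this], of fst]
    have "axis k (mconst (c i)) + axis k (- mconst (c j)) = (0 :: ('a, 'n) vfield)"
      using ij by (simp add: brk_left d m c W vf_bracket_axis mderiv_uminus)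
    from arg_cong[OF this, of "\<lambda>v. v $ k"]
    have "mconst (c i) = (mconst (c j) :: ('a, 'n) mpoly)" by simp
    thus ?thesis by simp
  qed
  moreover obtain i where "i \<in> I" using third by blast
  ultimately have "\<And>j. j \<in> I \<Longrightarrow> \<sigma> (axis j 1, 0) = (axis j (mconst (c i)), 0)" using c by metis
  thus thesis by (rule that)
qed

theorem hom_lie_structure_trivial:
  assumes "nonzero_map g \<sigma>"
  shows "trivial_structure g \<sigma>"
proof -
  have add: "\<sigma> (x + y) = \<sigma> x + \<sigma> y" if "x \<in> whole g" "y \<in> whole g" for x y
    using hom that unfolding hom_lie_structure_def by blast
  have par: "\<sigma> x \<in> part g p" if "x \<in> part g p" for x p
    using hom that unfolding hom_lie_structure_def by blast
  have mult: "\<sigma> (brk g x y) = brk g (\<sigma> x) (\<sigma> y)" if "x \<in> part g p" "y \<in> part g q" for x y p q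
    using hom that unfolding hom_lie_structure_def by blast
  have even0: "x \<in> part g 0 \<longleftrightarrow> x \<in> even_part g" for x by (simp add: part_def)
  obtain c where c: "\<And>i. i \<in> I \<Longrightarrow> \<sigma> (axis i 1, 0) = (axis i (mconst c), 0)"
    using sigma_translations by blast
  define \<tau> where "\<tau> v = \<sigma> v - scl g c v" for v
  have tau_part: "\<tau> v \<in> part g p" if "v \<in> part g p" for v p
    using part_linear that par[OF that] unfolding \<tau>_def part_def by (auto split: if_splits)
  \<comment> \<open>The twisted Jacobi identity for \<open>\<partial>\<^sub>i\<close>, \<open>v\<close> and \<open>Y\<close>, after the contribution of \<open>c\<close> has been
    distributed by the derivation property of \<open>\<partial>\<^sub>i\<close>.\<close>
  have rel: "brk g (\<tau> v) (vf_bracket (axis i 1) Y, 0) + brk g (brk g (axis i 1, 0) v) (\<tau> (Y, 0)) = 0"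
    if Y: "(Y, 0) \<in> even_part g" and v: "v \<in> part g p" and i: "i \<in> I" for v Y i p
  proof -
    obtain X w X' w' where e: "v = (X, w)" "\<sigma> v = (X', w')" by (cases v; cases "\<sigma> v")
    obtain Y' where Y': "\<sigma> (Y, 0) = (Y', 0)" using sigma_even[OF Y] by blast
    define Z where "Z = vf_bracket (axis i 1) Y"
    have Z: "vf_bracket Y (axis i 1) = - Z" unfolding Z_def by (rule vf_bracket_skew)
    note cv = vf_bracket_constant_axis[of i c]
    have ca: "act (axis i (mconst c)) u = smult c (act (axis i 1) u)" for u
      unfolding mconst_axis[symmetric] by (rule act_scale)
    have neg: "vf_bracket X' (- Z) = - vf_bracket X' Z"
      using vf_bracket_diff[of X' 0 Z] by simp
    have b: "brk g v (Y, 0) = (vf_bracket X Y, - act Y w)"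
        "brk g (axis i 1, 0) v = (vf_bracket (axis i 1) X, act (axis i 1) w)"
        "brk g (Y, 0) (axis i 1, 0) = (- Z, 0)"
      unfolding e(1) by (simp_all only: brk_left brk_right Z act_zero minus_zero)
    note J0 = twisted_jacobi[OF translation_mem[OF i] Y v, unfolded b e(2) Y' c[OF i] brk_left brk_right
        Z act_zero minus_zero cv vf_bracket_translation_derivation neg act_minus, folded Z_def]
    have J: "mconst c *s (vf_bracket (vf_bracket (axis i 1) X) Y + vf_bracket X Z)
          - vf_bracket X' Z + vf_bracket Y' (vf_bracket (axis i 1) X) = 0"
        "act (axis i (mconst c)) (- act Y w) + act Z w' + act Y' (act (axis i 1) w) = 0"
      using arg_cong[OF J0, of fst] arg_cong[OF J0, of snd] by simp_all
    have a: "act (axis i (mconst c)) (- act Y w) = - smult c (act Z w + act Y (act (axis i 1) w))"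
    proof -
      have "act (axis i 1) (- act Y w) = - (act Z w + act Y (act (axis i 1) w))"
        using act_right[of "axis i 1" 0 1 "act Y w"] act_translation[OF i, of Y w] by (simp add: Z_def)
      thus ?thesis by (simp only: ca F.scale_minus_right)
    qed
    have t: "\<tau> v = (X' - mconst c *s X, w' - smult c w)" "\<tau> (Y, 0) = (Y' - mconst c *s Y, 0)"
      using e Y' by (simp_all add: \<tau>_def scl)
    have r: "vf_bracket U (Y' - mconst c *s Y) = - vf_bracket Y' U - mconst c *s vf_bracket U Y" for U
      by (simp add: vf_bracket_diff vf_bracket_mconst vf_bracket_skew[of U Y'])
    have "brk g (\<tau> v) (Z, 0) = (vf_bracket X' Z - mconst c *s vf_bracket X Z, - (act Z w' - smult c (act Z w)))"
      unfolding t(1) brk_right vf_bracket_linear_left act_right ..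
    moreover have "brk g (brk g (axis i 1, 0) v) (\<tau> (Y, 0)) =
        (- vf_bracket Y' (vf_bracket (axis i 1) X) - mconst c *s vf_bracket (vf_bracket (axis i 1) X) Y,
         - (act Y' (act (axis i 1) w) - smult c (act Y (act (axis i 1) w))))"
      unfolding b(2) t(2) brk_right r act_left ..
    ultimately show ?thesis
      using J unfolding a Z_def[symmetric]
      by (simp add: zero_prod_def F.scale_right_distrib vector_add_ldistrib algebra_simps)
  qed
  \<comment> \<open>If \<open>Y\<close> does not depend on \<open>x\<^sub>j\<close>, then the second term of the relation vanishes and
    \<open>\<tau> Y\<close> commutes with the image of \<open>\<partial>\<^sub>j\<close>.\<close>
  have tau_constant: "\<tau> (Y, 0) = 0"
    if Y: "(Y, 0) \<in> even_part g" and j: "j \<in> I" "vf_bracket (axis j 1) Y = 0" for Y j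
  proof (rule tests_centralizer[where p = 0])
    show "\<tau> (Y, 0) \<in> part g 0" using tau_part Y even0 by blast
    fix z assume "z \<in> tests"
    then obtain Z where Z: "(Z, 0) \<in> even_part g" "vf_bracket (axis j 1) Z = z"
      using primitive_of_test j(1) by blast
    obtain Z' where "\<tau> (Z, 0) = (Z', 0)"
      using tau_part[of "(Z, 0)" 0] Z(1) even0 even_part by (cases "\<tau> (Z, 0)") force
    thus "brk g (\<tau> (Y, 0)) (z, 0) = 0"
      using rel[OF Z(1), of "(Y, 0)" 0 j] Y even0 j Z(2) by (simp add: brk_left flip: zero_prod_def)
  qed
  \<comment> \<open>For general \<open>v\<close> the second term vanishes for the fields \<open>Y\<close> just treated.\<close>
  have tau_zero: "\<tau> v = 0" if v: "v \<in> part g p" for v p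
  proof (rule tests_centralizer[OF tau_part[OF v]])
    fix z assume "z \<in> tests"
    then obtain i j Y where Y: "i \<in> I" "j \<in> I" "(Y, 0) \<in> even_part g"
      "vf_bracket (axis i 1) Y = z" "vf_bracket (axis j 1) Y = 0"
      using constant_primitive_of_test by metis
    show "brk g (\<tau> v) (z, 0) = 0"
      using rel[OF Y(3) v Y(1)] tau_constant[OF Y(3,2,5)] Y(4) by simp
  qed
  have sigma: "\<sigma> v = scl g c v" if "v \<in> whole g" for v
  proof -
    obtain x y where xy: "v = x + y" "x \<in> even_part g" "y \<in> odd_part g"
      using \<open>v \<in> whole g\<close> unfolding whole_def by blast
    have "x \<in> whole g" "y \<in> whole g"
      using xy part_whole[of x 0] part_whole[of y 1] by (simp_all add: part_def)
    moreover have "\<sigma> x = scl g c x" "\<sigma> y = scl g c y"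
      using tau_zero[of x 0] tau_zero[of y 1] xy by (simp_all add: \<tau>_def part_def)
    ultimately show ?thesis using add xy(1) by (simp add: G.scale_right_distrib)
  qed
  \<comment> \<open>Multiplicativity on \<open>[\<partial>\<^sub>i, x\<^sub>i \<partial>\<^sub>l] = \<partial>\<^sub>l\<close>.\<close>
  have "c = c * c"
  proof -
    obtain i where i: "i \<in> I" using third by blast
    obtain l where l: "l \<in> I" "l \<noteq> i" using third by blast
    have w: "x \<in> whole g" if "x \<in> even_part g" for x
      using that part_whole[of x 0] by (simp add: part_def)
    have "brk g (axis i 1, 0) (axis l (var i), 0) = (axis l 1, 0)"
      by (simp add: brk_left vf_bracket_axis)
    hence "scl g c (axis l 1, 0) = brk g (axis i (mconst c), 0) (scl g c (axis l (var i), 0))"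
      using mult[of "(axis i 1, 0)" 0 "(axis l (var i), 0)" 0] linear_mem[OF i l] translation_mem[OF i]
        translation_mem[OF l(1)] w sigma c[OF i] by (simp add: even0)
    also have "\<dots> = scl g (c * c) (axis l 1, 0)"
      by (simp add: scl brk_left vf_bracket_mconst vf_bracket_constant_axis vf_bracket_axis vector_smult_assoc)
    finally have "axis l (mconst c) = (axis l (mconst (c * c)) :: ('a, 'n) vfield)"
      unfolding scl mconst_axis by simp
    thus ?thesis by (metis axis_nth mconst_eq_iff)
  qed
  moreover have "c \<noteq> 0" using assms sigma by (auto simp: nonzero_map_def)
  ultimately have "c = 1" by simp
  thus ?thesis using sigma by (simp add: trivial_structure_def)
qed

end

end

section \<open>Lie derivatives and divergences\<close>

text \<open>
  Only one derivative per nonconstant monomial has to vanish, so the lemma also applies to polynomials in which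
  some variables are excluded by homogeneity rather than by a derivative.
\<close>

lemma mconst_if_mderiv_zero:
  fixes f :: "('a::field_char_0, 'n) mpoly"
  assumes "\<And>m. m \<noteq> 0 \<Longrightarrow> m \<in> Poly_Mapping.keys f \<Longrightarrow> \<exists>i. Poly_Mapping.lookup m i \<noteq> 0 \<and> mderiv i f = 0"
  shows "\<exists>c. f = mconst c"
proof -
  have "Poly_Mapping.lookup f m = 0" if m: "m \<noteq> 0" for m
  proof (rule ccontr)
    assume nz: "Poly_Mapping.lookup f m \<noteq> 0"
    then obtain i where i: "Poly_Mapping.lookup m i \<noteq> 0" "mderiv i f = 0"
      using assms m by (auto simp: in_keys_iff)
    define e where "e = Poly_Mapping.single i (1::nat)"
    have "m = (m - e) + e"
      by (rule poly_mapping_eqI) (use i in \<open>auto simp: e_def lookup_add lookup_minus lookup_single when_def\<close>)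
    moreover have "Poly_Mapping.lookup (mderiv i f) (m - e) = 0" using i by simp
    ultimately have "of_nat (Suc (Poly_Mapping.lookup (m - e) i)) * Poly_Mapping.lookup f m = 0"
      unfolding lookup_mderiv e_def[symmetric] by (metis Suc_eq_plus1)
    thus False using nz by (simp del: of_nat_Suc)
  qed
  hence "f = mconst (Poly_Mapping.lookup f 0)"
    by (intro poly_mapping_eqI) (simp add: mconst_def lookup_single when_def)
  thus ?thesis by blast
qed

lemma mconst_if_all_mderiv_zero:
  fixes f :: "('a::field_char_0, 'n) mpoly"
  assumes "\<And>i. mderiv i f = 0"
  shows "\<exists>c. f = mconst c"
proof (rule mconst_if_mderiv_zero)
  fix m :: "'n \<Rightarrow>\<^sub>0 nat" assume "m \<noteq> 0"
  then obtain i where "Poly_Mapping.lookup m i \<noteq> 0" by (metis poly_mapping_eqI lookup_zero)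
  thus "\<exists>i. Poly_Mapping.lookup m i \<noteq> 0 \<and> mderiv i f = 0" using assms by blast
qed

lemma axis_if_supported:
  fixes X :: "('a::zero, 'n::finite) vfield"
  assumes "\<And>j. j \<noteq> i \<Longrightarrow> X $ j = 0" "X $ i = mconst c"
  shows "X = axis i (mconst c)"
  using assms by (simp add: vec_eq_iff axis_def)

lemma lie_deriv1_axis:
  fixes w :: "('a::comm_ring_1, 'n::finite) form1"
  shows "lie_deriv1 (axis l p) w = (\<chi> i. p * mderiv l (w $ i) + mderiv i p * w $ l)"
proof -
  have "(axis l p :: ('a, 'n) vfield) $ k = (if k = l then p else 0)" for k
    by (simp add: axis_def)
  thus ?thesis
    by (simp add: lie_deriv1_def vec_eq_iff sum.distrib if_distrib[of "\<lambda>p. p * _"] if_distrib[of "mderiv _"] cong: if_cong)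
qed

lemma lie_deriv2_axis:
  fixes w :: "('a::comm_ring_1, 'n::finite) form2"
  shows "lie_deriv2 (axis l p) w =
    (\<chi> i j. p * mderiv l (w $ i $ j) + mderiv i p * w $ l $ j + mderiv j p * w $ i $ l)"
proof -
  have "(axis l p :: ('a, 'n) vfield) $ k = (if k = l then p else 0)" for k
    by (simp add: axis_def)
  thus ?thesis
    by (simp add: lie_deriv2_def vec_eq_iff sum.distrib if_distrib[of "\<lambda>p. p * _"] if_distrib[of "mderiv _"] cong: if_cong)
qed

lemma divergence_axis: "divergence (axis l p :: ('a::comm_ring_1, 'n::finite) vfield) = mderiv l p"
proof -
  have "(axis l p :: ('a, 'n) vfield) $ k = (if k = l then p else 0)" for k
    by (simp add: axis_def)
  thus ?thesis by (simp add: divergence_def if_distrib[of "mderiv _"] cong: if_cong)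
qed

lemma divergence_diff: "divergence (X - Y) = divergence X - divergence Y"
  by (simp add: divergence_def mderiv_diff sum_subtractf)

lemma divergence_scale: "divergence (mconst c *s X) = mconst c * divergence X"
  by (simp add: divergence_def mderiv_mult sum_distrib_left)

lemma divergence_translation:
  "divergence (vf_bracket (axis i 1) X) = mderiv i (divergence X)"
  by (simp add: vf_bracket_translation divergence_def mderiv_sum mderiv_commute[of i])

lemma lie_deriv1_linear:
  "lie_deriv1 X (w - mconst c *s v) = lie_deriv1 X w - mconst c *s lie_deriv1 X v"
  "lie_deriv1 (X - mconst c *s Y) w = lie_deriv1 X w - mconst c *s lie_deriv1 Y w"
  by (simp_all add: lie_deriv1_def vec_eq_iff mderiv_diff mderiv_mult algebra_simps sum.distrib
      sum_subtractf sum_distrib_left)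

lemma lie_deriv1_translation:
  "lie_deriv1 (axis i 1) (lie_deriv1 Y w) =
   lie_deriv1 (vf_bracket (axis i 1) Y) w + lie_deriv1 Y (lie_deriv1 (axis i 1) w)"
  unfolding lie_deriv1_axis vf_bracket_translation
  by (simp add: lie_deriv1_def vec_eq_iff mderiv_sum mderiv_mult mderiv_add mderiv_commute[of i]
      algebra_simps sum.distrib)

lemma lie_deriv2_linear:
  "lie_deriv2 X (w - (\<chi> i. mconst c *s (v $ i))) = lie_deriv2 X w - (\<chi> i. mconst c *s (lie_deriv2 X v $ i))"
  "lie_deriv2 (X - mconst c *s Y) w = lie_deriv2 X w - (\<chi> i. mconst c *s (lie_deriv2 Y w $ i))"
  by (simp_all add: lie_deriv2_def vec_eq_iff mderiv_diff mderiv_mult algebra_simps sum.distrib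
      sum_subtractf sum_distrib_left)

lemma lie_deriv2_translation:
  "lie_deriv2 (axis i 1) (lie_deriv2 Y w) =
   lie_deriv2 (vf_bracket (axis i 1) Y) w + lie_deriv2 Y (lie_deriv2 (axis i 1) w)"
  unfolding lie_deriv2_axis vf_bracket_translation
  by (simp add: lie_deriv2_def vec_eq_iff mderiv_sum mderiv_mult mderiv_add mderiv_commute[of i]
      algebra_simps sum.distrib)

section \<open>\<open>E(4,4)\<close>\<close>

text \<open>
  The coefficient of the contraction at the three indices other than \<open>t\<close> is \<open>\<plusminus> X\<^sub>t\<close>.  Injectivity of the
  contraction is what makes the description of the odd bracket determine its value.
\<close>

lemma interior_vol4_eq_zero:
  fixes X :: "('a::field_char_0, 4) vfield"
  assumes "interior_vol4 X = 0"
  shows "X = 0"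
proof -
  have "X $ t = 0" for t
  proof -
    have "\<exists>i j k. distinct [t, i, j, k] \<and> UNIV = {t, i, j, k}"
    proof -
      have "finite (UNIV - {t})" by simp
      then obtain xs where xs: "set xs = UNIV - {t}" "distinct xs"
        using finite_distinct_list[of "UNIV - {t}"] by metis
      have "card (UNIV - {t}) = CARD(4) - 1" by (rule card_Diff_singleton) simp
      hence "length xs = Suc (Suc (Suc 0))" using xs distinct_card by fastforce
      then obtain i j k where e: "xs = [i, j, k]" by (auto simp only: length_Suc_conv length_0_conv)
      have "t \<notin> set xs" "UNIV = insert t (set xs)" using xs by auto
      thus ?thesis using xs(2) unfolding e by auto
    qed
    then obtain i j k where d: "distinct [t, i, j, k]" "UNIV = {t, i, j, k}" by blast
    have "(\<Sum>t'\<in>UNIV. of_int (eps4 t' i j k) * X $ t') = 0"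
      using arg_cong[OF assms, of "\<lambda>w. w $ i $ j $ k"] by (simp add: interior_vol4_def)
    moreover have "eps4 t' i j k = 0" if "t' \<noteq> t" for t' using that d by (auto simp: eps4_def)
    hence "(\<Sum>t'\<in>UNIV. of_int (eps4 t' i j k) * X $ t') = (\<Sum>t'\<in>UNIV. if t' = t then of_int (eps4 t i j k) * X $ t else 0)"
      by (intro sum.cong) auto
    ultimately have "of_int (eps4 t i j k) * X $ t = 0" by simp
    moreover have "eps4 t i j k = 1 \<or> eps4 t i j k = -1" using d by (auto simp: eps4_def sign_def)
    ultimately show ?thesis by auto
  qed
  thus ?thesis by (simp add: vec_eq_iff)
qed

lemma E44_odd_bracket_zero [simp]:
  fixes w :: "('a::field_char_0, 4) form1"
  shows "E44_odd_bracket w 0 = 0" "E44_odd_bracket 0 w = 0"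
proof -
  have *: "(THE X. interior_vol4 X = 0) = (0 :: ('a, 4) vfield)"
    by (rule the_equality) (simp_all add: interior_vol4_eq_zero, simp add: interior_vol4_def vec_eq_iff)
  have "wedge21 (ext_deriv1 w) 0 + wedge12 w (ext_deriv1 0) = 0"
    "wedge21 (ext_deriv1 0) w + wedge12 0 (ext_deriv1 w) = 0"
    by (simp_all add: wedge21_def wedge12_def ext_deriv1_def vec_eq_iff)
  thus "E44_odd_bracket w 0 = 0" "E44_odd_bracket 0 w = 0"
    by (simp_all only: E44_odd_bracket_def *)
qed

lemma E44_action_axis:
  "E44_action (axis l p) w = (\<chi> i. p * mderiv l (w $ i) + mderiv i p * w $ l)
     - (mconst (1 / 2) * mderiv l p) *s w"
  by (simp add: E44_action_def lie_deriv1_axis divergence_axis)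

text \<open>
  On 1-forms with constant coefficients, \<open>x\<^sub>k \<partial>\<^sub>l\<close> maps \<open>w\<close> to \<open>w\<^sub>l dx\<^sub>k\<close>.  So a 1-form that is killed by
  these fields and by the translations is zero.
\<close>

lemma E44_vector_field_superalgebra:
  "vector_field_superalgebra (E44 :: ('a::field_char_0, _) superalgebra)
     E44_action (\<lambda>c w. mconst c *s w) UNIV {}"
proof (rule vector_field_superalgebra.intro)
  have E: "x \<in> even_part (E44 :: ('a, _) superalgebra) \<longleftrightarrow> snd x = 0"
    "x \<in> odd_part (E44 :: ('a, _) superalgebra) \<longleftrightarrow> fst x = 0" for x
    by (cases x; simp add: E44_def)+
  have scl: "scl E44 c (X, w) = (mconst c *s X, mconst c *s w)" for c :: 'a and X w
    by (simp add: E44_def)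
  fix X Y :: "('a, 4) vfield" and w v :: "('a, 4) form1" and x y :: "('a, 4) vfield \<times> ('a, 4) form1"
    and a c :: 'a and i j k l s
  note members = E zero_prod_def
  show "scl E44 c (X, w) = (mconst c *s X, mconst c *s w)" by (rule scl)
  show "brk E44 (X, 0) (Y, w) = (vf_bracket X Y, E44_action X w)"
    "brk E44 (X, w) (Y, 0) = (vf_bracket X Y, - E44_action Y w)"
    by (simp_all add: E44_def) (simp_all add: E44_action_def lie_deriv1_def vec_eq_iff)
  show "vector_space (\<lambda>(c::'a) (w :: ('a, 4) form1). mconst c *s w)"
    by unfold_locales (simp_all add: vec_eq_iff algebra_simps)
  show "E44_action X (w - mconst c *s v) = E44_action X w - mconst c *s E44_action X v"
    by (simp add: E44_action_def lie_deriv1_linear vec_eq_iff algebra_simps)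
  show "E44_action (X - mconst c *s Y) w = E44_action X w - mconst c *s E44_action Y w"
    by (simp add: E44_action_def lie_deriv1_linear divergence_diff divergence_scale vec_eq_iff algebra_simps)
  have t: "E44_action (axis i 1) w = lie_deriv1 (axis i 1) w" for w :: "('a, 4) form1" and i
    by (simp add: E44_action_def divergence_axis)
  have l: "lie_deriv1 (axis i 1) (p *s w) = mderiv i p *s w + p *s lie_deriv1 (axis i 1) w"
    for w :: "('a, 4) form1" and i p
    by (simp add: lie_deriv1_axis vec_eq_iff mderiv_mult)
  have m: "lie_deriv1 X (v - w) = lie_deriv1 X v - lie_deriv1 X w" for X and v w :: "('a, 4) form1"
    using lie_deriv1_linear(1)[of X v 1 w] by simp
  show "E44_action (axis i 1) (E44_action Y w) =
     E44_action (vf_bracket (axis i 1) Y) w + E44_action Y (E44_action (axis i 1) w)"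
    unfolding t unfolding E44_action_def m lie_deriv1_translation l divergence_translation
    by (simp add: mderiv_mult algebra_simps vec_eq_iff)
  show "\<exists>k\<in>UNIV. k \<noteq> i \<and> k \<noteq> j" for i j :: 4
    using two_points_not_all[of i j] by simp
  show "\<exists>c. X = axis i (mconst c)" if "\<And>j l. j \<in> UNIV \<Longrightarrow> mderiv j (X $ l) = 0"
    "\<And>j. j \<in> UNIV \<Longrightarrow> j \<noteq> i \<Longrightarrow> X $ j = 0"
    using that mconst_if_all_mderiv_zero[of "X $ i"] axis_if_supported[of i X] by blast
  show "w = 0" if z: "\<And>i. i \<in> UNIV \<Longrightarrow> E44_action (axis i 1) w = 0"
    "\<And>k l. k \<in> UNIV \<Longrightarrow> l \<in> UNIV \<Longrightarrow> k \<noteq> l \<Longrightarrow> E44_action (axis l (var k)) w = 0"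
  proof -
    have "w $ l = 0" for l
    proof -
      obtain k where k: "k \<noteq> l" using two_points_not_all[of l l] by auto
      have "mderiv l (w $ i) = 0" for i
        using arg_cong[OF z(1)[of l], of "\<lambda>w. w $ i"] by (simp add: E44_action_axis)
      thus ?thesis using arg_cong[OF z(2)[of k l], of "\<lambda>w. w $ k"] k by (simp add: E44_action_axis)
    qed
    thus ?thesis by (simp add: vec_eq_iff)
  qed
qed (auto simp: E44_def zero_prod_def)

section \<open>\<open>E(5,10)\<close>\<close>

lemma E510_odd_bracket_zero: "E510_odd_bracket 0 w = 0" "E510_odd_bracket w 0 = 0"
proof -
  have "(\<Sum>(i, j)\<in>A. \<Sum>(k, l)\<in>A. of_int (eps5 t i j k l) * ((0 :: ('a, 5) form2) $ i $ j * w $ k $ l)) = 0"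
    "(\<Sum>(i, j)\<in>A. \<Sum>(k, l)\<in>A. of_int (eps5 t i j k l) * (w $ i $ j * (0 :: ('a, 5) form2) $ k $ l)) = 0"
    for A and t and w :: "('a::comm_ring_1, 5) form2"
    by (auto intro!: sum.neutral)
  thus "E510_odd_bracket 0 w = 0" "E510_odd_bracket w 0 = 0"
    unfolding E510_odd_bracket_def by (simp_all only: vec_eq_iff vec_lambda_beta zero_index simp_thms)
qed

lemma E510_brk:
  "brk E510 (X, 0) (Y, w) = (vf_bracket X Y, lie_deriv2 X w)"
  "brk E510 (X, w) (Y, 0) = (vf_bracket X Y, - lie_deriv2 Y w)"
  by (simp_all add: E510_def E510_odd_bracket_zero) (simp_all add: lie_deriv2_def vec_eq_iff)

lemma E510_scl: "scl E510 c (X, w) = (mconst c *s X, (\<chi> i. mconst c *s (w $ i)))"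
  by (simp add: E510_def)

lemma form2_vector_space: "vector_space (\<lambda>(c::'a::field) (w :: ('a, 'n::finite) form2). (\<chi> i. mconst c *s (w $ i)))"
  by unfold_locales (simp_all add: vec_eq_iff algebra_simps)

lemma closed_form2_linear:
  assumes "closed_form2 w" "closed_form2 v"
  shows "closed_form2 (w - (\<chi> i. mconst c *s (v $ i)))"
  unfolding closed_form2_def
proof (intro conjI allI)
  fix i j k
  have s: "w $ i $ j = - w $ j $ i" "v $ i $ j = - v $ j $ i" for i j
    using assms unfolding closed_form2_def by blast+
  show "(w - (\<chi> i. mconst c *s (v $ i))) $ i $ j = - (w - (\<chi> i. mconst c *s (v $ i))) $ j $ i"
    using s[of i j] by simp
  have "mderiv i (w $ j $ k) + mderiv j (w $ k $ i) + mderiv k (w $ i $ j) = 0"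
    "mderiv i (v $ j $ k) + mderiv j (v $ k $ i) + mderiv k (v $ i $ j) = 0"
    using assms unfolding closed_form2_def by blast+
  hence "mderiv i (w $ j $ k) + mderiv j (w $ k $ i) + mderiv k (w $ i $ j)
    - mconst c * (mderiv i (v $ j $ k) + mderiv j (v $ k $ i) + mderiv k (v $ i $ j)) = 0"
    by simp
  thus "mderiv i ((w - (\<chi> i. mconst c *s (v $ i))) $ j $ k) + mderiv j ((w - (\<chi> i. mconst c *s (v $ i))) $ k $ i) +
    mderiv k ((w - (\<chi> i. mconst c *s (v $ i))) $ i $ j) = 0"
    by (simp add: mderiv_diff mderiv_mult algebra_simps)
qed

text \<open>
  On 2-forms whose coefficients do not depend on \<open>x\<^sub>l\<close>, the field \<open>x\<^sub>k \<partial>\<^sub>l\<close> substitutes \<open>dx\<^sub>k\<close> for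
  \<open>dx\<^sub>l\<close>; the coefficient of the image at \<open>(k, j)\<close> is the one of \<open>w\<close> at \<open>(l, j)\<close>.
\<close>

lemma form2_entry_zero:
  assumes "\<And>k. k \<in> I \<Longrightarrow> lie_deriv2 (axis k 1) w = 0"
    "\<And>k l. k \<in> I \<Longrightarrow> l \<in> I \<Longrightarrow> k \<noteq> l \<Longrightarrow> lie_deriv2 (axis l (var k)) w = 0"
    "k \<in> I" "k \<noteq> l" "k \<noteq> j" "l \<in> I"
  shows "w $ l $ j = 0"
proof -
  have "mderiv l (w $ i $ j) = 0" for i j
    using arg_cong[OF assms(1)[of l], of "\<lambda>w. w $ i $ j"] assms(6) by (simp add: lie_deriv2_axis)
  thus ?thesis using arg_cong[OF assms(2)[of k l], of "\<lambda>w. w $ k $ j"] assms(3-6)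
    by (simp add: lie_deriv2_axis)
qed

lemma mpoly_eq_neg_self:
  fixes f :: "('a::field_char_0, 'n) mpoly"
  assumes "f = - f" shows "f = 0"
proof -
  have "f = mconst (1 / 2) * (2 * f)" by simp
  also have "2 * f = 0" using assms by (metis mult_2 add.right_inverse)
  finally show ?thesis by simp
qed

lemma divergence_zero [simp]: "divergence 0 = 0"
  by (simp add: divergence_def)

lemma closed_form2_zero [simp]: "closed_form2 0"
  by (simp add: closed_form2_def)

lemma E510_parts:
  "x \<in> even_part E510 \<longleftrightarrow> snd x = 0 \<and> divergence (fst x) = 0"
  "x \<in> odd_part E510 \<longleftrightarrow> fst x = 0 \<and> closed_form2 (snd x)"
  by (cases x; auto simp: E510_def)+

lemma E510_vector_field_superalgebra:
  "vector_field_superalgebra (E510 :: ('a::field_char_0, _) superalgebra)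
     lie_deriv2 (\<lambda>c w. (\<chi> i. mconst c *s (w $ i))) UNIV {}"
proof (rule vector_field_superalgebra.intro)
  fix X Y :: "('a, 5) vfield" and w v :: "('a, 5) form2" and x y :: "('a, 5) vfield \<times> ('a, 5) form2"
    and a c :: 'a and i j k l s
  note members =  E510_parts zero_prod_def divergence_axis divergence_diff divergence_scale mderiv_mult
  show "x - scl E510 c y \<in> even_part E510" if "x \<in> even_part E510" "y \<in> even_part E510"
    using that by (cases x; cases y) (simp add: E510_scl members vec_eq_iff)
  show "x - scl E510 c y \<in> odd_part E510" if "x \<in> odd_part E510" "y \<in> odd_part E510"
    using that closed_form2_linear[of "snd x" "snd y" c] by (cases x; cases y) (simp add: E510_scl members vec_eq_iff)
  show "\<exists>k\<in>UNIV. k \<noteq> i \<and> k \<noteq> j" for i j :: 5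
    using two_points_not_all[of i j] by simp
  show "\<exists>c. X = axis i (mconst c)" if "\<And>j l. j \<in> UNIV \<Longrightarrow> mderiv j (X $ l) = 0"
    "\<And>j. j \<in> UNIV \<Longrightarrow> j \<noteq> i \<Longrightarrow> X $ j = 0"
    using that mconst_if_all_mderiv_zero[of "X $ i"] axis_if_supported[of i X] by blast
  show "w = 0" if w: "(0, w) \<in> odd_part E510" and z: "\<And>i. i \<in> UNIV \<Longrightarrow> lie_deriv2 (axis i 1) w = 0"
    "\<And>k l. k \<in> UNIV \<Longrightarrow> l \<in> UNIV \<Longrightarrow> k \<noteq> l \<Longrightarrow> lie_deriv2 (axis l (var k)) w = 0"
  proof -
    have "w $ l $ j = 0" for l j
    proof -
      obtain k where k: "k \<noteq> l" "k \<noteq> j" using two_points_not_all[of l j] by auto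
      thus ?thesis using form2_entry_zero[where I = UNIV and k = k and l = l and j = j, OF z] by simp
    qed
    thus ?thesis by (simp add: vec_eq_iff)
  qed
  show "(axis j (var j * var k) - axis k (mconst (1 / 2) * (var k * var k)), 0)
      \<in> even_part (E510 :: ('a, _) superalgebra)" if "j \<noteq> k" for j k
    using that by (simp add: members flip: mult_2)
  show "lie_deriv2 (axis i 1) (lie_deriv2 Y w) =
     lie_deriv2 (vf_bracket (axis i 1) Y) w + lie_deriv2 Y (lie_deriv2 (axis i 1) w)"
    by (rule lie_deriv2_translation)
  show "vector_space (\<lambda>(c::'a) (w :: ('a, 5) form2). (\<chi> i. mconst c *s (w $ i)))"
    by (rule form2_vector_space)
  show "lie_deriv2 X (w - (\<chi> i. mconst c *s (v $ i))) = lie_deriv2 X w - (\<chi> i. mconst c *s (lie_deriv2 X v $ i))"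
    "lie_deriv2 (X - mconst c *s Y) w = lie_deriv2 X w - (\<chi> i. mconst c *s (lie_deriv2 Y w $ i))"
    by (rule lie_deriv2_linear)+
  show "scl E510 c (X, w) = (mconst c *s X, (\<chi> i. mconst c *s (w $ i)))"
    by (rule E510_scl)
  show "brk E510 (X, 0) (Y, w) = (vf_bracket X Y, lie_deriv2 X w)"
    "brk E510 (X, w) (Y, 0) = (vf_bracket X Y, - lie_deriv2 Y w)"
    by (rule E510_brk)+
qed (simp_all add: E510_parts zero_prod_def divergence_axis divergence_diff divergence_scale mderiv_mult)

lemma exhaust_5: "i = 1 \<or> i = 2 \<or> i = 3 \<or> i = 4 \<or> i = (5 :: 5)"
proof -
  have "card {1, 2, 3, 4, 5 :: 5} = CARD(5)" by simp
  hence "{1, 2, 3, 4, 5 :: 5} = UNIV" by (intro card_subset_eq) simp_all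
  thus ?thesis by blast
qed

section \<open>\<open>E(3,6)\<close>\<close>

lemma mpoly_homogeneous_zero [simp]: "mpoly_homogeneous d 0"
  by (simp add: mpoly_homogeneous_def)

lemma mpoly_homogeneous_mconst [simp]: "mpoly_homogeneous 0 (mconst c)"
  by (simp add: mpoly_homogeneous_def mconst_def)

lemma mpoly_homogeneous_one [simp]: "mpoly_homogeneous 0 1"
  by (metis mpoly_homogeneous_mconst mconst_hom(2))

lemma mpoly_homogeneous_diff:
  fixes f g :: "('a::ab_group_add, 5) mpoly"
  shows "mpoly_homogeneous d f \<Longrightarrow> mpoly_homogeneous d g \<Longrightarrow> mpoly_homogeneous d (f - g)"
  using keys_diff[of f g] unfolding mpoly_homogeneous_def by blast

lemma mpoly_homogeneous_uminus [simp]: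
  fixes f :: "('a::ab_group_add, 5) mpoly"
  shows "mpoly_homogeneous d (- f) = mpoly_homogeneous d f"
  by (simp add: mpoly_homogeneous_def in_keys_iff)

lemma mpoly_homogeneous_mult:
  fixes f g :: "('a::comm_ring_1, 5) mpoly"
  assumes "mpoly_homogeneous d f" "mpoly_homogeneous e g"
  shows "mpoly_homogeneous (d + e) (f * g)"
  unfolding mpoly_homogeneous_def
proof
  fix m assume "m \<in> Poly_Mapping.keys (f * g)"
  then obtain a b where "m = a + b" "a \<in> Poly_Mapping.keys f" "b \<in> Poly_Mapping.keys g"
    using keys_mult[of f g] by blast
  thus "int (Poly_Mapping.lookup m 4 + Poly_Mapping.lookup m 5) = d + e"
    using assms unfolding mpoly_homogeneous_def by (auto simp: lookup_add)
qed

lemma mpoly_homogeneous_scale: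
  fixes f :: "('a::comm_ring_1, 5) mpoly"
  shows "mpoly_homogeneous d f \<Longrightarrow> mpoly_homogeneous d (mconst c * f)"
  using mpoly_homogeneous_mult[OF mpoly_homogeneous_mconst[of c]] by force

lemma mpoly_homogeneous_var: "mpoly_homogeneous (index_weight i) (var i)"
  by (auto simp: mpoly_homogeneous_def index_weight_def var_def lookup_single when_def)

lemma mpoly_homogeneous_negative: "mpoly_homogeneous d f \<Longrightarrow> d < 0 \<Longrightarrow> f = 0"
  unfolding mpoly_homogeneous_def by (metis keys_eq_empty ex_in_conv of_nat_0_le_iff not_le)

lemma E36_parts:
  "x \<in> even_part E36 \<longleftrightarrow> snd x = 0 \<and> divergence (fst x) = 0 \<and>
     (\<forall>i. mpoly_homogeneous (index_weight i) (fst x $ i))"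
  "x \<in> odd_part E36 \<longleftrightarrow> fst x = 0 \<and> closed_form2 (snd x) \<and>
     (\<forall>i j. mpoly_homogeneous (1 - index_weight i - index_weight j) (snd x $ i $ j))"
  by (cases x; auto simp: E36_def E510_degree_def E510_parts)+

lemma E36_axis_mem:
  assumes "mderiv l p = 0" "mpoly_homogeneous (index_weight l) p"
  shows "(axis l p, 0) \<in> even_part E36"
  using assms by (simp add: E36_parts divergence_axis) (simp add: axis_def)

lemma index_weight_eq_0_iff: "index_weight i = 0 \<longleftrightarrow> i \<in> {1, 2, 3}"
  using exhaust_5[of i] by (auto simp: index_weight_def)

text \<open>
  Multiplication by a variable shifts exponents, so no coefficient is lost.
\<close>

lemma var_mult_cancel:
  assumes "var i * f = 0"
  shows "f = 0"
proof (rule poly_mapping_eqI)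
  fix n
  let ?e = "Poly_Mapping.single i (1::nat)"
  have "Poly_Mapping.lookup (var i * f) (?e + n) = Poly_Mapping.lookup f n"
    by (subst mpoly_sum_of_monomials[of f])
      (simp add: var_def sum_distrib_left mult_single lookup_sum lookup_single when_def in_keys_iff)
  thus "Poly_Mapping.lookup f n = Poly_Mapping.lookup 0 n" using assms by simp
qed

text \<open>
  Commuting with \<open>sl\<^sub>2\<close> forces the part of \<open>X\<close> along the last two coordinates to be a multiple
  \<open>a (x\<^sub>4 \<partial>\<^sub>4 + x\<^sub>5 \<partial>\<^sub>5)\<close> of the Euler field.  The other components are constant along the first three
  coordinates, so the divergence of \<open>X\<close> is \<open>2 a\<close> and \<open>a\<close> vanishes.
\<close>

lemma E36_even_centralizer:
  fixes X :: "('a::field_char_0, 5) vfield"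
  assumes i: "i \<in> {1, 2, 3}" and X: "(X, 0) \<in> even_part E36"
    and d: "\<And>j l. j \<in> {1, 2, 3} \<Longrightarrow> mderiv j (X $ l) = 0"
    and z: "\<And>j. j \<in> {1, 2, 3} \<Longrightarrow> j \<noteq> i \<Longrightarrow> X $ j = 0"
    and s: "vf_bracket X (axis 5 (var 4)) = 0" "vf_bracket X (axis 4 (var 5)) = 0"
  shows "\<exists>c. X = axis i (mconst c)"
proof (intro exI axis_if_supported)
  have h: "mpoly_homogeneous (index_weight i) (X $ i)" "divergence X = 0" for i
    using X by (simp_all add: E36_parts)
  have "\<exists>c. X $ i = mconst c"
  proof (rule mconst_if_mderiv_zero)
    fix m assume m: "m \<noteq> 0" "m \<in> Poly_Mapping.keys (X $ i)"
    have "index_weight i = 0" using i unfolding index_weight_eq_0_iff .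
    hence "Poly_Mapping.lookup m 4 = 0" "Poly_Mapping.lookup m 5 = 0"
      using h(1)[of i] m(2) by (auto simp: mpoly_homogeneous_def)
    moreover obtain k where "Poly_Mapping.lookup m k \<noteq> 0" using m(1) by (metis poly_mapping_eqI lookup_zero)
    ultimately have "Poly_Mapping.lookup m k \<noteq> 0 \<and> k \<in> {1, 2, 3}" using exhaust_5[of k] by auto
    thus "\<exists>k. Poly_Mapping.lookup m k \<noteq> 0 \<and> mderiv k (X $ i) = 0" using d by blast
  qed
  then obtain c where c: "X $ i = mconst c" ..
  thus "X $ i = mconst (SOME c. X $ i = mconst c)" by (rule someI)
  have b: "axis 5 (X $ 4) $ j = var 4 * mderiv 5 (X $ j)" "axis 4 (X $ 5) $ j = var 5 * mderiv 4 (X $ j)" for j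
    using arg_cong[OF s(1), of "\<lambda>v. v $ j"] arg_cong[OF s(2), of "\<lambda>v. v $ j"]
    by (simp_all add: vf_bracket_axis_var)
  have "var 4 * mderiv 5 (X $ 4) = 0" "var 5 * mderiv 4 (X $ 5) = 0"
    using b(1)[of 4] b(2)[of 5] by (simp_all add: axis_def)
  hence off: "mderiv 5 (X $ 4) = 0" "mderiv 4 (X $ 5) = 0" by (blast intro: var_mult_cancel)+
  have X4: "X $ 4 = var 4 * mderiv 5 (X $ 5)" and X5: "X $ 5 = var 5 * mderiv 4 (X $ 4)"
    using b(1)[of 5] b(2)[of 4] by simp_all
  have "mderiv 4 (X $ 4) = mderiv 5 (X $ 5) + var 4 * mderiv 4 (mderiv 5 (X $ 5))"
    by (subst X4) (simp add: mderiv_mult)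
  also have "mderiv 4 (mderiv 5 (X $ 5)) = 0"
    using off by (simp add: mderiv_commute[of 4 5])
  finally have e: "mderiv 4 (X $ 4) = mderiv 5 (X $ 5)" by simp
  have "divergence X = (\<Sum>j\<in>{1, 2, 3, 4, 5}. mderiv j (X $ j))"
    unfolding divergence_def using exhaust_5 by (intro sum.cong) auto
  also have "\<dots> = mderiv 4 (X $ 4) + mderiv 5 (X $ 5)"
    using d by simp
  finally have "mderiv 5 (X $ 5) = - mderiv 5 (X $ 5)"
    using h(2) e by (simp add: eq_neg_iff_add_eq_0)
  hence "mderiv 5 (X $ 5) = 0" by (rule mpoly_eq_neg_self)
  hence "X $ 4 = 0" "X $ 5 = 0" using X4 X5 e by (metis mult_zero_right)+
  thus "X $ j = 0" if "j \<noteq> i" for j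
    using z[of j] exhaust_5[of j] that by auto
qed

text \<open>
  Substituting \<open>dx\<^sub>k\<close> for \<open>dx\<^sub>l\<close> kills every coefficient that involves one of the first three coordinates.
  The remaining coefficient, that of \<open>dx\<^sub>4 \<and> dx\<^sub>5\<close>, would have degree -1.
\<close>

lemma E36_odd_centralizer:
  fixes w :: "('a::field_char_0, 5) form2"
  assumes w: "(0, w) \<in> odd_part E36"
    and z: "\<And>i. i \<in> {1, 2, 3} \<Longrightarrow> lie_deriv2 (axis i 1) w = 0"
      "\<And>k l. k \<in> {1, 2, 3} \<Longrightarrow> l \<in> {1, 2, 3} \<Longrightarrow> k \<noteq> l \<Longrightarrow> lie_deriv2 (axis l (var k)) w = 0"
  shows "w = 0"
proof -
  have skew: "w $ i $ j = - w $ j $ i"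
    and deg: "mpoly_homogeneous (1 - index_weight i - index_weight j) (w $ i $ j)" for i j
    using w unfolding E36_parts closed_form2_def snd_conv by blast+
  have l: "w $ l $ j = 0" if "l \<in> {1, 2, 3}" for l j
  proof -
    have "\<exists>k\<in>{1, 2, 3}. k \<noteq> l \<and> k \<noteq> j" using that by auto
    then obtain k where "k \<in> {1, 2, 3}" "k \<noteq> l" "k \<noteq> j" by blast
    thus ?thesis by (intro form2_entry_zero[OF z]) (use that in blast)+
  qed
  have "w $ l $ j = 0" for l j
  proof (cases "l \<in> {1, 2, 3} \<or> j \<in> {1, 2, 3}")
    case True
    thus ?thesis using l skew[of l j] by (metis minus_zero)
  next
    case False
    hence "index_weight l = 1" "index_weight j = 1"
      using exhaust_5[of l] exhaust_5[of j] by (auto simp: index_weight_def)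
    thus ?thesis using deg[of l j] by (intro mpoly_homogeneous_negative) auto
  qed
  thus ?thesis by (simp add: vec_eq_iff)
qed

lemma E36_vector_field_superalgebra:
  "vector_field_superalgebra (E36 :: ('a::field_char_0, _) superalgebra)
     lie_deriv2 (\<lambda>c w. (\<chi> i. mconst c *s (w $ i))) {1, 2, 3} {axis 5 (var 4), axis 4 (var 5)}"
proof (rule vector_field_superalgebra.intro)
  have E36: "scl E36 = scl E510" "brk E36 = brk E510" by (simp_all add: E36_def)
  fix X Y :: "('a, 5) vfield" and w v :: "('a, 5) form2" and x y :: "('a, 5) vfield \<times> ('a, 5) form2"
    and a c :: 'a and i j k l s
  have iw: "i \<in> {1, 2, 3} \<Longrightarrow> index_weight i = 0" for i by (simp only: index_weight_eq_0_iff)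
  have hv: "i \<in> {1, 2, 3} \<Longrightarrow> mpoly_homogeneous 0 (var i :: ('a, 5) mpoly)" for i
    using mpoly_homogeneous_var[of i] iw by simp
  have hvv: "mpoly_homogeneous 0 (var i * var j :: ('a, 5) mpoly)" if "i \<in> {1, 2, 3}" "j \<in> {1, 2, 3}" for i j
    using mpoly_homogeneous_mult[OF hv[OF that(1)] hv[OF that(2)]] by simp
  show "scl E36 c (X, w) = (mconst c *s X, (\<chi> i. mconst c *s (w $ i)))"
    unfolding E36 by (rule E510_scl)
  show "brk E36 (X, 0) (Y, w) = (vf_bracket X Y, lie_deriv2 X w)"
    "brk E36 (X, w) (Y, 0) = (vf_bracket X Y, - lie_deriv2 Y w)"
    unfolding E36 by (rule E510_brk)+
  show "0 \<in> even_part E36" "0 \<in> odd_part E36" by (simp_all add: E36_parts)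
  show "x - scl E36 c y \<in> even_part E36" if "x \<in> even_part E36" "y \<in> even_part E36"
    using that unfolding E36
    by (cases x; cases y) (simp add: E510_scl E36_parts vec_eq_iff divergence_diff divergence_scale
        mpoly_homogeneous_diff mpoly_homogeneous_scale)
  show "x - scl E36 c y \<in> odd_part E36" if "x \<in> odd_part E36" "y \<in> odd_part E36"
    using that closed_form2_linear[of "snd x" "snd y" c] unfolding E36
    by (cases x; cases y) (simp add: E510_scl E36_parts vec_eq_iff mpoly_homogeneous_diff mpoly_homogeneous_scale)
  show "vector_space (\<lambda>(c::'a) (w :: ('a, 5) form2). (\<chi> i. mconst c *s (w $ i)))"
    by (rule form2_vector_space)
  show "lie_deriv2 X (w - (\<chi> i. mconst c *s (v $ i))) = lie_deriv2 X w - (\<chi> i. mconst c *s (lie_deriv2 X v $ i))"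
    "lie_deriv2 (X - mconst c *s Y) w = lie_deriv2 X w - (\<chi> i. mconst c *s (lie_deriv2 Y w $ i))"
    by (rule lie_deriv2_linear)+
  show "lie_deriv2 (axis i 1) (lie_deriv2 Y w) =
     lie_deriv2 (vf_bracket (axis i 1) Y) w + lie_deriv2 Y (lie_deriv2 (axis i 1) w)"
    by (rule lie_deriv2_translation)
  show "\<exists>k\<in>{1, 2, 3}. k \<noteq> i \<and> k \<noteq> j" for i j :: 5
    by auto
  show "(axis i 1, 0) \<in> even_part (E36 :: ('a, _) superalgebra)" if "i \<in> {1, 2, 3}" for i
    using iw[OF that] by (intro E36_axis_mem) simp_all
  show "(axis l (var i), 0) \<in> even_part (E36 :: ('a, _) superalgebra)"
    if "i \<in> {1, 2, 3}" "l \<in> {1, 2, 3}" "l \<noteq> i" for i l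
    using iw[OF that(2)] hv[OF that(1)] that(3) by (intro E36_axis_mem) simp_all
  show "(axis l (mconst a * (var i * var k)), 0) \<in> even_part (E36 :: ('a, _) superalgebra)"
    if "i \<in> {1, 2, 3}" "k \<in> {1, 2, 3}" "l \<in> {1, 2, 3}" "l \<noteq> i" "l \<noteq> k" for i k l and a :: 'a
    using iw[OF that(3)] hvv[OF that(1,2)] that(4,5)
    by (intro E36_axis_mem) (simp_all add: mderiv_mult mpoly_homogeneous_scale)
  show "(axis j (var j) - axis k (var k), 0) \<in> even_part (E36 :: ('a, _) superalgebra)"
    if "j \<in> {1, 2, 3}" "k \<in> {1, 2, 3}" "j \<noteq> k" for j k
    using hv[OF that(1)] hv[OF that(2)] iw[OF that(1)] iw[OF that(2)]
    by (simp add: E36_parts divergence_diff divergence_axis) (auto simp: axis_def intro!: mpoly_homogeneous_diff)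
  show "(axis j (var j * var k) - axis k (mconst (1 / 2) * (var k * var k)), 0)
      \<in> even_part (E36 :: ('a, _) superalgebra)"
    if "j \<in> {1, 2, 3}" "k \<in> {1, 2, 3}" "j \<noteq> k" for j k
  proof -
    have "mderiv j (var j * var k) - mderiv k (mconst (1 / 2) * (var k * var k)) = (0 :: ('a, 5) mpoly)"
      using that by (simp add: mderiv_mult flip: mult_2)
    thus ?thesis
      using hvv[OF that(1,2)] mpoly_homogeneous_scale[OF hvv[OF that(2,2)], of "1 / 2"] iw[OF that(1)] iw[OF that(2)]
      by (simp add: E36_parts divergence_diff divergence_axis) (auto simp: axis_def intro!: mpoly_homogeneous_diff)
  qed
  have h45: "mpoly_homogeneous 1 (var 4 :: ('a, 5) mpoly)" "mpoly_homogeneous 1 (var 5 :: ('a, 5) mpoly)"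
    "index_weight 4 = 1" "index_weight 5 = 1"
    using mpoly_homogeneous_var[of 4, where 'a = 'a] mpoly_homogeneous_var[of 5, where 'a = 'a] by (simp_all add: index_weight_def)
  show "(s, 0) \<in> even_part (E36 :: ('a, _) superalgebra)"
    if "s \<in> {axis 5 (var 4), axis 4 (var 5)}" for s
    using that h45 by (auto intro!: E36_axis_mem)
  show "(var i *s s, 0) \<in> even_part (E36 :: ('a, _) superalgebra)"
    if "s \<in> {axis 5 (var 4), axis 4 (var 5)}" "i \<in> {1, 2, 3}" for s i
  proof -
    have "mpoly_homogeneous 1 (var i * var 4 :: ('a, 5) mpoly)" "mpoly_homogeneous 1 (var i * var 5 :: ('a, 5) mpoly)"
      using mpoly_homogeneous_mult[OF hv[OF that(2)] h45(1)] mpoly_homogeneous_mult[OF hv[OF that(2)] h45(2)]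
      by simp_all
    thus ?thesis using that h45 by (auto simp: smult_axis mderiv_mult intro!: E36_axis_mem)
  qed
  show "vf_bracket (axis i 1) s = 0" if "s \<in> {axis 5 (var 4), axis 4 (var 5)}" "i \<in> {1, 2, 3}"
    for s :: "('a, 5) vfield" and i
    using that by (auto simp: vf_bracket_axis)
  show "\<exists>c. X = axis i (mconst c)"
    if "i \<in> {1, 2, 3}" "(X, 0) \<in> even_part E36" "\<And>j l. j \<in> {1, 2, 3} \<Longrightarrow> mderiv j (X $ l) = 0"
      "\<And>j. j \<in> {1, 2, 3} \<Longrightarrow> j \<noteq> i \<Longrightarrow> X $ j = 0"
      "\<And>s. s \<in> {axis 5 (var 4), axis 4 (var 5)} \<Longrightarrow> vf_bracket X s = 0" for i and X :: "('a, 5) vfield"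
    using that by (intro E36_even_centralizer) blast+
  show "w = 0" if "(0, w) \<in> odd_part E36" "\<And>i. i \<in> {1, 2, 3} \<Longrightarrow> lie_deriv2 (axis i 1) w = 0"
    "\<And>k l. k \<in> {1, 2, 3} \<Longrightarrow> l \<in> {1, 2, 3} \<Longrightarrow> k \<noteq> l \<Longrightarrow> lie_deriv2 (axis l (var k)) w = 0"
    using that by (rule E36_odd_centralizer)
qed (auto simp: E36_parts)

section \<open>The contact bracket on \<open>K(1,6)\<close>\<close>

text \<open>
  The sign that arises when \<open>\<xi>\<^sub>i\<close> is moved to its place among the factors indexed by \<open>K\<close>.
\<close>

abbreviation koszul :: "6 \<Rightarrow> 6 set \<Rightarrow> 'a::comm_ring_1" where
  "koszul i K \<equiv> (-1) ^ card {j \<in> K. j < i}"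

lemma K16_scale_vector_space: "vector_space (K16_scale :: 'a::field \<Rightarrow> _)"
  by unfold_locales (auto simp: K16_scale_def vec_eq_iff smult_add_left smult_add_right mult.commute)

lemma K16_mult_axis:
  "K16_mult (axis I p) g = (\<chi> K. if I \<subseteq> K then
     (-1) ^ card {(i, j). i \<in> I \<and> j \<in> K - I \<and> j < i} * (p * g $ (K - I)) else 0)"
proof -
  have "(\<Sum>J\<in>Pow K. (-1) ^ card {(i, j). i \<in> J \<and> j \<in> K - J \<and> j < i} * (axis I p $ J * g $ (K - J))) =
    (\<Sum>J\<in>Pow K. if J = I then (-1) ^ card {(i, j). i \<in> I \<and> j \<in> K - I \<and> j < i} * (p * g $ (K - I)) else 0)" for K
    by (intro sum.cong) (auto simp: axis_def)
  thus ?thesis by (simp add: K16_mult_def vec_eq_iff)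
qed

lemma K16_mult_xi:
  "K16_mult (xi i) g = (\<chi> K. if i \<in> K then koszul i K * g $ (K - {i}) else 0)"
proof -
  have "card {(i', j). i' \<in> {i} \<and> j \<in> K - {i} \<and> j < i'} = card {j \<in> K. j < i}" for K
    by (rule bij_betw_same_card[of snd]) (auto simp: bij_betw_def inj_on_def image_iff)
  thus ?thesis by (simp add: xi_def monomial16_def K16_mult_axis vec_eq_iff)
qed

lemma K16_mult_scalar: "K16_mult (axis {} p) g = p *s g"
  by (simp add: K16_mult_axis vec_eq_iff)

lemma K16_dxi_axis:
  "K16_dxi i (axis I p) = (if i \<in> I then axis (I - {i}) (koszul i I * p) else 0)"
proof -
  have "{j \<in> I - {i}. j < i} = {j \<in> I. j < i}" by auto
  thus ?thesis
    by (auto simp: K16_dxi_def vec_eq_iff axis_def insert_absorb)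
qed

lemma K16_dx_axis: "K16_dx (axis I p) = axis I (pderiv p)"
  by (auto simp: K16_dx_def vec_eq_iff axis_def)

text \<open>
  The operator \<open>\<Sum>\<^sub>i \<xi>\<^sub>i \<partial>\<^sub>i\<close> multiplies a monomial by its number of odd factors.
\<close>

lemma K16_two_minus_euler_nth:
  "K16_two_minus_euler f $ K = (2 - of_nat (card K)) * f $ K"
proof -
  have "(K16_mult (xi i) (K16_dxi i f)) $ K = (if i \<in> K then f $ K else 0)" for i
  proof -
    have "{j \<in> K - {i}. j < i} = {j \<in> K. j < i}" by auto
    hence "koszul i K * (koszul i (K - {i}) * f $ K) = f $ K"
      by (simp only: left_minus_one_mult_self)
    thus ?thesis by (simp add: K16_mult_xi K16_dxi_def insert_absorb)
  qed
  hence "(\<Sum>i\<in>UNIV. K16_mult (xi i) (K16_dxi i f)) $ K = (\<Sum>i\<in>UNIV. if i \<in> K then f $ K else 0)"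
    by (simp only: sum_component)
  also have "\<dots> = of_nat (card K) * f $ K"
    by (simp flip: sum.inter_restrict)
  finally show ?thesis
    by (simp add: K16_two_minus_euler_def K16_scale_def algebra_simps numeral_poly)
qed

lemma pderiv_sum: "pderiv (sum h A) = (\<Sum>a\<in>A. pderiv (h a))"
  by (induction A rule: infinite_finite_induct) (simp_all add: pderiv_add)

lemma smult_sum_right: "smult c (sum h A) = (\<Sum>a\<in>A. smult c (h a))"
  by (induction A rule: infinite_finite_induct) (simp_all add: smult_add_right)

lemma pderiv_minus_one_power [simp]: "pderiv ((-1) ^ n :: 'a::idom poly) = 0"
  by (cases "even n") (simp_all add: pderiv_minus)

lemma K16_dx_mult: "K16_dx (K16_mult f g) = K16_mult (K16_dx f) g + K16_mult f (K16_dx g)"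
  by (simp add: K16_dx_def K16_mult_def vec_eq_iff pderiv_sum pderiv_mult algebra_simps sum.distrib)

lemma K16_dx_linear:
  "K16_dx (f + g) = K16_dx f + K16_dx g" "K16_dx (f - g) = K16_dx f - K16_dx g"
  "K16_dx (K16_scale c f) = K16_scale c (K16_dx f)" "K16_dx 0 = 0"
  "K16_dx (\<Sum>i\<in>A. h i) = (\<Sum>i\<in>A. K16_dx (h i))"
  by (simp_all add: K16_dx_def K16_scale_def vec_eq_iff pderiv_add pderiv_diff pderiv_smult pderiv_sum)

lemma K16_mult_linear:
  "K16_mult (f + f') g = K16_mult f g + K16_mult f' g" "K16_mult f (g + g') = K16_mult f g + K16_mult f g'"
  "K16_mult (f - f') g = K16_mult f g - K16_mult f' g" "K16_mult f (g - g') = K16_mult f g - K16_mult f g'"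
  "K16_mult (K16_scale c f) g = K16_scale c (K16_mult f g)" "K16_mult f (K16_scale c g) = K16_scale c (K16_mult f g)"
  "K16_mult 0 g = 0" "K16_mult f 0 = 0"
  by (simp_all add: K16_mult_def K16_scale_def vec_eq_iff algebra_simps sum.distrib sum_subtractf smult_sum_right smult_add_right smult_diff_right)

lemma K16_dxi_linear:
  "K16_dxi i (f + g) = K16_dxi i f + K16_dxi i g" "K16_dxi i (f - g) = K16_dxi i f - K16_dxi i g"
  "K16_dxi i (K16_scale c f) = K16_scale c (K16_dxi i f)" "K16_dxi i 0 = 0"
  by (simp_all add: K16_dxi_def K16_scale_def vec_eq_iff algebra_simps)

lemma K16_two_minus_euler_linear:
  "K16_two_minus_euler (f + g) = K16_two_minus_euler f + K16_two_minus_euler g"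
  "K16_two_minus_euler (f - g) = K16_two_minus_euler f - K16_two_minus_euler g"
  "K16_two_minus_euler (K16_scale c f) = K16_scale c (K16_two_minus_euler f)" "K16_two_minus_euler 0 = 0"
  by (simp_all add: K16_two_minus_euler_nth K16_scale_def vec_eq_iff algebra_simps)

lemma K16_part_linear:
  "K16_part p (f + g) = K16_part p f + K16_part p g" "K16_part p (f - g) = K16_part p f - K16_part p g"
  "K16_part p (K16_scale c f) = K16_scale c (K16_part p f)" "K16_part p 0 = 0"
  by (simp_all add: K16_part_def K16_scale_def vec_eq_iff)

lemma K16_scale_linear:
  "K16_scale c (f + g) = K16_scale c f + K16_scale c g" "K16_scale c (f - g) = K16_scale c f - K16_scale c g"
  "K16_scale c 0 = 0" "K16_scale c (K16_scale d f) = K16_scale (c * d) f" "K16_scale 1 f = f"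
  "K16_scale 0 f = 0"
  by (simp_all add: K16_scale_def vec_eq_iff smult_add_right smult_diff_right mult.commute)

lemma K16_scale_sum: "K16_scale c (\<Sum>i\<in>A. h i) = (\<Sum>i\<in>A. K16_scale c (h i))"
  by (simp add: K16_scale_def vec_eq_iff smult_sum_right)

lemma K16_hom_bracket_linear:
  "K16_hom_bracket p q (f - K16_scale c f') g = K16_hom_bracket p q f g - K16_scale c (K16_hom_bracket p q f' g)"
  "K16_hom_bracket p q g (f - K16_scale c f') = K16_hom_bracket p q g f - K16_scale c (K16_hom_bracket p q g f')"
  unfolding K16_hom_bracket_def K16_two_minus_euler_linear K16_dx_linear K16_dxi_linear K16_mult_linear
    K16_scale_linear K16_scale_sum sum_subtractf mult.commute[of _ c] by (simp_all only: algebra_simps)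

lemma K16_bracket_linear:
  "K16_bracket (f - K16_scale c f') g = K16_bracket f g - K16_scale c (K16_bracket f' g)"
  "K16_bracket g (f - K16_scale c f') = K16_bracket g f - K16_scale c (K16_bracket g f')"
  unfolding K16_bracket_def K16_part_linear K16_hom_bracket_linear sum_subtractf K16_scale_linear K16_scale_sum by simp_all

lemma K16_dx_dxi: "K16_dx (K16_dxi i f) = K16_dxi i (K16_dx f)"
  by (simp add: K16_dx_def K16_dxi_def vec_eq_iff pderiv_mult)

lemma K16_dx_euler: "K16_dx (K16_two_minus_euler f) = K16_two_minus_euler (K16_dx f)"
  by (simp add: K16_dx_def vec_eq_iff K16_two_minus_euler_nth pderiv_mult pderiv_diff)

lemma K16_dx_part: "K16_dx (K16_part p f) = K16_part p (K16_dx f)"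
  by (simp add: K16_dx_def K16_part_def vec_eq_iff)

lemma K16_dx_hom_bracket:
  "K16_dx (K16_hom_bracket p q f g) = K16_hom_bracket p q (K16_dx f) g + K16_hom_bracket p q f (K16_dx g)"
  unfolding K16_hom_bracket_def K16_dx_linear K16_dx_mult K16_dx_dxi K16_dx_euler K16_scale_linear K16_scale_sum sum.distrib
  by (simp only: algebra_simps)

lemma K16_dx_bracket: "K16_dx (K16_bracket f g) = K16_bracket (K16_dx f) g + K16_bracket f (K16_dx g)"
  unfolding K16_bracket_def K16_dx_linear K16_dx_hom_bracket K16_dx_part[symmetric] sum.distrib by simp

lemma K16_hom_bracket_zero: "K16_hom_bracket p q 0 g = 0" "K16_hom_bracket p q f 0 = 0"
  by (simp_all add: K16_hom_bracket_def K16_two_minus_euler_linear K16_mult_linear K16_dx_linear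
      K16_dxi_linear K16_scale_linear)

text \<open>
  The formula for homogeneous elements depends on the parities modulo 2 only, while the bracket sums it over the
  representatives 0 and 1.
\<close>

lemma K16_bracket_eq_hom_bracket:
  assumes "K16_part p f = f" "K16_part q g = g"
  shows "K16_bracket f g = K16_hom_bracket p q f g"
proof -
  have par: "K16_part r f = (if even (r + p) then f else 0)" if "K16_part p f = f" for r p and f :: "'a K16"
  proof -
    have "f $ I = 0" if "odd (card I + p)" for I
      using arg_cong[OF \<open>K16_part p f = f\<close>, of "\<lambda>f. f $ I"] that by (simp add: K16_part_def)
    thus ?thesis by (auto simp: K16_part_def vec_eq_iff)
  qed
  have red: "K16_hom_bracket r s f g = K16_hom_bracket p q f g" if "even (r + p)" "even (s + q)" for r s
  proof -
    have "(-1) ^ (r * s) = ((-1) ^ (p * q) :: 'a)" "(-1) ^ r = ((-1) ^ p :: 'a)"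
      using that by (auto simp: minus_one_power_iff)
    thus ?thesis by (simp add: K16_hom_bracket_def)
  qed
  let ?r = "if even p then 0 else 1 :: nat" and ?s = "if even q then 0 else 1 :: nat"
  have "K16_bracket f g = K16_hom_bracket ?r ?s f g"
    by (simp add: K16_bracket_def par[OF assms(1)] par[OF assms(2)] K16_hom_bracket_zero)
  also have "\<dots> = K16_hom_bracket p q f g" by (rule red) auto
  finally show ?thesis .
qed

text \<open>
  Each pair from \<open>I \<times> J\<close> is an inversion in exactly one of the two orders.
\<close>

lemma inversions_complement:
  fixes I J :: "6 set"
  assumes "I \<inter> J = {}"
  shows "card {(i, j). i \<in> I \<and> j \<in> J \<and> j < i} + card {(j, i). j \<in> J \<and> i \<in> I \<and> i < j} = card I * card J"
proof -
  have "card {(j, i). j \<in> J \<and> i \<in> I \<and> i < j} = card {(i, j). i \<in> I \<and> j \<in> J \<and> i < j}"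
    by (rule bij_betw_same_card[of prod.swap]) (auto simp: bij_betw_def inj_on_def image_iff)
  moreover have "card {(i, j). i \<in> I \<and> j \<in> J \<and> j < i} + card {(i, j). i \<in> I \<and> j \<in> J \<and> i < j} =
      card ({(i, j). i \<in> I \<and> j \<in> J \<and> j < i} \<union> {(i, j). i \<in> I \<and> j \<in> J \<and> i < j})"
    by (rule card_Un_disjoint[symmetric]) auto
  moreover have "j < i \<or> i < j" if "i \<in> I" "j \<in> J" for i j
    using assms that by (metis disjoint_iff linorder_neqE)
  hence "{(i, j). i \<in> I \<and> j \<in> J \<and> j < i} \<union> {(i, j). i \<in> I \<and> j \<in> J \<and> i < j} = I \<times> J"
    by auto
  ultimately show ?thesis by (simp add: card_cartesian_product)
qed

lemma K16_part_zero:
  assumes "K16_part p f = f" "odd (card I + p)"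
  shows "f $ I = 0"
  using arg_cong[OF assms(1), of "\<lambda>f. f $ I"] assms(2) by (simp add: K16_part_def)

lemma K16_mult_supercommute:
  assumes "K16_part p f = f" "K16_part q g = g"
  shows "K16_mult f g = K16_scale ((-1) ^ (p * q)) (K16_mult g f)"
proof -
  have t: "(-1) ^ card {(i, j). i \<in> I \<and> j \<in> J \<and> j < i} * (f $ I * g $ J) =
    smult ((-1) ^ (p * q)) ((-1) ^ card {(j, i). j \<in> J \<and> i \<in> I \<and> i < j} * (g $ J * f $ I))"
    if d: "I \<inter> J = {}" for I J
  proof (cases "even (card I + p) \<and> even (card J + q)")
    case True
    define a where "a = card {(i, j). i \<in> I \<and> j \<in> J \<and> j < i}"
    define b where "b = card {(j, i). j \<in> J \<and> i \<in> I \<and> i < j}"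
    have "even (a + b) \<longleftrightarrow> even (p * q)"
      unfolding a_def b_def inversions_complement[OF d] using True by auto
    hence "even a \<and> (even b \<longleftrightarrow> even (p * q)) \<or> odd a \<and> (even b \<longleftrightarrow> odd (p * q))" by auto
    thus ?thesis
      unfolding a_def[symmetric] b_def[symmetric]
      by (elim disjE conjE; cases "even b") (simp_all add: minus_one_power_iff mult.commute)
  next
    case False
    hence "f $ I = 0 \<or> g $ J = 0" using K16_part_zero assms by blast
    thus ?thesis by auto
  qed
  have "(\<Sum>I\<in>Pow K. (-1) ^ card {(i, j). i \<in> I \<and> j \<in> K - I \<and> j < i} * (f $ I * g $ (K - I))) =
    (\<Sum>J\<in>Pow K. smult ((-1) ^ (p * q)) ((-1) ^ card {(j, i). j \<in> J \<and> i \<in> K - J \<and> i < j} * (g $ J * f $ (K - J))))"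
    (is "?L = sum ?H _") for K
  proof -
    have "?L = (\<Sum>I\<in>Pow K. ?H (K - I))"
    proof (intro sum.cong refl)
      fix I assume "I \<in> Pow K"
      hence e: "K - (K - I) = I" by auto
      show "(-1) ^ card {(i, j). i \<in> I \<and> j \<in> K - I \<and> j < i} * (f $ I * g $ (K - I)) = ?H (K - I)"
        unfolding e by (rule t) auto
    qed
    also have "\<dots> = sum ?H (Pow K)"
      by (rule sum.reindex_bij_witness[of _ "\<lambda>J. K - J" "\<lambda>I. K - I"]) auto
    finally show ?thesis .
  qed
  thus ?thesis
    by (simp add: K16_mult_def K16_scale_def vec_eq_iff smult_sum_right)
qed

lemma K16_part_dxi: "K16_part p f = f \<Longrightarrow> K16_part (Suc p) (K16_dxi i f) = K16_dxi i f"
  using K16_part_zero[of p f "insert i K" for K]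
  by (auto simp: vec_eq_iff K16_part_def[of "Suc p"] K16_dxi_def)

lemma K16_bracket_skew:
  assumes "K16_part p f = f" "K16_part q g = g"
  shows "K16_bracket f g = - K16_scale ((-1) ^ (p * q)) (K16_bracket g f)"
proof -
  have "K16_mult (K16_dxi i f) (K16_dxi i g) =
      K16_scale ((-1) ^ (Suc p * Suc q)) (K16_mult (K16_dxi i g) (K16_dxi i f))" for i
    using K16_part_dxi assms by (intro K16_mult_supercommute) blast+
  hence s: "(\<Sum>i\<in>UNIV. K16_mult (K16_dxi i f) (K16_dxi i g)) =
    K16_scale ((-1) ^ (Suc p * Suc q)) (\<Sum>i\<in>UNIV. K16_mult (K16_dxi i g) (K16_dxi i f))"
    by (simp only: K16_scale_sum)
  have "K16_bracket f g = K16_hom_bracket p q f g" "K16_bracket g f = K16_hom_bracket q p g f"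
    using K16_bracket_eq_hom_bracket assms by blast+
  moreover have "K16_scale (-1) h = - h" for h :: "'a K16"
    by (simp add: K16_scale_def vec_eq_iff)
  ultimately show ?thesis
    unfolding K16_hom_bracket_def s
    by (cases "even p"; cases "even q") (simp_all add: K16_scale_linear)
qed

lemma K16_mult_scalar_right: "K16_mult g (axis {} p) = p *s g"
proof -
  have "(\<Sum>I\<in>Pow K. (-1) ^ card {(i, j). i \<in> I \<and> j \<in> K - I \<and> j < i} * (g $ I * axis {} p $ (K - I))) =
    (\<Sum>I\<in>Pow K. if I = K then p * g $ K else 0)" for K
  proof (intro sum.cong)
    fix I assume I: "I \<in> Pow K"
    show "(-1) ^ card {(i, j). i \<in> I \<and> j \<in> K - I \<and> j < i} * (g $ I * axis {} p $ (K - I)) =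
        (if I = K then p * g $ K else 0)"
    proof (cases "I = K")
      case True
      have e: "{(i, j). i \<in> K \<and> j \<in> K - K \<and> j < i} = {}" by auto
      show ?thesis unfolding True e by (simp add: mult.commute)
    next
      case False
      hence "K - I \<noteq> {}" using I by auto
      thus ?thesis using False by (simp add: axis_def)
    qed
  qed simp
  thus ?thesis by (simp add: K16_mult_def vec_eq_iff)
qed

lemma Collect_eq_less [simp]: "{j. j = i \<and> j < (i :: 6)} = {}"
  by auto

lemma K16_part_axis: "K16_part p (axis I q) = (if even (card I + p) then axis I q else 0)"
  by (auto simp: K16_part_def vec_eq_iff axis_def)

lemma K16_two_minus_euler_axis: "K16_two_minus_euler (axis I p) = axis I ((2 - of_nat (card I)) * p)"
  by (auto simp: K16_two_minus_euler_nth vec_eq_iff axis_def)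

lemma xi_axis: "xi i = axis {i} 1"
  by (simp add: xi_def monomial16_def)

lemma K16_bracket_zero [simp]: "K16_bracket 0 g = 0" "K16_bracket f 0 = 0"
  using K16_bracket_linear(1)[of g 1 g g] K16_bracket_linear(2)[of f f 1 f] by (simp_all add: K16_scale_linear)

lemma K16_scale_minus_one: "K16_scale (- c) f = - K16_scale c f"
  by (simp add: K16_scale_def vec_eq_iff)

lemma K16_bracket_scale:
  "K16_bracket (K16_scale c f) g = K16_scale c (K16_bracket f g)"
  "K16_bracket f (K16_scale c g) = K16_scale c (K16_bracket f g)"
  using K16_bracket_linear(1)[of 0 "- c" f g] K16_bracket_linear(2)[of f 0 "- c" g]
  by (simp_all add: K16_scale_minus_one)

lemma K16_bracket_minus: "K16_bracket (- f) g = - K16_bracket f g" "K16_bracket f (- g) = - K16_bracket f g"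
  using K16_bracket_scale(1)[of "-1" f g] K16_bracket_scale(2)[of f "-1" g]
  by (simp_all add: K16_scale_minus_one K16_scale_linear)

lemma K16_bracket_add:
  "K16_bracket (f + f') g = K16_bracket f g + K16_bracket f' g"
  "K16_bracket g (f + f') = K16_bracket g f + K16_bracket g f'"
  using K16_bracket_linear(1)[of f "-1" f' g] K16_bracket_linear(2)[of g f "-1" f']
  by (simp_all add: K16_scale_minus_one K16_scale_linear)

lemma K16_part_sum: "K16_part 0 f + K16_part 1 f = f"
  by (simp add: K16_part_def vec_eq_iff)

lemma K16_bracket_one: "K16_bracket (axis {} [:c:]) f = K16_scale (2 * c) (K16_dx f)"
proof -
  have "K16_hom_bracket 0 q (axis {} [:c:]) g = K16_scale (2 * c) (K16_dx g)" for q g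
    by (simp add: K16_hom_bracket_def K16_two_minus_euler_axis K16_mult_scalar K16_dx_axis K16_dxi_axis
        K16_mult_linear K16_scale_def vec_eq_iff numeral_poly mult.commute)
  hence "K16_bracket (axis {} [:c:]) f = K16_scale (2 * c) (K16_dx (K16_part 0 f + K16_part 1 f))"
    by (simp add: K16_bracket_def K16_part_axis K16_hom_bracket_zero K16_dx_linear K16_scale_linear)
  thus ?thesis by (simp only: K16_part_sum)
qed

lemma K16_bracket_xi:
  assumes "K16_part p f = f"
  shows "K16_bracket f (xi i) = K16_scale ((-1) ^ p) (K16_dxi i f - K16_mult (xi i) (K16_dx f))"
proof -
  have "K16_bracket f (xi i) = K16_hom_bracket p 1 f (xi i)"
    by (rule K16_bracket_eq_hom_bracket[OF assms]) (simp add: K16_part_axis xi_axis)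
  moreover have "(\<Sum>k\<in>UNIV. K16_mult (K16_dxi k f) (K16_dxi k (xi i))) = (\<Sum>k\<in>UNIV. if k = i then K16_dxi i f else 0)"
    by (intro sum.cong) (auto simp: xi_axis K16_dxi_axis K16_mult_scalar_right K16_mult_linear vec_eq_iff)
  ultimately show ?thesis
    by (simp add: K16_hom_bracket_def K16_dx_axis K16_two_minus_euler_axis xi_axis K16_mult_linear K16_scale_linear)
qed

text \<open>
  Commuting with \<open>\<xi>\<^sub>i\<close> means \<open>\<partial>\<^sub>i f = \<xi>\<^sub>i \<partial>\<^sub>x f\<close>.  The left side has only monomials without \<open>\<xi>\<^sub>i\<close>, the
  right side only monomials with \<open>\<xi>\<^sub>i\<close>, so both vanish: \<open>f\<close> contains no \<open>\<xi>\<^sub>i\<close>, and then no \<open>x\<close> either.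
\<close>

lemma xi_centralizer:
  fixes f :: "'a::field_char_0 K16"
  assumes "K16_part p f = f" "\<And>i. K16_bracket f (xi i) = 0"
  shows "\<exists>c. f = axis {} [:c:]"
proof -
  have e: "K16_dxi i f = K16_mult (xi i) (K16_dx f)" for i
  proof -
    have "K16_scale ((-1) ^ p) (K16_scale ((-1) ^ p) (K16_dxi i f - K16_mult (xi i) (K16_dx f))) = 0"
      using assms(2)[of i] unfolding K16_bracket_xi[OF assms(1)] by (simp add: K16_scale_linear)
    thus ?thesis by (simp add: K16_scale_linear flip: power_add)
  qed
  have z: "f $ L = 0" if L: "L \<noteq> {}" for L
  proof -
    obtain i where i: "i \<in> L" using L by blast
    have "K16_dxi i f $ (L - {i}) = 0" unfolding e by (simp add: K16_mult_xi)
    thus ?thesis using i by (simp add: K16_dxi_def insert_absorb)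
  qed
  have "K16_mult (xi 1) (K16_dx f) $ {1} = 0" unfolding e[symmetric] by (simp add: K16_dxi_def)
  hence "pderiv (f $ {}) = 0" by (simp add: K16_mult_xi K16_dx_def)
  hence "degree (f $ {}) = 0" by (simp only: pderiv_eq_0_iff)
  then obtain c where "f $ {} = [:c:]" by (rule degree_eq_zeroE)
  thus ?thesis using z by (intro exI[of _ c]) (auto simp: vec_eq_iff axis_def)
qed

definition xi2 :: "6 \<Rightarrow> 6 \<Rightarrow> 'a::field K16" where
  "xi2 i j = K16_mult (xi i) (xi j)"

definition x_xi :: "6 \<Rightarrow> 'a::field K16" where
  "x_xi i = axis {i} [:0, 1:]"

abbreviation x_pow :: "nat \<Rightarrow> 'a::field K16" where
  "x_pow n \<equiv> axis {} (monom 1 n)"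

lemma K16_mult_xi_axis:
  "K16_mult (xi i) (axis J q) = (if i \<in> J then 0 else axis (insert i J) (koszul i J * q))"
proof -
  have k: "{j \<in> insert i J. j < i} = {j \<in> J. j < i}" by auto
  have "K16_mult (xi i) (axis J q) $ K = (if i \<in> J then 0 else axis (insert i J) (koszul i J * q)) $ K" for K
  proof (cases "i \<notin> J \<and> K = insert i J")
    case True
    thus ?thesis unfolding K16_mult_xi using k by simp
  next
    case False
    hence "i \<in> K \<Longrightarrow> K - {i} \<noteq> J" by auto
    thus ?thesis using False by (auto simp: K16_mult_xi axis_def)
  qed
  thus ?thesis by (simp add: vec_eq_iff)
qed

lemma xi2_axis:
  assumes "i \<noteq> j"
  shows "xi2 i j = axis {i, j} (if j < i then -1 else 1)"
proof -
  have "{k \<in> {j}. k < i} = (if j < i then {j} else {})" by auto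
  thus ?thesis using assms by (simp add: xi2_def xi_axis[of j] K16_mult_xi_axis)
qed

lemma xi2_dxi:
  assumes "i \<noteq> j"
  shows "K16_dxi l (xi2 i j :: 'a::field K16) = (if l = i then xi j else if l = j then - xi i else 0)"
proof -
  have "{k \<in> {i, j}. k < i} = (if j < i then {j} else {})"
    "{k \<in> {i, j}. k < j} = (if j < i then {} else {i})" using assms by auto
  moreover have "{i, j} - {i} = {j}" "{i, j} - {j} = {i}" using assms by auto
  moreover have "axis {i} (-1) = - axis {i} (1 :: 'a poly)" by (simp add: vec_eq_iff axis_def)
  ultimately show ?thesis
    using assms by (simp add: xi2_axis K16_dxi_axis xi_axis del: Collect_eq_less)
qed

lemma K16_dx_xi2: "i \<noteq> j \<Longrightarrow> K16_dx (xi2 i j) = 0"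
  by (simp add: xi2_axis K16_dx_axis pderiv_minus)

lemma K16_part_xi [simp]: "K16_part 1 (xi i) = xi i" "K16_part (Suc 0) (xi i) = xi i"
  by (simp_all add: xi_axis K16_part_axis)
lemma K16_part_x_xi [simp]: "K16_part 1 (x_xi i) = x_xi i" "K16_part (Suc 0) (x_xi i) = x_xi i"
  by (simp_all add: x_xi_def K16_part_axis)
lemma K16_part_xi2 [simp]: "i \<noteq> j \<Longrightarrow> K16_part 0 (xi2 i j) = xi2 i j"
  by (simp add: xi2_axis K16_part_axis)

lemma bracket_xi_xi: "K16_bracket (xi i) (xi i) = K16_scale (-1) (x_pow 0)"
proof -
  have "K16_bracket (xi i) (xi i) = K16_scale ((-1) ^ 1) (K16_dxi i (xi i) - K16_mult (xi i) (K16_dx (xi i)))"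
    by (rule K16_bracket_xi) simp
  thus ?thesis by (simp add: xi_axis K16_dxi_axis K16_dx_axis K16_mult_linear monom_0 one_pCons)
qed

lemma bracket_xi2_xi: "i \<noteq> j \<Longrightarrow> K16_bracket (xi2 i j) (xi i) = xi j"
proof -
  assume ij: "i \<noteq> j"
  have "K16_bracket (xi2 i j) (xi i) = K16_scale ((-1) ^ 0) (K16_dxi i (xi2 i j) - K16_mult (xi i) (K16_dx (xi2 i j)))"
    by (rule K16_bracket_xi) (simp add: ij)
  thus ?thesis using ij by (simp add: xi2_dxi K16_dx_xi2 K16_mult_linear K16_scale_linear)
qed

lemma bracket_x_xi_xi:
  "i \<noteq> k \<Longrightarrow> K16_bracket (x_xi k) (xi i) = (xi2 i k :: 'a::field K16)"
  "K16_bracket (x_xi k) (xi k) = K16_scale (-1) (x_pow 1 :: 'a K16)"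
proof -
  have e: "K16_bracket (x_xi k) (xi i) = K16_scale (-1) (K16_dxi i (x_xi k) - xi2 i k :: 'a K16)" for i
    using K16_bracket_xi[of 1 "x_xi k" i] by (simp add: xi2_def x_xi_def K16_dx_axis xi_axis pderiv_pCons K16_part_axis one_pCons)
  show "i \<noteq> k \<Longrightarrow> K16_bracket (x_xi k) (xi i) = (xi2 i k :: 'a K16)"
    unfolding e by (simp add: x_xi_def K16_dxi_axis K16_scale_def vec_eq_iff)
  have "xi2 k k = (0 :: 'a K16)" by (simp add: xi2_def K16_mult_xi vec_eq_iff) (auto simp: xi_axis axis_def)
  thus "K16_bracket (x_xi k) (xi k) = K16_scale (-1) (x_pow 1 :: 'a K16)"
    unfolding e by (simp add: x_xi_def K16_dxi_axis monom_altdef)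
qed

lemma bracket_xi2_xi2:
  assumes "i \<noteq> j" "i \<noteq> k" "j \<noteq> k"
  shows "K16_bracket (xi2 i j) (xi2 i k) = (xi2 j k :: 'a::field K16)"
proof -
  have "K16_bracket (xi2 i j :: 'a K16) (xi2 i k) = K16_hom_bracket 0 0 (xi2 i j) (xi2 i k)"
    by (rule K16_bracket_eq_hom_bracket) (use assms in simp_all)
  moreover have "(\<Sum>l\<in>UNIV. K16_mult (K16_dxi l (xi2 i j :: 'a K16)) (K16_dxi l (xi2 i k))) = (\<Sum>l\<in>UNIV. if l = i then xi2 j k else 0)"
    by (intro sum.cong) (use assms in \<open>auto simp: xi2_dxi K16_mult_linear xi2_def[of j k]\<close>)
  ultimately show ?thesis
    using assms by (simp add: K16_hom_bracket_def K16_dx_xi2 K16_mult_linear K16_scale_linear)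
qed

lemma bracket_x_x_xi: "K16_bracket (x_pow 1) (x_xi k) = (x_xi k :: 'a::field K16)"
proof -
  have "K16_bracket (x_pow 1) (x_xi k :: 'a K16) = K16_hom_bracket 0 1 (x_pow 1) (x_xi k)"
    by (rule K16_bracket_eq_hom_bracket) (simp_all add: K16_part_axis)
  thus ?thesis
    by (simp add: K16_hom_bracket_def K16_mult_scalar K16_mult_scalar_right K16_two_minus_euler_axis K16_dx_axis
        K16_dxi_axis K16_mult_linear K16_scale_linear x_xi_def vec_eq_iff)
      (simp add: axis_def monom_altdef pderiv_pCons numeral_poly K16_scale_def)
qed

lemma bracket_x_xi_x_xi: "K16_bracket (x_xi k) (x_xi k :: 'a::field K16) = K16_scale (-1) (x_pow 2)"
proof -
  have "K16_bracket (x_xi k) (x_xi k :: 'a K16) = K16_hom_bracket 1 1 (x_xi k) (x_xi k)"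
    by (rule K16_bracket_eq_hom_bracket) simp_all
  moreover have "K16_mult (axis {k} p) (axis {k} q) = 0" for p q :: "'a poly"
    by (simp add: K16_mult_axis vec_eq_iff) (auto simp: axis_def)
  moreover have "(\<Sum>l\<in>UNIV. K16_mult (K16_dxi l (x_xi k)) (K16_dxi l (x_xi k :: 'a K16))) = (\<Sum>l\<in>UNIV. if l = k then x_pow 2 else 0)"
    by (intro sum.cong) (simp_all add: x_xi_def K16_dxi_axis K16_mult_linear K16_mult_scalar smult_axis
        numeral_2_eq_2 monom_Suc monom_0)
  ultimately show ?thesis
    by (simp add: K16_hom_bracket_def x_xi_def K16_two_minus_euler_axis K16_dx_axis K16_scale_linear)
qed

section \<open>\<open>E(1,6)\<close>\<close>

lemma E16_part: "part (E16 M) p = {f \<in> E16_whole M. K16_part p f = f}"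
  by (auto simp: part_def E16_def K16_part_def)

interpretation K16: vector_space "K16_scale :: 'a::field \<Rightarrow> _"
  by (rule K16_scale_vector_space)

lemma E16_whole_subspace: "K16.subspace (E16_whole M)"
  unfolding E16_whole_def by (rule K16.subspace_Inter) blast

lemma E16_whole_bracket: "f \<in> E16_whole M \<Longrightarrow> g \<in> E16_whole M \<Longrightarrow> K16_bracket f g \<in> E16_whole M"
  unfolding E16_whole_def by blast

lemma E16_generators_subset: "E16_generators M \<subseteq> E16_whole M"
  unfolding E16_whole_def by blast

lemma E16_part_linear:
  assumes "f \<in> part (E16 M) p" "g \<in> part (E16 M) p"
  shows "f - K16_scale c g \<in> part (E16 M) p"
  using K16.subspace_diff[OF E16_whole_subspace[of M], of f "K16_scale c g"]
    K16.subspace_scale[OF E16_whole_subspace[of M], of g c] assms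
  by (simp add: E16_part K16_part_linear)

text \<open>
  The square of \<open>x\<close> is not among the generators, but up to sign it is the bracket of \<open>x \<xi>\<^sub>i\<close> with itself.
\<close>

lemma E16_mem:
  fixes M :: "'a::field K16 set"
  shows
  "axis {} [:c:] \<in> part (E16 M) 0"
  "xi i \<in> part (E16 M) 1"
  "i \<noteq> j \<Longrightarrow> xi2 i j \<in> part (E16 M) 0"
  "x_xi i \<in> part (E16 M) 1"
  "x_pow 1 \<in> part (E16 M) 0"
  "x_pow 2 \<in> part (E16 M) 0"
proof -
  have gen: "f \<in> E16_whole M" if "f \<in> K16_degree (-2) \<union> K16_degree (-1) \<union> K16_degree 0" for f
    using that E16_generators_subset unfolding E16_generators_def by blast
  have "axis {} [:c:] \<in> K16_degree (-2)" by (auto simp: K16_degree_def axis_def coeff_pCons split: nat.splits if_splits)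
  thus "axis {} [:c:] \<in> part (E16 M) 0" using gen by (simp add: E16_part K16_part_axis)
  have "(xi i :: 'a K16) \<in> K16_degree (-1)" by (auto simp: K16_degree_def xi_axis axis_def split: if_splits)
  thus "xi i \<in> part (E16 M) 1" using gen by (simp add: E16_part)
  have "(xi2 i j :: 'a K16) \<in> K16_degree 0" if "i \<noteq> j"
    using that by (auto simp: K16_degree_def xi2_axis axis_def split: if_splits)
  thus "xi2 i j \<in> part (E16 M) 0" if "i \<noteq> j" using gen that by (simp add: E16_part)
  have "(x_pow 1 :: 'a K16) \<in> K16_degree 0" by (auto simp: K16_degree_def axis_def split: if_splits)
  thus "x_pow 1 \<in> part (E16 M) 0" using gen by (simp add: E16_part K16_part_axis)
  have x: "x_xi i \<in> E16_whole M" for i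
  proof -
    have "x_xi i = K16_mult (monomial16 [:0, 1:] {}) (xi i)"
      by (simp add: monomial16_def K16_mult_scalar smult_axis x_xi_def xi_axis)
    hence "x_xi i \<in> E16_generators M" unfolding E16_generators_def
      by (intro UnI1[OF UnI2] CollectI exI[of _ i] conjI TrueI)
    thus ?thesis using E16_generators_subset by (rule subsetD[rotated])
  qed
  thus "x_xi i \<in> part (E16 M) 1" by (simp add: E16_part)
  have "K16_scale (-1) (K16_bracket (x_xi 1) (x_xi 1)) \<in> E16_whole M"
    using x by (intro K16.subspace_scale[OF E16_whole_subspace] E16_whole_bracket)
  thus "x_pow 2 \<in> part (E16 M) 0"
    by (simp add: bracket_x_xi_x_xi K16_scale_linear E16_part K16_part_axis)
qed

text \<open>
  The translation is the constant 1.  Elements commuting with all \<open>\<xi>\<^sub>i\<close> are constants, so the relation for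
  \<open>\<tau>\<close> with the partner \<open>x \<xi>\<^sub>k\<close>, whose derivative is \<open>\<xi>\<^sub>k\<close>, determines \<open>\<tau>\<close> up to constants as soon as
  \<open>\<tau> (x \<xi>\<^sub>k) = 0\<close>.  Constants are even, so this settles the odd part.  On the even part the partner
  \<open>x\<^sup>2\<close> removes the constant: \<open>\<sigma> x\<^sup>2\<close> is known from multiplicativity, and 1 does not commute with \<open>x\<close>.
\<close>

theorem E16_hom_lie_structure_trivial:
  fixes M :: "'a::field_char_0 K16 set"
  assumes hom: "hom_lie_structure (E16 M) \<sigma>" and nz: "nonzero_map (E16 M) \<sigma>"
  shows "trivial_structure (E16 M) \<sigma>"
proof -
  have ops: "scl (E16 M) = K16_scale" "brk (E16 M) = K16_bracket" by (simp_all add: E16_def)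
  have zero: "0 \<in> even_part (E16 M)" "0 \<in> odd_part (E16 M)"
    using K16.subspace_0[OF E16_whole_subspace] by (simp_all add: E16_def K16_part_linear)
  note pw = part_subset_whole[OF zero]
  have add: "\<sigma> (x + y) = \<sigma> x + \<sigma> y" if "x \<in> whole (E16 M)" "y \<in> whole (E16 M)" for x y
    using hom that unfolding hom_lie_structure_def by blast
  have sc: "\<sigma> (K16_scale a x) = K16_scale a (\<sigma> x)" if "x \<in> part (E16 M) p" for a x p
    using hom pw[OF that] unfolding hom_lie_structure_def ops by blast
  have par: "\<sigma> x \<in> part (E16 M) p" if "x \<in> part (E16 M) p" for x p
    using hom that unfolding hom_lie_structure_def by blast
  have mult: "\<sigma> (K16_bracket x y) = K16_bracket (\<sigma> x) (\<sigma> y)"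
    if "x \<in> part (E16 M) p" "y \<in> part (E16 M) q" for x y p q
    using hom that unfolding hom_lie_structure_def ops by blast
  have J: "K16_scale ((-1) ^ (p * r)) (K16_bracket (\<sigma> x) (K16_bracket y z)) +
      K16_scale ((-1) ^ (q * p)) (K16_bracket (\<sigma> y) (K16_bracket z x)) +
      K16_scale ((-1) ^ (r * q)) (K16_bracket (\<sigma> z) (K16_bracket x y)) = 0"
    if "x \<in> part (E16 M) p" "y \<in> part (E16 M) q" "z \<in> part (E16 M) r" for x y z p q r
    using hom that unfolding hom_lie_structure_def ops by blast
  have pp: "K16_part p x = x" if "x \<in> part (E16 M) p" for x p
    using that by (simp add: E16_part)
  let ?one = "axis {} [:1:] :: 'a K16"
  have one_right: "K16_bracket f (axis {} [:d:]) = K16_scale (-2 * d) (K16_dx f)" if "f \<in> part (E16 M) p" for f p d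
    using K16_bracket_skew[OF pp[OF that] pp[OF E16_mem(1)[of d M]]]
    by (simp add: K16_bracket_one K16_scale_linear K16_scale_minus_one)
  have x_pow_0: "x_pow 0 = ?one" by (simp add: monom_0)
  have dx: "K16_dx (xi i) = 0" "K16_dx (x_xi i) = xi i" for i
    by (simp_all add: xi_axis x_xi_def K16_dx_axis pderiv_pCons one_pCons)
  have scale_cancel: "f = 0" if "K16_scale a f = 0" "a \<noteq> 0" for a :: 'a and f
    using K16.scale_eq_0_iff that by blast
  \<comment> \<open>The triple \<open>1\<close>, \<open>\<xi>\<^sub>i \<xi>\<^sub>j\<close>, \<open>\<xi>\<^sub>i\<close>, in which 1 commutes with the other two.\<close>
  have "K16_bracket (\<sigma> ?one) (xi j) = 0" for j
  proof -
    obtain i :: 6 where ij: "i \<noteq> j" by (metis one_neq_zero)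
    from J[OF E16_mem(1)[of 1] E16_mem(3)[OF ij] E16_mem(2)[of i]] show ?thesis
      using one_right[OF E16_mem(2)[of i M], of 1]
      by (simp add: bracket_xi2_xi[OF ij] K16_dx_xi2[OF ij] K16_bracket_one dx K16_scale_linear)
  qed
  then obtain c where c: "\<sigma> ?one = axis {} [:c:]"
    using xi_centralizer[OF pp[OF par[OF E16_mem(1)]]] by blast
  define \<tau> where "\<tau> f = \<sigma> f - K16_scale c f" for f
  have tau_part: "\<tau> f \<in> part (E16 M) p" if "f \<in> part (E16 M) p" for f p
    unfolding \<tau>_def by (rule E16_part_linear[OF par[OF that] that])
  \<comment> \<open>The twisted Jacobi identity for \<open>1\<close>, \<open>y\<close> and \<open>z\<close>.\<close>
  have rel: "K16_bracket (\<tau> y) (K16_dx z) = K16_scale ((-1) ^ (r * q)) (K16_bracket (\<tau> z) (K16_dx y))"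
    if y: "y \<in> part (E16 M) q" and z: "z \<in> part (E16 M) r" for y z q r
  proof -
    let ?e = "(-1) ^ (r * q) :: 'a"
    have "K16_part q (K16_dx y) = K16_dx y" using pp[OF y] by (metis K16_dx_part)
    hence skew: "K16_bracket (K16_dx y) z = - K16_scale ?e (K16_bracket z (K16_dx y))"
      using K16_bracket_skew[OF _ pp[OF z]] by (metis mult.commute)
    have "K16_scale (2 * c) (K16_bracket (K16_dx y) z + K16_bracket y (K16_dx z))
      - K16_scale 2 (K16_bracket (\<sigma> y) (K16_dx z)) + K16_scale 2 (K16_scale ?e (K16_bracket (\<sigma> z) (K16_dx y))) = 0"
      using J[OF E16_mem(1)[of 1] y z] one_right[OF z, of 1]
      by (simp add: c K16_bracket_one K16_dx_bracket K16_bracket_scale K16_bracket_minus K16_scale_linear K16_scale_minus_one mult.commute)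
    hence "K16_scale 2 (K16_scale ?e (K16_bracket (\<tau> z) (K16_dx y)) - K16_bracket (\<tau> y) (K16_dx z)) = 0"
      unfolding skew \<tau>_def K16_bracket_linear
      by (simp add: K16_scale_linear K16_scale_minus_one mult.commute mult.left_commute algebra_simps)
    from scale_cancel[OF this] show ?thesis by simp
  qed
  have odd_zero: "f = 0" if f: "f \<in> part (E16 M) 1" "\<And>k. K16_bracket f (xi k) = 0" for f
  proof -
    obtain d where "f = axis {} [:d:]" using xi_centralizer[OF pp[OF f(1)] f(2)] by blast
    thus ?thesis using pp[OF f(1)] by (simp add: K16_part_axis)
  qed
  have even_const: "\<exists>d. f = axis {} [:d:]" if "f \<in> part (E16 M) 0" "\<And>k. K16_bracket f (xi k) = 0" for f
    using xi_centralizer[OF pp[OF that(1)] that(2)] by blast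
  have tau_xi_free: "K16_bracket (\<tau> f) (xi k) = 0" if "f \<in> part (E16 M) p" "K16_dx f = 0" for f p k
    using rel[OF that(1) E16_mem(4)[of k]] that(2) by (simp add: dx K16_scale_linear)
  have tau_xi: "\<tau> (xi i) = 0" for i
    by (rule odd_zero[OF tau_part[OF E16_mem(2)] tau_xi_free[OF E16_mem(2) dx(1)]])
  hence sigma_xi: "\<sigma> (xi i) = K16_scale c (xi i)" for i by (simp add: \<tau>_def)
  \<comment> \<open>Multiplicativity on \<open>[\<xi>\<^sub>1, \<xi>\<^sub>1] = -1\<close>.\<close>
  have cc: "c * c = c"
  proof -
    have "\<sigma> (K16_scale (-1) ?one) = K16_scale (-1) (axis {} [:c:])"
      using sc[OF E16_mem(1)] c by metis
    moreover have "\<sigma> (K16_scale (-1) ?one) = K16_scale (c * c) (K16_scale (-1) ?one)"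
      using mult[OF E16_mem(2)[of 1] E16_mem(2)[of 1]]
      unfolding bracket_xi_xi x_pow_0 sigma_xi K16_bracket_scale K16_scale_linear by (simp only: mult.assoc)
    ultimately have "K16_scale (-1) (axis {} [:c:]) $ {} = K16_scale (c * c) (K16_scale (-1) ?one) $ {}"
      by (simp only:)
    thus ?thesis by (simp add: K16_scale_def)
  qed
  \<comment> \<open>\<open>\<xi>\<^sub>i \<xi>\<^sub>j\<close> is fixed up to constants.  They disappear in \<open>[\<xi>\<^sub>i \<xi>\<^sub>j, \<xi>\<^sub>i \<xi>\<^sub>k] = \<xi>\<^sub>j \<xi>\<^sub>k\<close>.\<close>
  have sigma_xi2: "\<sigma> (xi2 j k) = K16_scale c (xi2 j k)" if jk: "j \<noteq> k" for j k
  proof -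
    obtain i :: 6 where i: "i \<noteq> j" "i \<noteq> k" using two_points_not_all[of j k] by auto
    have "\<exists>d. \<tau> (xi2 i l) = axis {} [:d:]" if "i \<noteq> l" for l
      by (rule even_const[OF tau_part[OF E16_mem(3)] tau_xi_free[OF E16_mem(3) K16_dx_xi2]]) (rule that)+
    then obtain d e where "\<tau> (xi2 i j) = axis {} [:d:]" "\<tau> (xi2 i k) = axis {} [:e:]" using i by metis
    hence s: "\<sigma> (xi2 i j) = K16_scale c (xi2 i j) + axis {} [:d:]"
      "\<sigma> (xi2 i k) = K16_scale c (xi2 i k) + axis {} [:e:]" by (simp_all add: \<tau>_def algebra_simps)
    have "\<sigma> (xi2 j k) = K16_bracket (\<sigma> (xi2 i j)) (\<sigma> (xi2 i k))"
      using mult[OF E16_mem(3)[OF i(1)] E16_mem(3)[OF i(2)]] unfolding bracket_xi2_xi2[OF i jk] .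
    also have "\<dots> = K16_scale (c * c) (xi2 j k)"
      unfolding s using one_right[OF E16_mem(3)[OF i(1)], of e] i jk
      by (simp add: K16_bracket_add K16_bracket_scale K16_bracket_one K16_dx_linear K16_dx_xi2 K16_dx_axis
          K16_scale_linear bracket_xi2_xi2)
    finally show ?thesis unfolding cc .
  qed
  \<comment> \<open>If \<open>c = 0\<close>, then \<open>\<sigma>\<close> kills \<open>x\<close>, which is a bracket with \<open>\<xi>\<^sub>k\<close>, and \<open>x \<xi>\<^sub>k\<close>, which is a bracket with
    \<open>x\<close>.  Otherwise \<open>\<tau> (x \<xi>\<^sub>k)\<close> commutes with every \<open>\<xi>\<^sub>i\<close>: by multiplicativity for \<open>i \<noteq> k\<close>, and by the
    relation with \<open>y = z = x \<xi>\<^sub>k\<close>, in which the two sides have opposite signs, for \<open>i = k\<close>.\<close>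
  have tau_x_xi: "\<tau> (x_xi k) = 0" for k
  proof (cases "c = 0")
    case True
    have "\<sigma> (K16_scale (-1) (x_pow 1)) = 0"
      using mult[OF E16_mem(4)[of k] E16_mem(2)[of k]] True
      by (simp add: bracket_x_xi_xi(2) sigma_xi K16_scale_linear)
    hence "\<sigma> (x_pow 1) = 0" using sc[OF E16_mem(5), of "-1"] by (simp add: K16_scale_minus_one K16_scale_linear)
    hence "\<sigma> (x_xi k) = 0"
      using mult[OF E16_mem(5) E16_mem(4)[of k]] unfolding bracket_x_x_xi by simp
    thus ?thesis using True by (simp add: \<tau>_def K16_scale_linear)
  next
    case False
    hence c1: "c = 1" using cc by simp
    show ?thesis
    proof (rule odd_zero[OF tau_part[OF E16_mem(4)]])
      fix i
      show "K16_bracket (\<tau> (x_xi k)) (xi i) = 0"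
      proof (cases "i = k")
        case True
        have "K16_bracket (\<tau> (x_xi k)) (xi k) = - K16_bracket (\<tau> (x_xi k)) (xi k)"
          using rel[OF E16_mem(4)[of k] E16_mem(4)[of k]] by (simp add: dx K16_scale_minus_one K16_scale_linear)
        hence "K16_scale 2 (K16_bracket (\<tau> (x_xi k)) (xi k)) = 0"
          using K16.scale_left_distrib[of 1 1 "K16_bracket (\<tau> (x_xi k)) (xi k)"]
          by (simp add: eq_neg_iff_add_eq_0)
        from scale_cancel[OF this] show ?thesis using True by simp
      next
        case ik: False
        have "K16_bracket (\<sigma> (x_xi k)) (xi i) = xi2 i k"
          using mult[OF E16_mem(4)[of k] E16_mem(2)[of i]] ik
          by (simp add: bracket_x_xi_xi(1) sigma_xi sigma_xi2 c1 K16_scale_linear)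
        thus ?thesis unfolding \<tau>_def K16_bracket_linear using ik
          by (simp add: bracket_x_xi_xi(1) c1 K16_scale_linear)
      qed
    qed
  qed
  \<comment> \<open>From here on \<open>x \<xi>\<^sub>k\<close> may be used as a partner of arbitrary elements.\<close>
  have free: "K16_bracket (\<tau> f) (xi k) = 0" if "f \<in> part (E16 M) p" for f p k
    using rel[OF that E16_mem(4)[of k]] by (simp add: dx tau_x_xi K16_scale_linear)
  have tau_odd: "\<tau> f = 0" if "f \<in> part (E16 M) 1" for f
    by (rule odd_zero[OF tau_part[OF that] free[OF that]])
  have "\<sigma> (K16_scale (-1) (x_pow 2)) = K16_scale (c * c) (K16_scale (-1) (x_pow 2))"
    using mult[OF E16_mem(4)[of 1] E16_mem(4)[of 1]] tau_x_xi[of 1]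
    by (simp add: \<tau>_def bracket_x_xi_x_xi K16_bracket_scale K16_scale_linear)
  hence tau_x2: "\<tau> (x_pow 2) = 0"
    using sc[OF E16_mem(6), of "-1"] by (simp add: \<tau>_def cc K16_scale_minus_one K16_scale_linear)
  have tau_even: "\<tau> f = 0" if f: "f \<in> part (E16 M) 0" for f
  proof -
    obtain d where d: "\<tau> f = axis {} [:d:]" using even_const[OF tau_part[OF f] free[OF f]] ..
    have "K16_bracket (axis {} [:d:]) (K16_dx (x_pow 2)) = 0"
      using rel[OF f E16_mem(6)] by (simp add: d tau_x2 K16_scale_linear)
    moreover have "K16_dx (K16_dx (x_pow 2 :: 'a K16)) = axis {} [:2:]"
      by (simp add: K16_dx_axis numeral_2_eq_2 monom_Suc monom_0 pderiv_pCons)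
    ultimately have "K16_scale (2 * d) (axis {} [:2:]) $ {} = (0 :: 'a poly)"
      unfolding K16_bracket_one by (simp only: zero_index)
    thus ?thesis by (simp add: d K16_scale_def)
  qed
  have tau: "\<sigma> f = K16_scale c f" if "f \<in> part (E16 M) p" for f p
    using tau_even tau_odd that unfolding \<tau>_def by (cases "even p") (simp_all add: part_def)
  have sigma: "\<sigma> f = K16_scale c f" if f: "f \<in> whole (E16 M)" for f
  proof -
    obtain x y where xy: "f = x + y" "x \<in> even_part (E16 M)" "y \<in> odd_part (E16 M)"
      using f unfolding whole_def by blast
    hence "x \<in> part (E16 M) 0" "y \<in> part (E16 M) 1" by (simp_all add: part_def)
    thus ?thesis using add[OF pw pw] tau xy(1) by (simp add: K16_scale_linear)
  qed
  have "c \<noteq> 0" using nz sigma by (auto simp: nonzero_map_def K16_scale_linear)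
  hence "c = 1" using cc by simp
  thus ?thesis using sigma by (simp add: trivial_structure_def K16_scale_linear)
qed

section \<open>Centralizers in a transitive prolongation\<close>

text \<open>
  The matrix of \<open>u\<^sub>i \<and> u\<^sub>j\<close>.
\<close>

definition bivector :: "3 \<Rightarrow> 3 \<Rightarrow> 'a::ring_1 ^ 3 ^ 3" where
  "bivector i j = axis i (axis j 1) - axis j (axis i 1)"

lemma matrix_unit_mult:
  fixes M :: "'a::semiring_1 ^ 'n ^ 'm::finite"
  shows "(axis i (axis j 1) :: 'a ^ 'm ^ 'l::finite) ** M = axis i (M $ j)"
proof -
  have "((axis i (axis j 1) :: 'a ^ 'm ^ 'l) ** M) $ a $ b =
      (\<Sum>k\<in>UNIV. if k = j then if a = i then M $ j $ b else 0 else 0)" for a b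
    unfolding matrix_matrix_mult_def vec_lambda_beta by (intro sum.cong) (auto simp: axis_def)
  thus ?thesis by (simp add: vec_eq_iff) (simp add: axis_def)
qed

lemma mult_transpose_matrix_unit:
  fixes M :: "'a::semiring_1 ^ 'n::finite ^ 'm"
  shows "M ** transpose (axis q (axis p 1)) = (\<chi> a. axis q (M $ a $ p))"
proof -
  have "(M ** transpose (axis q (axis p 1))) $ a $ b =
      (\<Sum>k\<in>UNIV. if k = p then if b = q then M $ a $ p else 0 else 0)" for a b
    unfolding matrix_matrix_mult_def transpose_def vec_lambda_beta by (intro sum.cong) (auto simp: axis_def)
  thus ?thesis by (simp add: vec_eq_iff) (simp add: axis_def)
qed

lemma bivector_transpose: "transpose (bivector i j) = - bivector i j"
  by (auto simp: transpose_def bivector_def vec_eq_iff axis_def)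

text \<open>
  Any transitive graded Lie superalgebra \<open>H\<close> with components \<open>E k\<close> whose nonpositive part is identified with that of
  \<open>E(3,8)\<close> by \<open>f\<close>.  Its elements of positive degree are accessible only through transitivity.
\<close>

locale transitive38 =
  fixes \<omega> :: "'a::field_char_0 ^ 2 \<Rightarrow> 'a ^ 2 \<Rightarrow> 'a"
    and H :: "('a, 'v::ab_group_add) superalgebra" and E :: "int \<Rightarrow> 'v set" and f :: "'a nonpos38 \<Rightarrow> 'v"
  assumes alternating: "nonzero_alternating \<omega>"
    and prolongation: "transitive_prolongation nonpos38_comp (nonpos38_bracket \<omega>) nonpos38_scale H E f"
begin

abbreviation "br \<equiv> brk H"
abbreviation "D \<equiv> nonpos38_comp :: int \<Rightarrow> 'a nonpos38 set"
abbreviation "B \<equiv> nonpos38_bracket \<omega>"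

lemma lie: "lie_superalgebra H"
  using prolongation by (simp add: transitive_prolongation_def)

lemma scl_vector_space: "vector_space (scl H)"
  using lie by (simp add: lie_superalgebra_def)

sublocale V: vector_space "scl H" by (rule scl_vector_space)

lemma part_subspace: "V.subspace (part H p)"
  using lie by (auto simp: lie_superalgebra_def part_def)

lemma part_whole: "x \<in> part H p \<Longrightarrow> x \<in> whole H"
  using lie V.subspace_0 by (intro part_subset_whole) (auto simp: lie_superalgebra_def)

lemma part_0_1: "x \<in> part H 0 \<Longrightarrow> x \<in> part H 1 \<Longrightarrow> x = 0"
  using lie by (auto simp: lie_superalgebra_def part_def)

lemma br_part: "x \<in> part H p \<Longrightarrow> y \<in> part H q \<Longrightarrow> br x y \<in> part H (p + q)"
  using lie unfolding lie_superalgebra_def by blast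

lemma br_bilinear:
  assumes "x \<in> whole H" "y \<in> whole H" "z \<in> whole H"
  shows "br (x + y) z = br x z + br y z" "br x (y + z) = br x y + br x z"
    "br (scl H c x) y = scl H c (br x y)" "br x (scl H c y) = scl H c (br x y)"
proof -
  have "\<forall>x\<in>whole H. \<forall>y\<in>whole H. \<forall>z\<in>whole H. \<forall>c.
        br (x + y) z = br x z + br y z \<and> br x (y + z) = br x y + br x z \<and>
        br (scl H c x) y = scl H c (br x y) \<and> br x (scl H c y) = scl H c (br x y)"
    using lie unfolding lie_superalgebra_def by (elim conjE)
  from this[rule_format, OF assms, of c]
  show "br (x + y) z = br x z + br y z" "br x (y + z) = br x y + br x z"
    "br (scl H c x) y = scl H c (br x y)" "br x (scl H c y) = scl H c (br x y)" by blast+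
qed

lemma whole_zero: "0 \<in> whole H"
  using part_whole[OF V.subspace_0[OF part_subspace]] .

lemma br_zero: "x \<in> whole H \<Longrightarrow> br x 0 = 0" "x \<in> whole H \<Longrightarrow> br 0 x = 0"
  using br_bilinear(4)[of x 0 0 0] br_bilinear(3)[of 0 x 0 0] whole_zero by simp_all

lemma br_skew:
  assumes "x \<in> part H p" "y \<in> part H q"
  shows "br x y = - scl H ((-1) ^ (p * q)) (br y x)"
proof -
  have "\<forall>p q. \<forall>x\<in>part H p. \<forall>y\<in>part H q. br x y = - scl H ((-1) ^ (p * q)) (br y x)"
    using lie unfolding lie_superalgebra_def by (elim conjE)
  thus ?thesis using assms by blast
qed

lemma br_jacobi:
  assumes "x \<in> part H p" "y \<in> part H q" "z \<in> part H r"
  shows "br x (br y z) = br (br x y) z + scl H ((-1) ^ (p * q)) (br y (br x z))"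
proof -
  have "\<forall>p q r. \<forall>x\<in>part H p. \<forall>y\<in>part H q. \<forall>z\<in>part H r.
      br x (br y z) = br (br x y) z + scl H ((-1) ^ (p * q)) (br y (br x z))"
    using lie unfolding lie_superalgebra_def by (elim conjE)
  thus ?thesis using assms by blast
qed

lemma E_subspace: "V.subspace (E k)"
proof -
  have "\<forall>k. V.subspace (E k)"
    using prolongation unfolding transitive_prolongation_def by (elim conjE)
  thus ?thesis ..
qed

lemma E_whole: "whole H = {sum h K | h K. finite K \<and> (\<forall>k\<in>K. h k \<in> E k)}"
  using prolongation unfolding transitive_prolongation_def by (elim conjE)

lemma E_br: "x \<in> E i \<Longrightarrow> y \<in> E j \<Longrightarrow> br x y \<in> E (i + j)"
proof -
  have "\<forall>i j. \<forall>x\<in>E i. \<forall>y\<in>E j. br x y \<in> E (i + j)"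
    using prolongation unfolding transitive_prolongation_def by (elim conjE)
  thus "x \<in> E i \<Longrightarrow> y \<in> E j \<Longrightarrow> br x y \<in> E (i + j)" by blast
qed

lemma f_br:
  assumes "i \<le> 0" "j \<le> 0" "u \<in> D i" "u' \<in> D j"
  shows "br (f u) (f u') = f (B u u')"
proof -
  have "\<forall>i\<le>0. \<forall>j\<le>0. \<forall>x\<in>D i. \<forall>y\<in>D j. br (f x) (f y) = f (B x y)"
    using prolongation unfolding transitive_prolongation_def by (elim conjE)
  thus ?thesis using assms by blast
qed

lemma f_linear:
  assumes "k \<le> 0" "u \<in> D k" "u' \<in> D k"
  shows "f (nonpos38_scale a u + nonpos38_scale b u') = scl H a (f u) + scl H b (f u')"
proof -
  have "\<forall>k\<le>0. \<forall>x\<in>D k. \<forall>y\<in>D k. \<forall>a b.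
      f (nonpos38_scale a x + nonpos38_scale b y) = scl H a (f x) + scl H b (f y)"
    using prolongation unfolding transitive_prolongation_def by (elim conjE)
  thus ?thesis using assms by blast
qed

lemma f_bij:
  assumes "k \<le> 0"
  shows "bij_betw f (D k) (E k) \<and> f ` D k \<subseteq> part H (nat \<bar>k\<bar>)"
proof -
  have "\<forall>k\<le>0. bij_betw f (D k) (E k) \<and> f ` D k \<subseteq> part H (nat \<bar>k\<bar>)"
    using prolongation unfolding transitive_prolongation_def by (elim conjE)
  thus ?thesis using assms by blast
qed

lemma f_image: "k \<le> 0 \<Longrightarrow> f ` D k = E k"
  and f_inj: "k \<le> 0 \<Longrightarrow> inj_on f (D k)"
  and f_part: "k \<le> 0 \<Longrightarrow> u \<in> D k \<Longrightarrow> f u \<in> part H (nat \<bar>k\<bar>)"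
  using f_bij[of k] by (auto simp: bij_betw_def)

lemma E_independent:
  assumes "finite K" "\<And>k. k \<in> K \<Longrightarrow> h k \<in> E k" "sum h K = 0" "k \<in> K"
  shows "h k = 0"
proof -
  have "\<forall>h K. finite K \<and> (\<forall>k\<in>K. h k \<in> E k) \<and> sum h K = 0 \<longrightarrow> (\<forall>k\<in>K. h k = 0)"
    using prolongation unfolding transitive_prolongation_def by (elim conjE)
  thus ?thesis using assms by blast
qed

lemma transitive:
  assumes "k \<ge> 0" "x \<in> E k" "\<And>y. y \<in> E (-1) \<Longrightarrow> br x y = 0"
  shows "x = 0"
proof -
  have "\<forall>k\<ge>0. \<forall>x\<in>E k. (\<forall>y\<in>E (-1). br x y = 0) \<longrightarrow> x = 0"
    using prolongation unfolding transitive_prolongation_def by (elim conjE)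
  thus ?thesis using assms by blast
qed

lemma D_zero: "0 \<in> D k"
  by (auto simp: nonpos38_comp_def zero_prod_def)

lemma f_zero: "f 0 = 0"
  using f_linear[of 0 0 0 0 0] D_zero by (simp add: nonpos38_scale_def zero_prod_def)

lemma E_subset_whole: "x \<in> E k \<Longrightarrow> x \<in> whole H"
  unfolding E_whole by (rule CollectI, rule exI[of _ "\<lambda>_. x"], rule exI[of _ "{k}"]) simp

lemma whole_add: "x \<in> whole H \<Longrightarrow> y \<in> whole H \<Longrightarrow> x + y \<in> whole H"
proof -
  assume "x \<in> whole H" "y \<in> whole H"
  then obtain x0 x1 y0 y1 where "x = x0 + x1" "y = y0 + y1" and
    p: "x0 \<in> even_part H" "x1 \<in> odd_part H" "y0 \<in> even_part H" "y1 \<in> odd_part H"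
    unfolding whole_def by blast
  moreover have "x0 + y0 \<in> even_part H" "x1 + y1 \<in> odd_part H"
    using p V.subspace_add[OF part_subspace[of 0]] V.subspace_add[OF part_subspace[of 1]]
    by (simp_all add: part_def)
  moreover have "x + y = (x0 + y0) + (x1 + y1)" using calculation by simp
  ultimately show "x + y \<in> whole H" unfolding whole_def by blast
qed

lemma whole_sum: "(\<And>k. k \<in> K \<Longrightarrow> h k \<in> whole H) \<Longrightarrow> sum h K \<in> whole H"
  by (induction K rule: infinite_finite_induct) (auto intro: whole_add whole_zero)

lemma br_sum_left:
  assumes "\<And>k. k \<in> K \<Longrightarrow> h k \<in> whole H" "y \<in> whole H"
  shows "br (sum h K) y = (\<Sum>k\<in>K. br (h k) y)"
  using assms
  by (induction K rule: infinite_finite_induct) (auto simp: br_zero br_bilinear whole_sum)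

text \<open>
  The elements \<open>u\<^sub>i \<otimes> v\<^sub>p\<close>, \<open>u\<^sub>i \<and> u\<^sub>j\<close>, the matrix units of \<open>gl(U)\<close>, and the elements of \<open>sl(V)\<close>.
\<close>

definition gm :: "3 \<Rightarrow> 2 \<Rightarrow> 'v" where "gm i p = f (0, 0, axis i (axis p 1), 0, 0)"
definition gw :: "3 \<Rightarrow> 3 \<Rightarrow> 'v" where "gw i j = f (0, bivector i j, 0, 0, 0)"
definition gE :: "3 \<Rightarrow> 3 \<Rightarrow> 'v" where "gE i j = f (0, 0, 0, axis i (axis j 1), 0)"
definition gs :: "'a ^ 2 ^ 2 \<Rightarrow> 'v" where "gs S = f (0, 0, 0, 0, S)"

lemma D_members:
  "(0, 0, m, 0, 0) \<in> D (-1)" "(0, bivector i j, 0, 0, 0) \<in> D (-2)" "(c, 0, 0, 0, 0) \<in> D (-3)"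
  "(0, 0, 0, A, 0) \<in> D 0" "trace S = 0 \<Longrightarrow> (0, 0, 0, 0, S) \<in> D 0"
  by (simp_all add: nonpos38_comp_def bivector_transpose)

lemma gm_part: "gm i p \<in> part H 1"
  and gw_part: "gw i j \<in> part H 0"
  and gE_part: "gE i j \<in> part H 0"
  and gs_part: "trace S = 0 \<Longrightarrow> gs S \<in> part H 0"
  unfolding gm_def gw_def gE_def gs_def
  using f_part[OF _ D_members(1)] f_part[OF _ D_members(2)] f_part[OF _ D_members(4)] f_part[OF _ D_members(5)]
  by (simp_all add: part_def)

lemma E_minus_3_part: "x \<in> E (-3) \<Longrightarrow> x \<in> part H 1"
  and E_minus_2_part: "x \<in> E (-2) \<Longrightarrow> x \<in> part H 0"
  using f_bij[of "-3"] f_bij[of "-2"] by (auto simp: bij_betw_def part_def)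

lemma gm_span:
  assumes "V.subspace S" "v \<in> whole H" "\<And>i p. br v (gm i p) \<in> S" "y \<in> E (-1)"
  shows "br v y \<in> S"
proof -
  obtain m where y: "y = f (0, 0, m, 0, 0)"
    using assms(4) f_image[of "-1"] by (auto simp: nonpos38_comp_def)
  define F where "F m = f (0, 0, m, 0, 0)" for m
  have lin: "F (m + mscale b m') = F m + scl H b (F m')" for m m' b
    using f_linear[of "-1" "(0, 0, m, 0, 0)" "(0, 0, m', 0, 0)" 1 b] D_members(1)
    by (simp add: F_def nonpos38_scale_def)
  have F0: "F 0 = 0" using f_zero by (simp add: F_def zero_prod_def)
  define u where "u i p = mscale (m $ i $ p) (axis i (axis p 1))" for i p
  have "m = 0 + u 1 1 + u 1 2 + u 2 1 + u 2 2 + u 3 1 + u 3 2"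
    by (simp add: u_def vec_eq_iff forall_2 forall_3 mscale_def axis_def)
  note F_m = arg_cong[OF this, of F]
  have lin_u: "F (m' + u i p) = F m' + scl H (m $ i $ p) (gm i p)" for m' i p
    using lin[of m' "m $ i $ p" "axis i (axis p 1)"] by (simp add: u_def gm_def F_def)
  have "F m = scl H (m $ 1 $ 1) (gm 1 1) + scl H (m $ 1 $ 2) (gm 1 2) + scl H (m $ 2 $ 1) (gm 2 1)
      + scl H (m $ 2 $ 2) (gm 2 2) + scl H (m $ 3 $ 1) (gm 3 1) + scl H (m $ 3 $ 2) (gm 3 2)"
    using F_m lin_u[of 0 1 1] by (simp only: lin_u F0 add_0)
  moreover have "scl H c (gm i p) \<in> whole H" for c i p
    by (intro part_whole[of _ 1] V.subspace_scale[OF part_subspace] gm_part)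
  moreover have "br v (scl H c (gm i p)) \<in> S" for c i p
    using assms(3) V.subspace_scale[OF assms(1)] br_bilinear(4)[OF assms(2) part_whole[OF gm_part] whole_zero] by simp
  ultimately show ?thesis
    unfolding y F_def[symmetric] using assms(2) by (simp add: br_bilinear whole_add V.subspace_add[OF assms(1)])
qed

lemma nonpos_centralizer:
  assumes "x \<in> D k" "k = -1 \<or> k = -2" "\<And>i p. B x (0, 0, axis i (axis p 1), 0, 0) = 0"
  shows "x = 0"
proof -
  obtain t where t: "t \<noteq> 0" "\<omega> = (\<lambda>u v. t * (u $ 1 * v $ 2 - u $ 2 * v $ 1))"
    using nonzero_alternating_form[OF alternating] by metis
  show ?thesis
    using assms(1)
  proof (cases rule: nonpos38_cases)
    case (2 b)
    have "wedge38 (axis i (axis p 1)) b = 0" for i p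
      using assms(3)[of i p] 2 by (simp add: nonpos38_bracket_def zero_prod_def vec_eq_iff)
    hence "wedge38 (axis i (axis p 1)) b $ p = 0" for i p by simp
    from this[of 1 1] this[of 2 1] this[of 3 1] have "b = 0"
      using 2 by (simp add: wedge38_def vec_eq_iff forall_3 axis_def)
    thus ?thesis using 2 by (simp add: zero_prod_def)
  next
    case (3 n)
    have p: "pairing38 \<omega> n (axis i (axis p 1)) = 0" for i p
      using assms(3)[of i p] 3 by (simp add: nonpos38_bracket_def zero_prod_def vec_eq_iff)
    have "n $ l $ q = 0" for l q
    proof -
      obtain i where i: "i \<noteq> l" by (metis zero_neq_one)
      have z: "pairing38 \<omega> n (axis i (axis p 1)) $ l $ i = 0" for p unfolding p by simp
      show ?thesis using z[of 1] z[of 2] i t exhaust_2[of q] by (auto simp: pairing38_def axis_def)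
    qed
    thus ?thesis using 3 by (simp add: zero_prod_def vec_eq_iff)
  qed (use assms(2) in auto)
qed

text \<open>
  Transitivity covers the degrees from 0 on, and in degrees -1 and -2 the brackets with \<open>U \<otimes> V\<close> are nondegenerate.
  Degree -3 is central in the negative part and has to be excluded.
\<close>

lemma component_centralizer:
  assumes "x \<in> E k" "k \<noteq> -3" "\<And>y. y \<in> E (-1) \<Longrightarrow> br x y = 0"
  shows "x = 0"
proof -
  have g: "gm i p \<in> E (-1)" for i p
    using f_image[of "-1"] D_members(1) unfolding gm_def by auto
  consider "k \<ge> 0" | "k = -1 \<or> k = -2" | "k < -3" using assms(2) by linarith
  thus ?thesis
  proof cases
    case 1 thus ?thesis using transitive assms by blast
  next
    case 2
    hence "x \<in> f ` D k" using f_image[of k] assms(1) by auto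
    then obtain u where u: "u \<in> D k" "x = f u" by (rule imageE)
    have "B u (0, 0, axis i (axis p 1), 0, 0) = 0" for i p
    proof -
      let ?m = "(0, 0, axis i (axis p 1), 0, 0) :: 'a nonpos38"
      have "f (B u ?m) = f 0"
        using assms(3)[OF g, of i p] f_br[of k "-1" u ?m] 2 u D_members(1) f_zero by (auto simp: gm_def)
      moreover have "B u ?m \<in> D (k - 1)"
        using nonpositive_superalgebra.B_closed[OF nonpos38_superalgebra[OF alternating] u(1) D_members(1)] by simp
      moreover have "inj_on f (D (k - 1))" using 2 by (intro f_inj) auto
      ultimately show ?thesis using D_zero by (auto dest: inj_onD)
    qed
    hence "u = 0" using nonpos_centralizer u(1) 2 by blast
    thus ?thesis using u f_zero by simp
  next
    case 3
    hence "D k = {0}" by (simp add: nonpos38_comp_def)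
    thus ?thesis using f_image[of k] 3 assms(1) f_zero by auto
  qed
qed

text \<open>
  Bracketing with an element of degree -1 lowers the degree by one, so every component of \<open>v\<close> outside degree \<open>j\<close>
  centralizes the component of degree -1.
\<close>

lemma centralizer_mod:
  assumes v: "v \<in> whole H" and j: "\<And>i p. br v (gm i p) \<in> E (j - 1)"
  shows "\<exists>a\<in>E j. \<exists>b\<in>E (-3). v = a + b"
proof -
  obtain h0 K0 where h0: "v = sum h0 K0" "finite K0" "\<And>k. k \<in> K0 \<Longrightarrow> h0 k \<in> E k"
    using v unfolding E_whole by blast
  define h where "h k = (if k \<in> K0 then h0 k else 0)" for k
  define K where "K = insert j (insert (-3) K0)"
  have h: "h k \<in> E k" for k using h0(3) V.subspace_0[OF E_subspace] by (simp add: h_def)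
  have K: "finite K" using h0(2) by (simp add: K_def)
  have "sum h K = sum h K0"
    by (rule sum.mono_neutral_right) (use K in \<open>auto simp: K_def h_def\<close>)
  hence vh: "v = sum h K" using h0(1) by (simp add: h_def)
  have z: "h k = 0" if k: "k \<in> K" "k \<noteq> j" "k \<noteq> -3" for k
  proof (rule component_centralizer[OF h k(3)])
    fix y assume y: "y \<in> E (-1)"
    \<comment> \<open>\<open>g\<close> collects, degree by degree, the terms of \<open>\<Sum>\<^sub>k [h k, y] - [v, y] = 0\<close>.\<close>
    define g where "g l = br (h (l + 1)) y - (if l = j - 1 then br v y else 0)" for l
    have jy: "br v y \<in> E (j - 1)" by (rule gm_span[OF E_subspace v j y])
    have "(\<Sum>l\<in>(\<lambda>k. k - 1) ` K. g l) = (\<Sum>k\<in>K. br (h k) y - (if k = j then br v y else 0))"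
      by (subst sum.reindex) (auto simp: inj_on_def g_def intro!: sum.cong)
    also have "\<dots> = (\<Sum>k\<in>K. br (h k) y) - br v y"
      using K by (simp add: sum_subtractf) (simp add: K_def)
    also have "(\<Sum>k\<in>K. br (h k) y) = br v y"
      unfolding vh by (rule br_sum_left[symmetric]) (use h y E_subset_whole in blast)+
    finally have s: "(\<Sum>l\<in>(\<lambda>k. k - 1) ` K. g l) = 0" by simp
    have "g l \<in> E l" for l
      unfolding g_def using E_br[OF h[of "l + 1"] y] jy
      by (auto intro!: V.subspace_diff[OF E_subspace])
    hence "g (k - 1) = 0" using E_independent[OF _ _ s, of "k - 1"] K k(1) by blast
    thus "br (h k) y = 0" using k(2) by (simp add: g_def)
  qed
  have "v = sum h {j, -3}"
    unfolding vh using z K by (intro sum.mono_neutral_right) (auto simp: K_def)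
  moreover have "h (-3) \<in> E (-3)" "h j \<in> E j" "0 \<in> E (-3)" using h V.subspace_0[OF E_subspace] by auto
  ultimately show ?thesis by (cases "j = -3") (auto intro!: bexI)
qed

lemma centralizer_of_g_minus_1:
  assumes "v \<in> whole H" "\<And>i p. br v (gm i p) = 0"
  shows "v \<in> E (-3)"
proof -
  have "\<exists>a\<in>E (-3). \<exists>b\<in>E (-3). v = a + b"
    using assms V.subspace_0[OF E_subspace] by (intro centralizer_mod) auto
  thus ?thesis using V.subspace_add[OF E_subspace] by blast
qed

lemma even_centralizer:
  assumes "v \<in> part H 0" "\<And>i p. br v (gm i p) = 0"
  shows "v = 0"
  using centralizer_of_g_minus_1[OF part_whole[OF assms(1)] assms(2)] E_minus_3_part part_0_1 assms(1) by blast

text \<open>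
  The ambiguity of degree -3 is odd.
\<close>

lemma even_centralizer_mod:
  assumes "v \<in> part H 0" "\<And>i p. br v (gm i p) \<in> E (-3)"
  shows "v \<in> E (-2)"
proof -
  obtain a b where ab: "a \<in> E (-2)" "b \<in> E (-3)" "v = a + b"
    using centralizer_mod[OF part_whole[OF assms(1)], of "-2"] assms(2) by auto
  have "b = v - a" using ab(3) by simp
  hence "b \<in> part H 0" using V.subspace_diff[OF part_subspace] assms(1) E_minus_2_part[OF ab(1)] by blast
  hence "b = 0" using E_minus_3_part[OF ab(2)] part_0_1 by blast
  thus ?thesis using ab by simp
qed

end

lemma bivector_action:
  "axis i (axis j 1) ** bivector k l + bivector k l ** transpose (axis i (axis j 1)) =
   (if j = k then bivector i l else 0) + (if j = l then bivector k i else (0 :: 'a::comm_ring_1 ^ 3 ^ 3))"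
  unfolding matrix_unit_mult mult_transpose_matrix_unit
  by (auto simp: vec_eq_iff bivector_def axis_def)

lemma wedge38_bivector_cyclic:
  "wedge38 (axis i (axis p 1)) (bivector j k) = (wedge38 (axis j (axis p 1)) (bivector k i) :: 'a::field ^ 2)"
  using exhaust_3[of i] exhaust_3[of j] exhaust_3[of k]
  by (elim disjE) (simp_all add: wedge38_def bivector_def axis_def vec_eq_iff)

lemma wedge38_bivector_nonzero:
  "i \<noteq> j \<Longrightarrow> j \<noteq> k \<Longrightarrow> i \<noteq> k \<Longrightarrow> wedge38 (axis i (axis p 1)) (bivector j k) $ p \<noteq> (0 :: 'a::field)"
  using exhaust_3[of i] exhaust_3[of j] exhaust_3[of k]
  by (elim disjE) (simp_all add: wedge38_def bivector_def axis_def)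

lemma bivector_of_annihilator:
  fixes b :: "'a::field_char_0 ^ 3 ^ 3"
  assumes skew: "\<And>a c. b $ a $ c = - b $ c $ a"
    and "wedge38 (axis j (axis 1 1)) b = 0" "wedge38 (axis k (axis 1 1)) b = 0" "i \<noteq> j" "j \<noteq> k" "i \<noteq> k"
  shows "b = mscale (b $ j $ k) (bivector j k)"
proof -
  have "b $ a $ a = 0" for a using skew[of a a] by simp
  moreover have "wedge38 (axis j (axis 1 1)) b $ 1 = 0" "wedge38 (axis k (axis 1 1)) b $ 1 = 0"
    using assms(2,3) by simp_all
  ultimately show ?thesis
    using exhaust_3[of i] exhaust_3[of j] exhaust_3[of k] assms(4-6) skew[of 1 2] skew[of 1 3] skew[of 2 3]
    by (elim disjE) (simp_all add: wedge38_def bivector_def axis_def vec_eq_iff forall_3 mscale_def)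
qed

lemma nonpos38_scale_zero [simp]: "nonpos38_scale a 0 = 0"
  by (simp add: nonpos38_scale_def zero_prod_def)

context transitive38
begin

lemma \<omega>_form: obtains t where "t \<noteq> 0" "\<omega> = (\<lambda>u v. t * (u $ 1 * v $ 2 - u $ 2 * v $ 1))"
  using nonzero_alternating_form[OF alternating] by metis

lemma pairing38_zero [simp]: "pairing38 \<omega> m 0 = 0" "pairing38 \<omega> 0 m = 0"
  by (rule \<omega>_form; simp add: pairing38_def vec_eq_iff)+

lemma f_scale: "k \<le> 0 \<Longrightarrow> u \<in> D k \<Longrightarrow> f (nonpos38_scale a u) = scl H a (f u)"
  using f_linear[of k u 0 a 0] D_zero[of k] nonpos38_scale_zero by simp

lemma f_tuple_zero [simp]: "f (0, 0, 0, 0, 0) = 0"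
  using f_zero by (simp add: zero_prod_def)

lemma f_inj_minus_3:
  assumes "f (c, 0, 0, 0, 0) = f (d, 0, 0, 0, 0)"
  shows "c = d"
proof -
  have "inj_on f (D (-3))" by (rule f_inj) simp
  hence "(c, 0, 0, 0, 0) = (d, 0 :: 'a ^ 3 ^ 3, 0 :: 'a ^ 2 ^ 3, 0 :: 'a ^ 3 ^ 3, 0 :: 'a ^ 2 ^ 2)"
    using assms D_members(3) D_members(3) by (rule inj_onD)
  thus ?thesis by simp
qed

lemma bivector_same [simp]: "bivector i i = 0"
  by (simp add: bivector_def)

lemma gw_same [simp]: "gw i i = 0"
  by (simp add: gw_def)

lemma gw_swap: "gw j i = - gw i j"
proof -
  have "bivector j i = - (bivector i j :: 'a ^ 3 ^ 3)" by (simp add: bivector_def)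
  thus ?thesis using f_scale[OF _ D_members(2)[of i j], of "-1"]
    by (simp add: gw_def nonpos38_scale_def)
qed

lemmas brackets = f_br[OF _ _ D_members(1) D_members(1)] f_br[OF _ _ D_members(1) D_members(2)]
  f_br[OF _ _ D_members(2) D_members(1)] f_br[OF _ _ D_members(2) D_members(2)]
  f_br[OF _ _ D_members(4) D_members(1)] f_br[OF _ _ D_members(4) D_members(2)]
  f_br[OF _ _ D_members(4) D_members(4)] f_br[OF _ _ D_members(4) D_members(5)]
  f_br[OF _ _ D_members(5) D_members(1)] f_br[OF _ _ D_members(5) D_members(4)]
  f_br[OF _ _ D_members(5) D_members(5)] f_br[OF _ _ D_members(5) D_members(3)]

lemma gE_gm: "br (gE i j) (gm k p) = (if j = k then gm i p else 0)"
  unfolding gE_def gm_def by (simp add: brackets nonpos38_bracket_def matrix_unit_mult axis_nth_if)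

lemma gE_gw: "br (gE i j) (gw k l) = (if j = k then gw i l else 0) + (if j = l then gw k i else 0)"
proof -
  have "br (gE i j) (gw k l) =
      f (0, (if j = k then bivector i l else 0) + (if j = l then bivector k i else 0), 0, 0, 0)"
    unfolding gE_def gw_def by (simp add: brackets nonpos38_bracket_def bivector_action)
  moreover have "gw i k + gw k i = 0" using gw_swap[of k i] by simp
  ultimately show ?thesis
    using br_zero(1)[OF part_whole[OF gE_part]]
    by (cases "k = l"; cases "j = k"; cases "j = l") (simp_all add: gw_def[symmetric])
qed

lemma gs_gE: "trace S = 0 \<Longrightarrow> br (gs S) (gE i j) = 0" "trace S = 0 \<Longrightarrow> br (gE i j) (gs S) = 0"
  unfolding gE_def gs_def by (simp_all add: brackets nonpos38_bracket_def)

lemma gw_gw: "br (gw i j) (gw k l) = 0"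
  unfolding gw_def by (simp add: brackets nonpos38_bracket_def)

lemma gs_gm: "trace S = 0 \<Longrightarrow> br (gs S) (gm i p) = scl H (S $ 1 $ p) (gm i 1) + scl H (S $ 2 $ p) (gm i 2)"
proof -
  assume tr: "trace S = 0"
  have "axis i (axis p 1) ** transpose S = mscale (S $ 1 $ p) (axis i (axis 1 1)) + mscale (S $ 2 $ p) (axis i (axis 2 1))"
  proof -
    have "(axis i (axis p 1) ** transpose S) = axis i (transpose S $ p)" by (rule matrix_unit_mult)
    thus ?thesis using exhaust_2 by (auto simp: vec_eq_iff forall_2 mscale_def transpose_def axis_def)
  qed
  moreover have "br (gs S) (gm i p) = f (0, 0, axis i (axis p 1) ** transpose S, 0, 0)"
    unfolding gs_def gm_def using tr by (simp add: brackets nonpos38_bracket_def)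
  ultimately show ?thesis
    using f_linear[OF _ D_members(1) D_members(1), of "S $ 1 $ p" "axis i (axis 1 1)" "S $ 2 $ p" "axis i (axis 2 1)"]
    by (simp add: gm_def nonpos38_scale_def)
qed

lemma gm_gm: "br (gm i p) (gm j q) = scl H (\<omega> (axis p 1) (axis q 1)) (gw i j)"
proof (rule \<omega>_form)
  fix t assume t: "\<omega> = (\<lambda>u v. t * (u $ 1 * v $ 2 - u $ 2 * v $ 1))"
  have "pairing38 \<omega> (axis i (axis p 1)) (axis j (axis q 1)) = mscale (\<omega> (axis p 1) (axis q 1)) (bivector i j)"
    by (auto simp: t pairing38_def mscale_def bivector_def vec_eq_iff axis_def)
  thus ?thesis
    using f_scale[OF _ D_members(2)[of i j]] unfolding gm_def gw_def
    by (simp add: brackets nonpos38_bracket_def nonpos38_scale_def)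
qed

lemma gm_gw_cyclic: "br (gm i p) (gw j k) = br (gm j p) (gw k i)"
  unfolding gm_def gw_def using wedge38_bivector_cyclic[of i p j k, where 'a = 'a]
  by (simp add: brackets nonpos38_bracket_def)

lemma gm_gw_repeated: "br (gm i p) (gw i k) = 0" "br (gm i p) (gw k i) = 0"
  using gm_gw_cyclic[of k p i i] gm_gw_cyclic[of i p i k] gm_gw_cyclic[of i p k i]
    br_zero(1)[OF part_whole[OF gm_part]] by simp_all

lemma gm_gw_nonzero:
  assumes "i \<noteq> j" "j \<noteq> k" "i \<noteq> k"
  shows "br (gm i p) (gw j k) \<noteq> 0"
proof
  let ?c = "wedge38 (axis i (axis p 1)) (bivector j k) :: 'a ^ 2"
  assume "br (gm i p) (gw j k) = 0"
  hence "f (?c, 0, 0, 0, 0) = f (0, 0, 0, 0, 0)"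
    unfolding gm_def gw_def by (simp add: brackets nonpos38_bracket_def)
  hence "?c = 0" by (rule f_inj_minus_3)
  thus False using wedge38_bivector_nonzero[OF assms, of p, where 'a = 'a] by simp
qed

lemma gw_of_annihilator:
  assumes "w \<in> E (-2)" "br (gm j 1) w = 0" "br (gm k 1) w = 0" "i \<noteq> j" "j \<noteq> k" "i \<noteq> k"
  shows "\<exists>c. w = scl H c (gw j k)"
proof -
  have "w \<in> f ` D (-2)" using f_image[of "-2"] assms(1) by simp
  then obtain b where b: "w = f (0, b, 0, 0, 0)" "transpose b = - b"
    by (auto simp: nonpos38_comp_def)
  hence bD: "(0, b, 0, 0, 0) \<in> D (-2)" by (simp add: nonpos38_comp_def)
  have skew: "b $ a $ c = - b $ c $ a" for a c
    using arg_cong[OF b(2), of "\<lambda>M. M $ c $ a"] by (simp add: transpose_def)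
  have "wedge38 (axis l (axis 1 1)) b = 0" if "br (gm l 1) w = 0" for l
  proof -
    have "f (wedge38 (axis l (axis 1 1)) b, 0, 0, 0, 0) = f (0, 0, 0, 0, 0)"
      using that f_br[OF _ _ D_members(1) bD, of "axis l (axis 1 1)"] unfolding b(1) gm_def
      by (simp add: nonpos38_bracket_def)
    thus ?thesis by (rule f_inj_minus_3)
  qed
  hence "b = mscale (b $ j $ k) (bivector j k)"
    using bivector_of_annihilator[OF skew _ _ assms(4-6)] assms(2,3) by blast
  thus ?thesis
    using f_scale[OF _ D_members(2)[of j k], of "b $ j $ k"] unfolding b(1) gw_def
    by (intro exI[of _ "b $ j $ k"]) (simp add: nonpos38_scale_def)
qed

text \<open>
  The component of degree -3 is \<open>V\<close> as a module over \<open>sl(V)\<close>, and the diagonal element acts on \<open>V\<close> by the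
  eigenvalues 1 and -1.
\<close>

lemma E_minus_3_eigenvector:
  assumes "x \<in> E (-3)" "S = axis 1 (axis 1 1) - axis 2 (axis 2 1)" "br (gs S) x = 0"
  shows "x = 0"
proof -
  have "x \<in> f ` D (-3)" using f_image[of "-3"] assms(1) by simp
  then obtain c where c: "x = f (c, 0, 0, 0, 0)" by (auto simp: nonpos38_comp_def)
  have "trace S = 0" by (simp add: assms(2) trace_def sum_2 axis_def)
  hence "f (S *v c, 0, 0, 0, 0) = f (0, 0, 0, 0, 0)"
    using assms(3) unfolding c gs_def by (simp add: brackets nonpos38_bracket_def)
  hence "S *v c = 0" by (rule f_inj_minus_3)
  hence "c = 0"
    by (simp add: assms(2) vec_eq_iff forall_2 matrix_vector_mult_def sum_2 axis_def)
  thus ?thesis by (simp add: c)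
qed

text \<open>
  For odd \<open>x\<close> the Jacobi identity gives \<open>[P, [x, x]] = 2 [[P, x], x]\<close>.
\<close>

lemma odd_square:
  assumes "P \<in> part H 1" "x \<in> part H 1" "br P (br x x) = 0"
  shows "br (br P x) x = 0"
proof -
  have Q: "br P x \<in> part H 0" using br_part[OF assms(1,2)] by (simp add: part_def)
  have "br x (br P x) = - br (br P x) x" using br_skew[OF assms(2) Q] by simp
  hence "scl H 2 (br (br P x) x) = 0"
    using br_jacobi[OF assms(1,2,2)] assms(3) V.scale_left_distrib[of 1 1 "br (br P x) x"] by simp
  thus ?thesis by (metis V.scale_eq_0_iff zero_neq_numeral)
qed

text \<open>
  Only the brackets \<open>P p = [w, u\<^sub>i \<otimes> v\<^sub>p]\<close> can be nonzero.  They commute with all of \<open>U \<otimes> V\<close> except possibly with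
  \<open>u\<^sub>i \<otimes> v\<^sub>q\<close> for \<open>q \<noteq> p\<close>; and \<open>Q = [P 1, u\<^sub>i \<otimes> v\<^sub>2]\<close> is an even element that commutes with \<open>U \<otimes> V\<close>, so it
  vanishes.  Hence each \<open>P p\<close> has degree -3, which puts \<open>w\<close> into degree -2, where the claim is linear algebra.
\<close>

lemma gw_of_centralizer:
  assumes w: "w \<in> part H 0" and ijk: "i \<noteq> j" "j \<noteq> k" "i \<noteq> k"
    and ww: "\<And>a b. br w (gw a b) = 0" and wm: "\<And>l q. l \<noteq> i \<Longrightarrow> br w (gm l q) = 0"
  shows "\<exists>c. w = scl H c (gw j k)"
proof -
  note wh = part_whole[OF gm_part] part_whole[OF gw_part] part_whole[OF w]
  define P where "P p = br w (gm i p)" for p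
  have P: "P p \<in> part H 1" for p using br_part[OF w gm_part] by (simp add: P_def)
  note wP = part_whole[OF P]
  have wmm: "br w (br (gm a p) (gm b q)) = 0" for a p b q
    by (simp add: gm_gm br_bilinear(4)[OF wh(3,2) whole_zero] ww)
  \<comment> \<open>If \<open>a = i \<noteq> b\<close>, the bracket is rewritten so that a factor \<open>u\<^sub>b \<otimes> v\<^sub>p\<close> appears instead.\<close>
  have wmw: "br w (br (gm a p) (gw b d)) = 0" for a p b d
  proof -
    have z: "br w (br (gm a p) (gw b d)) = 0" if "a \<noteq> i" for a p b d
      using br_jacobi[OF w gm_part[of a p] gw_part[of b d]] that by (simp add: ww wm br_zero wh)
    show ?thesis
    proof (cases "b = i")
      case True
      thus ?thesis using gm_gw_repeated(1) br_zero(1)[OF wh(3)] z[of a p b d] by (cases "a = i") auto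
    next
      case False
      thus ?thesis using z[OF False] gm_gw_cyclic[of a p b d] by simp
    qed
  qed
  have Pw: "br (P p) (gw a b) = 0" for p a b
    using br_jacobi[OF w gm_part[of i p] gw_part[of a b]] by (simp add: P_def[symmetric] wmw ww br_zero wh)
  have Pmm: "br (P p) (br (gm a r) (gm b q)) = 0" for p a r b q
    by (simp add: gm_gm br_bilinear(4)[OF wP wh(2) whole_zero] Pw)
  have Pm: "br (P p) (gm l q) = 0" if "l \<noteq> i" for p l q
    using br_jacobi[OF w gm_part[of i p] gm_part[of l q]] that by (simp add: P_def[symmetric] wmm wm br_zero wh)
  \<comment> \<open>\<open>[w, [u\<^sub>i \<otimes> v\<^sub>p, u\<^sub>i \<otimes> v\<^sub>q]] = 0\<close> because \<open>u\<^sub>i \<and> u\<^sub>i = 0\<close>.\<close>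
  have anti: "br (P p) (gm i q) = - br (P q) (gm i p)" for p q
  proof -
    have "br (gm i p) (P q) = br (P q) (gm i p)" using br_skew[OF gm_part P, of i p q] by simp
    thus ?thesis using br_jacobi[OF w gm_part[of i p] gm_part[of i q]]
      by (simp add: P_def[symmetric] wmm eq_neg_iff_add_eq_0)
  qed
  have square: "br (P p) (gm i p) = 0" for p
  proof -
    have "scl H 2 (br (P p) (gm i p)) = 0"
      using anti[of p p] V.scale_left_distrib[of 1 1 "br (P p) (gm i p)"] by (simp add: eq_neg_iff_add_eq_0)
    thus ?thesis by (metis V.scale_eq_0_iff zero_neq_numeral)
  qed
  define Q where "Q = br (P 1) (gm i 2)"
  have Q: "Q \<in> part H 0" using br_part[OF P gm_part, of 1 i 2] by (simp add: Q_def part_def)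
  have "br Q (gm l q) = 0" for l q
  proof (cases "l = i")
    case False
    thus ?thesis using br_jacobi[OF P gm_part gm_part, of 1 i 2 l q]
      by (simp add: Q_def[symmetric] Pmm Pm br_zero wh)
  next
    case True
    have "br Q (gm i 2) = 0" unfolding Q_def by (rule odd_square[OF P gm_part Pmm])
    moreover have "br (- Q) (gm i 1) = 0"
      unfolding Q_def anti[of 1 2] using odd_square[OF P gm_part Pmm] by simp
    hence "br Q (gm i 1) = 0" using br_bilinear(3)[OF part_whole[OF Q] wh(1) whole_zero, of "-1" i 1] by simp
    ultimately show ?thesis using True exhaust_2[of q] by auto
  qed
  hence "Q = 0" by (rule even_centralizer[OF Q])
  hence "br (P p) (gm l q) = 0" for p l q
    using Pm square anti[of 2 1] exhaust_2[of p] exhaust_2[of q] by (cases "l = i") (auto simp: Q_def)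
  hence "P p \<in> E (-3)" for p by (intro centralizer_of_g_minus_1 wP)
  hence "br w (gm l q) \<in> E (-3)" for l q
    using wm V.subspace_0[OF E_subspace] by (cases "l = i") (simp_all add: P_def)
  hence wE: "w \<in> E (-2)" by (rule even_centralizer_mod[OF w])
  have "br (gm l q) w = 0" if "l \<noteq> i" for l q
    using br_skew[OF gm_part w, of l q] wm[OF that] by simp
  thus ?thesis using gw_of_annihilator[OF wE _ _ ijk] ijk by metis
qed

end

section \<open>\<open>E(3,8)\<close>\<close>

context transitive38
begin

lemma br_even_skew: "x \<in> part H p \<Longrightarrow> z \<in> part H 0 \<Longrightarrow> br x z = - br z x"
  using br_skew[of x p z 0] by simp

lemma br_minus:
  assumes "x \<in> whole H" "y \<in> whole H"
  shows "br x (- y) = - br x y"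
  using br_bilinear(4)[OF assms whole_zero, of "-1"] by simp

lemma basis_whole: "gm i p \<in> whole H" "gw i j \<in> whole H" "gE i j \<in> whole H"
  using part_whole gm_part gw_part gE_part by blast+

text \<open>
  The shape in which the Jacobi identity can be subtracted from its twisted version.
\<close>

lemma cyclic_jacobi:
  assumes "x \<in> part H p" "y \<in> part H q" "z \<in> part H r"
  shows "scl H ((-1) ^ (p * r)) (br x (br y z)) + scl H ((-1) ^ (q * p)) (br y (br z x)) +
    scl H ((-1) ^ (r * q)) (br z (br x y)) = 0"
proof -
  have w: "x \<in> whole H" "y \<in> whole H" "z \<in> whole H" using assms part_whole by blast+
  have zx: "br z x \<in> whole H" using br_part[OF assms(3,1)] part_whole by blast
  have a: "br (br x y) z = - scl H ((-1) ^ ((p + q) * r)) (br z (br x y))"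
    by (rule br_skew[OF br_part[OF assms(1,2)] assms(3)])
  have "br y (br x z) = br y (scl H (- ((-1) ^ (p * r))) (br z x))"
    using br_skew[OF assms(1,3)] by simp
  also have "\<dots> = scl H (- ((-1) ^ (p * r))) (br y (br z x))"
    by (rule br_bilinear(4)[OF w(2) zx whole_zero])
  finally have b: "br y (br x z) = - scl H ((-1) ^ (p * r)) (br y (br z x))" by simp
  show ?thesis
    using br_jacobi[OF assms] unfolding a b
    by (cases "even p"; cases "even q"; cases "even r") (simp_all add: algebra_simps eq_neg_iff_add_eq_0 neg_eq_iff_add_eq_0)
qed

context
  fixes \<sigma>
  assumes hom: "hom_lie_structure H \<sigma>"
begin

lemma sigma_part: "x \<in> part H p \<Longrightarrow> \<sigma> x \<in> part H p"
  using hom unfolding hom_lie_structure_def by blast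

lemma sigma_add: "x \<in> whole H \<Longrightarrow> y \<in> whole H \<Longrightarrow> \<sigma> (x + y) = \<sigma> x + \<sigma> y"
  and sigma_scale: "x \<in> whole H \<Longrightarrow> \<sigma> (scl H c x) = scl H c (\<sigma> x)"
  using hom unfolding hom_lie_structure_def by blast+

lemma twisted_jacobi:
  assumes "x \<in> part H p" "y \<in> part H q" "z \<in> part H r"
  shows "scl H ((-1) ^ (p * r)) (br (\<sigma> x) (br y z)) + scl H ((-1) ^ (q * p)) (br (\<sigma> y) (br z x)) +
    scl H ((-1) ^ (r * q)) (br (\<sigma> z) (br x y)) = 0"
proof -
  have "\<forall>p q r. \<forall>x\<in>part H p. \<forall>y\<in>part H q. \<forall>z\<in>part H r.
        scl H ((-1) ^ (p * r)) (br (\<sigma> x) (br y z)) +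
        scl H ((-1) ^ (q * p)) (br (\<sigma> y) (br z x)) +
        scl H ((-1) ^ (r * q)) (br (\<sigma> z) (br x y)) = 0"
    using hom unfolding hom_lie_structure_def by (elim conjE)
  thus ?thesis using assms by blast
qed

text \<open>
  In the twisted Jacobi identity for \<open>w = u\<^sub>j \<and> u\<^sub>k\<close>, an element \<open>x\<close> commuting with \<open>w\<close> and an element \<open>z\<close> of
  degree 0 that kills \<open>w\<close>, only the term of \<open>[z, x]\<close> remains.  Matrix units as \<open>z\<close> produce all \<open>u\<^sub>a \<and> u\<^sub>b\<close>
  and all \<open>u\<^sub>l \<otimes> v\<^sub>q\<close> with \<open>l \<noteq> i\<close>.
\<close>

lemma sigma_gw_eigenvector:
  assumes "i \<noteq> j" "j \<noteq> k" "i \<noteq> k"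
  shows "\<exists>c. \<sigma> (gw j k) = scl H c (gw j k)"
proof (rule gw_of_centralizer[OF sigma_part[OF gw_part] assms])
  let ?w = "gw j k"
  have sw: "\<sigma> x \<in> whole H" if "x \<in> part H p" for x p
    using part_whole[OF sigma_part[OF that]] .
  have c: "br (\<sigma> ?w) (br z x) = 0"
    if z: "z \<in> part H 0" "br z ?w = 0" and x: "x \<in> part H p" "br ?w x = 0" for x z p
  proof -
    have "br (\<sigma> ?w) (br x z) = 0"
      using twisted_jacobi[OF gw_part[of j k] x(1) z(1)] z(2) x(2) br_zero(1)[OF sw] z(1) x(1) by simp
    thus ?thesis
      using br_even_skew[OF x(1) z(1)] br_minus[OF sw[OF gw_part] part_whole[OF br_part[OF z(1) x(1)]]] by simp
  qed
  fix a b
  have ab: "br (\<sigma> ?w) (gw a b) = 0" if "b \<noteq> i" for a b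
    using c[OF gE_part[of a i] _ gw_part[of i b] gw_gw] assms that by (simp add: gE_gw)
  show "br (\<sigma> ?w) (gw a b) = 0"
  proof (cases "b = i \<and> a = i")
    case False
    thus ?thesis
      using ab[of b a] ab[of a b] gw_swap[of a b] br_minus[OF sw[OF gw_part] basis_whole(2)] by (cases "b = i") auto
  qed (simp add: br_zero sw[OF gw_part])
next
  let ?w = "gw j k"
  fix l q assume l: "l \<noteq> i"
  then obtain l' where l': "l' \<noteq> l" "l' \<noteq> i" and "(l = j \<and> l' = k) \<or> (l = k \<and> l' = j)"
  proof (cases "l = j")
    case True
    thus thesis using that[of k] assms by auto
  next
    case False
    hence "l = k" using three_cases[OF assms, of l] l by auto
    thus thesis using that[of j] assms by auto
  qed
  hence "br (gE l l') ?w = 0" "br ?w (gm l' q) = 0"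
    using br_even_skew[OF gm_part gw_part, of l' q j k] assms(2) by (auto simp: gE_gw gm_gw_repeated)
  moreover have "br (gm l' q) (gE l l') = - gm l q"
    using br_even_skew[OF gm_part gE_part, of l' q l l'] by (simp add: gE_gm)
  ultimately have "br (\<sigma> ?w) (- gm l q) = 0"
    using twisted_jacobi[OF gw_part[of j k] gm_part[of l' q] gE_part[of l l']]
    by (simp add: br_zero(1)[OF part_whole[OF sigma_part[OF gm_part]]]
        br_zero(1)[OF part_whole[OF sigma_part[OF gE_part]]])
  thus "br (\<sigma> ?w) (gm l q) = 0"
    using br_minus[OF part_whole[OF sigma_part[OF gw_part]] basis_whole(1)] by simp
qed

text \<open>
  The triples of \<open>u\<^sub>j \<and> u\<^sub>k\<close>, \<open>u\<^sub>k \<otimes> v\<^sub>1\<close>, \<open>E\<^sub>i\<^sub>k\<close> and of \<open>u\<^sub>k \<and> u\<^sub>i\<close>, \<open>u\<^sub>k \<otimes> v\<^sub>1\<close>, \<open>E\<^sub>j\<^sub>k\<close> contain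
  the same term for \<open>u\<^sub>k \<otimes> v\<^sub>1\<close>.  Their other terms are multiples, by the two eigenvalues, of the same nonzero
  element \<open>u\<^sub>1 \<and> u\<^sub>2 \<and> u\<^sub>3 \<otimes> v\<^sub>1\<close> up to sign.
\<close>

lemma sigma_gw_same_eigenvalue:
  assumes ijk: "i \<noteq> j" "j \<noteq> k" "i \<noteq> k"
    and c: "\<sigma> (gw j k) = scl H c (gw j k)" and d: "\<sigma> (gw k i) = scl H d (gw k i)"
  shows "c = d"
proof -
  have s: "\<sigma> (gm k 1) \<in> whole H" "\<sigma> (gE a b) \<in> whole H" "\<sigma> (gw a b) \<in> whole H" for a b
    using part_whole[OF sigma_part] gm_part gE_part gw_part by blast+
  have e: "br (gm k 1) (gE a k) = - gm a 1" for a
    using br_even_skew[OF gm_part gE_part] by (simp add: gE_gm)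
  have z: "br (gw j k) (gm k 1) = 0" "br (gw k i) (gm k 1) = 0"
    using br_even_skew[OF gm_part gw_part, of k 1 j k] br_even_skew[OF gm_part gw_part, of k 1 k i]
    by (simp_all add: gm_gw_repeated)
  have "br (\<sigma> (gw j k)) (- gm i 1) + br (\<sigma> (gm k 1)) (gw j i) = 0"
    using twisted_jacobi[OF gw_part[of j k] gm_part[of k 1] gE_part[of i k]] ijk
    by (simp add: e z gE_gw br_zero s)
  moreover have "br (\<sigma> (gw k i)) (- gm j 1) + br (\<sigma> (gm k 1)) (gw j i) = 0"
    using twisted_jacobi[OF gw_part[of k i] gm_part[of k 1] gE_part[of j k]] ijk
    by (simp add: e z gE_gw br_zero s)
  ultimately have "br (\<sigma> (gw j k)) (gm i 1) = br (\<sigma> (gw k i)) (gm j 1)"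
    by (simp add: br_minus s basis_whole)
  hence "scl H c (br (gw j k) (gm i 1)) = scl H d (br (gw k i) (gm j 1))"
    unfolding c d by (simp add: br_bilinear(3)[OF basis_whole(2,1) whole_zero])
  moreover have "br (gw j k) (gm i 1) = - br (gm i 1) (gw j k)" "br (gw k i) (gm j 1) = - br (gm i 1) (gw j k)"
    using br_even_skew[OF gm_part gw_part] gm_gw_cyclic[of i 1 j k] by simp_all
  ultimately have "scl H (c - d) (br (gm i 1) (gw j k)) = 0" by (simp add: V.scale_left_diff_distrib)
  thus ?thesis using gm_gw_nonzero[OF ijk] V.scale_eq_0_iff by auto
qed

lemma sigma_gw:
  obtains c where "\<And>a b. \<sigma> (gw a b) = scl H c (gw a b)"
proof -
  obtain c1 c2 c3 where c: "\<sigma> (gw 2 3) = scl H c1 (gw 2 3)" "\<sigma> (gw 3 1) = scl H c2 (gw 3 1)"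
    "\<sigma> (gw 1 2) = scl H c3 (gw 1 2)"
    using sigma_gw_eigenvector[of 1 2 3] sigma_gw_eigenvector[of 2 3 1] sigma_gw_eigenvector[of 3 1 2] by auto
  have "c1 = c2" "c2 = c3"
    using sigma_gw_same_eigenvalue[of 1 2 3 c1 c2] sigma_gw_same_eigenvalue[of 2 3 1 c2 c3] c by simp_all
  hence p: "\<sigma> (gw 2 3) = scl H c1 (gw 2 3)" "\<sigma> (gw 3 1) = scl H c1 (gw 3 1)"
    "\<sigma> (gw 1 2) = scl H c1 (gw 1 2)"
    using c by simp_all
  have swap: "\<sigma> (gw b a) = scl H d (gw b a)" if "\<sigma> (gw a b) = scl H d (gw a b)" for a b d
    using sigma_scale[OF basis_whole(2)[of a b], of "-1"] that gw_swap[of b a] by simp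
  have z: "\<sigma> 0 = scl H c1 0" using sigma_scale[OF whole_zero, of 0] by simp
  have "\<sigma> (gw a b) = scl H c1 (gw a b)" for a b
    using exhaust_3[of a] exhaust_3[of b]
    by (elim disjE; simp only: p p[THEN swap] gw_same z)
  thus thesis by (rule that)
qed

theorem hom_lie_structure_trivial:
  assumes nz: "nonzero_map H \<sigma>"
  shows "trivial_structure H \<sigma>"
proof -
  obtain c where c: "\<And>a b. \<sigma> (gw a b) = scl H c (gw a b)" using sigma_gw by blast
  define \<tau> where "\<tau> x = \<sigma> x - scl H c x" for x
  have tau_part: "\<tau> x \<in> part H p" if "x \<in> part H p" for x p
    unfolding \<tau>_def using sigma_part[OF that] that
    by (intro V.subspace_diff[OF part_subspace] V.subspace_scale[OF part_subspace])
  have tw: "\<tau> x \<in> whole H" if "x \<in> part H p" for x p using part_whole[OF tau_part[OF that]] .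
  have J: "scl H ((-1) ^ (p * r)) (br (\<tau> x) (br y z)) + scl H ((-1) ^ (q * p)) (br (\<tau> y) (br z x)) +
    scl H ((-1) ^ (r * q)) (br (\<tau> z) (br x y)) = 0"
    if xyz: "x \<in> part H p" "y \<in> part H q" "z \<in> part H r" for x y z p q r
  proof -
    have e: "br (\<tau> u) v = br (\<sigma> u) v - scl H c (br u v)" if u: "u \<in> part H s" and v: "v \<in> part H s'" for u v s s'
    proof -
      have w: "\<sigma> u \<in> whole H" "u \<in> whole H" "v \<in> whole H" "scl H (- c) u \<in> whole H"
        using part_whole sigma_part u v V.subspace_scale[OF part_subspace] by blast+
      have "br (\<sigma> u + scl H (- c) u) v = br (\<sigma> u) v + scl H (- c) (br u v)"
        unfolding br_bilinear(1)[OF w(1,4,3)] br_bilinear(3)[OF w(2,3,3)] ..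
      moreover have "\<tau> u = \<sigma> u + scl H (- c) u" by (simp add: \<tau>_def)
      ultimately show ?thesis by simp
    qed
    have comb: "scl H s1 (x1 - scl H c y1) + scl H s2 (x2 - scl H c y2) + scl H s3 (x3 - scl H c y3) =
        (scl H s1 x1 + scl H s2 x2 + scl H s3 x3) - scl H c (scl H s1 y1 + scl H s2 y2 + scl H s3 y3)"
      for s1 s2 s3 and x1 x2 x3 y1 y2 y3 :: 'v
      by (simp add: V.scale_right_distrib V.scale_right_diff_distrib mult.commute)
    show ?thesis
      unfolding e[OF xyz(1) br_part[OF xyz(2,3)]] e[OF xyz(2) br_part[OF xyz(3,1)]]
        e[OF xyz(3) br_part[OF xyz(1,2)]] comb twisted_jacobi[OF xyz] cyclic_jacobi[OF xyz]
      by simp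
  qed
  have tau_gw: "\<tau> (gw a b) = 0" for a b by (simp add: \<tau>_def c)
  define e where "e = gs (axis 1 (axis 2 1))"
  define f' where "f' = gs (axis 2 (axis 1 1))"
  define h where "h = gs (axis 1 (axis 1 1) - axis 2 (axis 2 1))"
  have tr: "trace (axis 1 (axis 2 1) :: 'a ^ 2 ^ 2) = 0" "trace (axis 2 (axis 1 1) :: 'a ^ 2 ^ 2) = 0"
    "trace (axis 1 (axis 1 1) - axis 2 (axis 2 1) :: 'a ^ 2 ^ 2) = 0"
    by (simp_all add: trace_def sum_2 axis_def)
  have ef_part: "e \<in> part H 0" "f' \<in> part H 0" "h \<in> part H 0"
    unfolding e_def f'_def h_def by (intro gs_part tr)+
  have ef_h: "br e f' = h"
    unfolding e_def f'_def h_def gs_def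
    by (simp add: brackets tr nonpos38_bracket_def matrix_unit_mult axis_nth_if)
  have ef_E: "br e (gE i j) = 0" "br f' (gE i j) = 0" for i j
    unfolding e_def f'_def by (simp_all add: gs_gE tr)
  have ef_m: "br e (gm i 1) = 0" "br e (gm i 2) = gm i 1" "br f' (gm i 1) = gm i 2" for i
    unfolding e_def f'_def gs_gm[OF tr(1)] gs_gm[OF tr(2)] by (simp_all add: axis_nth_if)
  have z0: "br (\<tau> x) 0 = 0" if "x \<in> part H p" for x p using br_zero(1)[OF tw[OF that]] .
  have J0: "br (\<tau> x) (br y z) + br (\<tau> y) (br z x) + br (\<tau> z) (br x y) = 0"
    if "x \<in> part H 0" "y \<in> part H 0" "z \<in> part H p" for x y z p
    using J[OF that] by simp
  have neg: "br (\<tau> x) (- y) = - br (\<tau> x) y" if "x \<in> part H p" "y \<in> part H q" for x y p q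
    using br_minus[OF tw[OF that(1)] part_whole[OF that(2)]] .
  \<comment> \<open>Matrix units off the diagonal: the partners are \<open>u\<^sub>i \<and> u\<^sub>k\<close>, which \<open>E\<^sub>i\<^sub>j\<close> kills, and the elements of \<open>sl(V)\<close>,
    which commute with \<open>E\<^sub>i\<^sub>j\<close>.\<close>
  have tau_gE_scaled: "\<exists>a. \<tau> (gE i j) = scl H a (gw k i)" if d: "i \<noteq> j" "j \<noteq> k" "i \<noteq> k" for i j k
  proof (rule gw_of_centralizer[OF tau_part[OF gE_part]])
    show "j \<noteq> k" "k \<noteq> i" "j \<noteq> i" using d by auto
    have w: "br (gw i k) (gE i j) = 0"
      using br_even_skew[OF gw_part gE_part, of i k i j] d by (simp add: gE_gw)
    have ww: "br (\<tau> (gE i j)) (br z (gw i k)) = 0" if z: "z \<in> part H 0" for z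
      using J0[OF gw_part[of i k] gE_part[of i j] z] w z0[OF z] br_zero(2)[OF part_whole[OF br_part[OF gE_part z]]]
      by (simp add: tau_gw)
    have k: "br (\<tau> (gE i j)) (gw a k) = 0" for a using ww[OF gE_part[of a i]] d by (simp add: gE_gw)
    have i: "br (\<tau> (gE i j)) (gw i a) = 0" for a using ww[OF gE_part[of a k]] d by (simp add: gE_gw)
    fix a b
    show "br (\<tau> (gE i j)) (gw a b) = 0"
    proof (cases "a = b")
      case False
      hence "a = i \<or> a = k \<or> b = i \<or> b = k"
        using three_cases[OF d, of a] three_cases[OF d, of b] by auto
      thus ?thesis using k[of a] i[of b] k[of b] i[of a] gw_swap[of a b] neg[OF gE_part gw_part, of i j b a] by auto
    qed (simp add: z0[OF gE_part])
  next
    fix l q assume l: "l \<noteq> j"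
    have s: "br (\<tau> (gE i j)) (br g (gm l p)) = 0" if g: "g \<in> part H 0" "br g (gE i j) = 0" for g p
    proof -
      have "br (\<tau> (gE i j)) (br (gm l p) g) = 0"
        using J0[OF g(1) gE_part[of i j] gm_part[of l p]] l g(2) z0[OF g(1)] z0[OF gm_part]
        by (simp add: gE_gm)
      thus ?thesis using br_even_skew[OF gm_part g(1), of l p] neg[OF gE_part br_part[OF g(1) gm_part]] by simp
    qed
    show "br (\<tau> (gE i j)) (gm l q) = 0"
      using s[OF ef_part(1) ef_E(1), of 2] s[OF ef_part(2) ef_E(2), of 1] exhaust_2[of q] by (auto simp: ef_m)
  qed
  \<comment> \<open>The triple of an element of \<open>sl(V)\<close>, \<open>E\<^sub>i\<^sub>j\<close> and \<open>u\<^sub>j \<otimes> v\<^sub>p\<close> links \<open>\<tau>\<close> on \<open>sl(V)\<close> with \<open>\<tau> E\<^sub>i\<^sub>j\<close>.\<close>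
  have swap_ef: "br (\<tau> g) (gm i p) + br (\<tau> (gE i j)) (br (gm j p) g) = 0"
    if g: "g \<in> part H 0" "br g (gE i j) = 0" for g i j p
    using J0[OF g(1) gE_part[of i j] gm_part[of j p]] g(2) z0[OF gm_part] by (simp add: gE_gm)
  have m1: "br (gm j 1) e = 0" "br (gm j 2) e = - gm j 1" for j
    using br_even_skew[OF gm_part ef_part(1)] by (simp_all add: ef_m)
  have others: "\<exists>j k. i \<noteq> j \<and> j \<noteq> k \<and> i \<noteq> k" for i :: 3
    using two_points_not_all[of i i] two_points_not_all[of i] by simp metis
  have e1: "br (\<tau> e) (gm i 1) = 0" for i
  proof -
    obtain j where "i \<noteq> j" using others[of i] by blast
    thus ?thesis using swap_ef[OF ef_part(1) ef_E(1), of i 1 j] z0[OF gE_part] by (simp add: m1)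
  qed
  have e2: "br (\<tau> e) (gm i 2) = br (\<tau> (gE i j)) (gm j 1)" for i j
    using swap_ef[OF ef_part(1) ef_E(1), of i 2 j] neg[OF gE_part gm_part] by (simp add: m1)
  have "br (\<tau> e) (gm i q) \<in> E (-3)" for i q
  proof -
    obtain j k where d: "i \<noteq> j" "j \<noteq> k" "i \<noteq> k" using others[of i] by blast
    then obtain a where a: "\<tau> (gE i j) = scl H a (gw k i)" using tau_gE_scaled by blast
    have "gw k i \<in> E (-2)" "gm j 1 \<in> E (-1)"
      using f_image[of "-2"] f_image[of "-1"] D_members(1,2) unfolding gw_def gm_def by auto
    hence "br (scl H a (gw k i)) (gm j 1) \<in> E (-3)"
      using E_br[OF V.subspace_scale[OF E_subspace, of "gw k i" "-2" a], of "gm j 1" "-1"] by simp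
    thus ?thesis using e1 e2[of i j] a V.subspace_0[OF E_subspace] exhaust_2[of q] by auto
  qed
  hence eE: "\<tau> e \<in> E (-2)" by (rule even_centralizer_mod[OF tau_part[OF ef_part(1)]])
  have tau_e: "\<tau> e = 0"
  proof -
    have m: "br (gm i 1) (\<tau> e) = 0" for i
      using br_even_skew[OF gm_part tau_part[OF ef_part(1)], of i 1] e1 by simp
    obtain a where a: "\<tau> e = scl H a (gw 2 3)"
      using gw_of_annihilator[OF eE m m, of 1 2 3] by auto
    have "scl H a (br (gm 1 1) (gw 2 3)) = 0"
      using m[of 1] unfolding a br_bilinear(4)[OF basis_whole(1,2) whole_zero] .
    hence "a = 0" using gm_gw_nonzero[of 1 2 3 1] V.scale_eq_0_iff by auto
    thus ?thesis using a by simp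
  qed
  have tau_gE: "\<tau> (gE i j) = 0" if ij: "i \<noteq> j" for i j
  proof -
    obtain k where k: "k \<noteq> i" "k \<noteq> j" using two_points_not_all[of i j] by auto
    hence d: "j \<noteq> k" "i \<noteq> k" by auto
    obtain a where a: "\<tau> (gE i j) = scl H a (gw k i)" using tau_gE_scaled[OF ij d] by blast
    have "br (\<tau> (gE i j)) (gm j 1) = 0" using e2[of i j] tau_e br_zero(2)[OF basis_whole(1)] by simp
    hence "scl H a (br (gw k i) (gm j 1)) = 0"
      unfolding a br_bilinear(3)[OF basis_whole(2,1) whole_zero] .
    moreover have "br (gw k i) (gm j 1) = - br (gm j 1) (gw k i)"
      using br_even_skew[OF gm_part gw_part, of j 1 k i] by simp
    ultimately have "a = 0" using gm_gw_nonzero[of j k i 1] d ij V.scale_eq_0_iff by auto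
    thus ?thesis using a by simp
  qed
  have tau_f: "\<tau> f' = 0"
  proof (rule even_centralizer[OF tau_part[OF ef_part(2)]])
    fix i :: 3 and p :: 2
    obtain j where "i \<noteq> j" using others[of i] by blast
    thus "br (\<tau> f') (gm i p) = 0"
      using swap_ef[OF ef_part(2) ef_E(2), of i p j] tau_gE br_zero(2)[OF part_whole[OF br_part[OF gm_part ef_part(2)]]]
      by simp
  qed
  \<comment> \<open>The triple of \<open>y\<close> with \<open>e\<close> and \<open>f'\<close>, on which \<open>\<tau>\<close> vanishes.\<close>
  have tau_h: "br h (\<tau> y) = 0" if y: "y \<in> part H p" for y p
  proof -
    have "br (\<tau> y) h = 0"
      using J[OF y ef_part(1,2)] br_zero(2) part_whole[OF br_part[OF ef_part(2) y]] part_whole[OF br_part[OF y ef_part(1)]]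
      by (simp add: tau_e tau_f ef_h)
    thus ?thesis using br_even_skew[OF tau_part[OF y] ef_part(3)] by simp
  qed
  have tau_if: "\<tau> y = 0" if y: "y \<in> part H p" and m: "\<And>i q. br (\<tau> y) (gm i q) = 0" for y p
    using E_minus_3_eigenvector[OF centralizer_of_g_minus_1[OF tw[OF y] m] refl] tau_h[OF y] unfolding h_def by blast
  \<comment> \<open>\<open>E\<^sub>i\<^sub>j\<close> maps \<open>u\<^sub>j \<otimes> v\<^sub>q\<close> to \<open>u\<^sub>i \<otimes> v\<^sub>q\<close> and kills \<open>u\<^sub>k \<otimes> v\<^sub>p\<close> for \<open>k \<noteq> j\<close>, so these three elements
    give \<open>[\<tau> (u\<^sub>k \<otimes> v\<^sub>p), u\<^sub>i \<otimes> v\<^sub>q] = 0\<close>.\<close>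
  have tau_gm: "\<tau> (gm k p) = 0" for k p
  proof (rule tau_if[OF gm_part])
    fix i :: 3 and q :: 2
    obtain j where j: "j \<noteq> i" "j \<noteq> k"
      using two_points_not_all[of i k] by auto
    have "br (gm j q) (gE i j) = - gm i q" using br_even_skew[OF gm_part gE_part, of j q i j] by (simp add: gE_gm)
    hence "br (\<tau> (gm k p)) (- gm i q) = 0"
      using J[OF gm_part[of k p] gm_part[of j q] gE_part[of i j]] j tau_gE[of i j] z0[OF gm_part]
        br_zero(2)[OF part_whole[OF br_part[OF gm_part gm_part]]]
      by (simp add: gE_gm)
    thus "br (\<tau> (gm k p)) (gm i q) = 0" using neg[OF gm_part gm_part] by simp
  qed
  \<comment> \<open>Now \<open>\<tau>\<close> vanishes on both partners \<open>E\<^sub>i\<^sub>j\<close> and \<open>u\<^sub>j \<otimes> v\<^sub>q\<close> of an arbitrary \<open>y\<close>.\<close>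
  have tau_zero: "\<tau> y = 0" if y: "y \<in> part H p" for y p
  proof (rule tau_if[OF y])
    fix i :: 3 and q :: 2
    obtain j where j: "i \<noteq> j" using others[of i] by blast
    have "scl H ((-1) ^ p) (br (\<tau> y) (gm i q)) = 0"
      using J[OF y gE_part[of i j] gm_part[of j q]] tau_gE[OF j] tau_gm
        br_zero(2)[OF part_whole[OF br_part[OF gm_part y]]] br_zero(2)[OF part_whole[OF br_part[OF y gE_part]]]
      by (simp add: gE_gm)
    thus "br (\<tau> y) (gm i q) = 0" by (simp add: V.scale_eq_0_iff)
  qed
  have sigma: "\<sigma> y = scl H c y" if y: "y \<in> whole H" for y
  proof -
    obtain y0 y1 where "y = y0 + y1" "y0 \<in> part H 0" "y1 \<in> part H 1"
      using y unfolding whole_def part_def by auto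
    thus ?thesis using tau_zero[of y0 0] tau_zero[of y1 1] sigma_add[OF part_whole part_whole]
      by (simp add: \<tau>_def V.scale_right_distrib)
  qed
  have gm_nz: "gm 1 1 \<noteq> 0" using gm_gw_nonzero[of 1 2 3 1] br_zero(2)[OF basis_whole(2)] by auto
  have "\<sigma> (br (gE 1 2) (gm 2 1)) = br (\<sigma> (gE 1 2)) (\<sigma> (gm 2 1))"
    using hom gE_part gm_part unfolding hom_lie_structure_def by blast
  also have "\<dots> = scl H (c * c) (gm 1 1)"
  proof -
    have w: "scl H c (gm 2 1) \<in> whole H"
      by (rule part_whole[OF V.subspace_scale[OF part_subspace gm_part]])
    show ?thesis
      unfolding sigma[OF basis_whole(1)] sigma[OF basis_whole(3)] br_bilinear(3)[OF basis_whole(3) w whole_zero]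
        br_bilinear(4)[OF basis_whole(3,1) whole_zero] by (simp add: gE_gm)
  qed
  finally have "scl H c (gm 1 1) = scl H (c * c) (gm 1 1)"
    by (simp add: gE_gm sigma[OF basis_whole(1)])
  hence "scl H (c - c * c) (gm 1 1) = 0" by (simp add: V.scale_left_diff_distrib)
  hence "c = c * c" using gm_nz V.scale_eq_0_iff by auto
  moreover have "c \<noteq> 0" using nz sigma by (auto simp: nonzero_map_def)
  ultimately have "c = 1" by simp
  thus ?thesis using sigma by (simp add: trivial_structure_def)
qed

end

end

text \<open>
  The full prolongation is a transitive graded Lie superalgebra with the nonpositive part in question.
\<close>

theorem E38_hom_lie_structure_trivial:
  fixes \<omega> :: "'a::field_char_0 ^ 2 \<Rightarrow> 'a ^ 2 \<Rightarrow> 'a"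
  assumes "nonzero_alternating \<omega>" "hom_lie_structure (E38 \<omega>) \<sigma>" "nonzero_map (E38 \<omega>) \<sigma>"
  shows "trivial_structure (E38 \<omega>) \<sigma>"
proof -
  obtain E f where "transitive_prolongation nonpos38_comp (nonpos38_bracket \<omega>) nonpos38_scale (E38 \<omega>) E f"
    using E38_full_prolongation[OF assms(1)] by blast
  then interpret transitive38 \<omega> "E38 \<omega>" E f
    by (rule transitive38.intro[OF assms(1)])
  show ?thesis by (rule hom_lie_structure_trivial[OF assms(2,3)])
qed

section \<open>All five algebras\<close>

theorem theorem3p8:
  shows "(\<forall>\<sigma>. hom_lie_structure (E44 :: ('a::{alg_closed_field, field_char_0}, _) superalgebra) \<sigma> \<and>
            nonzero_map (E44 :: ('a, _) superalgebra) \<sigma> \<longrightarrow>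
            trivial_structure (E44 :: ('a, _) superalgebra) \<sigma>) \<and>
         (\<forall>\<sigma>. hom_lie_structure (E510 :: ('a, _) superalgebra) \<sigma> \<and>
            nonzero_map (E510 :: ('a, _) superalgebra) \<sigma> \<longrightarrow>
            trivial_structure (E510 :: ('a, _) superalgebra) \<sigma>) \<and>
         (\<forall>\<sigma>. hom_lie_structure (E36 :: ('a, _) superalgebra) \<sigma> \<and>
            nonzero_map (E36 :: ('a, _) superalgebra) \<sigma> \<longrightarrow>
            trivial_structure (E36 :: ('a, _) superalgebra) \<sigma>) \<and>
         (\<forall>(\<omega> :: 'a ^ 2 \<Rightarrow> 'a ^ 2 \<Rightarrow> 'a) \<sigma>. nonzero_alternating \<omega> \<and>
            hom_lie_structure (E38 \<omega>) \<sigma> \<and> nonzero_map (E38 \<omega>) \<sigma> \<longrightarrow>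
            trivial_structure (E38 \<omega>) \<sigma>) \<and>
         (\<forall>(M :: 'a K16 set) \<sigma>. so6_irreducible10 M \<and>
            hom_lie_structure (E16 M) \<sigma> \<and> nonzero_map (E16 M) \<sigma> \<longrightarrow>
            trivial_structure (E16 M) \<sigma>)"
proof (intro conjI allI impI; (elim conjE)?)
  show "trivial_structure E44 \<sigma>" if "hom_lie_structure E44 \<sigma>" "nonzero_map E44 \<sigma>"
    for \<sigma> :: "('a, 4) vfield \<times> ('a, 4) form1 \<Rightarrow> _"
    using vector_field_superalgebra.hom_lie_structure_trivial[OF E44_vector_field_superalgebra that] .
  show "trivial_structure E510 \<sigma>" if "hom_lie_structure E510 \<sigma>" "nonzero_map E510 \<sigma>"
    for \<sigma> :: "('a, 5) vfield \<times> ('a, 5) form2 \<Rightarrow> _"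
    using vector_field_superalgebra.hom_lie_structure_trivial[OF E510_vector_field_superalgebra that] .
  show "trivial_structure E36 \<sigma>" if "hom_lie_structure E36 \<sigma>" "nonzero_map E36 \<sigma>"
    for \<sigma> :: "('a, 5) vfield \<times> ('a, 5) form2 \<Rightarrow> _"
    using vector_field_superalgebra.hom_lie_structure_trivial[OF E36_vector_field_superalgebra that] .
  show "trivial_structure (E38 \<omega>) \<sigma>"
    if "nonzero_alternating \<omega>" "hom_lie_structure (E38 \<omega>) \<sigma>" "nonzero_map (E38 \<omega>) \<sigma>"
    for \<omega> :: "'a ^ 2 \<Rightarrow> 'a ^ 2 \<Rightarrow> 'a" and \<sigma>
    using that by (rule E38_hom_lie_structure_trivial)
  show "trivial_structure (E16 M) \<sigma>" if "hom_lie_structure (E16 M) \<sigma>" "nonzero_map (E16 M) \<sigma>"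
    for M :: "'a K16 set" and \<sigma>
    using that by (rule E16_hom_lie_structure_trivial)
qed

end
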